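(* Let $\mathfrak{A}$ be a real normed division algebra, i.e. $\mathfrak{A}=\mathbb{R},\mathbb{C},\mathbb{H}$ or $\mathbb{O}$, of real dimension $\beta=1,2,4$ or $8$ respectively, and let $n\ge m\ge 1$ be integers. Let $\rho>0$, $k\in\mathbb{R}$, $\nu$ a parameter, $\tau=(t_1,\dots,t_m)\in\mathbb{R}^m$ and $\boldsymbol{\Sigma}\in\mathfrak{P}_m^{\beta}$. With $S$ a positive random variable and $\mathbf{Y}$ a random $n\times m$ matrix over $\mathfrak{A}$ independent of $S$, put $\mathbf{T}=S^{-1/2}\mathbf{Y}$, $\mathbf{W}=\mathbf{Y}^*\mathbf{Y}$ and $\mathbf{F}=\mathbf{T}^*\mathbf{T}\in\mathfrak{P}_m^\beta$, so that $\mathbf{F}=S^{-1}\mathbf{Y}^*\mathbf{Y}=S^{-1}\mathbf{W}$. (1) Suppose $\mathbf{T}$ has the matrix multivariate $T$-Riesz type I distribution with parameters $\nu,k,\tau,\rho$, $\boldsymbol\mu=\mathbf{0}$, $\boldsymbol\Theta=\mathbf{I}_n$, $\boldsymbol{\Sigma}$; that is, $S\sim\mathcal{R}_1^{\beta,I}(\nu\beta/2,k,\rho)$ with $\mathrm{Re}(\nu\beta/2)>-k$, and $\mathbf{Y}\sim\mathcal{KR}^{\beta,I}_{n\times m}(\tau,\mathbf{0},\mathbf{I}_n,\boldsymbol{\Sigma})$ with $\mathrm{Re}(n\beta/2)>(m-1)\beta/2-t_m$. Then $\mathbf{W}\sim\mathcal{R}_m^{\beta,I}(n\beta/2,\tau,\boldsymbol{\Sigma})$,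 and the density of $\mathbf{F}$ on $\mathfrak{P}_m^\beta$ with respect to $(d\mathbf{F})$ is $$ \frac{\Gamma_1^\beta\!\left[(\nu+mn)\beta/2+k+\sum_{i=1}^m t_i\right]\rho^{\beta mn/2+\sum_{i=1}^m t_i}}{\Gamma_m^\beta[n\beta/2,\tau]\;\Gamma_1^\beta[\nu\beta/2+k]\;|\boldsymbol{\Sigma}|^{n\beta/2}\,q_\tau(\boldsymbol{\Sigma})}\;|\mathbf{F}|^{(n-m+1)\beta/2-1}\left(1+\rho\,\mathrm{tr}\,\boldsymbol{\Sigma}^{-1}\mathbf{F}\right)^{-\left[(mn+\nu)\beta/2+k+\sum_{i=1}^m t_i\right]} q_\tau(\mathbf{F}), $$ where $\mathrm{Re}(\nu\beta/2)>(m-1)\beta/2-k$ and $\mathrm{Re}(m\beta/2)>(m-1)\beta/2-t_m$. $\mathbf{F}$ is said to have a matrix multivariate c-beta-Riesz type II distribution. (2) Suppose $\mathbf{T}$ has the matrix multivariate $T$-Riesz type II distribution with parameters $\nu,k,\tau,\rho$, $\boldsymbol\mu=\mathbf{0}$, $\boldsymbol\Theta=\mathbf{I}_n$, $\boldsymbol{\Sigma}$; that is, $S\sim\mathcal{R}_1^{\beta,II}(\nu\beta/2,k,\rho)$ with $\mathrm{Re}(\nu\beta/2)>k$, and $\mathbf{Y}\sim\mathcal{KR}^{\beta,II}_{n\times m}(\tau,\mathbf{0},\mathbf{I}_n,\boldsymbol{\Sigma})$ with $\mathrm{Re}(n\beta/2)>(m-1)\beta/2+t_1$. Then $\mathbf{W}\sim\mathcal{R}_m^{\beta,II}(n\beta/2,\tau,\boldsymbol{\Sigma})$,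 and the density of $\mathbf{F}$ on $\mathfrak{P}_m^\beta$ with respect to $(d\mathbf{F})$ is $$ \frac{\Gamma_1^\beta\!\left[(\nu+mn)\beta/2-k-\sum_{i=1}^m t_i\right]\rho^{\beta mn/2-\sum_{i=1}^m t_i}}{\Gamma_m^\beta[n\beta/2,-\tau]\;\Gamma_1^\beta[\nu\beta/2-k]\;|\boldsymbol{\Sigma}|^{n\beta/2}\,q_\tau(\boldsymbol{\Sigma}^{-1})}\;|\mathbf{F}|^{(n-m+1)\beta/2-1}\left(1+\rho\,\mathrm{tr}\,\boldsymbol{\Sigma}^{-1}\mathbf{F}\right)^{-\left[(mn+\nu)\beta/2-k-\sum_{i=1}^m t_i\right]} q_\tau(\mathbf{F}^{-1}), $$ where $\mathrm{Re}(\nu\beta/2)>(m-1)\beta/2+k$ and $\mathrm{Re}(m\beta/2)>(m-1)\beta/2+t_1$. $\mathbf{F}$ is said to have a matrix multivariate k-beta-Riesz type II distribution.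
   Context: Notation. $\mathfrak{A}$ is one of the four real normed division algebras: $\mathbb{R}$, $\mathbb{C}$, $\mathbb{H}$ (quaternions), $\mathbb{O}$ (octonions), of real dimension $\beta=1,2,4,8$. (The authors include the octonions, but remark that the veracity of the results in that case can in general only be conjectured, while asserting validity for the Albert algebra, i.e. when the Hermitian matrices are $3\times3$ octonionic.) $\mathfrak{A}^{n\times m}$ is the space of $n\times m$ matrices over $\mathfrak{A}$, identified with $\mathbb{R}^{\beta nm}$ by real components of the entries and given the corresponding Lebesgue measure. $\mathbf{A}^*$ is the conjugate transpose. $\mathfrak{P}_m^{\beta}$ is the cone of positive definite Hermitian $m\times m$ matrices over $\mathfrak{A}$, an open subset of the real vector space of Hermitian matrices; $(d\mathbf{F})$ is the Lebesgue measure on that space in the coordinates given by the diagonal entries $f_{ii}$ and the $\beta$ real components of each $f_{ij}$, $i>j$. $|\cdot|$ is the determinant of a Hermitian matrix (product of the eigenvalues). $\mathrm{tr}$ denotes the (real part of the) trace, and $\mathrm{etr}(\cdot)=\exp(\mathrm{tr}(\cdot))$. For $\mathbf{B}\in\mathfrak{P}_m^\beta$, $\mathcal{U}(\mathbf{B})$ is the upper triangular matrix with positive diagonal such that $\mathbf{B}=\mathcal{U}(\mathbf{B})^*\mathcal{U}(\mathbf{B})$ (Cholesky decomposition). Generalised power (highest weight vector). For $\kappa=(k_1,\dots,k_m)\in\mathbb{R}^m$, $q_\kappa(\mathbf{A})=|\mathbf{A}_m|^{k_m}\prod_{i=1}^{m-1}|\mathbf{A}_i|^{k_i-k_{i+1}}$,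 where $\mathbf{A}_p$ is the leading principal $p\times p$ submatrix of $\mathbf{A}$. Gamma functions. $\Gamma_m^\beta[a]=\pi^{m(m-1)\beta/4}\prod_{i=1}^m\Gamma[a-(i-1)\beta/2]$, $\Gamma_m^\beta[a,\kappa]=\pi^{m(m-1)\beta/4}\prod_{i=1}^m\Gamma[a+k_i-(i-1)\beta/2]$ and $\Gamma_m^\beta[a,-\kappa]=\pi^{m(m-1)\beta/4}\prod_{i=1}^m\Gamma[a-k_i-(m-i)\beta/2]$, where $\Gamma=\Gamma_1^\beta$ is the ordinary gamma function. Riesz distributions. Let $\boldsymbol{\Xi}\in\mathfrak{P}_m^\beta$. $\mathbf{V}\sim\mathcal{R}_m^{\beta,I}(a,\kappa,\boldsymbol{\Xi})$ (type I, $\mathrm{Re}(a)\ge(m-1)\beta/2-k_m$) means that $\mathbf{V}$ has density on $\mathfrak{P}_m^\beta$ $$\frac{\beta^{am+\sum_i k_i}}{\Gamma_m^\beta[a,\kappa]\,|\boldsymbol{\Xi}|^a q_\kappa(\boldsymbol{\Xi})}\,\mathrm{etr}\{-\beta\boldsymbol{\Xi}^{-1}\mathbf{V}\}\,|\mathbf{V}|^{a-(m-1)\beta/2-1}q_\kappa(\mathbf{V}),$$ and $\mathbf{V}\sim\mathcal{R}_m^{\beta,II}(a,\kappa,\boldsymbol{\Xi})$ (type II, $\mathrm{Re}(a)>(m-1)\beta/2+k_1$) means that $\mathbf{V}$ has density on $\mathfrak{P}_m^\beta$ $$\frac{\beta^{am-\sum_i k_i}}{\Gamma_m^\beta[a,-\kappa]\,|\boldsymbol{\Xi}|^a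 q_\kappa(\boldsymbol{\Xi}^{-1})}\,\mathrm{etr}\{-\beta\boldsymbol{\Xi}^{-1}\mathbf{V}\}\,|\mathbf{V}|^{a-(m-1)\beta/2-1}q_\kappa(\mathbf{V}^{-1}).$$ For $m=1$ these are the densities $\frac{\beta^{a\pm k}}{\Gamma[a\pm k]\rho^{a\pm k}}e^{-\beta s/\rho}s^{a\pm k-1}$ on $(0,\infty)$, with $+$ for $\mathcal{R}_1^{\beta,I}(a,k,\rho)$ and $-$ for $\mathcal{R}_1^{\beta,II}(a,k,\rho)$. Kotz-Riesz distributions. $\mathbf{Y}\sim\mathcal{KR}^{\beta,I}_{n\times m}(\kappa,\mathbf{0},\mathbf{I}_n,\boldsymbol{\Sigma})$ means that $\mathbf{Y}$ has density with respect to Lebesgue measure on $\mathfrak{A}^{n\times m}$ $$\frac{\beta^{mn\beta/2+\sum_i k_i}\,\Gamma_m^\beta[n\beta/2]}{\pi^{mn\beta/2}\,\Gamma_m^\beta[n\beta/2,\kappa]\,|\boldsymbol{\Sigma}|^{n\beta/2}}\,\mathrm{etr}\{-\beta\,\boldsymbol{\Sigma}^{-1}\mathbf{Y}^*\mathbf{Y}\}\; q_\kappa\!\left[\mathcal{U}(\boldsymbol{\Sigma})^{*-1}\mathbf{Y}^*\mathbf{Y}\,\mathcal{U}(\boldsymbol{\Sigma})^{-1}\right],$$ and $\mathbf{Y}\sim\mathcal{KR}^{\beta,II}_{n\times m}(\kappa,\mathbf{0},\mathbf{I}_n,\boldsymbol{\Sigma})$ means that $\mathbf{Y}$ has density $$\frac{\beta^{mn\beta/2-\sum_i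 k_i}\,\Gamma_m^\beta[n\beta/2]}{\pi^{mn\beta/2}\,\Gamma_m^\beta[n\beta/2,-\kappa]\,|\boldsymbol{\Sigma}|^{n\beta/2}}\,\mathrm{etr}\{-\beta\,\boldsymbol{\Sigma}^{-1}\mathbf{Y}^*\mathbf{Y}\}\; q_\kappa\!\left[\left(\mathcal{U}(\boldsymbol{\Sigma})^{*-1}\mathbf{Y}^*\mathbf{Y}\,\mathcal{U}(\boldsymbol{\Sigma})^{-1}\right)^{-1}\right].$$
   Formalization: In (2) the Kotz-Riesz type II density uses the lower triangular L with Σ = L*L instead of the upper triangular U(Σ), as (2) is false with U(Σ); octonions are covered only for m ≤ 2, since for m ≥ 3 Y*Y is not almost surely in P_m; ν is real. *)

theory Defs
  imports "HOL-Analysis.Analysis" "HOL-Probability.Probability"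
begin

section \<open>Real normed division algebras\<close>

text \<open>
  A real normed division algebra is a finite-dimensional real algebra with unit, carrying a
  Euclidean norm that is multiplicative. Associativity is not assumed. By Hurwitz' theorem the
  models are, up to isometric isomorphism, exactly the reals, the complex numbers, the quaternions
  and the octonions, and \<open>\<beta>\<close> is \<open>DIM('a)\<close>, i.e. 1, 2, 4 or 8; the octonions are the only
  non-associative one.
\<close>

class normed_division_algebra = euclidean_space + one + times +
  assumes nda_one_left: "1 * x = x"
    and nda_one_right: "x * 1 = x"
    and nda_add_left: "(x + y) * z = x * z + y * z"
    and nda_add_right: "x * (y + z) = x * y + x * z"
    and nda_scaleR_left: "(r *\<^sub>R x) * y = r *\<^sub>R (x * y)"
    and nda_scaleR_right: "x * (r *\<^sub>R y) = r *\<^sub>R (x * y)"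
    and nda_norm_mult: "norm (x * y) = norm x * norm y"

instance real :: normed_division_algebra
  by standard (auto simp: algebra_simps abs_mult)

instance complex :: normed_division_algebra
  by standard (auto simp: algebra_simps norm_mult)

definition nda_re :: "'a::normed_division_algebra \<Rightarrow> real" where
  "nda_re x = x \<bullet> 1"

definition nda_cnj :: "'a::normed_division_algebra \<Rightarrow> 'a" where
  "nda_cnj x = (2 * nda_re x) *\<^sub>R 1 - x"

section \<open>Matrices\<close>

text \<open>
  In \<open>('a, 'n, 'm) mtx\<close> rows are indexed by \<open>'n\<close> and columns by \<open>'m\<close>. The library
  product \<open>**\<close> needs an associative entry type, hence the separate definition.
\<close>

type_synonym ('a, 'n, 'm) mtx = "'a ^ 'm ^ 'n"

definition mmul ::
  "('a::normed_division_algebra, 'n::finite, 'l::finite) mtx \<Rightarrow> ('a, 'l, 'm::finite) mtx \<Rightarrow> ('a, 'n, 'm) mtx"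
    (infixl "\<odot>" 70) where
  "A \<odot> B = (\<chi> i j. \<Sum>l\<in>UNIV. A $ i $ l * B $ l $ j)"

definition mident :: "('a::normed_division_algebra, 'm::finite, 'm) mtx" where
  "mident = (\<chi> i j. if i = j then 1 else 0)"

definition ctrans :: "('a::normed_division_algebra, 'n::finite, 'm::finite) mtx \<Rightarrow> ('a, 'm, 'n) mtx" where
  "ctrans A = (\<chi> i j. nda_cnj (A $ j $ i))"

definition minv :: "('a::normed_division_algebra, 'm::finite, 'm) mtx \<Rightarrow> ('a, 'm, 'm) mtx" where
  "minv A = (THE B. A \<odot> B = mident \<and> B \<odot> A = mident)"

definition rtr :: "('a::normed_division_algebra, 'm::finite, 'm) mtx \<Rightarrow> real" where
  "rtr A = nda_re (\<Sum>i\<in>UNIV. A $ i $ i)"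

definition etr :: "('a::normed_division_algebra, 'm::finite, 'm) mtx \<Rightarrow> real" where
  "etr A = exp (rtr A)"

definition mvmul ::
  "('a::normed_division_algebra, 'n::finite, 'm::finite) mtx \<Rightarrow> ('a, 'm) vec \<Rightarrow> ('a, 'n) vec" where
  "mvmul A v = (\<chi> i. \<Sum>j\<in>UNIV. A $ i $ j * v $ j)"

definition hermitian :: "('a::normed_division_algebra, 'm::finite, 'm) mtx \<Rightarrow> bool" where
  "hermitian A \<longleftrightarrow> ctrans A = A"

definition pos_def :: "('a::normed_division_algebra, 'm::finite, 'm) mtx set" where
  "pos_def = {A. hermitian A \<and>
     (\<forall>v. v \<noteq> 0 \<longrightarrow> nda_re (\<Sum>i\<in>UNIV. nda_cnj (v $ i) * mvmul A v $ i) > 0)}"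

text \<open>
  \<open>leading p\<close> is the set of the first \<open>p\<close> indices in the linear order of \<open>'m\<close>. The determinant of
  the leading principal \<open>p \<times> p\<close> submatrix of a Hermitian matrix is the product of the (real)
  eigenvalues of that submatrix, counted with multiplicity, where the multiplicity is the dimension
  of the eigenspace over the algebra, that is, its real dimension divided by \<open>\<beta>\<close>. Vectors of length
  \<open>p\<close> are represented as vectors supported on \<open>leading p\<close>.
\<close>

definition leading :: "nat \<Rightarrow> 'm::{finite,linorder} set" where
  "leading p = {i. card {..<i} < p}"

definition lead_eigenspace ::
  "nat \<Rightarrow> ('a::normed_division_algebra, 'm, 'm::{finite,linorder}) mtx \<Rightarrow> real \<Rightarrow> ('a, 'm) vec set" where
  "lead_eigenspace p A c =
     {v. (\<forall>i. i \<notin> leading p \<longrightarrow> v $ i = 0) \<and>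
         (\<forall>i\<in>leading p. (\<Sum>j\<in>leading p. A $ i $ j * v $ j) = c *\<^sub>R (v $ i))}"

definition lead_det ::
  "nat \<Rightarrow> ('a::normed_division_algebra, 'm, 'm::{finite,linorder}) mtx \<Rightarrow> real" where
  "lead_det p A =
     (\<Prod>c\<in>{c. lead_eigenspace p A c \<noteq> {0}}. c ^ (dim (lead_eigenspace p A c) div DIM('a)))"

definition hdet :: "('a::normed_division_algebra, 'm, 'm::{finite,linorder}) mtx \<Rightarrow> real" where
  "hdet A = lead_det CARD('m) A"

text \<open>Generalised power; the exponents are \<open>\<kappa> 1, \<dots>, \<kappa> m\<close>, other values of \<open>\<kappa>\<close> are irrelevant.\<close>

definition gpower ::
  "(nat \<Rightarrow> real) \<Rightarrow> ('a::normed_division_algebra, 'm, 'm::{finite,linorder}) mtx \<Rightarrow> real" where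
  "gpower \<kappa> A = lead_det CARD('m) A powr \<kappa> CARD('m) *
     (\<Prod>i = 1..CARD('m) - 1. lead_det i A powr (\<kappa> i - \<kappa> (i + 1)))"

definition chol_upper ::
  "('a::normed_division_algebra, 'm, 'm::{finite,linorder}) mtx \<Rightarrow> ('a, 'm, 'm) mtx" where
  "chol_upper B = (THE U. (\<forall>i j. j < i \<longrightarrow> U $ i $ j = 0) \<and>
     (\<forall>i. \<exists>r>0. U $ i $ i = r *\<^sub>R 1) \<and> ctrans U \<odot> U = B)"

definition chol_lower ::
  "('a::normed_division_algebra, 'm, 'm::{finite,linorder}) mtx \<Rightarrow> ('a, 'm, 'm) mtx" where
  "chol_lower B = (THE L. (\<forall>i j. i < j \<longrightarrow> L $ i $ j = 0) \<and>
     (\<forall>i. \<exists>r>0. L $ i $ i = r *\<^sub>R 1) \<and> ctrans L \<odot> L = B)"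

text \<open>
  Lebesgue measure on Hermitian matrices, in the coordinates given by the diagonal entries and the
  real components of the entries below the diagonal; it is carried by the Hermitian matrices inside
  the full matrix space.
\<close>

definition herm_of :: "('m \<Rightarrow> real) \<times> ('m \<times> 'm \<Rightarrow> 'a) \<Rightarrow>
    ('a::normed_division_algebra, 'm, 'm::{finite,linorder}) mtx" where
  "herm_of = (\<lambda>(d, l). \<chi> i j. if i = j then d i *\<^sub>R 1
     else if j < i then l (i, j) else nda_cnj (l (j, i)))"

definition herm_lborel ::
  "('a::normed_division_algebra, 'm, 'm::{finite,linorder}) mtx measure" where
  "herm_lborel =
     distr ((\<Pi>\<^sub>M i\<in>(UNIV :: 'm set). (lborel :: real measure)) \<Otimes>\<^sub>M
            (\<Pi>\<^sub>M p\<in>{p :: 'm \<times> 'm. snd p < fst p}. (lborel :: 'a measure)))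
       borel herm_of"

section \<open>Gamma functions\<close>

definition mGamma :: "real \<Rightarrow> nat \<Rightarrow> real \<Rightarrow> real" where
  "mGamma \<beta> m a = pi powr (real m * (real m - 1) * \<beta> / 4) *
     (\<Prod>i = 1..m. Gamma (a - (real i - 1) * \<beta> / 2))"

definition mGamma_I :: "real \<Rightarrow> nat \<Rightarrow> real \<Rightarrow> (nat \<Rightarrow> real) \<Rightarrow> real" where
  "mGamma_I \<beta> m a \<kappa> = pi powr (real m * (real m - 1) * \<beta> / 4) *
     (\<Prod>i = 1..m. Gamma (a + \<kappa> i - (real i - 1) * \<beta> / 2))"

definition mGamma_II :: "real \<Rightarrow> nat \<Rightarrow> real \<Rightarrow> (nat \<Rightarrow> real) \<Rightarrow> real" where
  "mGamma_II \<beta> m a \<kappa> = pi powr (real m * (real m - 1) * \<beta> / 4) *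
     (\<Prod>i = 1..m. Gamma (a - \<kappa> i - (real m - real i) * \<beta> / 2))"

section \<open>Independence\<close>

text \<open>The library's \<open>indep_var\<close> requires both variables to have the same type.\<close>

definition indep_rv ::
  "'w measure \<Rightarrow> ('w \<Rightarrow> 'b::topological_space) \<Rightarrow> ('w \<Rightarrow> 'c::topological_space) \<Rightarrow> bool" where
  "indep_rv M X Y \<longleftrightarrow>
     X \<in> measurable M borel \<and> Y \<in> measurable M borel \<and>
     prob_space.indep_set M {X -` A \<inter> space M | A. A \<in> sets borel}
                            {Y -` B \<inter> space M | B. B \<in> sets borel}"

section \<open>Riesz distributions\<close>

definition riesz_I_density :: "real \<Rightarrow> (nat \<Rightarrow> real) \<Rightarrow>
    ('a::normed_division_algebra, 'm, 'm::{finite,linorder}) mtx \<Rightarrow> ('a, 'm, 'm) mtx \<Rightarrow> real" where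
  "riesz_I_density a \<kappa> \<Xi> V = (let \<beta> = real DIM('a); m = real CARD('m) in
     indicator pos_def V *
     (\<beta> powr (a * m + (\<Sum>i = 1..CARD('m). \<kappa> i)) /
       (mGamma_I \<beta> CARD('m) a \<kappa> * hdet \<Xi> powr a * gpower \<kappa> \<Xi>)) *
     etr (- \<beta> *\<^sub>R (minv \<Xi> \<odot> V)) * hdet V powr (a - (m - 1) * \<beta> / 2 - 1) * gpower \<kappa> V)"

definition riesz_II_density :: "real \<Rightarrow> (nat \<Rightarrow> real) \<Rightarrow>
    ('a::normed_division_algebra, 'm, 'm::{finite,linorder}) mtx \<Rightarrow> ('a, 'm, 'm) mtx \<Rightarrow> real" where
  "riesz_II_density a \<kappa> \<Xi> V = (let \<beta> = real DIM('a); m = real CARD('m) in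
     indicator pos_def V *
     (\<beta> powr (a * m - (\<Sum>i = 1..CARD('m). \<kappa> i)) /
       (mGamma_II \<beta> CARD('m) a \<kappa> * hdet \<Xi> powr a * gpower \<kappa> (minv \<Xi>))) *
     etr (- \<beta> *\<^sub>R (minv \<Xi> \<odot> V)) * hdet V powr (a - (m - 1) * \<beta> / 2 - 1) * gpower \<kappa> (minv V))"

definition riesz_I :: "'w measure \<Rightarrow> ('w \<Rightarrow> ('a, 'm, 'm) mtx) \<Rightarrow> real \<Rightarrow> (nat \<Rightarrow> real) \<Rightarrow>
    ('a::normed_division_algebra, 'm, 'm::{finite,linorder}) mtx \<Rightarrow> bool" where
  "riesz_I M V a \<kappa> \<Xi> \<longleftrightarrow> \<Xi> \<in> pos_def \<and>
     a \<ge> (real CARD('m) - 1) * real DIM('a) / 2 - \<kappa> CARD('m) \<and>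
     distributed M herm_lborel V (\<lambda>X. ennreal (riesz_I_density a \<kappa> \<Xi> X))"

definition riesz_II :: "'w measure \<Rightarrow> ('w \<Rightarrow> ('a, 'm, 'm) mtx) \<Rightarrow> real \<Rightarrow> (nat \<Rightarrow> real) \<Rightarrow>
    ('a::normed_division_algebra, 'm, 'm::{finite,linorder}) mtx \<Rightarrow> bool" where
  "riesz_II M V a \<kappa> \<Xi> \<longleftrightarrow> \<Xi> \<in> pos_def \<and>
     a > (real CARD('m) - 1) * real DIM('a) / 2 + \<kappa> 1 \<and>
     distributed M herm_lborel V (\<lambda>X. ennreal (riesz_II_density a \<kappa> \<Xi> X))"

text \<open>
  The case \<open>m = 1\<close>, for a real random variable: \<open>riesz1_density \<beta> (a + k) \<rho>\<close> is the density of
  type I and \<open>riesz1_density \<beta> (a - k) \<rho>\<close> that of type II.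
\<close>

definition riesz1_density :: "real \<Rightarrow> real \<Rightarrow> real \<Rightarrow> real \<Rightarrow> real" where
  "riesz1_density \<beta> b \<rho> s = indicator {0<..} s *
     (\<beta> powr b / (Gamma b * \<rho> powr b)) * exp (- \<beta> * s / \<rho>) * s powr (b - 1)"

definition riesz1_I ::
  "'w measure \<Rightarrow> ('w \<Rightarrow> real) \<Rightarrow> real \<Rightarrow> real \<Rightarrow> real \<Rightarrow> real \<Rightarrow> bool" where
  "riesz1_I M S \<beta> a k \<rho> \<longleftrightarrow> \<rho> > 0 \<and> a \<ge> - k \<and>
     distributed M lborel S (\<lambda>s. ennreal (riesz1_density \<beta> (a + k) \<rho> s))"

definition riesz1_II ::
  "'w measure \<Rightarrow> ('w \<Rightarrow> real) \<Rightarrow> real \<Rightarrow> real \<Rightarrow> real \<Rightarrow> real \<Rightarrow> bool" where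
  "riesz1_II M S \<beta> a k \<rho> \<longleftrightarrow> \<rho> > 0 \<and> a > k \<and>
     distributed M lborel S (\<lambda>s. ennreal (riesz1_density \<beta> (a - k) \<rho> s))"

section \<open>Kotz-Riesz distributions\<close>

definition kotz_riesz_I_density :: "(nat \<Rightarrow> real) \<Rightarrow>
    ('a::normed_division_algebra, 'm, 'm::{finite,linorder}) mtx \<Rightarrow> ('a, 'n::finite, 'm) mtx \<Rightarrow> real" where
  "kotz_riesz_I_density \<kappa> \<Sigma> Y =
    (let \<beta> = real DIM('a); m = real CARD('m); n = real CARD('n) in
     (\<beta> powr (m * n * \<beta> / 2 + (\<Sum>i = 1..CARD('m). \<kappa> i)) * mGamma \<beta> CARD('m) (n * \<beta> / 2) /
       (pi powr (m * n * \<beta> / 2) * mGamma_I \<beta> CARD('m) (n * \<beta> / 2) \<kappa> *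
        hdet \<Sigma> powr (n * \<beta> / 2))) *
     etr (- \<beta> *\<^sub>R (minv \<Sigma> \<odot> (ctrans Y \<odot> Y))) *
     gpower \<kappa> (minv (ctrans (chol_upper \<Sigma>)) \<odot> (ctrans Y \<odot> Y) \<odot> minv (chol_upper \<Sigma>)))"

text \<open>
  Type II uses the Cholesky factorisation \<open>\<Sigma> = L\<^sup>* L\<close> with \<open>L\<close> lower triangular. For a lower
  triangular factor \<open>(L\<^sup>*\<^sup>-\<^sup>1 W L\<^sup>-\<^sup>1)\<^sup>-\<^sup>1 = L W\<^sup>-\<^sup>1 L\<^sup>*\<close> has leading principal minors proportional to
  those of \<open>W\<^sup>-\<^sup>1\<close>, which is what makes \<open>Y\<^sup>* Y\<close> a Riesz matrix of type II. With the upper triangular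
  factor of type I this fails: for real \<open>2 \<times> 2\<close> matrices, \<open>\<Sigma> = [[1, 1], [1, 2]]\<close> and
  \<open>\<kappa> = (1, 0)\<close>, the generalised power at \<open>W = diag(1, t)\<close> would be \<open>1 + 1/t\<close>, whereas that of
  \<open>W\<^sup>-\<^sup>1\<close> is constant in \<open>t\<close>. Both conventions agree for diagonal \<open>\<Sigma>\<close>.
\<close>

definition kotz_riesz_II_density :: "(nat \<Rightarrow> real) \<Rightarrow>
    ('a::normed_division_algebra, 'm, 'm::{finite,linorder}) mtx \<Rightarrow> ('a, 'n::finite, 'm) mtx \<Rightarrow> real" where
  "kotz_riesz_II_density \<kappa> \<Sigma> Y =
    (let \<beta> = real DIM('a); m = real CARD('m); n = real CARD('n) in
     (\<beta> powr (m * n * \<beta> / 2 - (\<Sum>i = 1..CARD('m). \<kappa> i)) * mGamma \<beta> CARD('m) (n * \<beta> / 2) /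
       (pi powr (m * n * \<beta> / 2) * mGamma_II \<beta> CARD('m) (n * \<beta> / 2) \<kappa> *
        hdet \<Sigma> powr (n * \<beta> / 2))) *
     etr (- \<beta> *\<^sub>R (minv \<Sigma> \<odot> (ctrans Y \<odot> Y))) *
     gpower \<kappa>
       (minv (minv (ctrans (chol_lower \<Sigma>)) \<odot> (ctrans Y \<odot> Y) \<odot> minv (chol_lower \<Sigma>))))"

definition kotz_riesz_I :: "'w measure \<Rightarrow> ('w \<Rightarrow> ('a, 'n::finite, 'm) mtx) \<Rightarrow> (nat \<Rightarrow> real) \<Rightarrow>
    ('a::normed_division_algebra, 'm, 'm::{finite,linorder}) mtx \<Rightarrow> bool" where
  "kotz_riesz_I M Y \<kappa> \<Sigma> \<longleftrightarrow>
     distributed M lborel Y (\<lambda>A. ennreal (kotz_riesz_I_density \<kappa> \<Sigma> A))"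

definition kotz_riesz_II :: "'w measure \<Rightarrow> ('w \<Rightarrow> ('a, 'n::finite, 'm) mtx) \<Rightarrow> (nat \<Rightarrow> real) \<Rightarrow>
    ('a::normed_division_algebra, 'm, 'm::{finite,linorder}) mtx \<Rightarrow> bool" where
  "kotz_riesz_II M Y \<kappa> \<Sigma> \<longleftrightarrow>
     distributed M lborel Y (\<lambda>A. ennreal (kotz_riesz_II_density \<kappa> \<Sigma> A))"

end

theory Submission imports Defs begin

text \<open>The determinant of a positive definite matrix is encoded in its Gaussian integral, so every
  statement about it reduces to a change of variables in a real vector space. The law of \<open>Y\<^sup>*Y\<close> is found
  without Jacobians, by integrating out one column of \<open>Y\<close> at a time: given the earlier columns, the joint
  law of the inner products of the new column \<open>y\<close> with them and of \<open>\<bar>y\<bar>\<^sup>2\<close> is determined by translation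
  invariance and scaling up to a constant, which a Gaussian integral evaluates. This turns the
  Kotz-Riesz density into the Riesz density, because a congruence with a Cholesky factor multiplies
  all leading minors. Mixing over \<open>S\<close> is then a gamma integral for each \<open>F\<close>.

  For a non-associative algebra and \<open>m \<ge> 3\<close> the Gram matrix fails to be positive definite on a set
  of positive measure, so the last hypothesis excludes this case; for \<open>m \<le> 2\<close> the identities of a composition
  algebra suffice.\<close>

section \<open>Composition algebra identities\<close>

text \<open>The obstacle is that over a non-associative algebra \<open>mvmul (A \<odot> B)\<close>
  and the composition of \<open>mvmul A\<close> with \<open>mvmul B\<close> can be different maps.
  Quadratic forms and determinants are therefore handled through real-linear maps of the underlying
  Euclidean space: \<open>vol\<close> plays the role of |det|, congruences are identities between
  quadratic forms, and inverses first appear as linear operators. Rebracketing is confined to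
  termwise lemmas in which at most two indices force a real factor or the pattern conj(x) (x y). The
  conditions on the parameters say little about the signs of the individual Gamma factors, and
  positivity of \<open>1 + \<rho> * rtr (minv \<Sigma> \<odot> X)\<close> is not derived from matrix
  algebra. Both questions are settled by probability: the law of \<open>W\<close> has mass one,
  which fixes the sign of its constant, and the mixture density is finite almost everywhere, which
  forces the gamma integral over the values of \<open>S\<close> to converge.\<close>

lemma nda_one_neq_zero: "(1::'a::normed_division_algebra) \<noteq> 0"
proof
  assume "(1::'a) = 0"
  then have "x = 0" for x :: 'a
    using nda_scaleR_left[of 0 0 x] nda_one_left[of x] by simp
  then show False using nonzero_Basis nonempty_Basis by blast
qed

lemma nda_norm_one [simp]: "norm (1::'a::normed_division_algebra) = 1"
  using nda_norm_mult[of "1::'a" 1] nda_one_neq_zero[where 'a='a] by (simp add: nda_one_left)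

text \<open>Supplies distributivity over sums and differences, and continuity, for a product whose
  type class is not a ring.\<close>

interpretation nda_mult: bounded_bilinear "(*) :: 'a::normed_division_algebra \<Rightarrow> 'a \<Rightarrow> 'a"
  by standard (auto simp: nda_add_left nda_add_right nda_scaleR_left nda_scaleR_right nda_norm_mult
    intro!: exI[of _ 1])

lemma nda_inner_one_one [simp]: "(1::'a::normed_division_algebra) \<bullet> 1 = 1"
  by (simp add: dot_square_norm)

text \<open>Polarisation of the multiplicativity of the norm in the second factor.\<close>

lemma nda_inner_mult_left: "(x * y) \<bullet> (x * z) = (norm x)\<^sup>2 * (y \<bullet> z)"
  for x y z :: "'a::normed_division_algebra"
proof -
  have "(norm (x * (y + z)))\<^sup>2 = (norm x)\<^sup>2 * (norm (y + z))\<^sup>2"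
    by (simp add: nda_norm_mult power_mult_distrib)
  then have "(norm (x * y))\<^sup>2 + 2 * ((x * y) \<bullet> (x * z)) + (norm (x * z))\<^sup>2
      = (norm x)\<^sup>2 * ((norm y)\<^sup>2 + 2 * (y \<bullet> z) + (norm z)\<^sup>2)"
    unfolding nda_add_right power2_norm_eq_inner by (simp add: inner_add inner_commute algebra_simps)
  then show ?thesis by (simp add: nda_norm_mult power_mult_distrib algebra_simps)
qed

lemma nda_inner_mult_right: "(y * x) \<bullet> (z * x) = (norm x)\<^sup>2 * (y \<bullet> z)"
  for x y z :: "'a::normed_division_algebra"
proof -
  have "(norm ((y + z) * x))\<^sup>2 = (norm x)\<^sup>2 * (norm (y + z))\<^sup>2"
    by (simp add: nda_norm_mult power_mult_distrib)
  then have "(norm (y * x))\<^sup>2 + 2 * ((y * x) \<bullet> (z * x)) + (norm (z * x))\<^sup>2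
      = (norm x)\<^sup>2 * ((norm y)\<^sup>2 + 2 * (y \<bullet> z) + (norm z)\<^sup>2)"
    unfolding nda_add_left power2_norm_eq_inner by (simp add: inner_add inner_commute algebra_simps)
  then show ?thesis by (simp add: nda_norm_mult power_mult_distrib algebra_simps)
qed

text \<open>A second polarisation, now in the factor that the previous identities repeat. With one
  entry equal to 1 it becomes the adjunction rule for multiplication.\<close>

lemma nda_exchange_left: "(x * y) \<bullet> (z * w) + (z * y) \<bullet> (x * w) = 2 * (x \<bullet> z) * (y \<bullet> w)"
  for x y z w :: "'a::normed_division_algebra"
  using nda_inner_mult_left[of "x + z" y w] nda_inner_mult_left[of x y w] nda_inner_mult_left[of z y w]
  by (simp add: nda_add_left power2_norm_eq_inner inner_add algebra_simps inner_commute[of z x])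

lemma nda_exchange_right: "(x * y) \<bullet> (z * w) + (x * w) \<bullet> (z * y) = 2 * (x \<bullet> z) * (y \<bullet> w)"
  for x y z w :: "'a::normed_division_algebra"
  using nda_inner_mult_right[of x "y + w" z] nda_inner_mult_right[of x y z] nda_inner_mult_right[of x w z]
  by (simp add: nda_add_right power2_norm_eq_inner inner_add algebra_simps inner_commute[of w y])

text \<open>The exchange identity with third entry 1, where \<open>nda_cnj\<close> appears as twice
  the real part minus the element. It moves a single factor across the inner product, so it is
  available without associativity and carries the adjoint calculus below.\<close>

lemma nda_adjoint_left: "(x * y) \<bullet> z = y \<bullet> (nda_cnj x * z)"
  for x y z :: "'a::normed_division_algebra"
  using nda_exchange_left[of x y 1 z]
  by (simp add: nda_cnj_def nda_re_def nda_one_left nda_mult.diff_left nda_scaleR_left inner_diff_right)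

lemma nda_adjoint_right: "(x * y) \<bullet> z = x \<bullet> (z * nda_cnj y)"
  for x y z :: "'a::normed_division_algebra"
  using nda_exchange_right[of x y z 1]
  by (simp add: nda_cnj_def nda_re_def nda_one_right nda_one_left nda_mult.diff_right nda_scaleR_right
      inner_diff_right algebra_simps)

lemma nda_cnj_cnj [simp]: "nda_cnj (nda_cnj x) = x"
  by (simp add: nda_cnj_def nda_re_def inner_diff_left)

lemma nda_inner_cnj_cnj [simp]: "nda_cnj x \<bullet> nda_cnj y = x \<bullet> y"
  for x y :: "'a::normed_division_algebra"
  by (simp add: nda_cnj_def nda_re_def inner_diff_left inner_diff_right inner_commute[of "1::'a" y])

lemma nda_norm_cnj [simp]: "norm (nda_cnj x) = norm x"
  by (simp add: norm_eq_sqrt_inner)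

lemma linear_nda_cnj: "linear nda_cnj"
  by (rule linearI) (auto simp: nda_cnj_def nda_re_def inner_add_left algebra_simps)

lemma nda_cnj_add: "nda_cnj (x + y) = nda_cnj x + nda_cnj y"
  and nda_cnj_diff: "nda_cnj (x - y) = nda_cnj x - nda_cnj y"
  and nda_cnj_minus: "nda_cnj (- x) = - nda_cnj x"
  and nda_cnj_scaleR: "nda_cnj (r *\<^sub>R x) = r *\<^sub>R nda_cnj x"
  and nda_cnj_sum: "nda_cnj (sum f A) = (\<Sum>a\<in>A. nda_cnj (f a))"
  and nda_cnj_zero [simp]: "nda_cnj 0 = 0"
  by (fact linear_add[OF linear_nda_cnj] linear_diff[OF linear_nda_cnj] linear_neg[OF linear_nda_cnj]
      linear_scale[OF linear_nda_cnj] linear_sum[OF linear_nda_cnj] linear_0[OF linear_nda_cnj])+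

lemma nda_cnj_one [simp]: "nda_cnj 1 = 1"
  by (simp add: nda_cnj_def nda_re_def scaleR_2)

text \<open>The alternative law in conjugate form: against any test vector, adjunction turns the
  left side into the polarised norm identity. This and real scalar factors are what permits
  rebracketing matrix products when the algebra is not associative.\<close>

lemma nda_cnj_mult_cancel: "nda_cnj x * (x * y) = (norm x)\<^sup>2 *\<^sub>R y"
  for x y :: "'a::normed_division_algebra"
proof -
  have "\<forall>z. (nda_cnj x * (x * y)) \<bullet> z = ((norm x)\<^sup>2 *\<^sub>R y) \<bullet> z"
    by (simp add: nda_adjoint_left[of "nda_cnj x"] nda_inner_mult_left)
  then show ?thesis by (simp only: vector_eq_rdot)
qed

lemma nda_mult_cnj_cancel: "x * (nda_cnj x * y) = (norm x)\<^sup>2 *\<^sub>R y"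
  for x y :: "'a::normed_division_algebra"
  using nda_cnj_mult_cancel[of "nda_cnj x" y] by simp

lemma nda_cnj_mult_self: "nda_cnj x * x = (norm x)\<^sup>2 *\<^sub>R 1"
  for x :: "'a::normed_division_algebra"
  using nda_cnj_mult_cancel[of x 1] by (simp add: nda_one_right)

lemma nda_mult_cnj_self: "x * nda_cnj x = (norm x)\<^sup>2 *\<^sub>R 1"
  for x :: "'a::normed_division_algebra"
  using nda_mult_cnj_cancel[of x 1] by (simp add: nda_one_right)

text \<open>Real parts of triple products do not depend on the bracketing, by adjunction. The inner
  product of either side with \<open>z\<close> is such a real part, and these inner products
  determine the element.\<close>

lemma nda_cnj_mult: "nda_cnj (x * y) = nda_cnj y * nda_cnj x"
  for x y :: "'a::normed_division_algebra"
proof -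
  have re: "((u * v) * w) \<bullet> 1 = (u * (v * w)) \<bullet> 1" for u v w :: 'a
    by (simp add: nda_adjoint_right[of "u * v"] nda_adjoint_left[of u] nda_adjoint_right[of v] nda_one_left
        nda_one_right)
  have "\<forall>z. nda_cnj (x * y) \<bullet> z = (nda_cnj y * nda_cnj x) \<bullet> z"
  proof
    fix z
    have "nda_cnj (x * y) \<bullet> z = ((x * y) * z) \<bullet> 1"
      using nda_adjoint_left[of "x * y" z 1] by (simp add: nda_one_right inner_commute)
    also have "\<dots> = (x * (y * z)) \<bullet> 1" by (rule re)
    also have "\<dots> = (nda_cnj y * nda_cnj x) \<bullet> z"
      using nda_adjoint_left[of x "y * z" 1] nda_adjoint_left[of y z "nda_cnj x"]
      by (simp add: nda_one_right inner_commute)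
    finally show "nda_cnj (x * y) \<bullet> z = (nda_cnj y * nda_cnj x) \<bullet> z" .
  qed
  then show ?thesis by (simp only: vector_eq_rdot)
qed

lemma nda_re_cnj_mult: "nda_re (nda_cnj x * y) = x \<bullet> y"
  for x y :: "'a::normed_division_algebra"
  using nda_adjoint_left[of "nda_cnj x" y 1] by (simp add: nda_re_def nda_one_right inner_commute)

lemma nda_mult_eq_0_iff: "x * y = 0 \<longleftrightarrow> x = 0 \<or> y = 0"
  for x y :: "'a::normed_division_algebra"
  using nda_norm_mult[of x y] by (metis mult_eq_0_iff norm_eq_zero)

lemma nda_scaleR_one_mult [simp]: "(r *\<^sub>R 1) * x = r *\<^sub>R x" "x * (r *\<^sub>R 1) = r *\<^sub>R x"
  for x :: "'a::normed_division_algebra"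
  by (simp_all add: nda_scaleR_left nda_scaleR_right nda_one_left nda_one_right)

lemma nda_cnj_eq_self_iff: "nda_cnj x = x \<longleftrightarrow> (\<exists>r. x = r *\<^sub>R 1)"
proof
  assume "nda_cnj x = x"
  then have "(2 * nda_re x) *\<^sub>R 1 = 2 *\<^sub>R x" by (simp add: nda_cnj_def scaleR_2 algebra_simps)
  then have "x = nda_re x *\<^sub>R 1"
    by (metis scaleR_scaleR scaleR_left_imp_eq zero_neq_numeral)
  then show "\<exists>r. x = r *\<^sub>R 1" by blast
qed (auto simp: nda_cnj_scaleR)

section \<open>Matrices acting on vectors\<close>

lemma mvmul_nth: "mvmul A v $ i = (\<Sum>j\<in>UNIV. A $ i $ j * v $ j)"
  by (simp add: mvmul_def)

lemma linear_mvmul: "linear (mvmul A)"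
  by (rule linearI) (auto simp: vec_eq_iff mvmul_nth nda_add_right sum.distrib nda_scaleR_right scaleR_right.sum)

lemma mvmul_add_left: "mvmul (A + B) v = mvmul A v + mvmul B v"
  by (simp add: vec_eq_iff mvmul_nth nda_add_left sum.distrib)

lemma mvmul_scaleR_left: "mvmul (r *\<^sub>R A) v = r *\<^sub>R mvmul A v"
  by (simp add: vec_eq_iff mvmul_nth nda_scaleR_left scaleR_right.sum)

lemma mvmul_axis: "mvmul A (axis j x) $ i = A $ i $ j * x"
proof -
  have "mvmul A (axis j x) $ i = (\<Sum>l\<in>UNIV. if l = j then A $ i $ l * x else 0)"
    unfolding mvmul_nth by (rule sum.cong) (auto simp: axis_def nda_mult.zero_right)
  then show ?thesis by simp
qed

lemma mvmul_mident [simp]: "mvmul mident v = v"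
proof -
  have "(\<Sum>j\<in>UNIV. mident $ i $ j * v $ j) = (\<Sum>j\<in>UNIV. if j = i then v $ j else 0)" for i
    by (rule sum.cong) (auto simp: mident_def nda_one_left nda_mult.zero_left)
  then show ?thesis by (simp add: vec_eq_iff mvmul_nth)
qed

lemma mmul_nth: "(A \<odot> B) $ i $ j = (\<Sum>l\<in>UNIV. A $ i $ l * B $ l $ j)"
  by (simp add: mmul_def)

text \<open>On \<open>axis j 1\<close> the last factor is 1, so no bracket has to be moved. Matrix
  equations are therefore checked on these vectors.\<close>

lemma mmul_column: "(A \<odot> B) $ i $ j = mvmul A (mvmul B (axis j 1)) $ i"
  by (simp add: mmul_nth mvmul_nth[of A] mvmul_axis nda_one_right)

text \<open>Identifies the form in the definition of \<open>pos_def\<close> with a real inner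
  product, so that positivity becomes a statement about a symmetric real operator and its Gaussian
  integral.\<close>

lemma quad_form_eq: "nda_re (\<Sum>i\<in>UNIV. nda_cnj (v $ i) * w $ i) = v \<bullet> w"
  for v w :: "'a::normed_division_algebra ^ 'm::finite"
proof -
  have "nda_re (\<Sum>i\<in>UNIV. nda_cnj (v $ i) * w $ i) = (\<Sum>i\<in>UNIV. nda_re (nda_cnj (v $ i) * w $ i))"
    by (simp add: nda_re_def inner_sum_left)
  then show ?thesis by (simp add: nda_re_cnj_mult inner_vec_def)
qed

lemma hermitian_nth: "hermitian A \<longleftrightarrow> (\<forall>i j. nda_cnj (A $ j $ i) = A $ i $ j)"
  by (simp add: hermitian_def ctrans_def vec_eq_iff)

lemma pos_def_iff: "A \<in> pos_def \<longleftrightarrow> hermitian A \<and> (\<forall>v. v \<noteq> 0 \<longrightarrow> v \<bullet> mvmul A v > 0)"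
  by (simp add: pos_def_def quad_form_eq)

text \<open>Adjunction is applied entry by entry, to one product at a time, which makes the rule
  valid over every algebra of the class.\<close>

lemma mvmul_adjoint: "mvmul A v \<bullet> w = v \<bullet> mvmul (ctrans A) w"
proof -
  have "mvmul A v \<bullet> w = (\<Sum>i\<in>UNIV. \<Sum>j\<in>UNIV. (A $ i $ j * v $ j) \<bullet> w $ i)"
    by (simp add: inner_vec_def mvmul_nth inner_sum_left)
  also have "\<dots> = (\<Sum>j\<in>UNIV. \<Sum>i\<in>UNIV. v $ j \<bullet> (nda_cnj (A $ i $ j) * w $ i))"
    by (subst sum.swap) (simp add: nda_adjoint_left)
  also have "\<dots> = v \<bullet> mvmul (ctrans A) w"
    by (simp add: inner_vec_def mvmul_nth inner_sum_right ctrans_def)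
  finally show ?thesis .
qed

lemma ctrans_ctrans [simp]: "ctrans (ctrans A) = A"
  by (simp add: ctrans_def vec_eq_iff)

lemma ctrans_mmul: "ctrans (A \<odot> B) = ctrans B \<odot> ctrans A"
  by (simp add: ctrans_def vec_eq_iff mmul_nth nda_cnj_sum nda_cnj_mult)

lemma ctrans_scaleR: "ctrans (r *\<^sub>R A) = r *\<^sub>R ctrans A"
  by (simp add: ctrans_def vec_eq_iff nda_cnj_scaleR)

lemma ctrans_mident [simp]: "ctrans mident = mident"
  by (simp add: ctrans_def vec_eq_iff mident_def)

lemma mmul_scaleR_left: "(r *\<^sub>R A) \<odot> B = r *\<^sub>R (A \<odot> B)"
  and mmul_scaleR_right: "A \<odot> (r *\<^sub>R B) = r *\<^sub>R (A \<odot> B)"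
  by (simp_all add: vec_eq_iff mmul_nth nda_scaleR_left nda_scaleR_right scaleR_right.sum)

lemma hermitian_gram: "hermitian (ctrans A \<odot> A)"
  by (simp add: hermitian_def ctrans_mmul)

lemma hermitian_diag:
  assumes "hermitian A" shows "\<exists>r. A $ i $ i = r *\<^sub>R 1"
  using assms unfolding hermitian_nth by (metis nda_cnj_eq_self_iff)

lemma pos_def_inj: "A \<in> pos_def \<Longrightarrow> inj (mvmul A)"
  unfolding linear_injective_0[OF linear_mvmul] pos_def_iff by (metis inner_zero_right less_irrefl)

lemma pos_def_symmetric: "A \<in> pos_def \<Longrightarrow> mvmul A v \<bullet> w = v \<bullet> mvmul A w"
  by (metis hermitian_def mvmul_adjoint pos_def_iff)

section \<open>Uniqueness of translation invariant measures\<close>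

text \<open>Both sides are the integral of \<open>f x * g (x + y)\<close> over the product of the two measures.\<close>

lemma haar_measure_unique:
  fixes M N L :: "'g measure" and add sub :: "'g \<Rightarrow> 'g \<Rightarrow> 'g"
  assumes "sigma_finite_measure M" "sigma_finite_measure N"
    and sets [measurable_cong]: "sets M = sets L" "sets N = sets L"
    and add [measurable]: "(\<lambda>(x, y). add x y) \<in> L \<Otimes>\<^sub>M L \<rightarrow>\<^sub>M L"
    and sub [measurable]: "(\<lambda>(x, y). sub x y) \<in> L \<Otimes>\<^sub>M L \<rightarrow>\<^sub>M L"
    and cancel: "\<And>x y. x \<in> space L \<Longrightarrow> y \<in> space L \<Longrightarrow> sub (add x y) y = x"
    and M_inv: "\<And>h y. h \<in> borel_measurable L \<Longrightarrow> y \<in> space L \<Longrightarrow>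
      (\<integral>\<^sup>+x. h (add x y) \<partial>M) = (\<integral>\<^sup>+x. h x \<partial>M)"
    and N_inv: "\<And>h x. h \<in> borel_measurable L \<Longrightarrow> x \<in> space L \<Longrightarrow>
      (\<integral>\<^sup>+y. h (add x y) \<partial>N) = (\<integral>\<^sup>+y. h y \<partial>N)"
    and N_refl: "\<And>h x. h \<in> borel_measurable L \<Longrightarrow> x \<in> space L \<Longrightarrow>
      (\<integral>\<^sup>+y. h (sub x y) \<partial>N) = (\<integral>\<^sup>+y. h y \<partial>N)"
    and f [measurable]: "f \<in> borel_measurable L" and g [measurable]: "g \<in> borel_measurable L"
  shows "(\<integral>\<^sup>+x. f x \<partial>M) * (\<integral>\<^sup>+x. g x \<partial>N) = (\<integral>\<^sup>+x. f x \<partial>N) * (\<integral>\<^sup>+x. g x \<partial>M)"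
proof -
  interpret M: sigma_finite_measure M by fact
  interpret N: sigma_finite_measure N by fact
  interpret MN: pair_sigma_finite M N ..
  have sp: "space M = space L" "space N = space L" using sets by (auto dest: sets_eq_imp_space_eq)
  have [measurable]: "(\<lambda>y. add x y) \<in> L \<rightarrow>\<^sub>M L" "(\<lambda>y. sub x y) \<in> L \<rightarrow>\<^sub>M L"
    "(\<lambda>y. add y x) \<in> L \<rightarrow>\<^sub>M L" "(\<lambda>y. sub y x) \<in> L \<rightarrow>\<^sub>M L" if "x \<in> space L" for x
    using that measurable_compose[OF measurable_Pair1' add, of x] measurable_compose[OF measurable_Pair1' sub, of x]
      measurable_compose[OF measurable_Pair2' add, of x] measurable_compose[OF measurable_Pair2' sub, of x]
    by auto
  have "(\<integral>\<^sup>+x. f x \<partial>M) * (\<integral>\<^sup>+x. g x \<partial>N) = (\<integral>\<^sup>+x. f x * (\<integral>\<^sup>+y. g y \<partial>N) \<partial>M)"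
    by (simp add: nn_integral_multc)
  also have "\<dots> = (\<integral>\<^sup>+x. (\<integral>\<^sup>+y. f x * g (add x y) \<partial>N) \<partial>M)"
    by (intro nn_integral_cong) (simp add: sp nn_integral_cmult N_inv)
  also have "\<dots> = (\<integral>\<^sup>+y. (\<integral>\<^sup>+x. f x * g (add x y) \<partial>M) \<partial>N)"
    by (intro MN.Fubini'[symmetric]) measurable
  \<comment> \<open>Translating \<open>x\<close> by \<open>y\<close> under \<open>M\<close>:
    \<open>cancel\<close> restores the argument of \<open>f\<close>, so the shift moves from
    \<open>g\<close> to \<open>f\<close>.\<close>
  also have "\<dots> = (\<integral>\<^sup>+y. (\<integral>\<^sup>+x. f (sub x y) * g x \<partial>M) \<partial>N)"
  proof (rule nn_integral_cong)
    fix y assume "y \<in> space N"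
    then have y: "y \<in> space L" by (simp add: sp)
    have "(\<integral>\<^sup>+x. f (sub x y) * g x \<partial>M) = (\<integral>\<^sup>+x. f (sub (add x y) y) * g (add x y) \<partial>M)"
      using y by (intro M_inv[symmetric, where h = "\<lambda>x. f (sub x y) * g x"]) measurable
    also have "\<dots> = (\<integral>\<^sup>+x. f x * g (add x y) \<partial>M)"
      using y by (intro nn_integral_cong) (simp add: cancel sp)
    finally show "(\<integral>\<^sup>+x. f x * g (add x y) \<partial>M) = (\<integral>\<^sup>+x. f (sub x y) * g x \<partial>M)" by simp
  qed
  also have "\<dots> = (\<integral>\<^sup>+x. (\<integral>\<^sup>+y. f (sub x y) * g x \<partial>N) \<partial>M)"
    by (intro MN.Fubini') measurable
  \<comment> \<open>For fixed \<open>x\<close>, invariance of \<open>N\<close> under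
    \<open>y \<mapsto> sub x y\<close> removes \<open>x\<close> from the argument of
    \<open>f\<close>.\<close>
  also have "\<dots> = (\<integral>\<^sup>+x. (\<integral>\<^sup>+y. f y \<partial>N) * g x \<partial>M)"
    by (intro nn_integral_cong) (simp add: sp nn_integral_multc N_refl)
  also have "\<dots> = (\<integral>\<^sup>+x. f x \<partial>N) * (\<integral>\<^sup>+x. g x \<partial>M)"
    by (simp add: nn_integral_cmult)
  finally show ?thesis .
qed

section \<open>Lebesgue integrals under affine and coordinatewise maps\<close>

lemma nn_integral_lborel_affine:
  fixes f :: "'b::euclidean_space \<Rightarrow> ennreal"
  assumes "c \<noteq> 0" and [measurable]: "f \<in> borel_measurable borel"
  shows "(\<integral>\<^sup>+x. f (t + c *\<^sub>R x) \<partial>lborel) * ennreal (\<bar>c\<bar> ^ DIM('b)) = (\<integral>\<^sup>+x. f x \<partial>lborel)"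
  by (subst (2) lborel_affine[OF assms(1), of t])
     (simp add: nn_integral_density nn_integral_distr nn_integral_cmult mult.commute ennreal_power)

lemma nn_integral_lborel_translate:
  fixes f :: "'b::euclidean_space \<Rightarrow> ennreal"
  assumes "f \<in> borel_measurable borel"
  shows "(\<integral>\<^sup>+x. f (x + t) \<partial>lborel) = (\<integral>\<^sup>+x. f x \<partial>lborel)"
  using nn_integral_lborel_affine[OF _ assms, of 1 t] by (simp add: add.commute)

lemma nn_integral_lborel_reflect:
  fixes f :: "'b::euclidean_space \<Rightarrow> ennreal"
  assumes "f \<in> borel_measurable borel"
  shows "(\<integral>\<^sup>+x. f (t - x) \<partial>lborel) = (\<integral>\<^sup>+x. f x \<partial>lborel)"
  using nn_integral_lborel_affine[OF _ assms, of "-1" t] by simp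

text \<open>Fubini, one coordinate at a time: \<open>c i\<close> is the Jacobian of
  \<open>T i\<close>, and the Jacobians multiply. They are kept as factors beside the integral,
  which avoids division in \<open>ennreal\<close>.\<close>

lemma nn_integral_PiM_map:
  fixes M :: "'i \<Rightarrow> 'b measure"
  assumes "\<And>i. sigma_finite_measure (M i)"
    and "finite I"
    and T: "\<And>i. i \<in> I \<Longrightarrow> T i \<in> M i \<rightarrow>\<^sub>M M i"
    and c: "\<And>i f. i \<in> I \<Longrightarrow> f \<in> borel_measurable (M i) \<Longrightarrow>
      (\<integral>\<^sup>+x. f (T i x) \<partial>M i) * c i = (\<integral>\<^sup>+x. f x \<partial>M i)"
    and "f \<in> borel_measurable (PiM I M)"
  shows "(\<integral>\<^sup>+x. f (\<lambda>i\<in>I. T i (x i)) \<partial>PiM I M) * (\<Prod>i\<in>I. c i) = (\<integral>\<^sup>+x. f x \<partial>PiM I M)"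
  using assms(2-)
proof (induction I arbitrary: f rule: finite_induct)
  case empty
  interpret product_sigma_finite M using assms(1) by (simp add: product_sigma_finite_def)
  show ?case by (simp add: nn_integral_empty restrict_def del: nn_integral_const)
next
  case (insert i I)
  interpret product_sigma_finite M using assms(1) by (simp add: product_sigma_finite_def)
  note [measurable] = insert.prems(3)
  have [measurable]: "T k \<in> M k \<rightarrow>\<^sub>M M k" if "k \<in> insert i I" for k using insert.prems(1) that by blast
  have [measurable]: "T i \<in> M i \<rightarrow>\<^sub>M M i" by simp
  have [measurable]: "(\<lambda>x. \<lambda>k\<in>I. T k (x k)) \<in> PiM I M \<rightarrow>\<^sub>M PiM I M"
    by (rule measurable_restrict, rule measurable_compose[OF measurable_component_singleton]) auto
  have meas1: "(\<lambda>x. \<lambda>k\<in>insert i I. T k (x k)) \<in> PiM (insert i I) M \<rightarrow>\<^sub>M PiM (insert i I) M"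
    by (rule measurable_restrict, rule measurable_compose[OF measurable_component_singleton]) auto
  have upd: "f ((\<lambda>k\<in>I. T k (x k))(i := T i y)) = f (\<lambda>k\<in>insert i I. T k ((x(i := y)) k))" for x y
    using insert.hyps(2) by (intro arg_cong[where f = f]) (auto simp: restrict_def fun_eq_iff)
  have "(\<integral>\<^sup>+x. f (\<lambda>k\<in>insert i I. T k (x k)) \<partial>PiM (insert i I) M) * (\<Prod>k\<in>insert i I. c k)
    = (\<integral>\<^sup>+x. (\<integral>\<^sup>+y. f ((\<lambda>k\<in>I. T k (x k))(i := T i y)) \<partial>M i) \<partial>PiM I M) * (c i * (\<Prod>k\<in>I. c k))"
    by (simp only: product_nn_integral_insert[OF insert.hyps measurable_compose[OF meas1 insert.prems(3)]] upd
      prod.insert[OF insert.hyps])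
  also have "\<dots> = (\<integral>\<^sup>+x. (\<integral>\<^sup>+y. f ((\<lambda>k\<in>I. T k (x k))(i := T i y)) \<partial>M i) * c i \<partial>PiM I M) * (\<Prod>k\<in>I. c k)"
    by (subst nn_integral_multc) (auto simp: mult.assoc)
  also have "\<dots> = (\<integral>\<^sup>+x. (\<integral>\<^sup>+y. f ((\<lambda>k\<in>I. T k (x k))(i := y)) \<partial>M i) \<partial>PiM I M) * (\<Prod>k\<in>I. c k)"
    (is "_ = ?R * _")
  proof -
    have "(\<integral>\<^sup>+y. f ((\<lambda>k\<in>I. T k (x k))(i := T i y)) \<partial>M i) * c i =
      (\<integral>\<^sup>+y. f ((\<lambda>k\<in>I. T k (x k))(i := y)) \<partial>M i)" if "x \<in> space (PiM I M)" for x
    proof (rule insert.prems(2))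
      have "(\<lambda>k\<in>I. T k (x k)) \<in> space (PiM I M)"
        using that by (rule measurable_space[rotated]) measurable
      then show "(\<lambda>y. f ((\<lambda>k\<in>I. T k (x k))(i := y))) \<in> borel_measurable (M i)"
        using measurable_compose[OF measurable_Pair1' measurable_add_dim] insert.prems(3)
        by (auto intro!: measurable_compose[OF _ insert.prems(3)])
    qed simp
    then show ?thesis by (simp cong: nn_integral_cong)
  qed
  also have "\<dots> = (\<integral>\<^sup>+x. (\<integral>\<^sup>+y. f (x(i := y)) \<partial>M i) \<partial>PiM I M)"
  proof (rule insert.IH)
    have "(\<lambda>(x, y). f (x(i := y))) \<in> borel_measurable (PiM I M \<Otimes>\<^sub>M M i)"
      using measurable_compose[OF measurable_add_dim insert.prems(3)] by (simp add: split_beta)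
    then show "(\<lambda>x. \<integral>\<^sup>+y. f (x(i := y)) \<partial>M i) \<in> borel_measurable (PiM I M)"
      by (rule sigma_finite_measure.borel_measurable_nn_integral[OF assms(1)])
  qed (use insert.prems in auto)
  also have "\<dots> = (\<integral>\<^sup>+x. f x \<partial>PiM (insert i I) M)"
    using insert.hyps by (simp add: product_nn_integral_insert)
  finally show ?case .
qed

section \<open>Volume scaling of linear maps\<close>

text \<open>This is |det T| for an injective linear \<open>T\<close>, read off from the preimage of
  the unit ball.\<close>

definition vol :: "('b::euclidean_space \<Rightarrow> 'b) \<Rightarrow> real" where
  "vol T = measure lborel (cball (0::'b) 1) / measure lborel (T -` cball 0 1)"

lemma emeasure_lborel_bounded_real:
  fixes A :: "'b::euclidean_space set"
  assumes "A \<in> sets borel" "bounded A" "ball 0 e \<subseteq> A" "e > 0"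
  shows "emeasure lborel A = ennreal (measure lborel A)" "measure lborel A > 0"
proof -
  have fin: "emeasure lborel A < \<infinity>" using emeasure_bounded_finite[OF assms(2)] .
  then show 1: "emeasure lborel A = ennreal (measure lborel A)"
    by (intro emeasure_eq_ennreal_measure) (auto simp: less_top)
  have "emeasure lborel (ball (0::'b) e) = ennreal (measure lborel (ball (0::'b) e))"
    using emeasure_bounded_finite[OF bounded_ball] by (intro emeasure_eq_ennreal_measure) (simp add: less_top)
  then have "0 < emeasure lborel (ball (0::'b) e)"
    using content_ball_pos[OF assms(4), of "0::'b"] by simp
  also have "\<dots> \<le> emeasure lborel A" using assms by (intro emeasure_mono) auto
  finally show "measure lborel A > 0" by (simp add: 1)
qed

lemma linear_inj_bounds:
  fixes T :: "'b::euclidean_space \<Rightarrow> 'b"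
  assumes "linear T" "inj T"
  shows "bounded (T -` cball 0 r)" "r > 0 \<Longrightarrow> \<exists>e>0. ball 0 e \<subseteq> T -` cball 0 r"
proof -
  obtain B where B: "B > 0" "\<And>x. norm x * B \<le> norm (T x)"
    using linear_inj_bounded_below_pos[OF assms] by (metis mult.commute)
  show "bounded (T -` cball 0 r)"
    unfolding bounded_iff
  proof (intro exI ballI)
    fix x assume "x \<in> T -` cball 0 r"
    then have "norm x * B \<le> r" using B(2)[of x] by simp
    then show "norm x \<le> r / B" using B(1) by (simp add: field_simps)
  qed
  obtain C where C: "C > 0" "\<And>x. norm (T x) \<le> C * norm x"
    using linear_bounded_pos[OF assms(1)] by blast
  assume r: "r > 0"
  have "T x \<in> cball 0 r" if "norm x < r / C" for x
  proof -
    have "norm (T x) \<le> C * (r / C)" using C that by (meson less_imp_le mult_left_mono order_trans)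
    then show ?thesis using C(1) by simp
  qed
  then show "\<exists>e>0. ball 0 e \<subseteq> T -` cball 0 r"
    using r C(1) by (intro exI[of _ "r / C"]) auto
qed

lemma linear_borel_measurable:
  "linear (T :: 'b::euclidean_space \<Rightarrow> 'c::real_normed_vector) \<Longrightarrow> T \<in> borel_measurable borel"
  by (intro borel_measurable_continuous_onI linear_continuous_on) (simp add: linear_conv_bounded_linear)

lemma sigma_finite_if_finite_on_balls:
  fixes M :: "'b::real_normed_vector measure"
  assumes "sets M = sets borel" "\<And>n::nat. emeasure M (cball 0 (real n)) < \<infinity>"
  shows "sigma_finite_measure M"
proof
  have "(\<Union>n::nat. cball (0::'b) (real n)) = UNIV" using real_arch_simple by auto
  then show "\<exists>A. countable A \<and> A \<subseteq> sets M \<and> \<Union> A = space M \<and> (\<forall>a\<in>A. emeasure M a \<noteq> \<infinity>)"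
    using assms by (intro exI[of _ "range (\<lambda>n::nat. cball 0 (real n))"])
      (auto simp: less_top sets_eq_imp_space_eq[OF assms(1)])
qed

text \<open>The image of Lebesgue measure under \<open>T\<close> is translation invariant, because
  shifts can be pulled back through a right inverse. Uniqueness of invariant measures makes it a
  multiple of Lebesgue measure, and the unit ball gives the multiple.\<close>

lemma vol_props:
  fixes T :: "'b::euclidean_space \<Rightarrow> 'b"
  assumes T: "linear T" "inj T"
  shows vol_pos: "vol T > 0"
    and nn_integral_linear: "f \<in> borel_measurable borel \<Longrightarrow>
      (\<integral>\<^sup>+x. f (T x) \<partial>lborel) * ennreal (vol T) = (\<integral>\<^sup>+x. f x \<partial>lborel)"
proof -
  note [measurable] = linear_borel_measurable[OF T(1)]
  let ?P = "T -` cball 0 1" and ?B = "cball (0::'b) 1"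
  have Ps[measurable]: "T -` cball 0 r \<in> sets borel" for r
    using measurable_sets[of T borel borel "cball 0 r"] linear_borel_measurable[OF T(1)] by simp
  obtain e where e: "e > 0" "ball 0 e \<subseteq> ?P" using linear_inj_bounds(2)[OF T, of 1] by auto
  note P = emeasure_lborel_bounded_real[OF Ps linear_inj_bounds(1)[OF T] e(2,1)]
  have "ball (0::'b) 1 \<subseteq> ?B" by auto
  note B = emeasure_lborel_bounded_real[OF _ bounded_cball this]
  show "vol T > 0" using B P by (simp add: vol_def)
  assume f[measurable]: "f \<in> borel_measurable borel"
  let ?M = "distr lborel borel T"
  have sfM: "sigma_finite_measure ?M"
    using emeasure_bounded_finite[OF linear_inj_bounds(1)[OF T]]
    by (intro sigma_finite_if_finite_on_balls) (auto simp: emeasure_distr)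
  obtain T' where T': "T \<circ> T' = id"
    using linear_injective_imp_surjective[OF T] by (metis surj_iff)
  then have TT': "T (T' y) = y" for y by (metis comp_apply id_apply)
  have "(\<integral>\<^sup>+x. f x \<partial>?M) * (\<integral>\<^sup>+x. indicator ?B x \<partial>lborel)
    = (\<integral>\<^sup>+x. f x \<partial>lborel) * (\<integral>\<^sup>+x. indicator ?B x \<partial>?M)"
  proof (rule haar_measure_unique[where L = borel and add = "(+)" and sub = "(-)"])
    fix h :: "'b \<Rightarrow> ennreal" and y assume [measurable]: "h \<in> borel_measurable borel"
    have "(\<integral>\<^sup>+x. h (x + y) \<partial>?M) = (\<integral>\<^sup>+x. h (T (x + T' y)) \<partial>lborel)"
      by (simp add: nn_integral_distr linear_add[OF T(1)] TT')
    also have "\<dots> = (\<integral>\<^sup>+x. h (T x) \<partial>lborel)"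
      by (rule nn_integral_lborel_translate[where f = "\<lambda>x. h (T x)"]) measurable
    finally show "(\<integral>\<^sup>+x. h (x + y) \<partial>?M) = (\<integral>\<^sup>+x. h x \<partial>?M)" by (simp add: nn_integral_distr)
    show "(\<integral>\<^sup>+x. h (y + x) \<partial>lborel) = (\<integral>\<^sup>+x. h x \<partial>lborel)"
      using nn_integral_lborel_translate[of h y] by (simp add: add.commute)
    show "(\<integral>\<^sup>+x. h (y - x) \<partial>lborel) = (\<integral>\<^sup>+x. h x \<partial>lborel)"
      by (rule nn_integral_lborel_reflect) simp
  qed (auto intro!: sfM sigma_finite_lborel borel_measurable_indicator borel_closed)
  then have "(\<integral>\<^sup>+x. f (T x) \<partial>lborel) * emeasure lborel ?B = (\<integral>\<^sup>+x. f x \<partial>lborel) * emeasure lborel ?P"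
    by (simp add: nn_integral_distr emeasure_distr)
  then have *: "(\<integral>\<^sup>+x. f (T x) \<partial>lborel) * ennreal (measure lborel ?B)
      = (\<integral>\<^sup>+x. f x \<partial>lborel) * ennreal (measure lborel ?P)"
    using B(1) P(1) by simp
  have "(\<integral>\<^sup>+x. f (T x) \<partial>lborel) * ennreal (vol T)
    = (\<integral>\<^sup>+x. f (T x) \<partial>lborel) * ennreal (measure lborel ?B) * ennreal (inverse (measure lborel ?P))"
    using P(2) by (simp add: vol_def divide_inverse ennreal_mult mult.assoc)
  also have "\<dots> = (\<integral>\<^sup>+x. f x \<partial>lborel) * (ennreal (measure lborel ?P) * ennreal (inverse (measure lborel ?P)))"
    by (simp add: * mult.assoc)
  also have "ennreal (measure lborel ?P) * ennreal (inverse (measure lborel ?P)) = 1"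
    using P(2) by (simp flip: ennreal_mult)
  finally show "(\<integral>\<^sup>+x. f (T x) \<partial>lborel) * ennreal (vol T) = (\<integral>\<^sup>+x. f x \<partial>lborel)" by simp
qed

text \<open>The indicator of the unit ball shows that the constant in the transformation rule is
  unique. Multiplicativity of \<open>vol\<close> and explicit volume factors then follow by
  verifying that rule.\<close>

lemma vol_eqI:
  fixes T :: "'b::euclidean_space \<Rightarrow> 'b"
  assumes T: "linear T" "inj T" and "c > 0"
    and c: "\<And>f. f \<in> borel_measurable borel \<Longrightarrow>
      (\<integral>\<^sup>+x. f (T x) \<partial>lborel) * ennreal c = (\<integral>\<^sup>+x. f x \<partial>lborel)"
  shows "vol T = c"
proof -
  have Ps[measurable]: "T -` cball 0 r \<in> sets borel" for r
    using measurable_sets[of T borel borel "cball 0 r"] linear_borel_measurable[OF T(1)] by simp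
  obtain e where e: "e > 0" "ball 0 e \<subseteq> T -` cball 0 1" using linear_inj_bounds(2)[OF T, of 1] by auto
  note P = emeasure_lborel_bounded_real[OF Ps linear_inj_bounds(1)[OF T] e(2,1)]
  have "(\<integral>\<^sup>+x. indicator (cball 0 1) (T x) \<partial>lborel) = (\<integral>\<^sup>+x. indicator (T -` cball 0 1) x \<partial>lborel)"
    by (intro nn_integral_cong) (auto simp: indicator_def)
  also have "\<dots> = ennreal (measure lborel (T -` cball 0 1))" using P(1) by simp
  finally have eq: "(\<integral>\<^sup>+x. indicator (cball 0 1) (T x) \<partial>lborel) = ennreal (measure lborel (T -` cball 0 1))" .
  have [measurable]: "(indicator (cball 0 1) :: 'b \<Rightarrow> ennreal) \<in> borel_measurable borel"
    by (intro borel_measurable_indicator borel_closed closed_cball)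
  have "ennreal (measure lborel (T -` cball 0 1)) * ennreal c
      = ennreal (measure lborel (T -` cball 0 1)) * ennreal (vol T)"
    using c[of "indicator (cball 0 1)"] nn_integral_linear[OF T, of "indicator (cball 0 1)"] by (simp add: eq del: nn_integral_indicator)
  then have "measure lborel (T -` cball 0 1) * c = measure lborel (T -` cball 0 1) * vol T"
    using P(2) \<open>c > 0\<close> vol_pos[OF T] by (simp flip: ennreal_mult)
  then show ?thesis using P(2) by simp
qed

lemma vol_compose:
  fixes S T :: "'b::euclidean_space \<Rightarrow> 'b"
  assumes "linear S" "inj S" "linear T" "inj T"
  shows "vol (\<lambda>v. S (T v)) = vol S * vol T"
proof (rule vol_eqI)
  show "linear (\<lambda>v. S (T v))" using linear_compose[OF assms(3,1)] by (simp add: o_def)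
  show "inj (\<lambda>v. S (T v))" using inj_compose[OF assms(2,4)] by (simp add: o_def)
  show "vol S * vol T > 0" using assms by (simp add: vol_pos)
  fix f :: "'b \<Rightarrow> ennreal" assume f: "f \<in> borel_measurable borel"
  have "(\<integral>\<^sup>+x. f (S (T x)) \<partial>lborel) * ennreal (vol T) = (\<integral>\<^sup>+x. f (S x) \<partial>lborel)"
    using assms f measurable_compose[OF linear_borel_measurable f]
    by (intro nn_integral_linear[where f = "\<lambda>x. f (S x)"]) auto
  then show "(\<integral>\<^sup>+x. f (S (T x)) \<partial>lborel) * ennreal (vol S * vol T) = (\<integral>\<^sup>+x. f x \<partial>lborel)"
    using nn_integral_linear[OF assms(1,2) f] vol_pos[OF assms(1,2)] vol_pos[OF assms(3,4)]
    by (simp add: ennreal_mult mult.assoc[symmetric] mult.commute)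
       (metis mult.assoc mult.commute)
qed

lemma vol_isometry:
  fixes T :: "'b::euclidean_space \<Rightarrow> 'b"
  assumes "\<And>x. norm (T x) = norm x"
  shows "vol T = 1"
proof -
  have "T -` cball 0 1 = cball 0 1" using assms by auto
  moreover have "measure lborel (cball (0::'b) 1) > 0"
    by (rule emeasure_lborel_bounded_real(2)[OF _ bounded_cball ball_subset_cball zero_less_one]) simp
  ultimately show ?thesis by (simp add: vol_def)
qed

lemma nn_integral_isometry:
  fixes T :: "'b::euclidean_space \<Rightarrow> 'b"
  assumes "linear T" "\<And>x. norm (T x) = norm x" "f \<in> borel_measurable borel"
  shows "(\<integral>\<^sup>+x. f (T x) \<partial>lborel) = (\<integral>\<^sup>+x. f x \<partial>lborel)"
proof -
  have "inj T" using assms(1,2) by (metis linear_injective_0 norm_eq_zero)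
  then show ?thesis using nn_integral_linear[OF assms(1) _ assms(3)] vol_isometry[OF assms(2)] by simp
qed

section \<open>Symmetric positive operators\<close>

text \<open>A maximiser of the Rayleigh quotient on the unit sphere of \<open>S\<close> works.
  Perturbing it in the direction of its residual \<open>u = T v - c *\<^sub>R v\<close> shows that
  \<open>u\<close> vanishes.\<close>

lemma symmetric_eigenvector:
  fixes T :: "'b::euclidean_space \<Rightarrow> 'b"
  assumes lin: "linear T" and sym: "\<And>v w. T v \<bullet> w = v \<bullet> T w"
    and S: "subspace S" "T ` S \<subseteq> S" "S \<noteq> {0}"
  obtains v c where "v \<in> S" "norm v = 1" "T v = c *\<^sub>R v"
proof -
  have "0 \<in> S" using S(1) by (rule subspace_0)
  then obtain x where x: "x \<in> S" "x \<noteq> 0" using S(3) by blast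
  have "x /\<^sub>R norm x \<in> S \<inter> sphere 0 1" using x S(1) by (simp add: subspace_scale)
  then have ne: "S \<inter> sphere 0 1 \<noteq> {}" by blast
  have "compact (S \<inter> sphere 0 1)"
    using closed_subspace[OF S(1)] by (simp add: compact_Int_closed Int_commute closed_Int_compact)
  moreover have "continuous_on (S \<inter> sphere 0 1) (\<lambda>v. v \<bullet> T v)"
    by (intro continuous_intros linear_continuous_on_compose[OF _ lin])
  ultimately obtain v where v: "v \<in> S" "norm v = 1" and mx: "\<And>w. w \<in> S \<Longrightarrow> norm w = 1 \<Longrightarrow> w \<bullet> T w \<le> v \<bullet> T v"
    using continuous_attains_sup[OF _ ne] by fastforce
  define c where "c = v \<bullet> T v"
  have le: "w \<bullet> T w \<le> c * (w \<bullet> w)" if "w \<in> S" for w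
  proof (cases "w = 0")
    case False
    have "(w /\<^sub>R norm w) \<bullet> T (w /\<^sub>R norm w) \<le> c"
      unfolding c_def using False that S(1) by (intro mx) (auto simp: subspace_scale)
    then have "(w \<bullet> T w) / (norm w)\<^sup>2 \<le> c"
      by (simp add: linear_scale[OF lin] power2_eq_square divide_inverse mult_ac)
    then show ?thesis using False by (simp add: divide_le_eq power2_norm_eq_inner)
  qed (simp add: linear_0[OF lin])
  define u where "u = T v - c *\<^sub>R v"
  have uS: "u \<in> S" using S v(1) by (auto simp: u_def subspace_scale intro!: subspace_diff)
  have vv: "v \<bullet> v = 1" using v(2) by (simp add: dot_square_norm)
  define a where "a = u \<bullet> u"
  define b where "b = u \<bullet> T u - c * (u \<bullet> u)"
  have key: "2 * t * a + t\<^sup>2 * b \<le> 0" for t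
  proof -
    have "v + t *\<^sub>R u \<in> S" using S(1) v(1) uS by (simp add: subspace_add subspace_scale)
    from le[OF this] have "(v + t *\<^sub>R u) \<bullet> T (v + t *\<^sub>R u) \<le> c * ((v + t *\<^sub>R u) \<bullet> (v + t *\<^sub>R u))" .
    moreover have "v \<bullet> T u = u \<bullet> T v" using sym[of u v] by (simp add: inner_commute)
    moreover have "u \<bullet> T v = a + c * (u \<bullet> v)" by (simp add: a_def u_def inner_diff_right)
    moreover have "v \<bullet> u = u \<bullet> v" by (rule inner_commute)
    ultimately show ?thesis
      by (simp add: linear_add[OF lin] linear_scale[OF lin] inner_add b_def vv c_def[symmetric]
          power2_eq_square algebra_simps)
  qed
  have "a = 0"
  proof (rule ccontr)
    assume "a \<noteq> 0"
    then have a: "a > 0" by (simp add: a_def)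
    \<comment> \<open>With t = a / d and b >= - d, the left side of \<open>key\<close> is at least
      a^2 / d, which is positive.\<close>
    define d where "d = \<bar>b\<bar> + 1"
    have d: "d > 0" "- d \<le> b" by (auto simp: d_def)
    have "2 * (a / d) * a + (a / d)\<^sup>2 * b \<le> 0" by (rule key)
    moreover have "(a / d)\<^sup>2 * b \<ge> (a / d)\<^sup>2 * (- d)"
      using d by (intro mult_left_mono) auto
    moreover have "(a / d)\<^sup>2 * (- d) = - ((a / d) * a)"
      using d by (simp add: power2_eq_square)
    moreover have "(a / d) * a > 0" using a d by simp
    ultimately show False by linarith
  qed
  then have "T v = c *\<^sub>R v" by (simp add: a_def u_def)
  then show thesis using that v by blast
qed

text \<open>Split off one eigenvector; its orthogonal complement in \<open>S\<close> is invariant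
  because \<open>T\<close> is symmetric, and it has smaller dimension.\<close>

lemma symmetric_orthonormal_eigenbasis:
  fixes T :: "'b::euclidean_space \<Rightarrow> 'b"
  assumes lin: "linear T" and sym: "\<And>v w. T v \<bullet> w = v \<bullet> T w"
    and "subspace S" "T ` S \<subseteq> S"
  shows "\<exists>B. B \<subseteq> S \<and> pairwise orthogonal B \<and> (\<forall>b\<in>B. norm b = 1) \<and> S \<subseteq> span B \<and>
    (\<forall>b\<in>B. \<exists>c. T b = c *\<^sub>R b)"
  using assms(3-)
proof (induction "dim S" arbitrary: S rule: less_induct)
  case less
  show ?case
  proof (cases "S = {0}")
    case True
    then show ?thesis by (intro exI[of _ "{}"]) auto
  next
    case False
    obtain v c where v: "v \<in> S" "norm v = 1" "T v = c *\<^sub>R v"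
      using symmetric_eigenvector[OF lin sym less.prems False] by blast
    define S' where "S' = {y \<in> S. orthogonal v y}"
    have vv: "v \<bullet> v = 1" using v(2) by (simp add: dot_square_norm)
    have sub: "subspace S'"
      using less.prems(1) by (auto simp: S'_def subspace_def orthogonal_def inner_add_right)
    have inv: "T ` S' \<subseteq> S'"
    proof -
      have "T y \<in> S'" if "y \<in> S'" for y
      proof -
        have "v \<bullet> T y = c * (v \<bullet> y)" using sym[of v y] v(3) by simp
        then show ?thesis using that less.prems(2) by (auto simp: S'_def orthogonal_def)
      qed
      then show ?thesis by blast
    qed
    have "v \<notin> S'" using vv by (simp add: S'_def orthogonal_def)
    then have "S' \<subset> S" using v(1) by (auto simp: S'_def)
    then have "dim S' < dim S"
      using sub less.prems(1) by (metis dim_psubset span_eq_iff)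
    from less.hyps[OF this sub inv] obtain B where
      B: "B \<subseteq> S'" "pairwise orthogonal B" "\<forall>b\<in>B. norm b = 1" "S' \<subseteq> span B" "\<forall>b\<in>B. \<exists>c. T b = c *\<^sub>R b"
      by blast
    have "pairwise orthogonal (insert v B)"
      using B(1,2) by (auto simp: pairwise_insert S'_def orthogonal_commute)
    moreover have "S \<subseteq> span (insert v B)"
    proof
      fix x assume x: "x \<in> S"
      have "x - (v \<bullet> x) *\<^sub>R v \<in> S'"
        using x v(1) less.prems(1) vv
        by (auto simp: S'_def orthogonal_def inner_diff_right subspace_diff subspace_scale)
      then have "x - (v \<bullet> x) *\<^sub>R v \<in> span B" using B(4) by blast
      then show "x \<in> span (insert v B)" by (subst span_breakdown_eq) blast
    qed
    ultimately show ?thesis using B v by (intro exI[of _ "insert v B"]) (auto simp: S'_def)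
  qed
qed

section \<open>Gaussian integrals and volume factors as products of eigenvalues\<close>

lemma gaussian_nn_integral:
  "(\<integral>\<^sup>+x. ennreal (exp (- ((x::'b::euclidean_space) \<bullet> x))) \<partial>lborel) = ennreal (pi powr (DIM('b) / 2))"
proof -
  have "has_bochner_integral lborel (\<lambda>x::real. exp (- x\<^sup>2)) (2 *\<^sub>R (sqrt pi / 2))"
    by (rule has_bochner_integral_even_function[OF gaussian_moment_0]) simp
  then have one: "(\<integral>\<^sup>+x. ennreal (exp (- x\<^sup>2)) \<partial>lborel) = ennreal (sqrt pi)"
    by (subst nn_integral_eq_integral) (auto simp: has_bochner_integral_iff)
  have "(\<integral>\<^sup>+x. ennreal (exp (- ((x::'b) \<bullet> x))) \<partial>lborel)
    = (\<integral>\<^sup>+x. (\<Prod>b\<in>Basis. ennreal (exp (- ((x::'b) \<bullet> b)\<^sup>2))) \<partial>lborel)"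
  proof (rule nn_integral_cong)
    fix x :: 'b
    have "exp (- (x \<bullet> x)) = (\<Prod>b\<in>Basis. exp (- (x \<bullet> b)\<^sup>2))"
      by (subst euclidean_inner) (simp add: exp_sum[symmetric] sum_negf power2_eq_square)
    then show "ennreal (exp (- (x \<bullet> x))) = (\<Prod>b\<in>Basis. ennreal (exp (- (x \<bullet> b)\<^sup>2)))"
      by (simp add: prod_ennreal)
  qed
  also have "\<dots> = (\<Prod>b\<in>(Basis::'b set). (\<integral>\<^sup>+x. ennreal (exp (- x\<^sup>2)) \<partial>lborel))"
    by (rule nn_integral_lborel_prod) auto
  also have "\<dots> = ennreal (sqrt pi ^ DIM('b))" by (simp add: one ennreal_power)
  also have "sqrt pi ^ DIM('b) = pi powr (DIM('b) / 2)"
    by (simp add: powr_half_sqrt[symmetric] powr_powr powr_realpow[symmetric])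
  finally show ?thesis .
qed

lemma vol_diagonal:
  fixes l :: "'b::euclidean_space \<Rightarrow> real"
  assumes "\<And>b. b \<in> Basis \<Longrightarrow> l b > 0"
  shows "linear (\<lambda>x. \<Sum>b\<in>Basis. (l b * (x \<bullet> b)) *\<^sub>R b)" "inj (\<lambda>x. \<Sum>b\<in>Basis. (l b * (x \<bullet> b)) *\<^sub>R b)"
    "vol (\<lambda>x. \<Sum>b\<in>Basis. (l b * (x \<bullet> b)) *\<^sub>R b) = (\<Prod>b\<in>Basis. l b)"
proof -
  let ?D = "\<lambda>x. \<Sum>b\<in>Basis. (l b * (x \<bullet> b)) *\<^sub>R b"
  show lin: "linear ?D"
    by (rule linearI) (auto simp: inner_add_left algebra_simps sum.distrib scaleR_sum_right)
  have D: "?D x \<bullet> b = l b * (x \<bullet> b)" if "b \<in> Basis" for x b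
    using that by (simp add: inner_sum_left inner_Basis if_distrib sum.delta' cong: if_cong)
  show inj: "inj ?D"
    unfolding linear_injective_0[OF lin]
  proof (intro allI impI)
    fix x assume x: "?D x = 0"
    have "x \<bullet> b = 0" if b: "b \<in> Basis" for b
      using D[OF b, of x] assms[OF b] unfolding x by simp
    then show "x = 0" by (intro euclidean_eqI[of x 0]) simp
  qed
  note [measurable] = linear_borel_measurable[OF lin]
  show "vol ?D = (\<Prod>b\<in>Basis. l b)"
  proof (rule vol_eqI[OF lin inj])
    show "(\<Prod>b\<in>Basis. l b) > 0" using assms by (intro prod_pos) auto
    fix f :: "'b \<Rightarrow> ennreal" assume [measurable]: "f \<in> borel_measurable borel"
    have "(lborel :: 'b measure) = density (distr lborel borel (\<lambda>x. 0 + ?D x)) (\<lambda>_. (\<Prod>j\<in>Basis. \<bar>l j\<bar>))"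
      using assms by (intro lborel_affine_euclidean) force
    also have "(\<Prod>j\<in>(Basis::'b set). \<bar>l j\<bar>) = (\<Prod>b\<in>Basis. l b)"
      using assms by (intro prod.cong) force+
    finally have eq: "(lborel :: 'b measure) = density (distr lborel borel ?D) (\<lambda>_. (\<Prod>b\<in>Basis. l b))" by simp
    show "(\<integral>\<^sup>+x. f (?D x) \<partial>lborel) * ennreal (\<Prod>b\<in>Basis. l b) = (\<integral>\<^sup>+x. f x \<partial>lborel)"
      by (subst (2) eq) (simp add: nn_integral_density nn_integral_distr nn_integral_cmult mult.commute)
  qed
qed

text \<open>In an orthonormal eigenbasis \<open>T\<close> is diagonal, so \<open>vol T\<close> is
  the product of the eigenvalues with multiplicity, and substituting the square root of
  \<open>T\<close> reduces the Gaussian integral to the standard one. This is the bridge between the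
  eigenvalue definition of the determinant and integration.\<close>

lemma symmetric_pos_vol:
  fixes T :: "'b::euclidean_space \<Rightarrow> 'b"
  assumes lin: "linear T" and sym: "\<And>v w. T v \<bullet> w = v \<bullet> T w"
    and pos: "\<And>v. v \<noteq> 0 \<Longrightarrow> v \<bullet> T v > 0"
  shows vol_eq_prod_eigenvalues:
      "finite {c. {v. T v = c *\<^sub>R v} \<noteq> {0}}"
      "vol T = (\<Prod>c\<in>{c. {v. T v = c *\<^sub>R v} \<noteq> {0}}. c ^ dim {v. T v = c *\<^sub>R v})"
    and gaussian_nn_integral_symmetric:
      "(\<integral>\<^sup>+v. ennreal (exp (- (v \<bullet> T v))) \<partial>lborel) = ennreal (pi powr (DIM('b) / 2) / sqrt (vol T))"
proof -
  obtain B where B: "pairwise orthogonal B" "\<And>b. b \<in> B \<Longrightarrow> norm b = 1" "UNIV \<subseteq> span B"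
    and "\<And>b. b \<in> B \<Longrightarrow> \<exists>c. T b = c *\<^sub>R b"
    using symmetric_orthonormal_eigenbasis[OF lin sym, of UNIV] by auto
  from this(3) have spB: "span B = UNIV" by auto
  from \<open>\<And>b. b \<in> B \<Longrightarrow> \<exists>c. T b = c *\<^sub>R b\<close> obtain l where l: "\<And>b. b \<in> B \<Longrightarrow> T b = l b *\<^sub>R b" by metis
  have "0 \<notin> B" using B(2) by fastforce
  then have indep: "independent B" using B(1) by (rule pairwise_orthogonal_independent[rotated])
  then have fin: "finite B" by (rule independent_imp_finite)
  have card: "card B = DIM('b)"
    using indep spB by (metis dim_UNIV indep_card_eq_dim_span)
  have BB: "b \<bullet> b' = (if b = b' then 1 else 0)" if "b \<in> B" "b' \<in> B" for b b'
    using B(1,2) that by (auto simp: pairwise_def orthogonal_def dot_square_norm)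
  have lpos: "l b > 0" if "b \<in> B" for b
    using pos[of b] l[OF that] BB[OF that that] \<open>0 \<notin> B\<close> that by auto
  have expand: "(\<Sum>b\<in>B. (x \<bullet> b) *\<^sub>R b) = x" for x
    using orthonormal_basis_expand[OF B(1,2) _ fin] spB by auto
  obtain \<phi> where \<phi>: "bij_betw \<phi> (Basis::'b set) B"
    using finite_same_card_bij[OF finite_Basis fin] card by auto
  have \<phi>B: "\<phi> i \<in> B" if "i \<in> Basis" for i using \<phi> that by (auto dest: bij_betwE)
  have \<phi>\<phi>: "\<phi> i \<bullet> \<phi> j = (if i = j then 1 else 0)" if "i \<in> Basis" "j \<in> Basis" for i j
    using BB[OF \<phi>B \<phi>B] that \<phi> by (auto simp: bij_betw_def inj_on_def)
  define \<Phi> where "\<Phi> x = (\<Sum>i\<in>Basis. (x \<bullet> i) *\<^sub>R \<phi> i)" for x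
  have lin\<Phi>: "linear \<Phi>"
    unfolding \<Phi>_def by (rule linearI) (auto simp: inner_add_left scaleR_add_left sum.distrib scaleR_sum_right)
  have in\<Phi>: "\<Phi> x \<bullet> \<Phi> y = x \<bullet> y" for x y
  proof -
    have 1: "\<Phi> x \<bullet> \<phi> j = x \<bullet> j" if "j \<in> Basis" for j
    proof -
      have "\<Phi> x \<bullet> \<phi> j = (\<Sum>i\<in>Basis. if i = j then x \<bullet> i else 0)"
        unfolding \<Phi>_def inner_sum_left by (intro sum.cong refl) (simp add: \<phi>\<phi> that)
      then show ?thesis using that by simp
    qed
    have "\<Phi> x \<bullet> \<Phi> y = (\<Sum>j\<in>Basis. (y \<bullet> j) * (\<Phi> x \<bullet> \<phi> j))"
      by (simp add: \<Phi>_def[of y] inner_sum_right)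
    also have "\<dots> = (\<Sum>j\<in>Basis. (x \<bullet> j) * (y \<bullet> j))" by (simp add: 1 mult.commute)
    finally show ?thesis by (simp add: euclidean_inner[symmetric])
  qed
  have n\<Phi>: "norm (\<Phi> x) = norm x" for x by (simp add: norm_eq_sqrt_inner in\<Phi>)
  then have inj\<Phi>: "inj \<Phi>" by (metis lin\<Phi> linear_injective_0 norm_eq_zero)
  \<comment> \<open>Functional calculus in the coordinates of the eigenbasis:
    \<open>D (\<lambda>r. r)\<close> represents \<open>T\<close> and \<open>D sqrt\<close> its
    positive square root.\<close>
  define D where "D g x = (\<Sum>b\<in>Basis. (g (l (\<phi> b)) * (x \<bullet> b)) *\<^sub>R b)" for g :: "real \<Rightarrow> real" and x :: 'b
  have Dp: "linear (D g)" "inj (D g)" "vol (D g) = (\<Prod>b\<in>B. g (l b))" if "\<And>r. r > 0 \<Longrightarrow> g r > 0" for g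
  proof -
    have "g (l (\<phi> b)) > 0" if "b \<in> Basis" for b using lpos[OF \<phi>B[OF that]] \<open>\<And>r. r > 0 \<Longrightarrow> g r > 0\<close> by blast
    note v = vol_diagonal[of "\<lambda>b. g (l (\<phi> b))", OF this]
    show "linear (D g)" "inj (D g)" using v(1,2) by (simp_all add: D_def[abs_def])
    have "vol (D g) = (\<Prod>b\<in>Basis. g (l (\<phi> b)))" using v(3) by (simp add: D_def[abs_def])
    also have "\<dots> = (\<Prod>b\<in>B. g (l b))" by (rule prod.reindex_bij_betw[OF \<phi>])
    finally show "vol (D g) = (\<Prod>b\<in>B. g (l b))" .
  qed
  have Di: "D g x \<bullet> b = g (l (\<phi> b)) * (x \<bullet> b)" if "b \<in> Basis" for g x b
    using that by (simp add: D_def inner_sum_left inner_Basis if_distrib sum.delta' cong: if_cong)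
  have T\<Phi>: "T (\<Phi> x) = \<Phi> (D (\<lambda>r. r) x)" for x
  proof -
    have "T (\<Phi> x) = (\<Sum>i\<in>Basis. (x \<bullet> i) *\<^sub>R (l (\<phi> i) *\<^sub>R \<phi> i))"
      by (simp add: \<Phi>_def linear_sum[OF lin] linear_scale[OF lin] l \<phi>B)
    also have "\<dots> = \<Phi> (D (\<lambda>r. r) x)" by (simp add: \<Phi>_def Di mult.commute)
    finally show ?thesis .
  qed
  have injT: "inj T" unfolding linear_injective_0[OF lin] using pos by (metis inner_zero_right less_irrefl)
  have "vol (\<lambda>x. T (\<Phi> x)) = vol (\<lambda>x. \<Phi> (D (\<lambda>r. r) x))" by (simp add: T\<Phi>)
  then have volT: "vol T = (\<Prod>b\<in>B. l b)"
    using vol_compose[OF lin injT lin\<Phi> inj\<Phi>] vol_compose[OF lin\<Phi> inj\<Phi> Dp(1,2), of "\<lambda>r. r"]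
      vol_isometry[OF n\<Phi>] Dp(3)[of "\<lambda>r. r"] by simp
  have eig: "{v. T v = c *\<^sub>R v} = span {b\<in>B. l b = c}" for c
  proof
    show "span {b\<in>B. l b = c} \<subseteq> {v. T v = c *\<^sub>R v}"
      by (rule span_minimal)
        (auto simp: l subspace_def linear_add[OF lin] linear_scale[OF lin] linear_0[OF lin] algebra_simps)
    show "{v. T v = c *\<^sub>R v} \<subseteq> span {b\<in>B. l b = c}"
    proof
      fix v assume "v \<in> {v. T v = c *\<^sub>R v}"
      then have v: "T v = c *\<^sub>R v" by simp
      have z: "v \<bullet> b = 0" if "b \<in> B" "l b \<noteq> c" for b
        using sym[of v b] v l[OF that(1)] that(2) by simp
      have "(\<Sum>b\<in>B. (v \<bullet> b) *\<^sub>R b) \<in> span {b\<in>B. l b = c}"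
      proof (rule span_sum)
        fix b assume "b \<in> B"
        then show "(v \<bullet> b) *\<^sub>R b \<in> span {b\<in>B. l b = c}"
          using z[of b] by (cases "l b = c") (simp_all add: span_scale span_base span_zero)
      qed
      then show "v \<in> span {b\<in>B. l b = c}" by (simp add: expand)
    qed
  qed
  have dim: "dim {v. T v = c *\<^sub>R v} = card {b\<in>B. l b = c}" for c
  proof -
    have "independent {b\<in>B. l b = c}" using indep by (rule independent_mono) auto
    then show ?thesis unfolding eig by (simp add: indep_card_eq_dim_span)
  qed
  have im: "{c. {v. T v = c *\<^sub>R v} \<noteq> {0}} = l ` B"
  proof -
    have "{v. T v = c *\<^sub>R v} \<noteq> {0} \<longleftrightarrow> c \<in> l ` B" for c
    proof
      assume "c \<in> l ` B"
      then obtain b where b: "b \<in> B" "c = l b" by blast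
      have "b \<noteq> 0" using b(1) \<open>0 \<notin> B\<close> by blast
      moreover have "b \<in> {v. T v = c *\<^sub>R v}" using l[OF b(1)] b(2) by simp
      ultimately show "{v. T v = c *\<^sub>R v} \<noteq> {0}" by blast
    next
      assume "{v. T v = c *\<^sub>R v} \<noteq> {0}"
      moreover have "0 \<in> {v. T v = c *\<^sub>R v}" by (simp add: linear_0[OF lin])
      ultimately have "{b\<in>B. l b = c} \<noteq> {}" unfolding eig by (metis span_empty)
      then show "c \<in> l ` B" by blast
    qed
    then show ?thesis by blast
  qed
  show "finite {c. {v. T v = c *\<^sub>R v} \<noteq> {0}}" unfolding im using fin by simp
  show "vol T = (\<Prod>c\<in>{c. {v. T v = c *\<^sub>R v} \<noteq> {0}}. c ^ dim {v. T v = c *\<^sub>R v})"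
  proof -
    have "(\<Prod>b\<in>B. l b) = (\<Prod>c\<in>l ` B. \<Prod>b\<in>{b\<in>B. l b = c}. l b)"
      using fin by (rule prod.image_gen)
    also have "\<dots> = (\<Prod>c\<in>l ` B. c ^ card {b\<in>B. l b = c})"
      by (intro prod.cong refl) simp
    finally show ?thesis unfolding im dim volT .
  qed
  let ?R = "D sqrt"
  have R: "linear ?R" "inj ?R" "vol ?R = (\<Prod>b\<in>B. sqrt (l b))" using Dp[of sqrt] by auto
  have "sqrt (\<Prod>b\<in>C. l b) = (\<Prod>b\<in>C. sqrt (l b))" for C
    by (induction C rule: infinite_finite_induct) (auto simp: real_sqrt_mult)
  then have volR: "vol ?R = sqrt (vol T)" unfolding R(3) volT by simp
  have sq: "y * (r * y) = (s * y) * (s * y)" if "s * s = r" for y r s :: real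
    unfolding that[symmetric] by (simp only: mult_ac)
  have quad: "\<Phi> x \<bullet> T (\<Phi> x) = ?R x \<bullet> ?R x" for x
  proof -
    have "\<Phi> x \<bullet> T (\<Phi> x) = (\<Sum>b\<in>Basis. (x \<bullet> b) * (l (\<phi> b) * (x \<bullet> b)))"
      unfolding T\<Phi> in\<Phi> by (subst euclidean_inner) (simp add: Di)
    also have "\<dots> = (\<Sum>b\<in>Basis. (sqrt (l (\<phi> b)) * (x \<bullet> b)) * (sqrt (l (\<phi> b)) * (x \<bullet> b)))"
    proof (rule sum.cong)
      fix b :: 'b assume "b \<in> Basis"
      then have "sqrt (l (\<phi> b)) * sqrt (l (\<phi> b)) = l (\<phi> b)" using lpos[OF \<phi>B] by (simp add: less_imp_le)
      then show "(x \<bullet> b) * (l (\<phi> b) * (x \<bullet> b)) = (sqrt (l (\<phi> b)) * (x \<bullet> b)) * (sqrt (l (\<phi> b)) * (x \<bullet> b))"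
        by (rule sq)
    qed simp
    also have "\<dots> = ?R x \<bullet> ?R x" by (subst euclidean_inner) (simp add: Di)
    finally show ?thesis .
  qed
  note [measurable] = linear_borel_measurable[OF lin]
  have "(\<integral>\<^sup>+v. ennreal (exp (- (v \<bullet> T v))) \<partial>lborel) = (\<integral>\<^sup>+v. ennreal (exp (- (\<Phi> v \<bullet> T (\<Phi> v)))) \<partial>lborel)"
    by (rule nn_integral_isometry[OF lin\<Phi> n\<Phi>, symmetric]) measurable
  also have "\<dots> = (\<integral>\<^sup>+v. ennreal (exp (- (?R v \<bullet> ?R v))) \<partial>lborel)" by (simp add: quad)
  finally have "(\<integral>\<^sup>+v. ennreal (exp (- (v \<bullet> T v))) \<partial>lborel) * ennreal (vol ?R) = ennreal (pi powr (DIM('b) / 2))"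
    using nn_integral_linear[OF R(1,2), of "\<lambda>v. ennreal (exp (- (v \<bullet> v)))"]
    by (simp add: gaussian_nn_integral)
  then have *: "(\<integral>\<^sup>+v. ennreal (exp (- (v \<bullet> T v))) \<partial>lborel) * ennreal (sqrt (vol T)) = ennreal (pi powr (DIM('b) / 2))"
    by (simp add: volR)
  have vp: "sqrt (vol T) > 0" using vol_pos[OF lin injT] by simp
  have cancel: "J = ennreal (p / q)" if J: "J * ennreal q = ennreal p" and "q > 0" for J p q
  proof -
    have "J = J * ennreal q * ennreal (inverse q)"
      unfolding mult.assoc using \<open>q > 0\<close> by (simp flip: ennreal_mult)
    also have "\<dots> = ennreal (p / q)"
      unfolding J using \<open>q > 0\<close> by (simp add: divide_inverse ennreal_mult'')
    finally show ?thesis .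
  qed
  show "(\<integral>\<^sup>+v. ennreal (exp (- (v \<bullet> T v))) \<partial>lborel) = ennreal (pi powr (DIM('b) / 2) / sqrt (vol T))"
    by (rule cancel[OF * vp])
qed

section \<open>Lebesgue measure on vectors and matrices\<close>

lemma linear_axis: "linear (axis i :: 'b::real_vector \<Rightarrow> 'b ^ 'm::finite)"
  by (rule linearI) (auto simp: vec_eq_iff axis_def)

lemma borel_measurable_vec_lambda [measurable (raw)]:
  fixes f :: "'x \<Rightarrow> 'm::finite \<Rightarrow> 'b::euclidean_space"
  assumes [measurable]: "\<And>i. (\<lambda>x. f x i) \<in> borel_measurable M"
  shows "(\<lambda>x. \<chi> i. f x i) \<in> borel_measurable M"
proof -
  have eq: "(\<chi> i. f x i) = (\<Sum>i\<in>UNIV. axis i (f x i))" for x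
    by (simp add: vec_eq_iff axis_def)
  have "(\<lambda>x. axis i (f x i)) \<in> borel_measurable M" for i :: 'm
    by (rule measurable_compose[OF _ linear_borel_measurable[OF linear_axis]]) measurable
  then show ?thesis unfolding eq by measurable
qed

lemma borel_measurable_vec_nth [measurable (raw)]:
  fixes f :: "'x \<Rightarrow> 'b::euclidean_space ^ 'm::finite"
  assumes "f \<in> borel_measurable M"
  shows "(\<lambda>x. f x $ i) \<in> borel_measurable M"
  by (rule measurable_compose[OF assms linear_borel_measurable]) (rule bounded_linear.linear[OF bounded_linear_vec_nth])

lemma prod_Basis_vec:
  "(\<Prod>b\<in>(Basis :: ('b::euclidean_space ^ 'm::finite) set). g b) = (\<Prod>i\<in>UNIV. \<Prod>b\<in>Basis. g (axis i b))"
proof -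
  have "(\<Prod>b\<in>(Basis :: ('b ^ 'm) set). g b) = (\<Prod>i\<in>UNIV. \<Prod>b\<in>axis i ` Basis. g b)"
    unfolding Basis_vec_def
    by (subst prod.UNION_disjoint[symmetric])
      (auto simp: axis_eq_axis intro!: prod.cong)
  also have "\<dots> = (\<Prod>i\<in>UNIV. \<Prod>b\<in>Basis. g (axis i b))"
    by (intro prod.cong refl prod.reindex_cong[OF _ refl]) (auto simp: inj_on_def axis_eq_axis)
  finally show ?thesis .
qed

lemma mem_box_vec: "x \<in> box l u \<longleftrightarrow> (\<forall>i. x $ i \<in> box (l $ i) (u $ i))"
  for x :: "'b::euclidean_space ^ 'm::finite"
  by (auto simp: mem_box Basis_vec_def inner_axis)

lemma emeasure_lborel_box_prod:
  "(\<And>b. b \<in> Basis \<Longrightarrow> l \<bullet> b \<le> u \<bullet> b) \<Longrightarrow> emeasure lborel (box l u) = ennreal (\<Prod>b\<in>Basis. (u - l) \<bullet> b)"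
  by (auto simp: emeasure_lborel_box_eq)

lemma emeasure_PiM_lborel_box:
  fixes l u :: "'i::finite \<Rightarrow> 'b::euclidean_space"
  assumes "\<And>i b. b \<in> Basis \<Longrightarrow> l i \<bullet> b \<le> u i \<bullet> b"
  shows "emeasure (PiM UNIV (\<lambda>_. lborel)) (Pi\<^sub>E UNIV (\<lambda>i. box (l i) (u i))) =
    ennreal (\<Prod>i\<in>UNIV. \<Prod>b\<in>Basis. (u i - l i) \<bullet> b)"
proof -
  interpret product_sigma_finite "\<lambda>_::'i. lborel :: 'b measure"
    by (simp add: product_sigma_finite_def sigma_finite_lborel)
  have nn: "(\<Prod>b\<in>Basis. (u i - l i) \<bullet> b) \<ge> 0" for i
    using assms by (intro prod_nonneg) (simp add: inner_diff_left)
  have "emeasure (PiM UNIV (\<lambda>_. lborel)) (Pi\<^sub>E UNIV (\<lambda>i. box (l i) (u i)))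
    = (\<Prod>i\<in>UNIV. emeasure lborel (box (l i) (u i)))"
    by (rule emeasure_PiM) auto
  also have "\<dots> = (\<Prod>i\<in>UNIV. ennreal (\<Prod>b\<in>Basis. (u i - l i) \<bullet> b))"
    by (intro prod.cong refl emeasure_lborel_box_prod assms)
  finally show ?thesis using nn by (simp add: prod_ennreal)
qed

lemma lborel_vec:
  "(lborel :: ('b::euclidean_space ^ 'm::finite) measure) = distr (PiM UNIV (\<lambda>_. lborel)) borel (\<lambda>f. \<chi> i. f i)"
proof (rule lborel_eqI)
  fix l u :: "'b ^ 'm" assume le: "\<And>b. b \<in> Basis \<Longrightarrow> l \<bullet> b \<le> u \<bullet> b"
  have le': "l $ i \<bullet> b \<le> u $ i \<bullet> b" if "b \<in> Basis" for i b
    using le[of "axis i b"] that by (auto simp: Basis_vec_def inner_axis)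
  have [measurable]: "(\<lambda>f. \<chi> i. f i) \<in> PiM UNIV (\<lambda>_. lborel) \<rightarrow>\<^sub>M (borel :: ('b ^ 'm) measure)"
    by (rule borel_measurable_vec_lambda) simp
  have "(\<lambda>f. \<chi> i. f i) -` box l u \<inter> space (PiM UNIV (\<lambda>_. lborel :: 'b measure))
    = Pi\<^sub>E UNIV (\<lambda>i. box (l $ i) (u $ i))"
    by (auto simp: mem_box_vec space_PiM PiE_UNIV_domain Pi_iff)
  then show "emeasure (distr (PiM UNIV (\<lambda>_. lborel)) borel (\<lambda>f. \<chi> i. f i)) (box l u) = ennreal (\<Prod>b\<in>Basis. (u - l) \<bullet> b)"
    by (simp add: emeasure_distr emeasure_PiM_lborel_box le' prod_Basis_vec inner_axis)
qed simp

text \<open>The coordinate family consists of columns rather than rows, because columns are what the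
  Gram matrix pairs and what is integrated out one at a time.\<close>

lemma lborel_columns:
  "(lborel :: ('b::euclidean_space ^ 'm::finite ^ 'n::finite) measure) =
    distr (PiM UNIV (\<lambda>_. lborel)) borel (\<lambda>f. \<chi> i j. f j $ i)"
proof (rule lborel_eqI)
  fix l u :: "'b ^ 'm ^ 'n" assume le: "\<And>b. b \<in> Basis \<Longrightarrow> l \<bullet> b \<le> u \<bullet> b"
  have le'': "l $ i $ j \<bullet> b \<le> u $ i $ j \<bullet> b" if "b \<in> Basis" for i j b
    using le[of "axis i (axis j b)"] that by (auto simp: Basis_vec_def inner_axis)
  have le': "(\<chi> i. l $ i $ j) \<bullet> b \<le> (\<chi> i. u $ i $ j) \<bullet> b" if "b \<in> Basis" for j b
    using that le'' by (auto simp: Basis_vec_def inner_axis)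
  have [measurable]: "(\<lambda>f. \<chi> i j. f j $ i) \<in> PiM UNIV (\<lambda>_. lborel) \<rightarrow>\<^sub>M (borel :: ('b ^ 'm ^ 'n) measure)"
    by (intro borel_measurable_vec_lambda borel_measurable_vec_nth) simp
  have "(\<lambda>f. \<chi> i j. f j $ i) -` box l u \<inter> space (PiM UNIV (\<lambda>_. lborel :: ('b ^ 'n) measure))
    = Pi\<^sub>E UNIV (\<lambda>j. box (\<chi> i. l $ i $ j) (\<chi> i. u $ i $ j))"
    by (auto simp: mem_box_vec space_PiM PiE_UNIV_domain Pi_iff)
  then have "emeasure (distr (PiM UNIV (\<lambda>_. lborel)) borel (\<lambda>f. \<chi> i j. f j $ i)) (box l u)
    = ennreal (\<Prod>j\<in>UNIV. \<Prod>i\<in>UNIV. \<Prod>b\<in>Basis. (u $ i $ j - l $ i $ j) \<bullet> b)"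
    by (simp add: emeasure_distr emeasure_PiM_lborel_box le' prod_Basis_vec inner_axis)
  also have "(\<Prod>j\<in>UNIV. \<Prod>i\<in>UNIV. \<Prod>b\<in>Basis. (u $ i $ j - l $ i $ j) \<bullet> b)
    = (\<Prod>i\<in>UNIV. \<Prod>j\<in>UNIV. \<Prod>b\<in>Basis. (u $ i $ j - l $ i $ j) \<bullet> b)"
    by (rule prod.swap)
  also have "\<dots> = (\<Prod>b\<in>Basis. (u - l) \<bullet> b)" by (simp add: prod_Basis_vec inner_axis)
  finally show "emeasure (distr (PiM UNIV (\<lambda>_. lborel)) borel (\<lambda>f. \<chi> i j. f j $ i)) (box l u)
    = ennreal (\<Prod>b\<in>Basis. (u - l) \<bullet> b)" .
qed simp

section \<open>Joint law of a linear image and the squared norm\<close>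

lemma gamma_nn_integral:
  assumes "e > 0" "b > 0"
  shows "(\<integral>\<^sup>+s. ennreal (indicator {0<..} s * s powr (e - 1) * exp (- b * s)) \<partial>lborel) = ennreal (Gamma e / b powr e)"
proof -
  have 1: "(\<integral>\<^sup>+s. ennreal (indicator {0<..} s * s powr (e - 1) * exp (- s)) \<partial>lborel) = ennreal (Gamma e)"
  proof -
    have "((\<lambda>t. t powr (e - 1) / exp t) has_integral Gamma e) {0..}" by (rule Gamma_integral_real[OF assms(1)])
    then have "(\<integral>\<^sup>+s. ennreal (indicator {0..} s * (s powr (e - 1) / exp s)) \<partial>lborel) = ennreal (Gamma e)"
      by (intro nn_integral_has_integral_lebesgue) auto
    moreover have "AE s::real in lborel. ennreal (indicator {0..} s * (s powr (e - 1) / exp s))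
        = ennreal (indicator {0<..} s * s powr (e - 1) * exp (- s))"
      using AE_lborel_singleton[of "0::real"] by eventually_elim (auto simp: indicator_def exp_minus field_simps)
    ultimately show ?thesis by (subst nn_integral_cong_AE[symmetric]) auto
  qed
  have "(\<integral>\<^sup>+s. ennreal (indicator {0<..} s * s powr (e - 1) * exp (- s)) \<partial>lborel)
    = (\<integral>\<^sup>+s. ennreal (indicator {0<..} (b *\<^sub>R s) * (b *\<^sub>R s) powr (e - 1) * exp (- (b *\<^sub>R s))) \<partial>lborel) * ennreal b"
    using nn_integral_lborel_affine[of b "\<lambda>s. ennreal (indicator {0<..} s * s powr (e - 1) * exp (- s))" 0] assms
    by simp
  also have "(\<lambda>s. ennreal (indicator {0<..} (b *\<^sub>R s) * (b *\<^sub>R s) powr (e - 1) * exp (- (b *\<^sub>R s))))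
    = (\<lambda>s. ennreal (b powr (e - 1)) * ennreal (indicator {0<..} s * s powr (e - 1) * exp (- b * s)))"
    using assms by (auto simp: fun_eq_iff indicator_def zero_less_mult_iff powr_mult ennreal_mult[symmetric] mult_ac)
  also have "(\<integral>\<^sup>+s. ennreal (b powr (e - 1)) * ennreal (indicator {0<..} s * s powr (e - 1) * exp (- b * s)) \<partial>lborel) * ennreal b
    = ennreal (b powr e) * (\<integral>\<^sup>+s. ennreal (indicator {0<..} s * s powr (e - 1) * exp (- b * s)) \<partial>lborel)"
  proof -
    have "b powr e = b powr (e - 1) * b" using assms by (simp add: powr_diff)
    then have "ennreal (b powr e) = ennreal (b powr (e - 1)) * ennreal b"
      using assms by (simp add: ennreal_mult)
    then show ?thesis by (subst nn_integral_cmult) (simp_all only: mult_ac, measurable)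
  qed
  finally have *: "ennreal (Gamma e) = ennreal (b powr e) *
      (\<integral>\<^sup>+s. ennreal (indicator {0<..} s * s powr (e - 1) * exp (- b * s)) \<partial>lborel)"
    by (simp add: 1)
  have "(\<integral>\<^sup>+s. ennreal (indicator {0<..} s * s powr (e - 1) * exp (- b * s)) \<partial>lborel)
    = (ennreal (inverse (b powr e)) * ennreal (b powr e)) * (\<integral>\<^sup>+s. ennreal (indicator {0<..} s * s powr (e - 1) * exp (- b * s)) \<partial>lborel)"
    using assms by (simp flip: ennreal_mult)
  also have "\<dots> = ennreal (inverse (b powr e)) * ennreal (Gamma e)" by (simp add: * mult.assoc)
  also have "\<dots> = ennreal (Gamma e / b powr e)"
    using assms by (simp add: Gamma_real_nonneg divide_inverse mult.commute flip: ennreal_mult)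
  finally show ?thesis .
qed

lemma powr_nn_integral:
  assumes "e > 0" "R \<ge> 0"
  shows "(\<integral>\<^sup>+s. ennreal (indicator {0<..} s * s powr (e - 1)) * indicator {..R} s \<partial>lborel) = ennreal (R powr e / e)"
proof -
  have "((\<lambda>s. s powr (e - 1)) has_integral R powr (e - 1 + 1) / (e - 1 + 1)) {0..R}"
    by (rule has_integral_powr_from_0) (use assms in auto)
  then have "(\<integral>\<^sup>+s. ennreal (indicator {0..R} s * s powr (e - 1)) \<partial>lborel) = ennreal (R powr e / e)"
    by (intro nn_integral_has_integral_lebesgue) (use assms in auto)
  moreover have "AE s in lborel. ennreal (indicator {0..R} s * s powr (e - 1))
      = ennreal (indicator {0<..} s * s powr (e - 1)) * indicator {..R} s"
    using AE_lborel_singleton[of "0::real"] by eventually_elim (auto simp: indicator_def)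
  ultimately show ?thesis by (subst nn_integral_cong_AE[symmetric]) auto
qed

text \<open>Half-lines generate the Borel sets and are stable under intersection, so the
  distribution function decides. This will identify the law of the squared residual.\<close>

lemma measure_eqI_powr_cdf:
  fixes M :: "real measure"
  assumes "sets M = sets borel" "e > 0" "c \<ge> 0"
    and "\<And>R. emeasure M {..R} = ennreal (if R > 0 then c * R powr e else 0)"
  shows "M = density lborel (\<lambda>s. ennreal (c * e * (indicator {0<..} s * s powr (e - 1))))"
proof (rule measure_eqI_generator_eq[where E = "range atMost" and \<Omega> = UNIV and A = "\<lambda>n::nat. {..real n}"])
  show "Int_stable (range (atMost :: real \<Rightarrow> real set))"
    by (auto simp: Int_stable_def intro!: image_eqI[of _ _ "min _ _"])
  show "sets M = sigma_sets UNIV (range atMost)"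
    unfolding assms(1) borel_eq_atMost by simp
  show "sets (density lborel (\<lambda>s. ennreal (c * e * (indicator {0<..} s * s powr (e - 1))))) = sigma_sets UNIV (range atMost)"
    unfolding sets_density sets_lborel borel_eq_atMost by simp
  show "(\<Union>n::nat. {..real n}) = UNIV" using real_arch_simple by auto
  show "emeasure M {..real n} \<noteq> \<infinity>" for n using assms(4) by simp
  fix X :: "real set" assume "X \<in> range atMost"
  then obtain R where X: "X = {..R}" by auto
  have "emeasure (density lborel (\<lambda>s. ennreal (c * e * (indicator {0<..} s * s powr (e - 1))))) {..R}
    = (\<integral>\<^sup>+s. ennreal (c * e) * (ennreal (indicator {0<..} s * s powr (e - 1)) * indicator {..R} s) \<partial>lborel)"
    using assms(2,3) by (subst emeasure_density) (auto simp: ennreal_mult mult.assoc intro!: nn_integral_cong)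
  also have "\<dots> = ennreal (if R > 0 then c * R powr e else 0)"
  proof (cases "R > 0")
    case True
    then show ?thesis using assms(2,3) powr_nn_integral[OF assms(2), of R]
      by (simp add: nn_integral_cmult flip: ennreal_mult)
  next
    case False
    then have "ennreal (indicator {0<..} s * s powr (e - 1)) * indicator {..R} s = 0" for s
      by (auto simp: indicator_def)
    then have "(\<integral>\<^sup>+s. ennreal (c * e) * (ennreal (indicator {0<..} s * s powr (e - 1)) * indicator {..R} s) \<partial>lborel) = 0"
      by (simp only: mult_zero_right nn_integral_const mult_zero_left)
    then show ?thesis using False by simp
  qed
  finally show "emeasure M X = emeasure (density lborel (\<lambda>s. ennreal (c * e * (indicator {0<..} s * s powr (e - 1))))) X"
    by (simp add: X assms(4))
qed auto

section \<open>Scaling and translation of product Lebesgue measure; regression of one column on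
  others\<close>

lemma nn_integral_lborel_positive_cmult:
  fixes f :: "'b::euclidean_space \<Rightarrow> ennreal"
  assumes "s > 0" "f \<in> borel_measurable borel"
  shows "(\<integral>\<^sup>+x. f (s *\<^sub>R x) \<partial>lborel) * ennreal (s ^ DIM('b)) = (\<integral>\<^sup>+x. f x \<partial>lborel)"
  using nn_integral_lborel_affine[of s f 0] assms by simp

lemma nn_integral_PiM_lborel_scale:
  fixes f :: "('i \<Rightarrow> 'b::euclidean_space) \<Rightarrow> ennreal"
  assumes "s > 0" "finite I" "f \<in> borel_measurable (PiM I (\<lambda>_. lborel))"
  shows "(\<integral>\<^sup>+x. f (\<lambda>i\<in>I. s *\<^sub>R x i) \<partial>PiM I (\<lambda>_. lborel)) * ennreal (s ^ (card I * DIM('b))) =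
    (\<integral>\<^sup>+x. f x \<partial>PiM I (\<lambda>_. lborel))"
proof -
  have "(\<Prod>i\<in>I. ennreal (s ^ DIM('b))) = ennreal (s ^ (card I * DIM('b)))"
    using assms(1) by (simp add: ennreal_power power_mult[symmetric] mult.commute)
  moreover have "(\<integral>\<^sup>+x. f (\<lambda>i\<in>I. s *\<^sub>R x i) \<partial>PiM I (\<lambda>_. lborel)) * (\<Prod>i\<in>I. ennreal (s ^ DIM('b))) =
    (\<integral>\<^sup>+x. f x \<partial>PiM I (\<lambda>_. lborel))"
    by (rule nn_integral_PiM_map[where T = "\<lambda>_ x. s *\<^sub>R x"])
       (use assms in \<open>auto simp: sigma_finite_lborel nn_integral_lborel_positive_cmult\<close>)
  ultimately show ?thesis by simp
qed

lemma nn_integral_PiM_lborel_translate: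
  fixes f :: "('i \<Rightarrow> 'b::euclidean_space) \<Rightarrow> ennreal"
  assumes "finite I" "f \<in> borel_measurable (PiM I (\<lambda>_. lborel))"
  shows "(\<integral>\<^sup>+x. f (\<lambda>i\<in>I. t i + x i) \<partial>PiM I (\<lambda>_. lborel)) = (\<integral>\<^sup>+x. f x \<partial>PiM I (\<lambda>_. lborel))"
    and "(\<integral>\<^sup>+x. f (\<lambda>i\<in>I. t i - x i) \<partial>PiM I (\<lambda>_. lborel)) = (\<integral>\<^sup>+x. f x \<partial>PiM I (\<lambda>_. lborel))"
proof -
  have tr: "(\<integral>\<^sup>+x. h (t + x) \<partial>lborel) = (\<integral>\<^sup>+x. h x \<partial>lborel)" if "h \<in> borel_measurable borel" for h and t :: 'b
    using nn_integral_lborel_translate[OF that, of t] by (simp add: add.commute)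
  have "(\<integral>\<^sup>+x. f (\<lambda>i\<in>I. t i + x i) \<partial>PiM I (\<lambda>_. lborel)) * (\<Prod>i\<in>I. 1) = (\<integral>\<^sup>+x. f x \<partial>PiM I (\<lambda>_. lborel))"
    by (rule nn_integral_PiM_map[where T = "\<lambda>i x. t i + x"])
       (use assms in \<open>auto simp: sigma_finite_lborel tr\<close>)
  then show "(\<integral>\<^sup>+x. f (\<lambda>i\<in>I. t i + x i) \<partial>PiM I (\<lambda>_. lborel)) = (\<integral>\<^sup>+x. f x \<partial>PiM I (\<lambda>_. lborel))" by simp
  have "(\<integral>\<^sup>+x. f (\<lambda>i\<in>I. t i - x i) \<partial>PiM I (\<lambda>_. lborel)) * (\<Prod>i\<in>I. 1) = (\<integral>\<^sup>+x. f x \<partial>PiM I (\<lambda>_. lborel))"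
    by (rule nn_integral_PiM_map[where T = "\<lambda>i x. t i - x"])
       (use assms in \<open>auto simp: sigma_finite_lborel nn_integral_lborel_reflect\<close>)
  then show "(\<integral>\<^sup>+x. f (\<lambda>i\<in>I. t i - x i) \<partial>PiM I (\<lambda>_. lborel)) = (\<integral>\<^sup>+x. f x \<partial>PiM I (\<lambda>_. lborel))" by simp
qed

text \<open>Linear regression in abstract form: \<open>k\<close> stands for the inner products of
  \<open>y\<close> with earlier columns, and by \<open>orth\<close> the vector
  \<open>R (\<lambda>i\<in>I. k i y)\<close> is the orthogonal projection of \<open>y\<close> onto
  the range of \<open>R\<close>. Coefficient vectors are functions restricted to \<open>I\<close>,
  the points of the product measure that describes a row of off-diagonal entries. The number
  \<open>\<kappa>\<close> records the Jacobian of \<open>R\<close> through a Gaussian integral, and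
  the strict inequality of dimensions leaves a residual space of positive dimension.\<close>

locale column_projection =
  fixes I :: "'i set" and k :: "'i \<Rightarrow> 'e::euclidean_space \<Rightarrow> 'f::euclidean_space"
    and R :: "('i \<Rightarrow> 'f) \<Rightarrow> 'e" and \<kappa> :: real
  assumes fin: "finite I"
    and lin_k: "\<And>i. i \<in> I \<Longrightarrow> linear (k i)"
    and R_meas [measurable]: "R \<in> borel_measurable (PiM I (\<lambda>_. lborel))"
    and R_add: "\<And>w w'. R (\<lambda>i\<in>I. w i + w' i) = R w + R w'"
    and R_scale: "\<And>s w. R (\<lambda>i\<in>I. s *\<^sub>R w i) = s *\<^sub>R R w"
    and k_R: "\<And>i w. i \<in> I \<Longrightarrow> k i (R w) = w i"
    and orth: "\<And>y w. (y - R (\<lambda>i\<in>I. k i y)) \<bullet> R w = 0"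
    and \<kappa>_pos: "\<kappa> > 0"
    and \<kappa>: "(\<integral>\<^sup>+w. ennreal (exp (- (norm (R w))\<^sup>2)) \<partial>PiM I (\<lambda>_. lborel)) = ennreal \<kappa>"
    and dim: "card I * DIM('f) < DIM('e)"
begin

abbreviation X :: "('i \<Rightarrow> 'f) measure" where "X \<equiv> PiM I (\<lambda>_. lborel)"

definition K :: "'e \<Rightarrow> 'i \<Rightarrow> 'f" where "K y = (\<lambda>i\<in>I. k i y)"

definition res :: "'e \<Rightarrow> real" where "res y = (norm (y - R (K y)))\<^sup>2"

text \<open>Half the real dimension of the orthogonal complement of the range of \<open>R\<close>;
  the squared norm on that space has a density proportional to r^(\<epsilon> - 1).\<close>

definition \<epsilon> :: real where "\<epsilon> = (real DIM('e) - real (card I * DIM('f))) / 2"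

lemma \<epsilon>_pos: "\<epsilon> > 0"
proof -
  have "real (card I * DIM('f)) < real DIM('e)" using dim by (simp only: of_nat_less_iff)
  then show ?thesis unfolding \<epsilon>_def by (simp del: of_nat_mult)
qed

lemma K_measurable [measurable]: "K \<in> borel \<rightarrow>\<^sub>M X"
  unfolding K_def by (rule measurable_restrict) (simp add: linear_borel_measurable lin_k)

lemma res_measurable [measurable]: "res \<in> borel_measurable borel"
  unfolding res_def by measurable

lemma norm_split: "(norm y)\<^sup>2 = (norm (R (K y)))\<^sup>2 + res y"
  using orth[of y "K y"] unfolding res_def power2_norm_eq_inner K_def
  by (simp add: inner_diff_left inner_diff_right inner_commute)

lemma exp_split: "ennreal (exp (- (norm y)\<^sup>2)) = ennreal (exp (- res y)) * ennreal (exp (- (norm (R (K y)))\<^sup>2))"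
  by (subst norm_split) (simp add: exp_add[symmetric] add.commute flip: ennreal_mult)

lemma K_add: "K (y + R w) = (\<lambda>i\<in>I. K y i + w i)"
  unfolding K_def by (auto simp: linear_add lin_k k_R fun_eq_iff)

lemma K_scale: "K (s *\<^sub>R y) = (\<lambda>i\<in>I. s *\<^sub>R K y i)"
  unfolding K_def by (auto simp: linear_scale lin_k fun_eq_iff)

lemma res_add: "res (y + R w) = res y"
  unfolding res_def K_add R_add by simp

lemma res_scale: "res (s *\<^sub>R y) = s\<^sup>2 * res y"
  unfolding res_def K_scale R_scale by (simp add: scaleR_diff_right[symmetric] power_mult_distrib)

sublocale X: sigma_finite_measure X
proof -
  interpret product_sigma_finite "\<lambda>_::'i. lborel :: 'f measure"
    by (simp add: product_sigma_finite_def sigma_finite_lborel)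
  show "sigma_finite_measure X" by (rule sigma_finite[OF fin])
qed

text \<open>The weight makes the measure finite on the sets \<open>{w. norm (R w) \<le> n}\<close>, so that the uniqueness of
  translation invariant measures applies to it.\<close>

lemma weighted_product:
  assumes [measurable]: "A \<in> sets X" "B \<in> sets borel"
  shows "(\<integral>\<^sup>+y. indicator A (K y) * indicator B (res y) * ennreal (exp (- res y)) \<partial>lborel) * ennreal \<kappa> =
    emeasure X A * (\<integral>\<^sup>+y. indicator B (res y) * ennreal (exp (- (norm y)\<^sup>2)) \<partial>lborel)"
proof -
  let ?h = "\<lambda>y. indicator B (res y) * ennreal (exp (- res y))"
  let ?M = "distr (density lborel ?h) X K"
  have spX: "w \<in> space X \<longleftrightarrow> w \<in> extensional I" for w by (simp add: space_PiM PiE_def)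
  have nnM: "(\<integral>\<^sup>+w. f w \<partial>?M) = (\<integral>\<^sup>+y. ?h y * f (K y) \<partial>lborel)" if [measurable]: "f \<in> borel_measurable X" for f
    by (simp add: nn_integral_distr nn_integral_density)
  have sfM: "sigma_finite_measure ?M"
  proof
    let ?A = "\<lambda>n::nat. {w \<in> space X. norm (R w) \<le> real n}"
    have "emeasure ?M (?A n) \<noteq> \<infinity>" for n
    proof -
      have "emeasure ?M (?A n) = (\<integral>\<^sup>+w. indicator (?A n) w \<partial>?M)" by simp
      also have "\<dots> = (\<integral>\<^sup>+y. ?h y * indicator (?A n) (K y) \<partial>lborel)" by (rule nnM) measurable
      also have "\<dots> \<le> (\<integral>\<^sup>+y. ennreal (exp ((real n)\<^sup>2)) * ennreal (exp (- ((y::'e) \<bullet> y))) \<partial>lborel)"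
      proof (rule nn_integral_mono)
        fix y :: 'e
        have "exp (- res y) \<le> exp ((real n)\<^sup>2) * exp (- (y \<bullet> y))" if "norm (R (K y)) \<le> real n"
        proof -
          have "(norm (R (K y)))\<^sup>2 \<le> (real n)\<^sup>2" using that by (intro power_mono) auto
          then show ?thesis using norm_split[of y] unfolding power2_norm_eq_inner exp_add[symmetric] by simp
        qed
        then show "?h y * indicator (?A n) (K y) \<le> ennreal (exp ((real n)\<^sup>2)) * ennreal (exp (- (y \<bullet> y)))"
          by (auto simp: indicator_def simp flip: ennreal_mult intro!: ennreal_leI)
      qed
      also have "\<dots> = ennreal (exp ((real n)\<^sup>2)) * ennreal (pi powr (DIM('e) / 2))"
        by (simp add: nn_integral_cmult gaussian_nn_integral)
      also have "\<dots> < \<infinity>" by (simp add: ennreal_mult_less_top)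
      finally show ?thesis by simp
    qed
    moreover have "(\<Union>n. ?A n) = space X" using real_arch_simple by auto
    ultimately show "\<exists>A. countable A \<and> A \<subseteq> sets ?M \<and> \<Union> A = space ?M \<and> (\<forall>a\<in>A. emeasure ?M a \<noteq> \<infinity>)"
      by (intro exI[of _ "range ?A"]) auto
  qed
  have add_meas: "(\<lambda>(x, y). \<lambda>i\<in>I. x i + y i) \<in> X \<Otimes>\<^sub>M X \<rightarrow>\<^sub>M X"
    and sub_meas: "(\<lambda>(x, y). \<lambda>i\<in>I. x i - y i) \<in> X \<Otimes>\<^sub>M X \<rightarrow>\<^sub>M X"
    unfolding split_beta by (rule measurable_restrict, measurable)+
  \<comment> \<open>Comparison with the Gaussian of \<open>R w\<close>, whose integral is
    \<open>\<kappa>\<close>, normalises the invariant measure: by Pythagoras, its product with the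
    weight is the full Gaussian of \<open>y\<close>.\<close>
  have "(\<integral>\<^sup>+w. indicator A w \<partial>?M) * (\<integral>\<^sup>+w. ennreal (exp (- (norm (R w))\<^sup>2)) \<partial>X) =
    (\<integral>\<^sup>+w. indicator A w \<partial>X) * (\<integral>\<^sup>+w. ennreal (exp (- (norm (R w))\<^sup>2)) \<partial>?M)"
  proof (rule haar_measure_unique[where L = X and add = "\<lambda>x y. \<lambda>i\<in>I. x i + y i" and sub = "\<lambda>x y. \<lambda>i\<in>I. x i - y i"])
    fix x y assume "x \<in> space X" "y \<in> space X"
    then show "(\<lambda>i\<in>I. (\<lambda>i\<in>I. x i + y i) i - y i) = x"
      by (auto simp: spX fun_eq_iff extensional_def)
  next
    fix h :: "('i \<Rightarrow> 'f) \<Rightarrow> ennreal" and y assume [measurable]: "h \<in> borel_measurable X" and y: "y \<in> space X"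
    have [measurable]: "(\<lambda>x. \<lambda>i\<in>I. x i + y i) \<in> X \<rightarrow>\<^sub>M X" by (rule measurable_restrict) measurable
    have "(\<integral>\<^sup>+x. h (\<lambda>i\<in>I. x i + y i) \<partial>?M) = (\<integral>\<^sup>+x. ?h (x + R y) * h (K (x + R y)) \<partial>lborel)"
      by (subst nnM) (auto simp: K_add res_add)
    also have "\<dots> = (\<integral>\<^sup>+x. ?h x * h (K x) \<partial>lborel)"
      by (rule nn_integral_lborel_translate[where f = "\<lambda>x. ?h x * h (K x)"]) measurable
    finally show "(\<integral>\<^sup>+x. h (\<lambda>i\<in>I. x i + y i) \<partial>?M) = (\<integral>\<^sup>+x. h x \<partial>?M)" by (simp add: nnM)
  qed (use sfM X.sigma_finite_measure_axioms add_meas sub_meas nn_integral_PiM_lborel_translate[OF fin] in auto)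
  moreover have "(\<integral>\<^sup>+w. indicator A w \<partial>?M) = (\<integral>\<^sup>+y. indicator A (K y) * indicator B (res y) * ennreal (exp (- res y)) \<partial>lborel)"
    by (subst nnM) (auto intro!: nn_integral_cong simp: mult_ac)
  moreover have "(\<integral>\<^sup>+w. ennreal (exp (- (norm (R w))\<^sup>2)) \<partial>?M)
      = (\<integral>\<^sup>+y. indicator B (res y) * ennreal (exp (- (norm y)\<^sup>2)) \<partial>lborel)"
    by (subst nnM, measurable, rule nn_integral_cong, subst exp_split, simp only: mult_ac)
  ultimately show ?thesis by (simp add: \<kappa>)
qed

text \<open>The residual factor of Lebesgue measure. The plain image under \<open>res\<close> may be
  infinite on bounded sets, so the directions of \<open>K\<close> are integrated against the
  Gaussian of \<open>R\<close>, of mass \<open>\<kappa>\<close>; the factor exp r removes the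
  Gaussian weight from the residual itself.\<close>

definition \<eta> :: "real measure" where
  "\<eta> = density (distr (density lborel (\<lambda>y. ennreal (exp (- (norm y)\<^sup>2)))) borel res) (\<lambda>r. ennreal (exp r / \<kappa>))"

lemma sets_\<eta> [measurable_cong]: "sets \<eta> = sets borel" by (simp add: \<eta>_def)

lemma nn_integral_\<eta>:
  assumes [measurable]: "h \<in> borel_measurable borel"
  shows "(\<integral>\<^sup>+r. h r \<partial>\<eta>) = (\<integral>\<^sup>+y. h (res y) * ennreal (exp (- (norm (R (K y)))\<^sup>2) / \<kappa>) \<partial>lborel)"
proof -
  have "ennreal (exp (- (norm y)\<^sup>2)) * (ennreal (exp (res y) / \<kappa>) * h (res y))
      = h (res y) * ennreal (exp (- (norm (R (K y)))\<^sup>2) / \<kappa>)" for y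
  proof -
    have "exp (- res y) * exp (- (norm (R (K y)))\<^sup>2) * (exp (res y) / \<kappa>) = exp (- (norm (R (K y)))\<^sup>2) / \<kappa>"
      by (simp add: exp_minus field_simps)
    then have e: "ennreal (exp (- (norm y)\<^sup>2)) * ennreal (exp (res y) / \<kappa>) = ennreal (exp (- (norm (R (K y)))\<^sup>2) / \<kappa>)"
      unfolding exp_split[of y] using \<kappa>_pos by (simp flip: ennreal_mult)
    show ?thesis by (subst mult.assoc[symmetric], subst e, rule mult.commute)
  qed
  then show ?thesis unfolding \<eta>_def by (simp add: nn_integral_density nn_integral_distr)
qed

lemma weight: "ennreal (exp (- res y)) * ennreal (exp (- (norm (R (K y)))\<^sup>2) / \<kappa>) =
    ennreal (inverse \<kappa>) * ennreal (exp (- (norm y)\<^sup>2))"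
  unfolding exp_split[of y] using \<kappa>_pos by (simp add: divide_inverse ennreal_mult mult_ac)

lemma finite_exp_\<eta>: "(\<integral>\<^sup>+r. ennreal (exp (- r)) \<partial>\<eta>) = ennreal (pi powr (DIM('e) / 2) / \<kappa>)"
proof -
  have "(\<integral>\<^sup>+r. ennreal (exp (- r)) \<partial>\<eta>) =
      (\<integral>\<^sup>+y. ennreal (exp (- res y)) * ennreal (exp (- (norm (R (K y)))\<^sup>2) / \<kappa>) \<partial>lborel)"
    by (rule nn_integral_\<eta>) measurable
  also have "\<dots> = (\<integral>\<^sup>+y. ennreal (inverse \<kappa>) * ennreal (exp (- ((y::'e) \<bullet> y))) \<partial>lborel)"
    by (simp only: weight dot_square_norm)
  also have "\<dots> = ennreal (inverse \<kappa>) * (\<integral>\<^sup>+y. ennreal (exp (- ((y::'e) \<bullet> y))) \<partial>lborel)"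
    by (rule nn_integral_cmult) measurable
  also have "\<dots> = ennreal (inverse \<kappa>) * ennreal (pi powr (DIM('e) / 2))"
    unfolding gaussian_nn_integral ..
  also have "\<dots> = ennreal (inverse \<kappa> * pi powr (DIM('e) / 2))"
    using \<kappa>_pos by (intro ennreal_mult[symmetric]) auto
  finally show ?thesis by (simp only: divide_inverse mult.commute)
qed

text \<open>Rectangles suffice once both sides are weighted by exp(- r), which makes the residual
  factor finite; \<open>weighted_product\<close> evaluates them.\<close>

lemma pushforward_product:
  assumes [measurable]: "case_prod g \<in> borel_measurable (X \<Otimes>\<^sub>M borel)"
  shows "(\<integral>\<^sup>+y. g (K y) (res y) \<partial>lborel) = (\<integral>\<^sup>+w. (\<integral>\<^sup>+r. g w r \<partial>\<eta>) \<partial>X)"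
proof -
  let ?D = "density \<eta> (\<lambda>r. ennreal (exp (- r)))"
  let ?N = "distr (density lborel (\<lambda>y. ennreal (exp (- res y)))) (X \<Otimes>\<^sub>M borel) (\<lambda>y. (K y, res y))"
  have fD: "finite_measure ?D"
    by (rule finite_measureI) (simp add: emeasure_density finite_exp_\<eta> cong: nn_integral_cong)
  then have sD: "sigma_finite_measure ?D" by (rule finite_measure.axioms)
  have "X \<Otimes>\<^sub>M ?D = ?N"
  proof (rule pair_measure_eqI)
    show "sets (X \<Otimes>\<^sub>M ?D) = sets ?N" by (simp add: sets_\<eta> cong: sets_pair_measure_cong)
    fix A B assume A[measurable]: "A \<in> sets X" and "B \<in> sets ?D"
    then have B[measurable]: "B \<in> sets borel" by (simp add: sets_\<eta>)
    have "emeasure ?D B = (\<integral>\<^sup>+r. ennreal (exp (- r)) * indicator B r \<partial>\<eta>)"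
      by (simp add: emeasure_density sets_\<eta>)
    also have "\<dots> = (\<integral>\<^sup>+y. ennreal (inverse \<kappa>) * (indicator B (res y) * ennreal (exp (- (norm y)\<^sup>2))) \<partial>lborel)"
      by (subst nn_integral_\<eta>) (auto intro!: nn_integral_cong simp: weight indicator_def)
    also have "\<dots> = ennreal (inverse \<kappa>) * (\<integral>\<^sup>+y. indicator B (res y) * ennreal (exp (- (norm y)\<^sup>2)) \<partial>lborel)"
      by (rule nn_integral_cmult) measurable
    finally have 1: "emeasure X A * emeasure ?D B = ennreal (inverse \<kappa>) *
        (emeasure X A * (\<integral>\<^sup>+y. indicator B (res y) * ennreal (exp (- (norm y)\<^sup>2)) \<partial>lborel))"
      by (simp only: mult_ac)
    have "emeasure ?N (A \<times> B) = (\<integral>\<^sup>+z. indicator (A \<times> B) z \<partial>?N)" by simp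
    also have "\<dots> = (\<integral>\<^sup>+y. indicator A (K y) * indicator B (res y) * ennreal (exp (- res y)) \<partial>lborel)"
      by (subst nn_integral_distr, measurable, subst nn_integral_density, measurable)
         (auto intro!: nn_integral_cong simp: indicator_def)
    also have "\<dots> = (ennreal (inverse \<kappa>) * ennreal \<kappa>) * \<dots>"
      using \<kappa>_pos by (simp flip: ennreal_mult)
    also have "\<dots> = ennreal (inverse \<kappa>) *
        (emeasure X A * (\<integral>\<^sup>+y. indicator B (res y) * ennreal (exp (- (norm y)\<^sup>2)) \<partial>lborel))"
      unfolding weighted_product[OF A B, symmetric] by (simp only: mult_ac)
    finally show "emeasure X A * emeasure ?D B = emeasure ?N (A \<times> B)" using 1 by simp
  qed (fact X.sigma_finite_measure_axioms sD)+
  note eq = this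
  \<comment> \<open>The factor exp r cancels the weight that both measures carry.\<close>
  let ?g = "\<lambda>z. ennreal (exp (snd z)) * g (fst z) (snd z)"
  have [measurable]: "(\<lambda>z. g (fst z) (snd z)) \<in> borel_measurable (X \<Otimes>\<^sub>M borel)"
    using assms by (simp add: split_beta)
  have [measurable]: "g w \<in> borel_measurable borel" if "w \<in> space X" for w
    using measurable_compose[OF measurable_Pair1'[OF that] assms] by simp
  have e: "ennreal (exp (- r)) * (ennreal (exp r) * a) = a" for r a
    by (simp add: mult.assoc[symmetric] mult_exp_exp flip: ennreal_mult)
  have "(\<integral>\<^sup>+z. ?g z \<partial>?N) = (\<integral>\<^sup>+y. g (K y) (res y) \<partial>lborel)"
    by (subst nn_integral_distr, measurable, subst nn_integral_density, measurable) (simp add: e)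
  moreover have "(\<integral>\<^sup>+z. ?g z \<partial>(X \<Otimes>\<^sub>M ?D)) = (\<integral>\<^sup>+w. (\<integral>\<^sup>+r. g w r \<partial>\<eta>) \<partial>X)"
  proof -
    have m: "?g \<in> borel_measurable (X \<Otimes>\<^sub>M borel)" by measurable
    have s: "sets (X \<Otimes>\<^sub>M ?D) = sets (X \<Otimes>\<^sub>M borel)"
      by (rule sets_pair_measure_cong) (simp_all add: sets_\<eta>)
    have "?g \<in> borel_measurable (X \<Otimes>\<^sub>M ?D)" using m by (subst measurable_cong_sets[OF s refl])
    then have "(\<integral>\<^sup>+z. ?g z \<partial>(X \<Otimes>\<^sub>M ?D)) = (\<integral>\<^sup>+w. (\<integral>\<^sup>+r. ?g (w, r) \<partial>?D) \<partial>X)"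
      by (rule sigma_finite_measure.nn_integral_fst[OF sD, symmetric])
    also have "\<dots> = (\<integral>\<^sup>+w. (\<integral>\<^sup>+r. g w r \<partial>\<eta>) \<partial>X)"
      by (intro nn_integral_cong, subst nn_integral_density) (auto simp: e)
    finally show ?thesis .
  qed
  ultimately show ?thesis unfolding eq by simp
qed

text \<open>Dilating \<open>y\<close> by \<open>s\<close> scales \<open>K\<close> by
  \<open>s\<close> and \<open>res\<close> by \<open>s\<^sup>2\<close>. The Jacobian has one factor
  \<open>s\<close> for each real coordinate of \<open>y\<close>; the product measure absorbs those
  belonging to \<open>K\<close>, and s^(2 \<epsilon>) remains for the residual.\<close>

lemma cdf_\<eta>_scale:
  assumes "s > 0"
  shows "emeasure \<eta> {..t} = ennreal (s powr (2 * \<epsilon>)) * emeasure \<eta> {..t / s\<^sup>2}"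
proof -
  let ?g = "\<lambda>w. ennreal (exp (- (norm (R w))\<^sup>2))"
  let ?p = "\<lambda>t y. ?g (K y) * indicator {..t} (res y)"
  have [measurable]: "(\<lambda>x. \<lambda>i\<in>I. s *\<^sub>R x i) \<in> X \<rightarrow>\<^sub>M X" by (rule measurable_restrict) measurable
  have L: "(\<integral>\<^sup>+y. f (K y) * indicator {..t} (res y) \<partial>lborel) = (\<integral>\<^sup>+w. f w \<partial>X) * emeasure \<eta> {..t}"
    if [measurable]: "f \<in> borel_measurable X" for f t
    by (subst pushforward_product[where g = "\<lambda>w r. f w * indicator {..t} r"])
      (auto simp: nn_integral_cmult nn_integral_multc sets_\<eta>)
  have r: "indicator {..t} (s\<^sup>2 * r) = (indicator {..t / s\<^sup>2} r :: ennreal)" for r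
    using assms by (auto simp: indicator_def field_simps)
  have "ennreal \<kappa> * emeasure \<eta> {..t} = (\<integral>\<^sup>+y. ?p t y \<partial>lborel)"
    by (subst L[of ?g]) (simp_all add: \<kappa>)
  also have "\<dots> = (\<integral>\<^sup>+y. ?p t (s *\<^sub>R y) \<partial>lborel) * ennreal (s ^ DIM('e))"
    using assms by (intro nn_integral_lborel_positive_cmult[symmetric]) measurable
  also have "(\<integral>\<^sup>+y. ?p t (s *\<^sub>R y) \<partial>lborel) = (\<integral>\<^sup>+y. ?g (\<lambda>i\<in>I. s *\<^sub>R K y i) * indicator {..t / s\<^sup>2} (res y) \<partial>lborel)"
    unfolding K_scale res_scale r ..
  also have "\<dots> = (\<integral>\<^sup>+w. ?g (\<lambda>i\<in>I. s *\<^sub>R w i) \<partial>X) * emeasure \<eta> {..t / s\<^sup>2}"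
    by (rule L[where f = "\<lambda>w. ?g (\<lambda>i\<in>I. s *\<^sub>R w i)"]) measurable
  finally have "ennreal \<kappa> * emeasure \<eta> {..t} = (\<integral>\<^sup>+w. ?g (\<lambda>i\<in>I. s *\<^sub>R w i) \<partial>X) * ennreal (s ^ DIM('e)) * emeasure \<eta> {..t / s\<^sup>2}"
    by (simp only: mult_ac)
  also have "ennreal (s ^ DIM('e)) = ennreal (s ^ (card I * DIM('f))) * ennreal (s powr (2 * \<epsilon>))"
  proof -
    have "real DIM('e) = real (card I * DIM('f)) + 2 * \<epsilon>"
      by (simp add: \<epsilon>_def diff_divide_distrib del: of_nat_mult)
    then have "s ^ DIM('e) = s ^ (card I * DIM('f)) * s powr (2 * \<epsilon>)"
      using assms by (simp add: powr_realpow[symmetric] powr_add[symmetric] del: of_nat_mult)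
    then show ?thesis using assms by (simp add: ennreal_mult)
  qed
  also have "(\<integral>\<^sup>+w. ?g (\<lambda>i\<in>I. s *\<^sub>R w i) \<partial>X) * (ennreal (s ^ (card I * DIM('f))) * ennreal (s powr (2 * \<epsilon>))) * emeasure \<eta> {..t / s\<^sup>2}
    = ennreal \<kappa> * (ennreal (s powr (2 * \<epsilon>)) * emeasure \<eta> {..t / s\<^sup>2})"
    using nn_integral_PiM_lborel_scale[OF assms fin, of ?g] by (simp add: \<kappa> mult.assoc[symmetric])
  finally show ?thesis
    using \<kappa>_pos by (simp add: ennreal_mult_cancel_left)
qed

text \<open>Homogeneity, used with \<open>s = sqrt t\<close>, leaves only c t^\<epsilon> for the
  distribution function. The integral of exp(- r), known from the Gaussian integral over the whole
  space, then gives c through the Gamma function.\<close>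

lemma \<eta>_eq: "\<eta> = density lborel (\<lambda>r. ennreal (pi powr (DIM('e) / 2) / (\<kappa> * Gamma \<epsilon>) * (indicator {0<..} r * r powr (\<epsilon> - 1))))"
proof -
  have fin: "emeasure \<eta> {..t} < \<infinity>" for t
  proof -
    have "emeasure \<eta> {..t} = (\<integral>\<^sup>+r. indicator {..t} r \<partial>\<eta>)" by (simp add: sets_\<eta>)
    also have "\<dots> \<le> (\<integral>\<^sup>+r. ennreal (exp t) * ennreal (exp (- r)) \<partial>\<eta>)"
      by (intro nn_integral_mono) (auto simp: indicator_def mult_exp_exp simp flip: ennreal_mult)
    also have "\<dots> = ennreal (exp t) * ennreal (pi powr (DIM('e) / 2) / \<kappa>)"
      by (simp add: nn_integral_cmult finite_exp_\<eta>)
    also have "\<dots> < \<infinity>" by (simp add: ennreal_mult_less_top)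
    finally show ?thesis .
  qed
  define c where "c = enn2real (emeasure \<eta> {..1})"
  have c: "emeasure \<eta> {..1} = ennreal c" "c \<ge> 0" using fin[of 1] by (auto simp: c_def)
  \<comment> \<open>No atom at 0: by scaling with 2, the finite mass of \<open>{..0}\<close> equals
    2^(2 \<epsilon>) times itself.\<close>
  have zero: "emeasure \<eta> {..0} = 0"
  proof -
    obtain z where z: "emeasure \<eta> {..0} = ennreal z" "z \<ge> 0"
      using fin[of 0] by (metis ennreal_enn2real enn2real_nonneg infinity_ennreal_def)
    have "ennreal z = ennreal (2 powr (2 * \<epsilon>) * z)"
      using cdf_\<eta>_scale[of 2 0] z by (simp add: ennreal_mult)
    then have "z = 2 powr (2 * \<epsilon>) * z" using z(2) by (subst (asm) ennreal_inj) auto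
    moreover have "z * (2 powr (2 * \<epsilon>) - 1) = 2 powr (2 * \<epsilon>) * z - z" by (simp add: algebra_simps)
    ultimately have "z * (2 powr (2 * \<epsilon>) - 1) = 0" by linarith
    moreover have "2 powr (2 * \<epsilon>) - 1 > (0::real)" using \<epsilon>_pos by simp
    ultimately have "z = 0" by (metis less_irrefl mult_eq_0_iff)
    then show ?thesis using z by simp
  qed
  have cdf: "emeasure \<eta> {..t} = ennreal (if t > 0 then c * t powr \<epsilon> else 0)" for t
  proof (cases "t > 0")
    case True
    then have "emeasure \<eta> {..t} = ennreal (sqrt t powr (2 * \<epsilon>)) * ennreal c"
      using cdf_\<eta>_scale[of "sqrt t" t] by (simp add: c)
    moreover have "sqrt t powr (2 * \<epsilon>) = t powr \<epsilon>"
      using True by (simp add: powr_half_sqrt[symmetric] powr_powr)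
    ultimately show ?thesis using True c(2) by (simp add: ennreal_mult[symmetric] mult.commute)
  next
    case False
    then have "emeasure \<eta> {..t} \<le> emeasure \<eta> {..0}" by (intro emeasure_mono) (auto simp: sets_\<eta>)
    then show ?thesis using False zero by simp
  qed
  note eq = measure_eqI_powr_cdf[OF sets_\<eta> \<epsilon>_pos c(2) cdf]
  have "ennreal (pi powr (DIM('e) / 2) / \<kappa>) = (\<integral>\<^sup>+r. ennreal (exp (- r)) \<partial>\<eta>)" by (rule finite_exp_\<eta>[symmetric])
  also have "\<dots> = (\<integral>\<^sup>+r. ennreal (c * \<epsilon>) * ennreal (indicator {0<..} r * r powr (\<epsilon> - 1) * exp (- 1 * r)) \<partial>lborel)"
    using c(2) \<epsilon>_pos
    by (subst eq, subst nn_integral_density) (auto intro!: nn_integral_cong simp: mult_ac simp flip: ennreal_mult)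
  also have "\<dots> = ennreal (c * \<epsilon>) * ennreal (Gamma \<epsilon>)"
    using gamma_nn_integral[OF \<epsilon>_pos, of 1] by (simp add: nn_integral_cmult)
  also have "\<dots> = ennreal (c * \<epsilon> * Gamma \<epsilon>)"
    using c(2) \<epsilon>_pos by (simp add: ennreal_mult Gamma_real_nonneg)
  finally have "pi powr (DIM('e) / 2) / \<kappa> = c * \<epsilon> * Gamma \<epsilon>"
    using c(2) \<epsilon>_pos \<kappa>_pos by (simp add: Gamma_real_nonneg)
  moreover have "Gamma \<epsilon> > 0" using \<epsilon>_pos by (rule Gamma_real_pos)
  ultimately have "c * \<epsilon> = pi powr (DIM('e) / 2) / (\<kappa> * Gamma \<epsilon>)"
    using \<kappa>_pos by (simp add: field_simps)
  then show ?thesis using eq by simp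
qed

text \<open>The squared norm, not the residual, is the new diagonal entry of a Gram matrix; passing
  between them is a translation by the squared norm of the projection.\<close>

lemma nn_integral_column:
  assumes [measurable]: "case_prod g \<in> borel_measurable (X \<Otimes>\<^sub>M borel)"
  shows "(\<integral>\<^sup>+y. g (K y) ((norm y)\<^sup>2) \<partial>lborel) =
    (\<integral>\<^sup>+w. (\<integral>\<^sup>+u. ennreal (pi powr (DIM('e) / 2) / (\<kappa> * Gamma \<epsilon>) *
      (indicator {0<..} (u - (norm (R w))\<^sup>2) * (u - (norm (R w))\<^sup>2) powr (\<epsilon> - 1))) * g w u \<partial>lborel) \<partial>X)"
proof -
  have [measurable]: "(\<lambda>z. g (fst z) (snd z)) \<in> borel_measurable (X \<Otimes>\<^sub>M borel)"
    using assms by (simp add: split_beta)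
  have gw: "g w \<in> borel_measurable borel" if "w \<in> space X" for w
    using measurable_compose[OF measurable_Pair1'[OF that] assms] by simp
  have "(\<integral>\<^sup>+y. g (K y) ((norm (y::'e))\<^sup>2) \<partial>lborel) = (\<integral>\<^sup>+y. g (K y) ((norm (R (K y)))\<^sup>2 + res y) \<partial>lborel)"
    by (subst norm_split) (rule refl)
  also have "\<dots> = (\<integral>\<^sup>+w. (\<integral>\<^sup>+r. g w ((norm (R w))\<^sup>2 + r) \<partial>\<eta>) \<partial>X)"
  proof (rule pushforward_product)
    have "(\<lambda>z. g (fst z) ((norm (R (fst z)))\<^sup>2 + snd z)) \<in> borel_measurable (X \<Otimes>\<^sub>M borel)"
      by (rule measurable_compose[of "\<lambda>z. (fst z, (norm (R (fst z)))\<^sup>2 + snd z)" _ "X \<Otimes>\<^sub>M borel" "\<lambda>z. g (fst z) (snd z)", simplified])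
         measurable
    then show "(\<lambda>(w, r). g w ((norm (R w))\<^sup>2 + r)) \<in> borel_measurable (X \<Otimes>\<^sub>M borel)"
      by (simp add: split_beta)
  qed
  also have "\<dots> = (\<integral>\<^sup>+w. (\<integral>\<^sup>+u. ennreal (pi powr (DIM('e) / 2) / (\<kappa> * Gamma \<epsilon>) *
      (indicator {0<..} (u - (norm (R w))\<^sup>2) * (u - (norm (R w))\<^sup>2) powr (\<epsilon> - 1))) * g w u \<partial>lborel) \<partial>X)"
  proof (rule nn_integral_cong)
    fix w assume w: "w \<in> space X"
    note [measurable] = gw[OF w]
    let ?q = "(norm (R w))\<^sup>2"
    let ?d = "\<lambda>r. ennreal (pi powr (DIM('e) / 2) / (\<kappa> * Gamma \<epsilon>) * (indicator {0<..} r * r powr (\<epsilon> - 1)))"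
    have "(\<integral>\<^sup>+r. g w (?q + r) \<partial>\<eta>) = (\<integral>\<^sup>+r. ?d r * g w (?q + r) \<partial>lborel)"
      by (subst \<eta>_eq, subst nn_integral_density) auto
    also have "\<dots> = (\<integral>\<^sup>+r. ?d (r + ?q - ?q) * g w (r + ?q) \<partial>lborel)" by (simp add: add.commute)
    also have "\<dots> = (\<integral>\<^sup>+u. ?d (u - ?q) * g w u \<partial>lborel)"
      by (rule nn_integral_lborel_translate[where f = "\<lambda>u. ?d (u - ?q) * g w u"]) measurable
    finally show "(\<integral>\<^sup>+r. g w (?q + r) \<partial>\<eta>) = (\<integral>\<^sup>+u. ?d (u - ?q) * g w u \<partial>lborel)" .
  qed
  finally show ?thesis .
qed

end

section \<open>Padded leading blocks and the determinant of a positive definite matrix\<close>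

definition proj :: "'m set \<Rightarrow> ('a::normed_division_algebra, 'm::finite) vec \<Rightarrow> ('a, 'm) vec" where
  "proj J v = (\<chi> i. if i \<in> J then v $ i else 0)"

text \<open>Blocks stay in the full matrix type: filling up with the identity changes neither
  positivity nor the determinant of the block, and avoids a separate type for every block
  size.\<close>

definition pad :: "'m set \<Rightarrow> ('a::normed_division_algebra, 'm::finite, 'm) mtx \<Rightarrow> ('a, 'm, 'm) mtx" where
  "pad J A = (\<chi> i j. if i \<in> J \<and> j \<in> J then A $ i $ j else if i = j then 1 else 0)"

lemma proj_nth: "proj J v $ i = (if i \<in> J then v $ i else 0)"
  by (simp add: proj_def)

lemma linear_proj: "linear (proj J)"
  by (rule linearI) (auto simp: proj_def vec_eq_iff)

lemma proj_proj [simp]: "proj J (proj K v) = proj (J \<inter> K) v"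
  by (auto simp: proj_def vec_eq_iff)

lemma proj_empty [simp]: "proj {} v = 0" and proj_UNIV [simp]: "proj UNIV v = v"
  by (auto simp: proj_def vec_eq_iff)

lemma proj_compl: "proj J v + proj (- J) v = v"
  by (auto simp: proj_def vec_eq_iff)

lemma inner_proj: "proj J v \<bullet> w = v \<bullet> proj J w"
  unfolding inner_vec_def by (intro sum.cong refl) (simp add: proj_nth)

lemma mvmul_pad: "mvmul (pad J A) v = proj J (mvmul A (proj J v)) + proj (- J) v"
proof -
  have "mvmul (pad J A) v $ i = (proj J (mvmul A (proj J v)) + proj (- J) v) $ i" for i
  proof (cases "i \<in> J")
    case True
    have "(\<Sum>j\<in>UNIV. pad J A $ i $ j * v $ j) = (\<Sum>j\<in>UNIV. A $ i $ j * proj J v $ j)"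
      by (rule sum.cong) (auto simp: pad_def True proj_nth nda_mult.zero_left nda_mult.zero_right)
    then show ?thesis using True by (simp add: mvmul_nth proj_nth)
  next
    case False
    have "(\<Sum>j\<in>UNIV. pad J A $ i $ j * v $ j) = (\<Sum>j\<in>UNIV. if j = i then v $ j else 0)"
      by (rule sum.cong) (auto simp: pad_def False nda_mult.zero_left nda_one_left)
    then show ?thesis using False by (simp add: mvmul_nth proj_nth)
  qed
  then show ?thesis by (simp add: vec_eq_iff)
qed

lemma pad_UNIV [simp]: "pad UNIV A = A" and pad_empty [simp]: "pad {} A = mident"
  by (simp_all add: pad_def mident_def vec_eq_iff)

lemma quad_pad: "v \<bullet> mvmul (pad J A) v = proj J v \<bullet> mvmul A (proj J v) + proj (- J) v \<bullet> proj (- J) v"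
  by (simp add: mvmul_pad inner_add_right inner_proj)

lemma hermitian_pad: "hermitian A \<Longrightarrow> hermitian (pad J A)"
  by (auto simp: hermitian_nth pad_def)

lemma pad_pos_def:
  assumes "A \<in> pos_def" shows "pad J A \<in> pos_def"
proof -
  have "v \<bullet> mvmul (pad J A) v > 0" if "v \<noteq> 0" for v
  proof (cases "proj J v = 0")
    case True
    then have "proj (- J) v \<noteq> 0" using that proj_compl[of J v] by auto
    then show ?thesis using True by (simp add: quad_pad)
  next
    case False
    then have "proj J v \<bullet> mvmul A (proj J v) > 0" using assms by (simp add: pos_def_iff)
    then show ?thesis by (simp add: quad_pad add_pos_nonneg)
  qed
  then show ?thesis using assms by (simp add: pos_def_iff hermitian_pad)
qed

lemma mident_pos_def: "mident \<in> pos_def"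
  by (simp add: pos_def_iff hermitian_def)

section \<open>Measurability of matrix operations and of the positive definite cone\<close>

lemma borel_measurable_nda_mult [measurable (raw)]:
  fixes f g :: "'x \<Rightarrow> 'a::normed_division_algebra"
  assumes "f \<in> borel_measurable M" "g \<in> borel_measurable M"
  shows "(\<lambda>x. f x * g x) \<in> borel_measurable M"
  using assms by (rule borel_measurable_continuous_Pair) (intro nda_mult.continuous_on continuous_intros)

lemma borel_measurable_nda_cnj [measurable (raw)]:
  assumes "f \<in> borel_measurable M"
  shows "(\<lambda>x. nda_cnj (f x)) \<in> borel_measurable M"
  by (rule measurable_compose[OF assms linear_borel_measurable[OF linear_nda_cnj]])

lemma borel_measurable_mvmul [measurable (raw)]:
  assumes [measurable]: "f \<in> borel_measurable M" "g \<in> borel_measurable M"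
  shows "(\<lambda>x. mvmul (f x) (g x)) \<in> borel_measurable M"
  unfolding mvmul_def by measurable

lemma borel_measurable_mmul [measurable (raw)]:
  assumes [measurable]: "f \<in> borel_measurable M" "g \<in> borel_measurable M"
  shows "(\<lambda>x. f x \<odot> g x) \<in> borel_measurable M"
  unfolding mmul_def by measurable

lemma borel_measurable_ctrans [measurable (raw)]:
  assumes [measurable]: "f \<in> borel_measurable M"
  shows "(\<lambda>x. ctrans (f x)) \<in> borel_measurable M"
  unfolding ctrans_def by measurable

lemma borel_measurable_pad [measurable (raw)]:
  assumes [measurable]: "f \<in> borel_measurable M"
  shows "(\<lambda>x. pad J (f x)) \<in> borel_measurable M"
  unfolding pad_def by (intro borel_measurable_vec_lambda) auto

text \<open>Compactness of the unit sphere gives a uniform lower bound. Bounds of the form 1 / (n +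
  1) make the union over all bounds countable, with closed sets inside, and so
  \<open>pos_def\<close> becomes a Borel set.\<close>

lemma pos_def_coercive:
  fixes A :: "('a::normed_division_algebra, 'm::finite, 'm) mtx"
  assumes "A \<in> pos_def"
  shows "\<exists>n::nat. \<forall>v. (v \<bullet> v) / (real n + 1) \<le> v \<bullet> mvmul A v"
proof -
  let ?S = "sphere (0 :: ('a, 'm) vec) 1"
  have ne: "?S \<noteq> {}" by simp
  have "continuous_on ?S (\<lambda>v. v \<bullet> mvmul A v)"
    by (intro continuous_intros linear_continuous_on_compose[OF _ linear_mvmul])
  then obtain u where u: "norm u = 1" and mn: "\<And>v. norm v = 1 \<Longrightarrow> u \<bullet> mvmul A u \<le> v \<bullet> mvmul A v"
    using continuous_attains_inf[OF compact_sphere ne] by fastforce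
  have "u \<bullet> mvmul A u > 0" using assms u by (metis norm_zero pos_def_iff zero_neq_one)
  then obtain n where n: "inverse (real n + 1) < u \<bullet> mvmul A u"
    using reals_Archimedean by (metis of_nat_Suc add.commute)
  have "(v \<bullet> v) / (real n + 1) \<le> v \<bullet> mvmul A v" for v
  proof (cases "v = 0")
    case False
    have "u \<bullet> mvmul A u \<le> (v /\<^sub>R norm v) \<bullet> mvmul A (v /\<^sub>R norm v)" using False by (intro mn) simp
    also have "\<dots> = (v \<bullet> mvmul A v) / (v \<bullet> v)"
      by (simp add: linear_scale[OF linear_mvmul] power2_norm_eq_inner[symmetric] power2_eq_square divide_inverse)
    finally have "inverse (real n + 1) \<le> (v \<bullet> mvmul A v) / (v \<bullet> v)" using n by linarith
    then show ?thesis using False by (simp add: field_simps)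
  qed simp
  then show ?thesis by blast
qed

lemma closed_hermitian: "closed {A :: ('a::normed_division_algebra, 'm::finite, 'm) mtx. hermitian A}"
proof -
  have "closed {A :: ('a, 'm, 'm) mtx. nda_cnj (A $ j $ i) = A $ i $ j}" for i j
    by (intro closed_Collect_eq continuous_intros linear_continuous_on_compose[OF _ linear_nda_cnj])
  then show ?thesis unfolding hermitian_nth by (intro closed_Collect_all)
qed

lemma continuous_on_mvmul_left: "continuous_on UNIV (\<lambda>A. mvmul A v)"
  by (rule linear_continuous_on[OF linear_conv_bounded_linear[THEN iffD1]])
     (rule linearI, simp_all add: mvmul_add_left mvmul_scaleR_left)

lemma pos_def_sets [measurable]:
  "(pos_def :: ('a::normed_division_algebra, 'm::finite, 'm) mtx set) \<in> sets borel"
proof -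
  have eq: "pos_def = {A :: ('a, 'm, 'm) mtx. hermitian A} \<inter>
      (\<Union>n::nat. \<Inter>v. {A. (v \<bullet> v) / (real n + 1) \<le> v \<bullet> mvmul A v})" (is "_ = ?R")
  proof
    show "pos_def \<subseteq> ?R" using pos_def_coercive by (fastforce simp: pos_def_iff)
    show "?R \<subseteq> pos_def"
    proof
      fix A assume "A \<in> ?R"
      then obtain n where h: "hermitian A" and n: "\<And>v. (v \<bullet> v) / (real n + 1) \<le> v \<bullet> mvmul A v" by auto
      have "v \<bullet> mvmul A v > 0" if "v \<noteq> 0" for v
      proof -
        have "(v \<bullet> v) / (real n + 1) > 0" using that by simp
        then show ?thesis using n[of v] by linarith
      qed
      then show "A \<in> pos_def" using h by (simp add: pos_def_iff)
    qed
  qed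
  have "closed {A :: ('a, 'm, 'm) mtx. (v \<bullet> v) / (real n + 1) \<le> v \<bullet> mvmul A v}" for v n
    by (intro closed_Collect_le continuous_intros continuous_on_mvmul_left)
  then have "closed (\<Inter>v. {A :: ('a, 'm, 'm) mtx. (v \<bullet> v) / (real n + 1) \<le> v \<bullet> mvmul A v})" for n
    by blast
  then show ?thesis unfolding eq using closed_hermitian
    by (intro sets.Int sets.countable_UN) (auto intro: borel_closed)
qed

definition gint :: "('a::normed_division_algebra, 'm::finite, 'm) mtx \<Rightarrow> ennreal" where
  "gint A = (\<integral>\<^sup>+v. ennreal (exp (- (v \<bullet> mvmul A v))) \<partial>lborel)"

text \<open>The Gaussian integral of a positive definite matrix is \<open>(\<pi>\<^sup>m\<^sup>\<beta> / det\<^sup>\<beta>)\<^sup>1\<^sup>/\<^sup>2\<close>. Taking it as the definition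
  of the determinant gives measurability and the transformation rules without using associativity.\<close>

definition gdet :: "('a::normed_division_algebra, 'm::finite, 'm) mtx \<Rightarrow> real" where
  "gdet A = ((pi powr (DIM(('a, 'm) vec) / 2) / enn2real (gint A))\<^sup>2) powr (1 / DIM('a))"

lemma gint_measurable [measurable]: "gint \<in> borel_measurable borel"
  unfolding gint_def by measurable

lemma gdet_measurable [measurable]: "gdet \<in> borel_measurable borel"
  unfolding gdet_def by measurable

lemma pos_def_vol:
  assumes "A \<in> pos_def"
  shows "vol (mvmul A) > 0" "gint A = ennreal (pi powr (DIM(('a, 'm) vec) / 2) / sqrt (vol (mvmul A)))"
    "gdet (A :: ('a::normed_division_algebra, 'm::finite, 'm) mtx) = vol (mvmul A) powr (1 / DIM('a))"
    "gdet A > 0" "vol (mvmul A) = gdet A powr DIM('a)"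
proof -
  show v: "vol (mvmul A) > 0" by (rule vol_pos[OF linear_mvmul pos_def_inj[OF assms]])
  show g: "gint A = ennreal (pi powr (DIM(('a, 'm) vec) / 2) / sqrt (vol (mvmul A)))"
    unfolding gint_def using assms pos_def_symmetric[OF assms]
    by (intro gaussian_nn_integral_symmetric linear_mvmul) (auto simp: pos_def_iff)
  show d: "gdet A = vol (mvmul A) powr (1 / DIM('a))"
    unfolding gdet_def g using v by simp
  show "gdet A > 0" using v by (simp add: d)
  show "vol (mvmul A) = gdet A powr DIM('a)" using v by (simp add: d powr_powr)
qed

lemma gint_transform:
  fixes A B :: "('a::normed_division_algebra, 'm::finite, 'm) mtx"
  assumes "linear L" "inj L" and "\<And>v. v \<bullet> mvmul B v = L v \<bullet> mvmul A (L v)"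
  shows "gint B * ennreal (vol L) = gint A"
  unfolding gint_def assms(3)
  by (rule nn_integral_linear[OF assms(1,2), where f = "\<lambda>v. ennreal (exp (- (v \<bullet> mvmul A v)))"]) measurable

text \<open>The congruence rule for any injective real-linear \<open>L\<close>, with the matrix
  product replaced by an identity of quadratic forms, so that it makes sense without associativity.
  The exponent contains 2 because \<open>L\<close> enters the form twice, and 1 / DIM('a) because
  \<open>gdet\<close> is that root of the real volume factor.\<close>

lemma gdet_transform:
  fixes A B :: "('a::normed_division_algebra, 'm::finite, 'm) mtx"
  assumes "linear L" "inj L" and "\<And>v. v \<bullet> mvmul B v = L v \<bullet> mvmul A (L v)" and "A \<in> pos_def" "hermitian B"
  shows "B \<in> pos_def" "gdet B = gdet A * vol L powr (2 / DIM('a))"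
proof -
  have "L v \<noteq> 0" if "v \<noteq> 0" for v using assms(1,2) that by (metis linear_injective_0)
  then show B: "B \<in> pos_def" using assms(3-5) by (auto simp: pos_def_iff)
  note vL = vol_pos[OF assms(1,2)]
  note vA = pos_def_vol(1,2)[OF assms(4)] and vB = pos_def_vol(1,2)[OF B]
  let ?P = "pi powr (DIM(('a, 'm) vec) / 2)"
  have "ennreal (?P / sqrt (vol (mvmul B))) * ennreal (vol L) = ennreal (?P / sqrt (vol (mvmul A)))"
    using gint_transform[OF assms(1-3)] vA(2) vB(2) by simp
  then have "?P / sqrt (vol (mvmul B)) * vol L = ?P / sqrt (vol (mvmul A))"
    using vL vA(1) vB(1) by (simp flip: ennreal_mult)
  then have "sqrt (vol (mvmul B)) = sqrt (vol (mvmul A)) * vol L"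
    using vA(1) vB(1) by (simp add: field_simps)
  then have "(sqrt (vol (mvmul B)))\<^sup>2 = (sqrt (vol (mvmul A)) * vol L)\<^sup>2" by simp
  then have "vol (mvmul B) = vol (mvmul A) * (vol L)\<^sup>2"
    using vA(1) vB(1) by (simp add: power_mult_distrib)
  moreover have "((vol L)\<^sup>2) powr (1 / DIM('a)) = vol L powr (2 / DIM('a))"
    using powr_powr[of "vol L" 2 "1 / DIM('a)"] vL by simp
  ultimately show "gdet B = gdet A * vol L powr (2 / DIM('a))"
    using vA(1) vL by (simp add: pos_def_vol(3)[OF assms(4)] pos_def_vol(3)[OF B] powr_mult)
qed

lemma gdet_mident [simp]: "gdet (mident :: ('a::normed_division_algebra, 'm::finite, 'm) mtx) = 1"
proof -
  have "vol (mvmul (mident :: ('a, 'm, 'm) mtx)) = 1" by (rule vol_isometry) simp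
  then show ?thesis using pos_def_vol(3)[OF mident_pos_def, where 'a='a and 'm='m] by simp
qed

section \<open>Dilations, shears and block triangular maps\<close>

definition dilate :: "'m set \<Rightarrow> real \<Rightarrow> ('a::normed_division_algebra, 'm::finite) vec \<Rightarrow> ('a, 'm) vec" where
  "dilate J s v = s *\<^sub>R proj J v + proj (- J) v"

lemma dilate_nth: "dilate J s v $ i = (if i \<in> J then s *\<^sub>R v $ i else v $ i)"
  by (simp add: dilate_def proj_nth)

lemma dilate_props:
  assumes "s > 0"
  shows "linear (dilate J s :: ('a, 'm) vec \<Rightarrow> _)" "inj (dilate J s :: ('a, 'm) vec \<Rightarrow> _)"
    "vol (dilate J s :: ('a::normed_division_algebra, 'm::finite) vec \<Rightarrow> _) = s ^ (card J * DIM('a))"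
proof -
  define l :: "('a, 'm) vec \<Rightarrow> real" where "l b = (if \<exists>i\<in>J. b $ i \<noteq> 0 then s else 1)" for b
  have l: "l (axis i b) = (if i \<in> J then s else 1)" if "b \<in> Basis" for i b
    using nonzero_Basis[OF that] by (auto simp: l_def axis_def)
  have eq: "dilate J s = (\<lambda>x. \<Sum>b\<in>Basis. (l b * (x \<bullet> b)) *\<^sub>R b)"
  proof (rule ext, rule euclidean_eqI)
    fix x b :: "('a, 'm) vec" assume b: "b \<in> Basis"
    then obtain i u where u: "b = axis i u" "u \<in> Basis" by (auto simp: Basis_vec_def)
    have "(\<Sum>b\<in>Basis. (l b * (x \<bullet> b)) *\<^sub>R b) \<bullet> b = l b * (x \<bullet> b)"
      using b by (simp add: inner_sum_left inner_Basis if_distrib sum.delta' cong: if_cong)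
    then show "dilate J s x \<bullet> b = (\<Sum>b\<in>Basis. (l b * (x \<bullet> b)) *\<^sub>R b) \<bullet> b"
      by (simp add: u l inner_axis dilate_nth)
  qed
  have lp: "l b > 0" for b using assms by (simp add: l_def)
  note v = vol_diagonal[of l, OF lp]
  show "linear (dilate J s :: ('a, 'm) vec \<Rightarrow> _)" "inj (dilate J s :: ('a, 'm) vec \<Rightarrow> _)"
    using v(1,2) by (simp_all add: eq)
  have "vol (dilate J s :: ('a, 'm) vec \<Rightarrow> _) = (\<Prod>b\<in>Basis. l b)" using v(3) by (simp add: eq)
  also have "\<dots> = (\<Prod>i\<in>UNIV. if i \<in> J then s ^ DIM('a) else 1)"
    unfolding prod_Basis_vec by (intro prod.cong refl) (simp add: l)
  also have "\<dots> = s ^ (card J * DIM('a))"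
    by (simp add: prod.If_cases power_mult[symmetric] mult.commute)
  finally show "vol (dilate J s :: ('a, 'm) vec \<Rightarrow> _) = s ^ (card J * DIM('a))" .
qed

text \<open>Scaling the block by \<open>s\<close> is the congruence that dilates the coordinates in
  \<open>J\<close> by \<open>sqrt s\<close> and leaves the padding alone.\<close>

lemma gdet_pad_scaleR:
  fixes A :: "('a::normed_division_algebra, 'm::finite, 'm) mtx"
  assumes "s > 0" "A \<in> pos_def"
  shows "gdet (pad J (s *\<^sub>R A)) = s ^ card J * gdet (pad J A)"
proof -
  have s: "sqrt s > 0" using assms by simp
  note d = dilate_props[OF s, of J, where 'a='a]
  have "hermitian (s *\<^sub>R A)" using assms(2) by (auto simp: pos_def_iff hermitian_nth nda_cnj_scaleR)
  then have h: "hermitian (pad J (s *\<^sub>R A))" by (rule hermitian_pad)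
  have q: "v \<bullet> mvmul (pad J (s *\<^sub>R A)) v = dilate J (sqrt s) v \<bullet> mvmul (pad J A) (dilate J (sqrt s) v)" for v
  proof -
    have "proj J (dilate J (sqrt s) v) = sqrt s *\<^sub>R proj J v" "proj (- J) (dilate J (sqrt s) v) = proj (- J) v"
      by (auto simp: vec_eq_iff proj_nth dilate_nth)
    then show ?thesis using assms(1)
      by (simp add: quad_pad mvmul_scaleR_left linear_scale[OF linear_mvmul] flip: mult.assoc)
  qed
  have "gdet (pad J (s *\<^sub>R A)) = gdet (pad J A) * (sqrt s ^ (card J * DIM('a))) powr (2 / DIM('a))"
    using gdet_transform(2)[OF d(1,2) q pad_pos_def[OF assms(2)] h] d(3) by metis
  also have "(sqrt s ^ (card J * DIM('a))) powr (2 / DIM('a)) = s ^ card J"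
    using assms(1) by (simp add: powr_realpow[symmetric] powr_half_sqrt[symmetric] powr_powr)
  finally show ?thesis by simp
qed

text \<open>Write D for the dilation by 2 outside \<open>J\<close>. Since N maps into those
  coordinates and depends only on the others, D (1 + N) = (1 + 2 N) D and (1 + N) (1 + N) = 1 + 2 N.
  So the volume factor of 1 + N equals its own square.\<close>

lemma vol_shear:
  fixes N :: "('a::normed_division_algebra, 'm::finite) vec \<Rightarrow> ('a, 'm) vec"
  assumes N: "linear N" "\<And>v. N v = proj (- J) (N (proj J v))"
  shows "linear (\<lambda>v. v + N v)" "inj (\<lambda>v. v + N v)" "vol (\<lambda>v. v + N v) = 1"
proof -
  have lin: "linear (\<lambda>v. v + c *\<^sub>R N v)" for c
    using linear_compose_add[OF linear_ident linear_compose_scale_right[OF N(1)]] by simp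
  have NN: "N (N v) = 0" for v
    by (subst (2) N(2), subst N(2)) (simp add: linear_0[OF N(1)] linear_0[OF linear_proj])
  have inj: "inj (\<lambda>v. v + c *\<^sub>R N v)" for c
    unfolding linear_injective_0[OF lin]
  proof (intro allI impI)
    fix v assume v: "v + c *\<^sub>R N v = 0"
    then have "N (v + c *\<^sub>R N v) = 0" by (simp add: linear_0[OF N(1)])
    then have "N v = 0" by (simp add: linear_add[OF N(1)] linear_scale[OF N(1)] NN)
    then show "v = 0" using v by simp
  qed
  note d = dilate_props[of 2 "- J", where 'a='a, simplified]
  have ND: "N (dilate (- J) 2 v) = N v" for v
  proof -
    have "proj J (dilate (- J) 2 v) = proj J v" by (auto simp: vec_eq_iff proj_nth dilate_nth)
    then show ?thesis by (metis N(2))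
  qed
  have DN: "dilate (- J) 2 (N v) = 2 *\<^sub>R N v" for v
    by (subst (1 2) N(2)) (auto simp: vec_eq_iff proj_nth dilate_nth)
  have "vol (\<lambda>v. dilate (- J) 2 (v + 1 *\<^sub>R N v)) = vol (\<lambda>v. dilate (- J) 2 v + 2 *\<^sub>R N (dilate (- J) 2 v))"
    by (simp add: linear_add[OF d(1)] DN ND)
  then have "vol (dilate (- J) 2 :: ('a, 'm) vec \<Rightarrow> _) * vol (\<lambda>v. v + 1 *\<^sub>R N v)
      = vol (\<lambda>v. v + 2 *\<^sub>R N v) * vol (dilate (- J) 2 :: ('a, 'm) vec \<Rightarrow> _)"
    by (simp only: vol_compose[OF d(1,2) lin inj] vol_compose[OF lin inj d(1,2)])
  then have 1: "vol (\<lambda>v. v + 1 *\<^sub>R N v) = vol (\<lambda>v. v + 2 *\<^sub>R N v)"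
    using vol_pos[OF d(1,2)] by (simp add: mult.commute)
  have "vol (\<lambda>v. v + 2 *\<^sub>R N v) = vol (\<lambda>v. (v + 1 *\<^sub>R N v) + 1 *\<^sub>R N (v + 1 *\<^sub>R N v))"
    by (simp add: linear_add[OF N(1)] NN scaleR_2 add.assoc)
  also have "\<dots> = vol (\<lambda>v. v + 1 *\<^sub>R N v) * vol (\<lambda>v. v + 1 *\<^sub>R N v)"
    by (rule vol_compose[OF lin inj lin inj])
  finally have "vol (\<lambda>v. v + 1 *\<^sub>R N v) = vol (\<lambda>v. v + 1 *\<^sub>R N v) * vol (\<lambda>v. v + 1 *\<^sub>R N v)" using 1 by simp
  then have "vol (\<lambda>v. v + 1 *\<^sub>R N v) = 1" using vol_pos[OF lin inj, of 1] by simp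
  then show "vol (\<lambda>v. v + N v) = 1" by simp
  show "linear (\<lambda>v. v + N v)" "inj (\<lambda>v. v + N v)" using lin[of 1] inj[of 1] by simp_all
qed

lemma linear_inverse_obtain:
  fixes T :: "'b::euclidean_space \<Rightarrow> 'b"
  assumes "linear T" "inj T"
  obtains S where "linear S" "\<And>v. S (T v) = v" "\<And>v. T (S v) = v"
  using linear_injective_isomorphism[OF assms] by metis

text \<open>The map factors as (1 + N) C, where C is the padded diagonal block and the shear N is
  the off-diagonal part composed with the inverse of C; the shear has volume factor 1.\<close>

lemma vol_block_triangular:
  fixes T :: "('a::normed_division_algebra, 'm::finite) vec \<Rightarrow> ('a, 'm) vec"
  assumes T: "linear T" and C: "inj (\<lambda>v. proj J (T (proj J v)) + proj (- J) v)"
  shows "linear (\<lambda>v. T (proj J v) + proj (- J) v)" "inj (\<lambda>v. T (proj J v) + proj (- J) v)"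
    "vol (\<lambda>v. T (proj J v) + proj (- J) v) = vol (\<lambda>v. proj J (T (proj J v)) + proj (- J) v)"
proof -
  let ?C = "\<lambda>v. proj J (T (proj J v)) + proj (- J) v"
  have TP: "linear (\<lambda>v. T (proj J v))" using linear_compose[OF linear_proj T] by (simp add: o_def)
  have linC: "linear ?C"
    using linear_compose_add[OF linear_compose[OF TP linear_proj] linear_proj] by (simp add: o_def)
  obtain S where S: "linear S" "\<And>v. S (?C v) = v" "\<And>v. ?C (S v) = v"
    using linear_inverse_obtain[OF linC C] by metis
  define N where "N u = proj (- J) (T (proj J (S (proj J u))))" for u
  have linN: "linear N"
    using linear_compose[OF linear_compose[OF linear_proj S(1)] linear_compose[OF TP linear_proj]]
    by (simp add: o_def N_def[abs_def])
  have NP: "N v = proj (- J) (N (proj J v))" for v by (simp add: N_def)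
  note sh = vol_shear[OF linN NP]
  have "proj J (?C v) = ?C (proj J v)" for v
    by (simp add: linear_add[OF linear_proj])
  then have "S (proj J (?C v)) = proj J v" for v using S(2) by metis
  then have "N (?C v) = proj (- J) (T (proj J v))" for v by (simp add: N_def)
  then have eq: "T (proj J v) + proj (- J) v = ?C v + N (?C v)" for v
    using proj_compl[of J "T (proj J v)"] by (metis (no_types, opaque_lifting) add.assoc add.commute)
  show "linear (\<lambda>v. T (proj J v) + proj (- J) v)"
    using linear_compose_add[OF TP linear_proj] by simp
  show "inj (\<lambda>v. T (proj J v) + proj (- J) v)"
    unfolding eq using inj_compose[OF sh(2) C] by (simp add: o_def)
  show "vol (\<lambda>v. T (proj J v) + proj (- J) v) = vol ?C"
    unfolding eq using vol_compose[OF sh(1,2) linC C] sh(3) by simp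
qed

text \<open>Jacobi's identity for complementary minors, from
  \<open>A (A\<^sup>-\<^sup>1 P\<^sub>J + P\<^sub>J\<^sub>c) = P\<^sub>J + A P\<^sub>J\<^sub>c\<close>, where both factors in parentheses are block triangular.\<close>

lemma gdet_complementary:
  fixes A B :: "('a::normed_division_algebra, 'm::finite, 'm) mtx"
  assumes A: "A \<in> pos_def" and B: "B \<in> pos_def" and AB: "\<And>v. mvmul A (mvmul B v) = v"
  shows "gdet A * gdet (pad J B) = gdet (pad (- J) A)"
proof -
  have cB: "(\<lambda>v. proj J (mvmul B (proj J v)) + proj (- J) v) = mvmul (pad J B)"
    by (simp add: mvmul_pad fun_eq_iff)
  have cA: "(\<lambda>v. proj (- J) (mvmul A (proj (- J) v)) + proj (- (- J)) v) = mvmul (pad (- J) A)"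
    by (simp add: mvmul_pad fun_eq_iff)
  note pB = pad_pos_def[OF B, of J] and pA = pad_pos_def[OF A, of "- J"]
  note bB = vol_block_triangular[OF linear_mvmul, of J B, unfolded cB, OF pos_def_inj[OF pB]]
  note bA = vol_block_triangular[OF linear_mvmul, of "- J" A, unfolded cA, OF pos_def_inj[OF pA]]
  have "vol (mvmul A) * vol (mvmul (pad J B)) = vol (\<lambda>v. mvmul A (mvmul B (proj J v) + proj (- J) v))"
    using vol_compose[OF linear_mvmul pos_def_inj[OF A] bB(1,2)] bB(3) by simp
  also have "\<dots> = vol (\<lambda>v. mvmul A (proj (- J) v) + proj (- (- J)) v)"
    by (simp add: linear_add[OF linear_mvmul] AB add.commute)
  also have "\<dots> = vol (mvmul (pad (- J) A))" by (rule bA(3))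
  finally have "vol (mvmul A) * vol (mvmul (pad J B)) = vol (mvmul (pad (- J) A))" .
  then show ?thesis
    using pos_def_vol(1,3)[OF A] pos_def_vol(1,3)[OF pA] pos_def_vol(1,3)[OF pB]
    by (simp add: powr_mult[symmetric])
qed

text \<open>When \<open>V\<close> preserves the coordinates in \<open>J\<close>, one and the same
  factor serves all pairs of forms, so its value can be found from any convenient pair.\<close>

lemma gdet_pad_block_transform:
  fixes V :: "('a::normed_division_algebra, 'm::finite) vec \<Rightarrow> ('a, 'm) vec"
  assumes V: "linear V" "inj V" "\<And>v. proj J (V (proj J v)) = V (proj J v)"
  obtains c where "c > 0" "\<And>A B :: ('a, 'm, 'm) mtx. A \<in> pos_def \<Longrightarrow> hermitian B \<Longrightarrow>
    (\<And>v. v \<bullet> mvmul B v = V v \<bullet> mvmul A (V v)) \<Longrightarrow> gdet (pad J B) = gdet (pad J A) * c"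
proof -
  let ?L = "\<lambda>v. V (proj J v) + proj (- J) v"
  have VP: "linear (\<lambda>v. V (proj J v))" using linear_compose[OF linear_proj V(1)] by (simp add: o_def)
  have lin: "linear ?L" using linear_compose_add[OF VP linear_proj] by simp
  have pJ: "proj J (?L v) = V (proj J v)" for v
    by (simp add: linear_add[OF linear_proj] V(3))
  have pJc: "proj (- J) (?L v) = proj (- J) v" for v
    by (simp add: linear_add[OF linear_proj]) (metis V(3) Compl_disjoint2 proj_empty proj_proj)
  have inj: "inj ?L"
    unfolding linear_injective_0[OF lin]
  proof (intro allI impI)
    fix v assume "?L v = 0"
    then have "V (proj J v) = 0" "proj (- J) v = 0" using pJ[of v] pJc[of v] by (auto simp: linear_0[OF linear_proj])
    then show "v = 0" using V(1,2) proj_compl[of J v] by (metis add_0 linear_injective_0)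
  qed
  have "gdet (pad J B) = gdet (pad J A) * vol ?L powr (2 / DIM('a))"
    if A: "A \<in> pos_def" and B: "hermitian B" and q: "\<And>v. v \<bullet> mvmul B v = V v \<bullet> mvmul A (V v)"
    for A B :: "('a, 'm, 'm) mtx"
    by (rule gdet_transform(2)[OF lin inj _ pad_pos_def[OF A] hermitian_pad[OF B]])
       (simp only: quad_pad pJ pJc q)
  note eq = this
  show ?thesis
  proof (rule that)
    show "vol ?L powr (2 / DIM('a)) > 0" using vol_pos[OF lin inj] by simp
  qed (fact eq)
qed

section \<open>Bordered matrices and Schur complements\<close>

definition rmul :: "('a::normed_division_algebra, 'm::finite) vec \<Rightarrow> 'a \<Rightarrow> ('a, 'm) vec" where
  "rmul v x = (\<chi> i. v $ i * x)"

definition border :: "'m set \<Rightarrow> 'm \<Rightarrow> ('a::normed_division_algebra, 'm::finite, 'm) mtx \<Rightarrow> ('a, 'm) vec \<Rightarrow> real \<Rightarrow>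
    ('a, 'm, 'm) mtx" where
  "border J j W w \<omega> = (\<chi> a b. if a = j \<and> b = j then \<omega> *\<^sub>R 1
     else if a = j \<and> b \<in> J then nda_cnj (w $ b)
     else if b = j \<and> a \<in> J then w $ a else W $ a $ b)"

text \<open>In a block with at most one index the entry is diagonal, hence a real multiple of
  1.\<close>

lemma hermitian_entry_assoc:
  assumes "hermitian W" "i \<in> J" "j \<in> J"
    and "(\<forall>x y z :: 'a. (x * y) * z = x * (y * z)) \<or> card J \<le> 1"
  shows "W $ i $ j * (a * x) = (W $ i $ j * a) * (x :: 'a::normed_division_algebra)"
  using assms(4)
proof
  assume "card (J :: 'b::finite set) \<le> 1"
  then have "i = j" using assms(2,3) by (simp add: card_le_Suc0_iff_eq)
  then obtain r where "W $ i $ j = r *\<^sub>R 1" using hermitian_diag[OF assms(1)] by blast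
  then show ?thesis by (simp add: nda_scaleR_left nda_one_left)
qed simp

lemma ennreal_mult_right_cancel:
  assumes "a * ennreal p = b * ennreal p" "p > 0"
  shows "a = b"
proof -
  have "x = x * ennreal p * ennreal (inverse p)" for x
    unfolding mult.assoc using assms(2) by (simp flip: ennreal_mult)
  then show ?thesis by (metis assms(1))
qed

lemma inner_proj_disjoint: "J \<inter> K = {} \<Longrightarrow> proj J v \<bullet> proj K w = 0"
  by (simp add: inner_proj)

text \<open>\<open>W\<close> is the block about to be bordered, so total size two corresponds to
  \<open>card J \<le> 1\<close>. Its inverse is carried as a linear operator \<open>S\<close>, which
  keeps matrix products out of the Schur complement.\<close>

locale padded_block =
  fixes J :: "'m::finite set" and W :: "('a::normed_division_algebra, 'm, 'm) mtx"
    and S :: "('a, 'm) vec \<Rightarrow> ('a, 'm) vec"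
  assumes good: "(\<forall>x y z :: 'a. (x * y) * z = x * (y * z)) \<or> card J \<le> 1"
    and W_pad: "pad J W = W" and W_pd: "W \<in> pos_def"
    and lin_S: "linear S" and S_W: "\<And>v. S (mvmul W v) = v" and W_S: "\<And>v. mvmul W (S v) = v"
begin

lemma mvmul_W: "mvmul W v = proj J (mvmul W (proj J v)) + proj (- J) v"
  by (subst W_pad[symmetric], subst mvmul_pad) (rule refl)

lemma S_sym: "S v \<bullet> w = v \<bullet> S w"
  by (metis W_S W_pd pos_def_symmetric)

lemma S_compl: "proj (- J) (S v) = proj (- J) v"
proof -
  have "proj (- J) (mvmul W (S v)) = proj (- J) (S v)"
    by (subst mvmul_W) (simp add: linear_add[OF linear_proj])
  then show ?thesis by (simp add: W_S)
qed

lemma S_supp: "proj J w = w \<Longrightarrow> proj J (S w) = S w"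
  using S_compl[of w] proj_compl[of J "S w"] proj_compl[of J w] by (metis add.right_neutral add_left_cancel)

lemma S_off: "S (proj (- J) u) = proj (- J) u"
proof -
  have "mvmul W (proj (- J) u) = proj (- J) u"
    by (subst mvmul_W) (simp add: linear_0[OF linear_mvmul] linear_0[OF linear_proj])
  then show ?thesis by (metis S_W)
qed

lemma quad_S: "u \<bullet> S u = proj J u \<bullet> S (proj J u) + proj (- J) u \<bullet> proj (- J) u"
proof -
  have "S u = S (proj J u) + proj (- J) u"
    by (metis S_off lin_S linear_add proj_compl)
  then have "u \<bullet> S u = u \<bullet> proj J (S (proj J u)) + u \<bullet> proj (- J) (proj (- J) u)"
    using S_supp[of "proj J u"] by (simp add: inner_add_right)
  then show ?thesis
    by (simp only: inner_proj[symmetric])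
qed

text \<open>Right linearity over the algebra on vectors supported in \<open>J\<close>; completing
  the square below moves a bracket only through this fact.\<close>

lemma mvmul_rmul:
  assumes "proj J u = u"
  shows "mvmul W (rmul u x) = rmul (mvmul W u) x"
proof -
  have u0: "u $ b = 0" if "b \<notin> J" for b using assms that by (metis proj_nth)
  have "mvmul W (rmul u x) $ i = rmul (mvmul W u) x $ i" for i
  proof (cases "i \<in> J")
    case True
    have "W $ i $ b * (u $ b * x) = (W $ i $ b * u $ b) * x" for b
    proof (cases "b \<in> J")
      case b: True
      have "hermitian W" using W_pd by (simp add: pos_def_iff)
      then show ?thesis by (rule hermitian_entry_assoc[OF _ True b good])
    qed (simp add: u0 nda_mult.zero_left nda_mult.zero_right)
    then show ?thesis by (simp add: mvmul_nth rmul_def nda_mult.sum_left)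
  next
    case False
    have "mvmul W v $ i = v $ i" for v
      using False by (subst mvmul_W) (simp add: proj_nth)
    then show ?thesis by (simp add: rmul_def)
  qed
  then show ?thesis by (simp add: vec_eq_iff)
qed

context
  fixes j :: 'm and w :: "('a, 'm) vec" and \<omega> :: real
  assumes jJ: "j \<notin> J" and w: "proj J w = w"
begin

lemma w_off: "b \<notin> J \<Longrightarrow> w $ b = 0" using w by (metis proj_nth)

lemma W_off: "a \<notin> J \<or> b \<notin> J \<Longrightarrow> W $ a $ b = (if a = b then 1 else 0)"
  using arg_cong[OF W_pad, of "\<lambda>A. A $ a $ b"] by (auto simp: pad_def)

lemma hermitian_border: "hermitian (border J j W w \<omega>)"
  using W_pd by (auto simp: pos_def_iff hermitian_nth border_def nda_cnj_scaleR W_off)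

lemma quad_border:
  "v \<bullet> mvmul (border J j W w \<omega>) v = proj J v \<bullet> mvmul W (proj J v) + 2 * (proj J v \<bullet> rmul w (v $ j)) +
    \<omega> * (norm (v $ j))\<^sup>2 + (proj (- J) v \<bullet> proj (- J) v - (norm (v $ j))\<^sup>2)"
proof -
  let ?E = "border J j W w \<omega>" and ?u = "proj J v" and ?x = "axis j (v $ j)" and ?r = "proj (- insert j J) v"
  have v: "v = ?u + ?x + ?r" using jJ by (auto simp: vec_eq_iff proj_nth axis_def)
  have Eu: "mvmul ?E ?u $ i = (if i = j then (\<Sum>b\<in>UNIV. nda_cnj (w $ b) * ?u $ b) else mvmul W ?u $ i)" for i
    unfolding mvmul_nth
    by (auto intro!: sum.cong simp: border_def proj_nth nda_mult.zero_right jJ)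
  have Ex: "mvmul ?E ?x = rmul w (v $ j) + \<omega> *\<^sub>R ?x"
    unfolding vec_eq_iff mvmul_axis
    using jJ by (auto simp: border_def rmul_def axis_def w_off nda_mult.zero_left W_off)
  have Er: "mvmul ?E ?r = ?r"
  proof -
    have "(\<Sum>b\<in>UNIV. ?E $ i $ b * ?r $ b) = (\<Sum>b\<in>UNIV. if b = i then ?r $ b else 0)" for i
      by (rule sum.cong) (auto simp: border_def proj_nth nda_mult.zero_right nda_mult.zero_left W_off nda_one_left)
    then show ?thesis by (simp add: vec_eq_iff mvmul_nth)
  qed
  have sym: "mvmul ?E a \<bullet> b = a \<bullet> mvmul ?E b" for a b
    using hermitian_border by (metis hermitian_def mvmul_adjoint)
  have uj: "?u $ j = 0" "?r $ j = 0" using jJ by (auto simp: proj_nth)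
  have xp: "?x = proj {j} v" by (auto simp: vec_eq_iff proj_nth axis_def)
  have ur: "?u \<bullet> ?r = 0" "?x \<bullet> ?r = 0" "?u \<bullet> ?x = 0"
    unfolding xp using jJ by (auto intro!: inner_proj_disjoint)
  have uEu: "?u \<bullet> mvmul ?E ?u = ?u \<bullet> mvmul W ?u"
    unfolding inner_vec_def by (intro sum.cong refl) (auto simp: Eu uj)
  have uEx: "?u \<bullet> mvmul ?E ?x = ?u \<bullet> rmul w (v $ j)"
    by (simp add: Ex inner_add_right ur)
  have xEx: "?x \<bullet> mvmul ?E ?x = \<omega> * (norm (v $ j))\<^sup>2"
  proof -
    have "?x \<bullet> rmul w (v $ j) = 0"
      using jJ by (simp add: inner_axis' rmul_def w_off nda_mult.zero_left)
    then show ?thesis unfolding power2_norm_eq_inner by (simp add: Ex inner_add_right inner_axis inner_axis')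
  qed
  have "v \<bullet> mvmul ?E v = (?u + ?x + ?r) \<bullet> mvmul ?E (?u + ?x + ?r)" by (simp flip: v)
  also have "\<dots> = ?u \<bullet> mvmul ?E ?u + 2 * (?u \<bullet> mvmul ?E ?x) + ?x \<bullet> mvmul ?E ?x + ?r \<bullet> ?r"
  proof -
    have "?x \<bullet> mvmul ?E ?u = ?u \<bullet> mvmul ?E ?x" by (metis sym inner_commute)
    moreover have "?r \<bullet> mvmul ?E ?u = 0" "?r \<bullet> mvmul ?E ?x = 0"
      using ur by (simp_all flip: sym add: Er inner_commute)
    ultimately show ?thesis
      using ur by (simp add: linear_add[OF linear_mvmul] inner_add_left inner_add_right Er)
  qed
  also have "?r \<bullet> ?r = proj (- J) v \<bullet> proj (- J) v - (norm (v $ j))\<^sup>2"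
  proof -
    have "proj (- J) v = ?x + ?r" using jJ by (auto simp: vec_eq_iff proj_nth axis_def)
    then show ?thesis using ur(2) unfolding power2_norm_eq_inner
      by (simp add: inner_add_left inner_add_right inner_commute inner_axis')
  qed
  finally show ?thesis by (simp add: uEu uEx xEx)
qed

text \<open>The substitution that completes the square in the bordered form.\<close>

definition shearmap :: "('a, 'm) vec \<Rightarrow> ('a, 'm) vec" where "shearmap v = v + rmul (S w) (v $ j)"

lemma z_supp: "proj J (S w) = S w" by (rule S_supp[OF w])

lemma shearmap_props: "linear shearmap" "inj shearmap" "vol shearmap = 1"
proof -
  let ?N = "\<lambda>v. rmul (S w) (v $ j)"
  have lin: "linear ?N"
    by (rule linearI) (auto simp: rmul_def vec_eq_iff nda_add_right nda_scaleR_right)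
  have "S w $ i = 0" if "i \<notin> J" for i using z_supp that by (metis proj_nth)
  then have "?N v = proj (- (- J)) (?N (proj (- J) v))" for v
    using jJ by (auto simp: vec_eq_iff proj_nth rmul_def nda_mult.zero_left)
  note sh = vol_shear[OF lin this]
  show "linear shearmap" "inj shearmap" "vol shearmap = 1"
    using sh by (simp_all add: shearmap_def[abs_def])
qed

lemma shearmap_nth_j: "shearmap v $ j = v $ j"
proof -
  have "S w $ j = 0" using z_supp jJ by (metis proj_nth)
  then show ?thesis by (simp add: shearmap_def rmul_def nda_mult.zero_left)
qed

text \<open>Completing the square. The summand - 1 removes the unit diagonal entry that the padding
  of \<open>W\<close> already contributes at index \<open>j\<close>.\<close>

lemma quad_shearmap:
  "v \<bullet> mvmul (border J j W w \<omega>) v = shearmap v \<bullet> mvmul W (shearmap v) + (\<omega> - S w \<bullet> w - 1) * (norm (v $ j))\<^sup>2"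
proof -
  let ?u = "proj J v" and ?z = "rmul (S w) (v $ j)"
  have zs: "proj J ?z = ?z" "proj (- J) ?z = 0"
    using z_supp by (auto simp: vec_eq_iff proj_nth rmul_def) (metis nda_mult.zero_left)+
  have Wz: "mvmul W ?z = rmul w (v $ j)" by (simp add: mvmul_rmul z_supp W_S)
  have zw: "?z \<bullet> rmul w (v $ j) = (norm (v $ j))\<^sup>2 * (S w \<bullet> w)"
    by (simp add: inner_vec_def rmul_def nda_inner_mult_right sum_distrib_left)
  have "shearmap v \<bullet> mvmul W (shearmap v) =
      proj J (shearmap v) \<bullet> mvmul W (proj J (shearmap v)) + proj (- J) (shearmap v) \<bullet> proj (- J) (shearmap v)"
    by (metis W_pad quad_pad)
  also have "\<dots> = (?u + ?z) \<bullet> mvmul W (?u + ?z) + proj (- J) v \<bullet> proj (- J) v"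
    by (simp add: shearmap_def linear_add[OF linear_proj] zs)
  also have "(?u + ?z) \<bullet> mvmul W (?u + ?z) = ?u \<bullet> mvmul W ?u + 2 * (?u \<bullet> rmul w (v $ j)) + (norm (v $ j))\<^sup>2 * (S w \<bullet> w)"
  proof -
    have "?z \<bullet> mvmul W ?u = ?u \<bullet> rmul w (v $ j)"
      using pos_def_symmetric[OF W_pd, of ?z ?u] by (simp add: Wz inner_commute)
    then show ?thesis by (simp add: linear_add[OF linear_mvmul] inner_add_left inner_add_right Wz zw)
  qed
  finally show ?thesis by (simp add: quad_border algebra_simps)
qed

lemma border_pos_def_imp: "border J j W w \<omega> \<in> pos_def \<Longrightarrow> S w \<bullet> w < \<omega>"
proof -
  assume pd: "border J j W w \<omega> \<in> pos_def"
  \<comment> \<open>The preimage of \<open>axis j 1\<close> under the shear; there the bordered form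
    takes the Schur complement as its value.\<close>
  let ?v = "axis j 1 - S w"
  have zj: "S w $ j = 0" using z_supp jJ by (metis proj_nth)
  have vj: "?v $ j = 1" using zj by (simp add: axis_def)
  then have "?v \<noteq> 0" using nda_one_neq_zero by (metis zero_index)
  have sv: "shearmap ?v = axis j 1"
    unfolding shearmap_def vj by (simp add: rmul_def nda_one_right)
  have "axis j 1 \<bullet> mvmul W (axis j (1::'a)) = 1"
    using jJ by (simp add: inner_axis' mvmul_axis W_off nda_one_left)
  then have "?v \<bullet> mvmul (border J j W w \<omega>) ?v = \<omega> - S w \<bullet> w"
    unfolding quad_shearmap sv vj by simp
  moreover have "?v \<bullet> mvmul (border J j W w \<omega>) ?v > 0" using pd \<open>?v \<noteq> 0\<close> unfolding pos_def_iff by blast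
  ultimately show ?thesis by linarith
qed

text \<open>Shear first, then dilate coordinate \<open>j\<close> by the root of the Schur
  complement: this pulls the form of \<open>W\<close> back to the bordered form. Only the dilation
  changes volume, and the exponent 2 / DIM('a) turns its factor into the Schur complement
  itself.\<close>

lemma border_schur:
  assumes "S w \<bullet> w < \<omega>"
  shows "border J j W w \<omega> \<in> pos_def" "gdet (border J j W w \<omega>) = gdet W * (\<omega> - S w \<bullet> w)"
proof -
  define s where "s = \<omega> - S w \<bullet> w"
  have s: "s > 0" "sqrt s > 0" using assms by (auto simp: s_def)
  note d = dilate_props[OF s(2), of "{j}", where 'a='a]
  let ?L = "\<lambda>v. dilate {j} (sqrt s) (shearmap v)"
  have lin: "linear ?L" using linear_compose[OF shearmap_props(1) d(1)] by (simp add: o_def)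
  have inj: "inj ?L" using inj_compose[OF d(2) shearmap_props(2)] by (simp add: o_def)
  have q: "dilate {j} (sqrt s) u \<bullet> mvmul W (dilate {j} (sqrt s) u) = u \<bullet> mvmul W u + (s - 1) * (norm (u $ j))\<^sup>2" for u
  proof -
    let ?d = "dilate {j} (sqrt s) u"
    have 1: "proj J ?d = proj J u" using jJ by (auto simp: vec_eq_iff proj_nth dilate_nth)
    have 2: "proj (- J) x \<bullet> proj (- J) x = proj (- insert j J) x \<bullet> proj (- insert j J) x + (norm (x $ j))\<^sup>2" for x :: "('a, 'm) vec"
    proof -
      have "proj (- J) x = axis j (x $ j) + proj (- insert j J) x"
        using jJ by (auto simp: vec_eq_iff proj_nth axis_def)
      then show ?thesis unfolding power2_norm_eq_inner
        by (simp add: inner_add_left inner_add_right inner_axis inner_axis' proj_nth)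
    qed
    have 3: "proj (- insert j J) ?d = proj (- insert j J) u" by (auto simp: vec_eq_iff proj_nth dilate_nth)
    have 4: "(norm (?d $ j))\<^sup>2 = s * (norm (u $ j))\<^sup>2"
      using s by (simp add: dilate_nth power_mult_distrib)
    have e: "x \<bullet> mvmul W x = proj J x \<bullet> mvmul W (proj J x) + proj (- J) x \<bullet> proj (- J) x" for x
      by (metis W_pad quad_pad)
    show ?thesis unfolding e[of ?d] e[of u] 1 2[of ?d] 2[of u] 3 4 by (simp add: algebra_simps)
  qed
  have "v \<bullet> mvmul (border J j W w \<omega>) v = ?L v \<bullet> mvmul W (?L v)" for v
    unfolding quad_shearmap q shearmap_nth_j by (simp add: s_def)
  note t = gdet_transform[OF lin inj this W_pd hermitian_border]
  show "border J j W w \<omega> \<in> pos_def" by (rule t(1))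
  have "vol ?L = sqrt s ^ DIM('a)"
    using vol_compose[OF d(1,2) shearmap_props(1,2)] shearmap_props(3) d(3) by simp
  moreover have "(sqrt s ^ DIM('a)) powr (2 / DIM('a)) = s"
  proof -
    have "sqrt s ^ DIM('a) = (s powr (1 / 2)) powr real DIM('a)" using s by (simp add: powr_half_sqrt powr_realpow)
    then show ?thesis using s(1) by (simp add: powr_powr)
  qed
  ultimately show "gdet (border J j W w \<omega>) = gdet W * (\<omega> - S w \<bullet> w)" using t(2) by (simp add: s_def)
qed

end

lemma vol_S: "vol S = inverse (vol (mvmul W))"
proof -
  have "inj S" by (metis W_S injI)
  then have "vol (mvmul W) * vol S = vol (\<lambda>v. mvmul W (S v))"
    using vol_compose[OF linear_mvmul pos_def_inj[OF W_pd] lin_S] by simp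
  also have "\<dots> = 1" by (rule vol_isometry) (simp add: W_S)
  finally show ?thesis by (simp add: inverse_unique)
qed

lemma S_pos: "v \<noteq> 0 \<Longrightarrow> v \<bullet> S v > 0"
proof -
  assume "v \<noteq> 0"
  then have "S v \<noteq> 0" using W_S[of v] by (metis linear_0[OF linear_mvmul])
  then have "S v \<bullet> mvmul W (S v) > 0" using W_pd by (simp add: pos_def_iff)
  then show "v \<bullet> S v > 0" by (simp add: W_S inner_commute)
qed

lemma gaussian_S: "(\<integral>\<^sup>+v. ennreal (exp (- (v \<bullet> S v))) \<partial>lborel) =
    ennreal (pi powr (DIM(('a, 'm) vec) / 2) * sqrt (vol (mvmul W)))"
  using gaussian_nn_integral_symmetric[OF lin_S S_sym S_pos]
  unfolding vol_S real_sqrt_inverse divide_inverse inverse_inverse_eq .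

text \<open>By \<open>quad_S\<close> the Gaussian of \<open>S\<close> factors into the block part
  and a standard Gaussian outside \<open>J\<close>. The block part becomes the constant
  \<open>\<kappa>\<close> of the regression, because the projection onto the earlier columns has its
  squared norm given by the inverse Gram block.\<close>

lemma gaussian_S_block:
  "(\<integral>\<^sup>+x. ennreal (exp (- ((\<chi> i. if i \<in> J then x i else 0) \<bullet> S (\<chi> i. if i \<in> J then x i else 0)))) \<partial>PiM J (\<lambda>_. lborel)) =
    ennreal (pi powr (card J * DIM('a) / 2) * gdet W powr (DIM('a) / 2))"
proof -
  interpret product_sigma_finite "\<lambda>_::'m. lborel :: 'a measure"
    by (simp add: product_sigma_finite_def sigma_finite_lborel)
  note [measurable] = linear_borel_measurable[OF lin_S]
  let ?e = "\<lambda>x. \<chi> i. if i \<in> J then x i else (0::'a)"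
  let ?I = "\<integral>\<^sup>+x. ennreal (exp (- (?e x \<bullet> S (?e x)))) \<partial>PiM J (\<lambda>_. lborel)"
  have me [measurable]: "?e \<in> borel_measurable (PiM J (\<lambda>_. lborel))"
  proof (rule borel_measurable_vec_lambda, goal_cases)
    case (1 i)
    then show ?case
      using measurable_component_singleton[of i J "\<lambda>_. lborel :: 'a measure"] by (cases "i \<in> J") simp_all
  qed
  have mv [measurable]: "(\<lambda>x. \<chi> i. x i) \<in> PiM UNIV (\<lambda>_. lborel) \<rightarrow>\<^sub>M (borel :: ('a, 'm) vec measure)"
    by (intro borel_measurable_vec_lambda) auto
  have "ennreal (pi powr (DIM(('a, 'm) vec) / 2) * sqrt (vol (mvmul W)))
    = (\<integral>\<^sup>+x. ennreal (exp (- ((\<chi> i. x i) \<bullet> S (\<chi> i. x i)))) \<partial>PiM UNIV (\<lambda>_. lborel))"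
    by (subst gaussian_S[symmetric], subst lborel_vec, subst nn_integral_distr) auto
  also have "\<dots> = (\<integral>\<^sup>+x. ennreal (exp (- ((\<chi> i. x i) \<bullet> S (\<chi> i. x i)))) \<partial>PiM (J \<union> - J) (\<lambda>_. lborel))"
    by simp
  also have "\<dots> = (\<integral>\<^sup>+x. \<integral>\<^sup>+y. ennreal (exp (- ((\<chi> i. merge J (- J) (x, y) i) \<bullet> S (\<chi> i. merge J (- J) (x, y) i))))
      \<partial>PiM (- J) (\<lambda>_. lborel) \<partial>PiM J (\<lambda>_. lborel))"
    by (rule product_nn_integral_fold) auto
  also have "\<dots> = (\<integral>\<^sup>+x. \<integral>\<^sup>+y. ennreal (exp (- (?e x \<bullet> S (?e x)))) * (\<Prod>i\<in>- J. ennreal (exp (- ((y i :: 'a) \<bullet> y i))))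
      \<partial>PiM (- J) (\<lambda>_. lborel) \<partial>PiM J (\<lambda>_. lborel))"
  proof (rule nn_integral_cong, rule nn_integral_cong, goal_cases)
    case (1 x y)
    let ?u = "\<chi> i. merge J (- J) (x, y) i"
    have 1: "proj J ?u = ?e x" by (auto simp: vec_eq_iff proj_nth merge_def)
    have "proj (- J) ?u \<bullet> proj (- J) ?u = (\<Sum>i\<in>UNIV. if i \<in> - J then y i \<bullet> y i else 0)"
      unfolding inner_vec_def by (intro sum.cong refl) (auto simp: proj_nth merge_def)
    also have "\<dots> = (\<Sum>i\<in>- J. y i \<bullet> y i)" by (rule sum.mono_neutral_cong_right) auto
    finally have "?u \<bullet> S ?u = ?e x \<bullet> S (?e x) + (\<Sum>i\<in>- J. y i \<bullet> y i)" using quad_S[of ?u] 1 by simp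
    then show ?case
      by (simp add: prod_ennreal exp_sum[symmetric] sum_negf exp_add[symmetric] flip: ennreal_mult)
  qed
  also have "\<dots> = ?I * (\<integral>\<^sup>+y. (\<Prod>i\<in>- J. ennreal (exp (- ((y i :: 'a) \<bullet> y i)))) \<partial>PiM (- J) (\<lambda>_. lborel))"
    by (simp add: nn_integral_cmult nn_integral_multc)
  also have "(\<integral>\<^sup>+y. (\<Prod>i\<in>- J. ennreal (exp (- ((y i :: 'a) \<bullet> y i)))) \<partial>PiM (- J) (\<lambda>_. lborel)) = ennreal (pi powr (card (- J) * DIM('a) / 2))"
    by (subst product_nn_integral_prod)
       (auto simp: gaussian_nn_integral ennreal_power powr_realpow[symmetric] powr_powr mult_ac)
  finally have *: "?I * ennreal (pi powr (card (- J) * DIM('a) / 2)) = ennreal (pi powr (DIM(('a, 'm) vec) / 2) * sqrt (vol (mvmul W)))"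
    by simp
  have "CARD('m) = card J + card (- J)"
    by (subst card_Un_disjoint[symmetric]) auto
  then have "pi powr (DIM(('a, 'm) vec) / 2) = pi powr (card J * DIM('a) / 2) * pi powr (card (- J) * DIM('a) / 2)"
    by (simp add: powr_add[symmetric] add_divide_distrib[symmetric] algebra_simps)
  moreover have "sqrt (vol (mvmul W)) = gdet W powr (DIM('a) / 2)"
    using pos_def_vol(4,5)[OF W_pd] by (simp add: powr_half_sqrt[symmetric] powr_powr)
  ultimately have "?I * ennreal (pi powr (card (- J) * DIM('a) / 2))
      = ennreal (pi powr (card J * DIM('a) / 2) * gdet W powr (DIM('a) / 2)) * ennreal (pi powr (card (- J) * DIM('a) / 2))"
    unfolding * by (simp add: ennreal_mult[symmetric] mult_ac)
  then show ?thesis by (rule ennreal_mult_right_cancel) simp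
qed

end

text \<open>Used with \<open>c\<close> the conjugation: the coordinates list the entries of row
  \<open>j\<close>, while the regression works with the conjugate column.\<close>

lemma PiM_lborel_reindex:
  fixes I :: "'i set" and J :: "'k set" and c :: "'b::euclidean_space \<Rightarrow> 'b"
  assumes "finite I" "bij_betw h I J" "linear c" "\<And>x. norm (c x) = norm x"
  shows "distr (PiM J (\<lambda>_. lborel)) (PiM I (\<lambda>_. lborel)) (\<lambda>x. \<lambda>p\<in>I. c (x (h p))) = PiM I (\<lambda>_. lborel)"
proof -
  interpret I: product_sigma_finite "\<lambda>_::'i. lborel :: 'b measure"
    by (simp add: product_sigma_finite_def sigma_finite_lborel)
  interpret J: product_sigma_finite "\<lambda>_::'k. lborel :: 'b measure"
    by (simp add: product_sigma_finite_def sigma_finite_lborel)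
  note [measurable] = linear_borel_measurable[OF assms(3)]
  have fJ: "finite J" using assms(1,2) bij_betw_finite by blast
  have hJ: "h p \<in> J" if "p \<in> I" for p using assms(2) that by (auto dest: bij_betwE)
  have m [measurable]: "(\<lambda>x. \<lambda>p\<in>I. c (x (h p))) \<in> PiM J (\<lambda>_. lborel) \<rightarrow>\<^sub>M PiM I (\<lambda>_. lborel)"
    by (intro measurable_restrict measurable_compose[OF measurable_component_singleton[OF hJ]]) auto
  let ?g = "inv_into I h"
  have g: "?g j \<in> I" "h (?g j) = j" if "j \<in> J" for j
    using that assms(2) by (auto simp: bij_betw_def inv_into_into f_inv_into_f)
  have gh: "?g (h p) = p" if "p \<in> I" for p using that assms(2) by (simp add: bij_betw_def)
  show ?thesis
  proof (rule I.PiM_eqI[OF assms(1)])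
    fix A assume A: "\<And>p. p \<in> I \<Longrightarrow> A p \<in> sets (lborel :: 'b measure)"
    have cA: "emeasure lborel (c -` A p) = emeasure lborel (A p)" "c -` A p \<in> sets borel" if "p \<in> I" for p
    proof -
      have [measurable]: "A p \<in> sets borel" using A[OF that] by simp
      show s [measurable]: "c -` A p \<in> sets borel"
        using measurable_sets[of c borel borel "A p"] linear_borel_measurable[OF assms(3)] by simp
      have "(\<integral>\<^sup>+x. indicator (A p) (c x) \<partial>lborel) = (\<integral>\<^sup>+x. indicator (A p) x \<partial>lborel)"
        by (rule nn_integral_isometry[OF assms(3,4)]) measurable
      moreover have "(\<lambda>x. indicator (A p) (c x)) = (indicator (c -` A p) :: 'b \<Rightarrow> ennreal)"
        by (auto simp: indicator_def fun_eq_iff)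
      ultimately show "emeasure lborel (c -` A p) = emeasure lborel (A p)" by simp
    qed
    have "(\<lambda>x. \<lambda>p\<in>I. c (x (h p))) -` Pi\<^sub>E I A \<inter> space (PiM J (\<lambda>_. lborel)) = Pi\<^sub>E J (\<lambda>j. c -` A (?g j))"
    proof (intro equalityI subsetI)
      fix x assume x: "x \<in> (\<lambda>x. \<lambda>p\<in>I. c (x (h p))) -` Pi\<^sub>E I A \<inter> space (PiM J (\<lambda>_. lborel))"
      then have "c (x j) \<in> A (?g j)" if "j \<in> J" for j
        using g[OF that] by (auto simp: PiE_iff)
      then show "x \<in> Pi\<^sub>E J (\<lambda>j. c -` A (?g j))" using x by (auto simp: space_PiM PiE_iff)
    next
      fix x assume x: "x \<in> Pi\<^sub>E J (\<lambda>j. c -` A (?g j))"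
      then have "c (x (h p)) \<in> A p" if "p \<in> I" for p
        using hJ[OF that] gh[OF that] by (auto simp: PiE_iff)
      then show "x \<in> (\<lambda>x. \<lambda>p\<in>I. c (x (h p))) -` Pi\<^sub>E I A \<inter> space (PiM J (\<lambda>_. lborel))"
        using x by (auto simp: space_PiM PiE_iff)
    qed
    moreover have "Pi\<^sub>E I A \<in> sets (PiM I (\<lambda>_. lborel :: 'b measure))"
      using A assms(1) by (intro sets_PiM_I_finite) auto
    ultimately have "emeasure (distr (PiM J (\<lambda>_. lborel)) (PiM I (\<lambda>_. lborel)) (\<lambda>x. \<lambda>p\<in>I. c (x (h p)))) (Pi\<^sub>E I A)
      = emeasure (PiM J (\<lambda>_. lborel)) (Pi\<^sub>E J (\<lambda>j. c -` A (?g j)))"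
      by (subst emeasure_distr[OF m]) simp_all
    also have "\<dots> = (\<Prod>j\<in>J. emeasure lborel (c -` A (?g j)))"
      using cA(2)[OF g(1)] fJ by (intro J.emeasure_PiM) auto
    also have "\<dots> = (\<Prod>j\<in>J. emeasure lborel (A (?g j)))" using cA(1)[OF g(1)] by simp
    also have "\<dots> = (\<Prod>p\<in>I. emeasure lborel (A (?g (h p))))"
      by (rule prod.reindex_bij_betw[OF assms(2), symmetric])
    also have "\<dots> = (\<Prod>p\<in>I. emeasure lborel (A p))" by (simp add: gh)
    finally show "emeasure (distr (PiM J (\<lambda>_. lborel)) (PiM I (\<lambda>_. lborel)) (\<lambda>x. \<lambda>p\<in>I. c (x (h p)))) (Pi\<^sub>E I A)
      = (\<Prod>p\<in>I. emeasure lborel (A p))" .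
  qed simp
qed

section \<open>The law of the Gram matrix\<close>

definition gram :: "('m::finite \<Rightarrow> ('a::normed_division_algebra, 'n::finite) vec) \<Rightarrow> ('a, 'm, 'm) mtx" where
  "gram Y = (\<chi> i j. \<Sum>k\<in>UNIV. nda_cnj (Y i $ k) * Y j $ k)"

text \<open>One step of the integration: the earlier columns are frozen with a positive definite
  Gram block, and column \<open>j\<close> is free. The bound on \<open>card J\<close> provides the
  positive residual dimension.\<close>

locale column_step =
  fixes J :: "'m::finite set" and j :: 'm and Y :: "'m \<Rightarrow> ('a::normed_division_algebra, 'n::finite) vec"
  assumes good: "(\<forall>x y z :: 'a. (x * y) * z = x * (y * z)) \<or> card J \<le> 1"
    and jJ: "j \<notin> J" and pd: "pad J (gram Y) \<in> pos_def" and card: "card J < CARD('n)"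
begin

definition W :: "('a, 'm, 'm) mtx" where "W = pad J (gram Y)"

definition S :: "('a, 'm) vec \<Rightarrow> ('a, 'm) vec" where "S = inv (mvmul W)"

lemma W_pd: "W \<in> pos_def" using pd by (simp add: W_def)

sublocale padded_block J W S
proof (rule padded_block.intro)
  obtain S' where S': "linear S'" "\<And>v. S' (mvmul W v) = v" "\<And>v. mvmul W (S' v) = v"
    using linear_inverse_obtain[OF linear_mvmul pos_def_inj[OF W_pd]] by metis
  have "S v = S' v" for v
    unfolding S_def using S' pos_def_inj[OF W_pd] by (metis inv_f_f)
  then have "S = S'" by auto
  then show "linear S" "\<And>v. S (mvmul W v) = v" "\<And>v. mvmul W (S v) = v" using S' by auto
  show "pad J W = W" by (auto simp: W_def pad_def vec_eq_iff)
qed (fact good W_pd)+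

text \<open>Right linear combinations of the earlier columns; \<open>adj\<close> is the adjoint map
  and lists the inner products with these columns.\<close>

definition comb :: "('a, 'm) vec \<Rightarrow> ('a, 'n) vec" where "comb u = (\<chi> k. \<Sum>i\<in>J. Y i $ k * u $ i)"

definition adj :: "('a, 'n) vec \<Rightarrow> ('a, 'm) vec" where
  "adj y = (\<chi> i. if i \<in> J then \<Sum>k\<in>UNIV. nda_cnj (Y i $ k) * y $ k else 0)"

lemma linear_comb: "linear comb"
  by (rule linearI) (auto simp: comb_def vec_eq_iff nda_add_right sum.distrib nda_scaleR_right scaleR_right.sum)

lemma linear_adj: "linear adj"
  by (rule linearI) (auto simp: adj_def vec_eq_iff nda_add_right sum.distrib nda_scaleR_right scaleR_right.sum)

lemma proj_adj [simp]: "proj J (adj y) = adj y"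
  by (auto simp: adj_def vec_eq_iff proj_nth)

lemma inner_comb: "y \<bullet> comb u = adj y \<bullet> u"
proof -
  have "y \<bullet> comb u = (\<Sum>k\<in>UNIV. \<Sum>i\<in>J. (Y i $ k * u $ i) \<bullet> y $ k)"
    by (simp add: inner_vec_def comb_def inner_sum_right inner_commute)
  also have "\<dots> = (\<Sum>i\<in>J. \<Sum>k\<in>UNIV. u $ i \<bullet> (nda_cnj (Y i $ k) * y $ k))"
    by (subst sum.swap) (simp add: nda_adjoint_left)
  also have "\<dots> = (\<Sum>i\<in>UNIV. adj y $ i \<bullet> u $ i)"
    by (rule sum.mono_neutral_cong_left) (auto simp: adj_def inner_sum_right inner_commute)
  finally show ?thesis by (simp add: inner_vec_def)
qed

text \<open>If \<open>card J \<le> 1\<close>, only products of the form conj(y) (y x) have to be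
  rebracketed, which the cancellation law permits.\<close>

lemma adj_comb: "adj (comb u) = proj J (mvmul W (proj J u))"
proof -
  have "adj (comb u) $ i = proj J (mvmul W (proj J u)) $ i" for i
  proof (cases "i \<in> J")
    case True
    have a: "nda_cnj (Y i $ k) * (Y b $ k * x) = (nda_cnj (Y i $ k) * Y b $ k) * x" if "b \<in> J" for b k x
      using good
    proof
      assume "card J \<le> 1"
      then have "b = i" using True that by (simp add: card_le_Suc0_iff_eq)
      then show ?thesis by (simp add: nda_cnj_mult_cancel nda_cnj_mult_self)
    qed simp
    have "adj (comb u) $ i = (\<Sum>k\<in>UNIV. \<Sum>b\<in>J. (nda_cnj (Y i $ k) * Y b $ k) * u $ b)"
      using True by (simp add: adj_def comb_def nda_mult.sum_right a)
    also have "\<dots> = (\<Sum>b\<in>J. \<Sum>k\<in>UNIV. (nda_cnj (Y i $ k) * Y b $ k) * u $ b)" by (rule sum.swap)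
    also have "\<dots> = (\<Sum>b\<in>UNIV. W $ i $ b * proj J u $ b)"
      by (rule sum.mono_neutral_cong_left)
         (auto simp: True W_def pad_def gram_def proj_nth nda_mult.sum_left nda_mult.zero_right)
    finally show ?thesis using True by (simp add: proj_nth mvmul_nth)
  qed (simp add: adj_def proj_nth)
  then show ?thesis by (simp add: vec_eq_iff)
qed

lemma adj_comb_S: "proj J w = w \<Longrightarrow> adj (comb (S w)) = w"
  by (simp add: adj_comb S_supp W_S)

text \<open>Coordinates of Hermitian matrices are the entries below the diagonal, here those of row
  \<open>j\<close>; the bordering vector is column \<open>j\<close>, hence the conjugate.\<close>

definition below :: "('m \<times> 'm \<Rightarrow> 'a) \<Rightarrow> ('a, 'm) vec" where
  "below l = (\<chi> i. if i \<in> J then nda_cnj (l (j, i)) else 0)"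

lemma proj_below [simp]: "proj J (below l) = below l"
  by (auto simp: below_def vec_eq_iff proj_nth)

definition kk :: "'m \<times> 'm \<Rightarrow> ('a, 'n) vec \<Rightarrow> 'a" where
  "kk p y = (\<Sum>k\<in>UNIV. nda_cnj (y $ k) * Y (snd p) $ k)"

lemma below_kk: "below (\<lambda>p\<in>{j} \<times> J. kk p y) = adj y"
  by (auto simp: below_def kk_def adj_def vec_eq_iff nda_cnj_sum nda_cnj_mult)

text \<open>Solution of the normal equations: the combination of the earlier columns with prescribed
  inner products against them.\<close>

definition RR :: "('m \<times> 'm \<Rightarrow> 'a) \<Rightarrow> ('a, 'n) vec" where "RR l = comb (S (below l))"

lemma norm_RR: "(norm (RR l))\<^sup>2 = S (below l) \<bullet> below l"
  unfolding power2_norm_eq_inner RR_def inner_comb by (simp add: adj_comb_S inner_commute)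

lemma gaussian_RR: "(\<integral>\<^sup>+l. ennreal (exp (- (norm (RR l))\<^sup>2)) \<partial>PiM ({j} \<times> J) (\<lambda>_. lborel)) =
    ennreal (pi powr (card J * DIM('a) / 2) * gdet W powr (DIM('a) / 2))"
proof -
  note [measurable] = linear_borel_measurable[OF lin_S]
  have [measurable]: "below \<in> borel_measurable (PiM ({j} \<times> J) (\<lambda>_. lborel))"
    unfolding below_def
  proof (rule borel_measurable_vec_lambda, goal_cases)
    case (1 i)
    show ?case
      using measurable_component_singleton[of "(j, i)" "{j} \<times> J" "\<lambda>_. lborel :: 'a measure"]
      by (cases "i \<in> J") (simp_all add: borel_measurable_nda_cnj)
  qed
  have m: "(\<lambda>x. \<lambda>p\<in>{j} \<times> J. nda_cnj (x (snd p))) \<in> PiM J (\<lambda>_. lborel :: 'a measure) \<rightarrow>\<^sub>M PiM ({j} \<times> J) (\<lambda>_. lborel)"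
    using borel_measurable_nda_cnj[where M = borel and f = "\<lambda>x::'a. x"]
    by (intro measurable_restrict measurable_compose[OF measurable_component_singleton]) auto
  have bij: "bij_betw snd ({j} \<times> J) J"
    by (rule bij_betwI[where g = "\<lambda>i. (j, i)"]) auto
  have "PiM ({j} \<times> J) (\<lambda>_. lborel :: 'a measure) =
      distr (PiM J (\<lambda>_. lborel)) (PiM ({j} \<times> J) (\<lambda>_. lborel)) (\<lambda>x. \<lambda>p\<in>{j} \<times> J. nda_cnj (x (snd p)))"
    by (rule PiM_lborel_reindex[OF _ bij linear_nda_cnj, symmetric]) auto
  then have "(\<integral>\<^sup>+l. ennreal (exp (- (S (below l) \<bullet> below l))) \<partial>PiM ({j} \<times> J) (\<lambda>_. lborel))
    = (\<integral>\<^sup>+l. ennreal (exp (- (S (below l) \<bullet> below l))) \<partial>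
      distr (PiM J (\<lambda>_. lborel)) (PiM ({j} \<times> J) (\<lambda>_. lborel)) (\<lambda>x. \<lambda>p\<in>{j} \<times> J. nda_cnj (x (snd p))))"
    by simp
  also have "\<dots> = (\<integral>\<^sup>+x. ennreal (exp (- (S (below (\<lambda>p\<in>{j} \<times> J. nda_cnj (x (snd p)))) \<bullet>
      below (\<lambda>p\<in>{j} \<times> J. nda_cnj (x (snd p)))))) \<partial>PiM J (\<lambda>_. lborel))"
    by (rule nn_integral_distr[OF m]) measurable
  also have "\<dots> = (\<integral>\<^sup>+x. ennreal (exp (- ((\<chi> i. if i \<in> J then x i else 0) \<bullet> S (\<chi> i. if i \<in> J then x i else 0)))) \<partial>PiM J (\<lambda>_. lborel))"
  proof -
    have "below (\<lambda>p\<in>{j} \<times> J. nda_cnj (x (snd p))) = (\<chi> i. if i \<in> J then x i else 0)" for x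
      by (auto simp: below_def vec_eq_iff)
    then show ?thesis by (simp add: inner_commute)
  qed
  finally show ?thesis by (simp add: norm_RR gaussian_S_block)
qed

lemma gdetW: "gdet W > 0" by (rule pos_def_vol(4)[OF W_pd])

sublocale CP: column_projection "{j} \<times> J" kk RR "pi powr (card J * DIM('a) / 2) * gdet W powr (DIM('a) / 2)"
proof (rule column_projection.intro)
  show "linear (kk p)" for p
    by (rule linearI) (auto simp: kk_def nda_cnj_add nda_cnj_scaleR nda_add_left nda_scaleR_left sum.distrib scaleR_right.sum)
  show "RR \<in> borel_measurable (PiM ({j} \<times> J) (\<lambda>_. lborel))"
  proof -
    have [measurable]: "below \<in> borel_measurable (PiM ({j} \<times> J) (\<lambda>_. lborel))"
      unfolding below_def
    proof (rule borel_measurable_vec_lambda, goal_cases)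
      case (1 i)
      show ?case
        using measurable_component_singleton[of "(j, i)" "{j} \<times> J" "\<lambda>_. lborel :: 'a measure"]
        by (cases "i \<in> J") (simp_all add: borel_measurable_nda_cnj)
    qed
    note [measurable] = linear_borel_measurable[OF lin_S] linear_borel_measurable[OF linear_comb]
    show ?thesis unfolding RR_def by measurable
  qed
  show "RR (\<lambda>i\<in>{j} \<times> J. w i + w' i) = RR w + RR w'" for w w'
  proof -
    have "below (\<lambda>i\<in>{j} \<times> J. w i + w' i) = below w + below w'"
      by (auto simp: below_def vec_eq_iff nda_cnj_add)
    then show ?thesis by (simp add: RR_def linear_add[OF lin_S] linear_add[OF linear_comb])
  qed
  show "RR (\<lambda>i\<in>{j} \<times> J. s *\<^sub>R w i) = s *\<^sub>R RR w" for s w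
  proof -
    have "below (\<lambda>i\<in>{j} \<times> J. s *\<^sub>R w i) = s *\<^sub>R below w"
      by (auto simp: below_def vec_eq_iff nda_cnj_scaleR)
    then show ?thesis by (simp add: RR_def linear_scale[OF lin_S] linear_scale[OF linear_comb])
  qed
  show "kk i (RR w) = w i" if "i \<in> {j} \<times> J" for i w
  proof -
    obtain b where b: "i = (j, b)" "b \<in> J" using \<open>i \<in> {j} \<times> J\<close> by auto
    have "adj (RR w) = below w" by (simp add: RR_def adj_comb_S)
    then have "adj (RR w) $ b = below w $ b" by simp
    then have "nda_cnj (adj (RR w) $ b) = w i" using b by (simp add: below_def)
    then show ?thesis using b by (simp add: adj_def kk_def nda_cnj_sum nda_cnj_mult)
  qed
  show "(y - RR (\<lambda>i\<in>{j} \<times> J. kk i y)) \<bullet> RR w = 0" for y w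
  proof -
    have "adj (y - RR (\<lambda>i\<in>{j} \<times> J. kk i y)) = 0"
      by (simp add: linear_diff[OF linear_adj] RR_def below_kk adj_comb_S)
    then show ?thesis unfolding RR_def[of w] inner_comb by simp
  qed
  show "card ({j} \<times> J) * DIM('a) < DIM(('a, 'n) vec)"
    using card by (simp add: card_cartesian_product)
  show "pi powr (card J * DIM('a) / 2) * gdet W powr (DIM('a) / 2) > 0"
    using gdetW by simp
qed (simp_all add: gaussian_RR)

lemma exponent: "CP.\<epsilon> = (real CARD('n) - real (card J)) * DIM('a) / 2"
  by (simp add: CP.\<epsilon>_def card_cartesian_product algebra_simps)

lemma pad_gram_insert:
  "pad (insert j J) (gram (Y(j := y))) = border J j W (below (CP.K y)) ((norm y)\<^sup>2)"
proof -
  have "(\<Sum>k\<in>UNIV. nda_cnj (y $ k) * y $ k) = (norm y)\<^sup>2 *\<^sub>R 1"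
    by (simp add: nda_cnj_mult_self scaleR_left.sum[symmetric] power2_norm_eq_inner inner_vec_def)
  moreover have "below (CP.K y) = adj y" unfolding CP.K_def by (rule below_kk)
  ultimately show ?thesis
    using jJ by (auto simp: vec_eq_iff pad_def gram_def border_def adj_def W_def nda_cnj_sum nda_cnj_mult)
qed

definition eJ :: real where "eJ = (real CARD('n) - real (card J)) * DIM('a) / 2"

text \<open>The regression formula, translated twice through the Schur complement: a positive
  residual means that the bordered matrix is positive definite, and the residual is the quotient of
  the two determinants. The power of \<open>gdet W\<close> collects - (eJ - 1) from this quotient
  and - DIM('a) / 2 from \<open>\<kappa>\<close>.\<close>

lemma nn_integral_new_column:
  fixes g :: "('a, 'm, 'm) mtx \<Rightarrow> ennreal"
  assumes [measurable]: "g \<in> borel_measurable borel"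
  shows "(\<integral>\<^sup>+y. g (pad (insert j J) (gram (Y(j := y)))) \<partial>lborel) =
    (\<integral>\<^sup>+l. (\<integral>\<^sup>+\<omega>. g (border J j W (below l) \<omega>) * (indicator pos_def (border J j W (below l) \<omega>) *
      ennreal (pi powr eJ / Gamma eJ * gdet W powr (- DIM('a) / 2 - (eJ - 1)) *
        gdet (border J j W (below l) \<omega>) powr (eJ - 1))) \<partial>lborel) \<partial>PiM ({j} \<times> J) (\<lambda>_. lborel))"
proof -
  have mb [measurable]: "(\<lambda>(l, \<omega>). border J j W (below l) \<omega>) \<in> borel_measurable (PiM ({j} \<times> J) (\<lambda>_. lborel :: 'a measure) \<Otimes>\<^sub>M borel)"
    unfolding border_def split_beta
  proof (rule borel_measurable_vec_lambda, rule borel_measurable_vec_lambda, goal_cases)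
    case (1 a b)
    have c: "(\<lambda>x. fst x (j, i)) \<in> borel_measurable (PiM ({j} \<times> J) (\<lambda>_. lborel :: 'a measure) \<Otimes>\<^sub>M (borel :: real measure))" if "i \<in> J" for i
      using measurable_compose[OF measurable_fst measurable_component_singleton[of "(j, i)" "{j} \<times> J" "\<lambda>_. lborel :: 'a measure"]] that
      by simp
    show ?case
      by (cases "a = j"; cases "b = j"; cases "a \<in> J"; cases "b \<in> J") (simp_all add: below_def c borel_measurable_nda_cnj)
  qed
  have eq: "eJ = CP.\<epsilon>" by (simp add: exponent eJ_def)
  have "(\<integral>\<^sup>+y. g (pad (insert j J) (gram (Y(j := y)))) \<partial>lborel) = (\<integral>\<^sup>+y. g (border J j W (below (CP.K y)) ((norm y)\<^sup>2)) \<partial>lborel)"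
    by (simp add: pad_gram_insert)
  also have "\<dots> = (\<integral>\<^sup>+l. (\<integral>\<^sup>+u. ennreal (pi powr (DIM(('a, 'n) vec) / 2) / (pi powr (card J * DIM('a) / 2) * gdet W powr (DIM('a) / 2) * Gamma CP.\<epsilon>) *
      (indicator {0<..} (u - (norm (RR l))\<^sup>2) * (u - (norm (RR l))\<^sup>2) powr (CP.\<epsilon> - 1))) * g (border J j W (below l) u) \<partial>lborel)
      \<partial>PiM ({j} \<times> J) (\<lambda>_. lborel))"
    using measurable_compose[OF mb assms]
    by (intro CP.nn_integral_column) (simp add: split_beta)
  also have "\<dots> = (\<integral>\<^sup>+l. (\<integral>\<^sup>+\<omega>. g (border J j W (below l) \<omega>) * (indicator pos_def (border J j W (below l) \<omega>) *
      ennreal (pi powr eJ / Gamma eJ * gdet W powr (- DIM('a) / 2 - (eJ - 1)) *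
        gdet (border J j W (below l) \<omega>) powr (eJ - 1))) \<partial>lborel) \<partial>PiM ({j} \<times> J) (\<lambda>_. lborel))"
  proof (rule nn_integral_cong, rule nn_integral_cong, goal_cases)
    case (1 l u)
    let ?q = "S (below l) \<bullet> below l"
    show ?case
    proof (cases "?q < u")
      case False
      then have "border J j W (below l) u \<notin> pos_def"
        using border_pos_def_imp[OF jJ proj_below[of l], of u] by blast
      then show ?thesis using False by (simp add: norm_RR)
    next
      case True
      note b = border_schur[OF jJ proj_below[of l] True]
      have 1: "pi powr (DIM(('a, 'n) vec) / 2) = pi powr (card J * DIM('a) / 2) * pi powr eJ"
        by (simp add: eJ_def powr_add[symmetric] add_divide_distrib[symmetric] algebra_simps)
      have 2: "gdet W powr (- DIM('a) / 2 - (eJ - 1)) * (gdet W * (u - ?q)) powr (eJ - 1)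
        = (u - ?q) powr (eJ - 1) / gdet W powr (DIM('a) / 2)"
      proof -
        have e: "gdet W powr (- DIM('a) / 2 - (eJ - 1)) * gdet W powr (eJ - 1) = inverse (gdet W powr (DIM('a) / 2))"
          by (simp add: powr_add[symmetric] powr_minus[symmetric])
        have pm: "(gdet W * (u - ?q)) powr (eJ - 1) = gdet W powr (eJ - 1) * (u - ?q) powr (eJ - 1)"
          by (rule powr_mult)
        show ?thesis
          by (subst pm, subst mult.assoc[symmetric], subst e, rule divide_inverse_commute[symmetric])
      qed
      have "pi powr (DIM(('a, 'n) vec) / 2) / (pi powr (card J * DIM('a) / 2) * gdet W powr (DIM('a) / 2) * Gamma CP.\<epsilon>) * (u - ?q) powr (CP.\<epsilon> - 1)
        = pi powr eJ / Gamma eJ * gdet W powr (- DIM('a) / 2 - (eJ - 1)) * (gdet W * (u - ?q)) powr (eJ - 1)"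
        unfolding mult.assoc 2 unfolding 1 eq by simp
      then show ?thesis using True b by (simp add: norm_RR mult.commute)
    qed
  qed
  finally show ?thesis .
qed

end

section \<open>Induction over the columns\<close>

definition below_pairs :: "'m::linorder set \<Rightarrow> ('m \<times> 'm) set" where
  "below_pairs J = {(i, k). i \<in> J \<and> k \<in> J \<and> k < i}"

lemma below_pairs_insert:
  assumes "\<forall>a\<in>J. a < j"
  shows "below_pairs (insert j J) = below_pairs J \<union> {j} \<times> J" "below_pairs J \<inter> {j} \<times> J = {}"
  using assms by (auto simp: below_pairs_def)

lemma finite_below_pairs: "finite J \<Longrightarrow> finite (below_pairs J)"
  by (rule finite_subset[of _ "J \<times> J"]) (auto simp: below_pairs_def)

lemma borel_measurable_pad_herm_of:
  fixes l :: "'x \<Rightarrow> 'm::{finite,linorder} \<times> 'm \<Rightarrow> 'a::normed_division_algebra"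
  assumes "\<And>i. i \<in> J \<Longrightarrow> (\<lambda>x. d x i) \<in> borel_measurable M"
    and "\<And>p. p \<in> below_pairs J \<Longrightarrow> (\<lambda>x. l x p) \<in> borel_measurable M"
  shows "(\<lambda>x. pad J (herm_of (d x, l x))) \<in> borel_measurable M"
  unfolding pad_def
proof (rule borel_measurable_vec_lambda, rule borel_measurable_vec_lambda, goal_cases)
  case (1 a b)
  note [measurable] = assms
  have "(\<lambda>x. herm_of (d x, l x) $ a $ b) \<in> borel_measurable M" if ab: "a \<in> J" "b \<in> J"
  proof -
    consider "a = b" | "b < a" | "a < b" by fastforce
    then show ?thesis
    proof cases
      case 1
      then show ?thesis using assms(1)[OF ab(1)] by (simp add: herm_of_def)
    next
      case 2
      then have "a \<noteq> b" by auto
      then show ?thesis using assms(2)[of "(a, b)"] ab 2 by (simp add: herm_of_def below_pairs_def)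
    next
      case 3
      then have "a \<noteq> b" "\<not> b < a" by auto
      then show ?thesis using assms(2)[of "(b, a)"] ab 3
        by (simp add: herm_of_def below_pairs_def borel_measurable_nda_cnj)
    qed
  qed
  then show ?case by (cases "a \<in> J \<and> b \<in> J") auto
qed

lemma borel_measurable_gram:
  assumes "\<And>i. i \<in> J \<Longrightarrow> (\<lambda>x. Y x i) \<in> borel_measurable M"
  shows "(\<lambda>x. pad J (gram (Y x))) \<in> borel_measurable M"
  unfolding pad_def
proof (rule borel_measurable_vec_lambda, rule borel_measurable_vec_lambda, goal_cases)
  case (1 a b)
  have "(\<lambda>x. gram (Y x) $ a $ b) \<in> borel_measurable M" if "a \<in> J" "b \<in> J"
    using assms[OF that(1)] assms[OF that(2)] unfolding gram_def by simp
  then show ?case by (cases "a \<in> J \<and> b \<in> J") auto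
qed

text \<open>One factor \<pi>^e / \<Gamma>(e) per column, with e half the real dimension left over
  after q earlier columns. For p = m the product is \<pi>^(m n \<beta> / 2) divided by the
  multivariate gamma function at n \<beta> / 2.\<close>

definition gram_const :: "real \<Rightarrow> real \<Rightarrow> nat \<Rightarrow> real" where
  "gram_const n \<beta> p = (\<Prod>q<p. pi powr ((n - real q) * \<beta> / 2) / Gamma ((n - real q) * \<beta> / 2))"

text \<open>Density of the image of Lebesgue measure under the Gram map: a Wishart density without
  its exponential factor.\<close>

definition gram_density :: "nat \<Rightarrow> nat \<Rightarrow> ('a::normed_division_algebra, 'm::finite, 'm) mtx \<Rightarrow> ennreal" where
  "gram_density n p H = indicator pos_def H *
    ennreal (gram_const n (DIM('a)) p * gdet H powr ((real n - real p + 1) * DIM('a) / 2 - 1))"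

lemma gram_density_measurable [measurable]: "gram_density n p \<in> borel_measurable borel"
  unfolding gram_density_def by measurable

lemma gram_const_nonneg: "p \<le> n \<Longrightarrow> \<beta> > 0 \<Longrightarrow> gram_const (real n) \<beta> p \<ge> 0"
  unfolding gram_const_def by (intro prod_nonneg) (auto intro!: divide_nonneg_pos Gamma_real_pos)

lemma border_herm_of:
  assumes "\<forall>a\<in>J. a < j"
  shows "border J j (pad J (herm_of (d, l))) (\<chi> i. if i \<in> J then nda_cnj (l' (j, i)) else 0) \<omega> =
    pad (insert j J) (herm_of (d(j := \<omega>), merge (below_pairs J) ({j} \<times> J) (l, l')))"
  using assms
  by (auto simp: border_def pad_def herm_of_def vec_eq_iff merge_def below_pairs_def)

text \<open>Columns are added in increasing order of index, so the coordinates gained are the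
  diagonal entry at \<open>j\<close> and row \<open>j\<close> below the diagonal, exactly those of
  the larger block. The determinant of the old block cancels between the density of that block and
  the conditional density of the new row.\<close>

theorem nn_integral_gram_block:
  fixes g :: "('a::normed_division_algebra, 'm::{finite,linorder}, 'm) mtx \<Rightarrow> ennreal"
  assumes "(\<forall>x y z :: 'a. (x * y) * z = x * (y * z)) \<or> card J \<le> 2"
    and "card J \<le> CARD('n::finite)" and "g \<in> borel_measurable borel"
  shows "(\<integral>\<^sup>+Y. g (pad J (gram Y)) \<partial>PiM J (\<lambda>_. lborel :: ('a, 'n) vec measure)) =
    (\<integral>\<^sup>+d. \<integral>\<^sup>+l. g (pad J (herm_of (d, l))) * gram_density CARD('n) (card J) (pad J (herm_of (d, l)))
      \<partial>PiM (below_pairs J) (\<lambda>_. lborel) \<partial>PiM J (\<lambda>_. lborel))"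
  using finite[of J] assms
proof (induction J arbitrary: g rule: finite_linorder_max_induct)
  case empty
  have 1: "below_pairs {} = ({} :: ('m \<times> 'm) set)" by (simp add: below_pairs_def)
  have "gram_density CARD('n) (card {}) (mident :: ('a, 'm, 'm) mtx) = 1"
    by (simp add: gram_density_def gram_const_def mident_pos_def)
  then show ?case
    by (simp add: 1 product_sigma_finite.nn_integral_empty[unfolded product_sigma_finite_def]
        sigma_finite_lborel space_PiM PiM_empty emeasure_count_space)
next
  case (insert j J)
  interpret Y: product_sigma_finite "\<lambda>_::'m. lborel :: ('a, 'n) vec measure"
    by (simp add: product_sigma_finite_def sigma_finite_lborel)
  interpret d: product_sigma_finite "\<lambda>_::'m. lborel :: real measure"
    by (simp add: product_sigma_finite_def sigma_finite_lborel)
  interpret l: product_sigma_finite "\<lambda>_::'m \<times> 'm. lborel :: 'a measure"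
    by (simp add: product_sigma_finite_def sigma_finite_lborel)
  note g [measurable] = insert.prems(3)
  have jJ: "j \<notin> J" using insert.hyps(2) by auto
  have fin: "finite J" "finite (below_pairs J)" "finite ({j} \<times> J)"
    using insert.hyps(1) by (auto intro: finite_below_pairs)
  have good: "(\<forall>x y z :: 'a. (x * y) * z = x * (y * z)) \<or> card J \<le> 1"
    and good': "(\<forall>x y z :: 'a. (x * y) * z = x * (y * z)) \<or> card J \<le> 2"
    and cJ: "card J < CARD('n)"
    using insert.prems(1,2) insert.hyps(1) jJ by auto
  let ?n = "real CARD('n)" and ?b = "real DIM('a)" and ?p = "real (card J)"
  define e where "e = (?n - ?p) * ?b / 2"
  have e: "e > 0" using cJ by (simp add: e_def)
  define bl where "bl l' = (\<chi> i. if i \<in> J then nda_cnj (l' (j, i)) else (0 :: 'a))" for l'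
  \<comment> \<open>\<open>D H B\<close> is the conditional density of the bordered block
    \<open>B\<close> given the old block \<open>H\<close>, times the test function. Its integral
    \<open>G\<close> is the test function that remains for the induction hypothesis.\<close>
  define D where "D H B = g B * (indicator pos_def B *
      ennreal (pi powr e / Gamma e * gdet H powr (- ?b / 2 - (e - 1)) * gdet B powr (e - 1)))"
    for H B :: "('a, 'm, 'm) mtx"
  define G where "G H = (\<integral>\<^sup>+l'. (\<integral>\<^sup>+\<omega>. D H (border J j H (bl l') \<omega>) \<partial>lborel) \<partial>PiM ({j} \<times> J) (\<lambda>_. lborel))"
    for H :: "('a, 'm, 'm) mtx"
  have D_meas [measurable]: "(\<lambda>x. D (f x) (h x)) \<in> borel_measurable M"
    if [measurable]: "f \<in> borel_measurable M" "h \<in> borel_measurable M" for f h and M :: "'x measure"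
    unfolding D_def by measurable
  have D_meas' [measurable]: "case_prod D \<in> borel_measurable (borel \<Otimes>\<^sub>M borel)"
    unfolding D_def split_beta by measurable
  interpret PJ: sigma_finite_measure "PiM ({j} \<times> J) (\<lambda>_. lborel :: 'a measure)" by (rule l.sigma_finite[OF fin(3)])
  interpret PP: sigma_finite_measure "PiM (below_pairs J) (\<lambda>_. lborel :: 'a measure)" by (rule l.sigma_finite[OF fin(2)])
  have border_meas: "(\<lambda>x. border J j (H x) (bl (l' x)) (\<omega> x)) \<in> borel_measurable M"
    if [measurable]: "H \<in> borel_measurable M" "l' \<in> M \<rightarrow>\<^sub>M PiM ({j} \<times> J) (\<lambda>_. lborel)" "\<omega> \<in> borel_measurable M"
    for H l' \<omega> and M :: "'x measure"
    unfolding border_def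
  proof (rule borel_measurable_vec_lambda, rule borel_measurable_vec_lambda, goal_cases)
    case (1 a b)
    have c: "(\<lambda>x. l' x (j, i)) \<in> borel_measurable M" if "i \<in> J" for i
      using measurable_compose[OF \<open>l' \<in> _\<close> measurable_component_singleton[of "(j, i)" "{j} \<times> J"]] that by simp
    show ?case
      by (cases "a = j"; cases "b = j"; cases "a \<in> J"; cases "b \<in> J") (simp_all add: bl_def c borel_measurable_nda_cnj)
  qed
  have G_meas [measurable]: "G \<in> borel_measurable borel"
  proof -
    have "(\<lambda>x. D (fst (fst x)) (border J j (fst (fst x)) (bl (snd (fst x))) (snd x)))
        \<in> borel_measurable ((borel \<Otimes>\<^sub>M PiM ({j} \<times> J) (\<lambda>_. lborel)) \<Otimes>\<^sub>M lborel)"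
      by (intro D_meas border_meas) measurable
    then have "(\<lambda>x. \<integral>\<^sup>+\<omega>. D (fst x) (border J j (fst x) (bl (snd x)) \<omega>) \<partial>lborel)
        \<in> borel_measurable (borel \<Otimes>\<^sub>M PiM ({j} \<times> J) (\<lambda>_. lborel))"
      by (intro lborel.borel_measurable_nn_integral) (simp add: split_beta)
    then show ?thesis unfolding G_def[abs_def]
      by (intro PJ.borel_measurable_nn_integral) (simp add: split_beta)
  qed
  \<comment> \<open>The induction hypothesis is applied to the indicator of the complement of
    \<open>pos_def\<close>, where the density vanishes. So almost all earlier columns satisfy the
    assumptions of \<open>column_step\<close>.\<close>
  have pd_AE: "AE Y in PiM J (\<lambda>_. lborel :: ('a, 'n) vec measure). pad J (gram Y) \<in> pos_def"
  proof -
    have [measurable]: "(\<lambda>Y. pad J (gram Y)) \<in> borel_measurable (PiM J (\<lambda>_. lborel :: ('a, 'n) vec measure))"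
      by (rule borel_measurable_gram) simp
    have "(\<integral>\<^sup>+Y. indicator (- pos_def) (pad J (gram Y)) \<partial>PiM J (\<lambda>_. lborel :: ('a, 'n) vec measure)) = 0"
    proof (subst insert.IH[OF good'])
      show "card J \<le> CARD('n)" using cJ by simp
      have z: "indicator (- pos_def) H * gram_density CARD('n) (card J) H = 0" for H :: "('a, 'm, 'm) mtx"
        by (auto simp: gram_density_def indicator_def)
      show "(\<integral>\<^sup>+d. \<integral>\<^sup>+l. indicator (- pos_def) (pad J (herm_of (d, l))) *
          gram_density CARD('n) (card J) (pad J (herm_of (d, l)) :: ('a, 'm, 'm) mtx)
        \<partial>PiM (below_pairs J) (\<lambda>_. lborel) \<partial>PiM J (\<lambda>_. lborel)) = 0"
        unfolding z by simp
    qed measurable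
    then have "AE Y in PiM J (\<lambda>_. lborel :: ('a, 'n) vec measure). indicator (- pos_def) (pad J (gram Y)) = (0::ennreal)"
      by (subst (asm) nn_integral_0_iff_AE) auto
    then show ?thesis by eventually_elim (auto simp: indicator_def split: if_splits)
  qed
  have mY: "(\<lambda>Y. pad (insert j J) (gram Y)) \<in> borel_measurable (PiM (insert j J) (\<lambda>_. lborel :: ('a, 'n) vec measure))"
    by (rule borel_measurable_gram) simp
  have "(\<integral>\<^sup>+Y. g (pad (insert j J) (gram Y)) \<partial>PiM (insert j J) (\<lambda>_. lborel :: ('a, 'n) vec measure))
    = (\<integral>\<^sup>+Y. (\<integral>\<^sup>+y. g (pad (insert j J) (gram (Y(j := y)))) \<partial>lborel) \<partial>PiM J (\<lambda>_. lborel :: ('a, 'n) vec measure))"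
    by (rule Y.product_nn_integral_insert[OF insert.hyps(1) jJ measurable_compose[OF mY g]])
  also have "\<dots> = (\<integral>\<^sup>+Y. G (pad J (gram Y)) \<partial>PiM J (\<lambda>_. lborel :: ('a, 'n) vec measure))"
  proof (rule nn_integral_cong_AE)
    show "AE Y in PiM J (\<lambda>_. lborel). (\<integral>\<^sup>+y. g (pad (insert j J) (gram (Y(j := y)))) \<partial>lborel) =
        G (pad J (gram (Y :: 'm \<Rightarrow> ('a, 'n) vec)))"
      using pd_AE
    proof eventually_elim
      case (elim Y)
      interpret column_step J j Y by standard (fact good jJ elim cJ)+
      have "below = bl" by (simp add: fun_eq_iff below_def bl_def)
      moreover have "eJ = e" by (simp add: eJ_def e_def)
      ultimately show ?case
        using nn_integral_new_column[OF g] by (simp add: G_def D_def W_def)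
    qed
  qed
  also have "\<dots> = (\<integral>\<^sup>+d. \<integral>\<^sup>+l. G (pad J (herm_of (d, l))) * gram_density CARD('n) (card J) (pad J (herm_of (d, l)))
      \<partial>PiM (below_pairs J) (\<lambda>_. lborel) \<partial>PiM J (\<lambda>_. lborel))"
    using cJ by (intro insert.IH good' G_meas) simp
  \<comment> \<open>The entry \<open>\<omega>\<close> moves outside the off-diagonal coordinates, so
    that \<open>d\<close> with \<open>\<omega>\<close>, and \<open>l\<close> with \<open>l'\<close>,
    recombine into product measures for the larger index set.\<close>
  also have "\<dots> = (\<integral>\<^sup>+d. \<integral>\<^sup>+\<omega>. \<integral>\<^sup>+l. \<integral>\<^sup>+l'.
      g (border J j (pad J (herm_of (d, l))) (bl l') \<omega>) *
      gram_density CARD('n) (card (insert j J)) (border J j (pad J (herm_of (d, l))) (bl l') \<omega>)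
      \<partial>PiM ({j} \<times> J) (\<lambda>_. lborel) \<partial>PiM (below_pairs J) (\<lambda>_. lborel) \<partial>lborel \<partial>PiM J (\<lambda>_. lborel))"
  proof (rule nn_integral_cong)
    fix d :: "'m \<Rightarrow> real"
    let ?H = "\<lambda>l. pad J (herm_of (d, l)) :: ('a, 'm, 'm) mtx"
    let ?B = "\<lambda>l l' \<omega>. border J j (?H l) (bl l') \<omega>"
    let ?F = "\<lambda>l l' \<omega>. g (?B l l' \<omega>) * gram_density CARD('n) (card (insert j J)) (?B l l' \<omega>)"
    have mH [measurable]: "?H \<in> borel_measurable (PiM (below_pairs J) (\<lambda>_. lborel))"
      by (rule borel_measurable_pad_herm_of) auto
    have eq: "G (?H l) * gram_density CARD('n) (card J) (?H l) =
        (\<integral>\<^sup>+l'. \<integral>\<^sup>+\<omega>. ?F l l' \<omega> \<partial>lborel \<partial>PiM ({j} \<times> J) (\<lambda>_. lborel))" for l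
    proof -
      have mB: "(\<lambda>x. ?B l (fst x) (snd x)) \<in> borel_measurable (PiM ({j} \<times> J) (\<lambda>_. lborel) \<Otimes>\<^sub>M lborel)"
        by (intro border_meas) measurable
      have mB1 [measurable]: "(\<lambda>\<omega>. ?B l l' \<omega>) \<in> borel_measurable lborel" if "l' \<in> space (PiM ({j} \<times> J) (\<lambda>_. lborel))" for l'
        using that by (intro border_meas) auto
      have DF: "D (?H l) (?B l l' \<omega>) * gram_density CARD('n) (card J) (?H l) = ?F l l' \<omega>" for l' \<omega>
      proof (cases "?B l l' \<omega> \<in> pos_def")
        case False
        then show ?thesis by (simp add: D_def gram_density_def)
      next
        case True
        have "pad J (?B l l' \<omega>) = ?H l"
          using jJ by (auto simp: pad_def border_def vec_eq_iff)
        then have H: "?H l \<in> pos_def" using pad_pos_def[OF True, of J] by simp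
        have gp: "gdet (?H l) > 0" by (rule pos_def_vol(4)[OF H])
        let ?gH = "gdet (?H l)" and ?gB = "gdet (?B l l' \<omega>)"
        have c0: "gram_const ?n ?b (card J) \<ge> 0" using cJ by (intro gram_const_nonneg) auto
        have c1: "gram_const ?n ?b (card (insert j J)) = gram_const ?n ?b (card J) * (pi powr e / Gamma e)"
          using jJ insert.hyps(1) by (simp add: gram_const_def e_def)
        \<comment> \<open>The old determinant has total exponent zero: its exponent in
          \<open>gram_density\<close> is e + \<beta> / 2 - 1.\<close>
        have ex: "- ?b / 2 - (e - 1) + ((?n - ?p + 1) * ?b / 2 - 1) = 0"
          by (simp add: e_def algebra_simps add_divide_distrib diff_divide_distrib)
        have x1: "?gH powr (- ?b / 2 - (e - 1)) * ?gH powr ((?n - ?p + 1) * ?b / 2 - 1) = 1"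
          unfolding powr_add[symmetric] ex using gp by simp
        have x2: "(?n - real (card (insert j J)) + 1) * ?b / 2 - 1 = e - 1"
          using jJ insert.hyps(1) by (simp add: e_def)
        have alg: "p * x * y * (c * z) = c * p * y" if "x * z = 1" for p x y c z :: real
        proof -
          have "p * x * y * (c * z) = c * p * y * (x * z)" by (simp only: mult_ac)
          then show ?thesis using that by simp
        qed
        have r: "pi powr e / Gamma e * ?gH powr (- ?b / 2 - (e - 1)) * ?gB powr (e - 1) *
            (gram_const ?n ?b (card J) * ?gH powr ((?n - ?p + 1) * ?b / 2 - 1))
          = gram_const ?n ?b (card (insert j J)) * ?gB powr ((?n - real (card (insert j J)) + 1) * ?b / 2 - 1)"
          unfolding c1 x2 by (rule alg[OF x1])
        have "ennreal (pi powr e / Gamma e * ?gH powr (- ?b / 2 - (e - 1)) * ?gB powr (e - 1)) *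
            ennreal (gram_const ?n ?b (card J) * ?gH powr ((?n - ?p + 1) * ?b / 2 - 1))
          = ennreal (gram_const ?n ?b (card (insert j J)) * ?gB powr ((?n - real (card (insert j J)) + 1) * ?b / 2 - 1))"
          unfolding r[symmetric] using e c0 Gamma_real_pos[OF e]
          by (intro ennreal_mult[symmetric] mult_nonneg_nonneg) auto
        then show ?thesis using True H by (simp add: D_def gram_density_def mult.assoc)
      qed
      have "G (?H l) * gram_density CARD('n) (card J) (?H l) =
          (\<integral>\<^sup>+l'. (\<integral>\<^sup>+\<omega>. D (?H l) (?B l l' \<omega>) \<partial>lborel) * gram_density CARD('n) (card J) (?H l) \<partial>PiM ({j} \<times> J) (\<lambda>_. lborel))"
        unfolding G_def
      proof (rule nn_integral_multc[symmetric])
        have "(\<lambda>x. D (?H l) (?B l (fst x) (snd x))) \<in> borel_measurable (PiM ({j} \<times> J) (\<lambda>_. lborel) \<Otimes>\<^sub>M lborel)"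
          by (intro D_meas mB) auto
        then show "(\<lambda>l'. \<integral>\<^sup>+\<omega>. D (?H l) (?B l l' \<omega>) \<partial>lborel) \<in> borel_measurable (PiM ({j} \<times> J) (\<lambda>_. lborel))"
          by (intro lborel.borel_measurable_nn_integral) (simp add: split_beta)
      qed
      also have "\<dots> = (\<integral>\<^sup>+l'. \<integral>\<^sup>+\<omega>. ?F l l' \<omega> \<partial>lborel \<partial>PiM ({j} \<times> J) (\<lambda>_. lborel))"
      proof (rule nn_integral_cong)
        fix l' assume l': "l' \<in> space (PiM ({j} \<times> J) (\<lambda>_. lborel :: 'a measure))"
        have "(\<lambda>\<omega>. D (?H l) (?B l l' \<omega>)) \<in> borel_measurable lborel"
          by (intro D_meas mB1 l') auto
        then show "(\<integral>\<^sup>+\<omega>. D (?H l) (?B l l' \<omega>) \<partial>lborel) * gram_density CARD('n) (card J) (?H l) = (\<integral>\<^sup>+\<omega>. ?F l l' \<omega> \<partial>lborel)"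
          by (subst nn_integral_multc[symmetric]) (simp_all add: DF)
      qed
      finally show ?thesis .
    qed
    have mF: "(\<lambda>x. ?F (l x) (l' x) (\<omega> x)) \<in> borel_measurable M"
      if [measurable]: "l \<in> M \<rightarrow>\<^sub>M PiM (below_pairs J) (\<lambda>_. lborel)" "l' \<in> M \<rightarrow>\<^sub>M PiM ({j} \<times> J) (\<lambda>_. lborel)" "\<omega> \<in> borel_measurable M"
      for l l' \<omega> and M :: "'x measure"
    proof -
      have [measurable]: "(\<lambda>x. ?B (l x) (l' x) (\<omega> x)) \<in> borel_measurable M"
        by (intro border_meas measurable_compose[OF _ mH] that)
      show ?thesis by measurable
    qed
    have "(\<integral>\<^sup>+l. G (?H l) * gram_density CARD('n) (card J) (?H l) \<partial>PiM (below_pairs J) (\<lambda>_. lborel))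
      = (\<integral>\<^sup>+l. \<integral>\<^sup>+\<omega>. \<integral>\<^sup>+l'. ?F l l' \<omega> \<partial>PiM ({j} \<times> J) (\<lambda>_. lborel) \<partial>lborel \<partial>PiM (below_pairs J) (\<lambda>_. lborel))"
    proof (rule nn_integral_cong)
      fix l assume l: "l \<in> space (PiM (below_pairs J) (\<lambda>_. lborel :: 'a measure))"
      interpret pair_sigma_finite "lborel :: real measure" "PiM ({j} \<times> J) (\<lambda>_. lborel :: 'a measure)" ..
      have "(\<lambda>x. ?F l (snd x) (fst x)) \<in> borel_measurable (lborel \<Otimes>\<^sub>M PiM ({j} \<times> J) (\<lambda>_. lborel))"
        using l by (intro mF) auto
      then show "G (?H l) * gram_density CARD('n) (card J) (?H l) =
          (\<integral>\<^sup>+\<omega>. \<integral>\<^sup>+l'. ?F l l' \<omega> \<partial>PiM ({j} \<times> J) (\<lambda>_. lborel) \<partial>lborel)"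
        unfolding eq by (intro Fubini') (simp add: split_beta)
    qed
    also have "\<dots> = (\<integral>\<^sup>+\<omega>. \<integral>\<^sup>+l. \<integral>\<^sup>+l'. ?F l l' \<omega> \<partial>PiM ({j} \<times> J) (\<lambda>_. lborel) \<partial>PiM (below_pairs J) (\<lambda>_. lborel) \<partial>lborel)"
    proof -
      interpret pair_sigma_finite "lborel :: real measure" "PiM (below_pairs J) (\<lambda>_. lborel :: 'a measure)" ..
      have "(\<lambda>x. ?F (snd (fst x)) (snd x) (fst (fst x))) \<in>
          borel_measurable ((lborel \<Otimes>\<^sub>M PiM (below_pairs J) (\<lambda>_. lborel)) \<Otimes>\<^sub>M PiM ({j} \<times> J) (\<lambda>_. lborel))"
        by (intro mF) auto
      then have "(\<lambda>x. \<integral>\<^sup>+l'. ?F (snd x) l' (fst x) \<partial>PiM ({j} \<times> J) (\<lambda>_. lborel)) \<in>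
          borel_measurable (lborel \<Otimes>\<^sub>M PiM (below_pairs J) (\<lambda>_. lborel))"
        by (intro PJ.borel_measurable_nn_integral) (simp add: split_beta)
      then show ?thesis by (intro Fubini') (simp add: split_beta)
    qed
    finally show "(\<integral>\<^sup>+l. G (?H l) * gram_density CARD('n) (card J) (?H l) \<partial>PiM (below_pairs J) (\<lambda>_. lborel))
      = (\<integral>\<^sup>+\<omega>. \<integral>\<^sup>+l. \<integral>\<^sup>+l'. ?F l l' \<omega> \<partial>PiM ({j} \<times> J) (\<lambda>_. lborel) \<partial>PiM (below_pairs J) (\<lambda>_. lborel) \<partial>lborel)" .
  qed
  also have "\<dots> = (\<integral>\<^sup>+d. \<integral>\<^sup>+\<omega>. \<integral>\<^sup>+l. g (pad (insert j J) (herm_of (d(j := \<omega>), l))) *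
      gram_density CARD('n) (card (insert j J)) (pad (insert j J) (herm_of (d(j := \<omega>), l)))
      \<partial>PiM (below_pairs (insert j J)) (\<lambda>_. lborel) \<partial>lborel \<partial>PiM J (\<lambda>_. lborel))"
  proof (rule nn_integral_cong, rule nn_integral_cong)
    fix d :: "'m \<Rightarrow> real" and \<omega> :: real
    have m: "(\<lambda>l. g (pad (insert j J) (herm_of (d(j := \<omega>), l))) *
      gram_density CARD('n) (card (insert j J)) (pad (insert j J) (herm_of (d(j := \<omega>), l))))
      \<in> borel_measurable (PiM (below_pairs J \<union> {j} \<times> J) (\<lambda>_. lborel))"
    proof -
      have [measurable]: "(\<lambda>l. pad (insert j J) (herm_of (d(j := \<omega>), l)) :: ('a, 'm, 'm) mtx) \<in>
          borel_measurable (PiM (below_pairs J \<union> {j} \<times> J) (\<lambda>_. lborel))"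
        unfolding below_pairs_insert(1)[OF insert.hyps(2), symmetric]
        by (rule borel_measurable_pad_herm_of) auto
      show ?thesis by measurable
    qed
    show "(\<integral>\<^sup>+l. \<integral>\<^sup>+l'. g (border J j (pad J (herm_of (d, l))) (bl l') \<omega>) *
      gram_density CARD('n) (card (insert j J)) (border J j (pad J (herm_of (d, l))) (bl l') \<omega>)
      \<partial>PiM ({j} \<times> J) (\<lambda>_. lborel) \<partial>PiM (below_pairs J) (\<lambda>_. lborel))
     = (\<integral>\<^sup>+l. g (pad (insert j J) (herm_of (d(j := \<omega>), l))) *
      gram_density CARD('n) (card (insert j J)) (pad (insert j J) (herm_of (d(j := \<omega>), l)))
      \<partial>PiM (below_pairs (insert j J)) (\<lambda>_. lborel))"
      unfolding below_pairs_insert(1)[OF insert.hyps(2)]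
        l.product_nn_integral_fold[OF below_pairs_insert(2)[OF insert.hyps(2)] fin(2,3) m]
        bl_def border_herm_of[OF insert.hyps(2)] ..
  qed
  also have "\<dots> = (\<integral>\<^sup>+d. \<integral>\<^sup>+l. g (pad (insert j J) (herm_of (d, l))) *
      gram_density CARD('n) (card (insert j J)) (pad (insert j J) (herm_of (d, l)))
      \<partial>PiM (below_pairs (insert j J)) (\<lambda>_. lborel) \<partial>PiM (insert j J) (\<lambda>_. lborel))"
  proof (rule d.product_nn_integral_insert[OF insert.hyps(1) jJ, symmetric])
    interpret PI: sigma_finite_measure "PiM (below_pairs (insert j J)) (\<lambda>_. lborel :: 'a measure)"
      using insert.hyps(1) by (intro l.sigma_finite finite_below_pairs) simp
    have [measurable]: "(\<lambda>x. pad (insert j J) (herm_of (fst x, snd x)) :: ('a, 'm, 'm) mtx) \<in>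
        borel_measurable (PiM (insert j J) (\<lambda>_. lborel) \<Otimes>\<^sub>M PiM (below_pairs (insert j J)) (\<lambda>_. lborel))"
      by (rule borel_measurable_pad_herm_of) auto
    have "(\<lambda>x. g (pad (insert j J) (herm_of (fst x, snd x))) *
        gram_density CARD('n) (card (insert j J)) (pad (insert j J) (herm_of (fst x, snd x))))
        \<in> borel_measurable (PiM (insert j J) (\<lambda>_. lborel) \<Otimes>\<^sub>M PiM (below_pairs (insert j J)) (\<lambda>_. lborel))"
      by measurable
    then show "(\<lambda>d. \<integral>\<^sup>+l. g (pad (insert j J) (herm_of (d, l))) *
        gram_density CARD('n) (card (insert j J)) (pad (insert j J) (herm_of (d, l)))
        \<partial>PiM (below_pairs (insert j J)) (\<lambda>_. lborel)) \<in> borel_measurable (PiM (insert j J) (\<lambda>_. lborel))"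
      by (intro PI.borel_measurable_nn_integral) (simp add: split_beta)
  qed
  finally show ?case .
qed

lemma below_pairs_UNIV: "below_pairs UNIV = {p. snd p < fst p}"
  by (auto simp: below_pairs_def)

theorem nn_integral_gram:
  fixes g :: "('a::normed_division_algebra, 'm::{finite,linorder}, 'm) mtx \<Rightarrow> ennreal"
  assumes "(\<forall>x y z :: 'a. (x * y) * z = x * (y * z)) \<or> CARD('m) \<le> 2"
    and "CARD('m) \<le> CARD('n::finite)" and [measurable]: "g \<in> borel_measurable borel"
  shows "(\<integral>\<^sup>+A. g (ctrans A \<odot> A) \<partial>(lborel :: ('a, 'n, 'm) mtx measure)) =
    (\<integral>\<^sup>+X. g X * gram_density CARD('n) CARD('m) X \<partial>herm_lborel)"
proof -
  interpret l: product_sigma_finite "\<lambda>_::'m \<times> 'm. lborel :: 'a measure"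
    by (simp add: product_sigma_finite_def sigma_finite_lborel)
  interpret P: sigma_finite_measure "PiM {p :: 'm \<times> 'm. snd p < fst p} (\<lambda>_. lborel :: 'a measure)"
    by (rule l.sigma_finite) simp
  have [measurable]: "(\<lambda>f. \<chi> i j. f j $ i) \<in> PiM UNIV (\<lambda>_. lborel) \<rightarrow>\<^sub>M (borel :: ('a, 'n, 'm) mtx measure)"
    by (intro borel_measurable_vec_lambda borel_measurable_vec_nth) simp
  have h [measurable]: "herm_of \<in> (PiM (UNIV :: 'm set) (\<lambda>_. lborel) \<Otimes>\<^sub>M
      PiM {p :: 'm \<times> 'm. snd p < fst p} (\<lambda>_. lborel)) \<rightarrow>\<^sub>M (borel :: ('a, 'm, 'm) mtx measure)"
    using borel_measurable_pad_herm_of[of UNIV fst "PiM (UNIV :: 'm set) (\<lambda>_. lborel) \<Otimes>\<^sub>M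
      PiM {p :: 'm \<times> 'm. snd p < fst p} (\<lambda>_. lborel :: 'a measure)" snd] by (simp add: below_pairs_UNIV)
  have eq: "ctrans (\<chi> i j. f j $ i) \<odot> (\<chi> i j. f j $ i) = gram f" for f :: "'m \<Rightarrow> ('a, 'n) vec"
    by (simp add: vec_eq_iff mmul_nth ctrans_def gram_def)
  have "(\<integral>\<^sup>+A. g (ctrans A \<odot> A) \<partial>(lborel :: ('a, 'n, 'm) mtx measure)) =
      (\<integral>\<^sup>+f. g (gram f) \<partial>PiM UNIV (\<lambda>_. lborel :: ('a, 'n) vec measure))"
    by (subst lborel_columns, subst nn_integral_distr) (simp_all add: eq)
  also have "\<dots> = (\<integral>\<^sup>+d. \<integral>\<^sup>+l. g (herm_of (d, l)) * gram_density CARD('n) CARD('m) (herm_of (d, l))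
      \<partial>PiM {p. snd p < fst p} (\<lambda>_. lborel) \<partial>PiM UNIV (\<lambda>_. lborel))"
    using nn_integral_gram_block[OF _ assms(2,3)] assms(1) by (simp add: below_pairs_UNIV)
  also have "\<dots> = (\<integral>\<^sup>+x. g (herm_of x) * gram_density CARD('n) CARD('m) (herm_of x)
      \<partial>(PiM UNIV (\<lambda>_. lborel) \<Otimes>\<^sub>M PiM {p. snd p < fst p} (\<lambda>_. lborel)))"
    by (rule P.nn_integral_fst) measurable
  also have "\<dots> = (\<integral>\<^sup>+X. g X * gram_density CARD('n) CARD('m) X \<partial>herm_lborel)"
    unfolding herm_lborel_def by (rule nn_integral_distr[symmetric]) measurable
  finally show ?thesis .
qed

section \<open>Leading minors\<close>

lemma dim_coordinate_subspace:
  "dim {v :: ('a::normed_division_algebra, 'm::finite) vec. \<forall>i. i \<notin> K \<longrightarrow> v $ i = 0} = card K * DIM('a)"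
proof -
  let ?d = "(\<lambda>(i, u). axis i u) ` (K \<times> (Basis :: 'a set))"
  have d: "?d \<subseteq> (Basis :: ('a, 'm) vec set)" by (auto simp: Basis_vec_def)
  have "{v :: ('a, 'm) vec. \<forall>i. i \<notin> K \<longrightarrow> v $ i = 0} = {v. \<forall>b\<in>Basis. b \<notin> ?d \<longrightarrow> v \<bullet> b = 0}"
  proof (intro Collect_cong iffI)
    fix v :: "('a, 'm) vec" assume "\<forall>i. i \<notin> K \<longrightarrow> v $ i = 0"
    then show "\<forall>b\<in>Basis. b \<notin> ?d \<longrightarrow> v \<bullet> b = 0"
      by (auto simp: Basis_vec_def inner_axis)
  next
    fix v :: "('a, 'm) vec" assume v: "\<forall>b\<in>Basis. b \<notin> ?d \<longrightarrow> v \<bullet> b = 0"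
    show "\<forall>i. i \<notin> K \<longrightarrow> v $ i = 0"
    proof (intro allI impI)
      fix i assume i: "i \<notin> K"
      have "v $ i \<bullet> u = 0" if u: "u \<in> Basis" for u
      proof -
        have "axis i u \<notin> ?d" using i u nonzero_Basis by (auto simp: axis_eq_axis)
        moreover have "axis i u \<in> (Basis :: ('a, 'm) vec set)" using u by (auto simp: Basis_vec_def)
        ultimately have "v \<bullet> axis i u = 0" using v by blast
        then show ?thesis by (simp add: inner_axis)
      qed
      then show "v $ i = 0" by (intro euclidean_eqI[of "v $ i" 0]) simp
    qed
  qed
  then have "dim {v :: ('a, 'm) vec. \<forall>i. i \<notin> K \<longrightarrow> v $ i = 0} = card ?d" using dim_substandard[OF d] by simp
  also have "\<dots> = card (K \<times> (Basis :: 'a set))"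
    by (intro card_image) (auto simp: inj_on_def axis_eq_axis)
  finally show ?thesis by (simp add: card_cartesian_product)
qed

lemma dim_rmul_image:
  fixes v :: "('a::normed_division_algebra, 'm::finite) vec"
  assumes "v \<noteq> 0"
  shows "subspace (range (rmul v))" "dim (range (rmul v)) = DIM('a)"
proof -
  have lin: "linear (rmul v)"
    by (rule linearI) (auto simp: rmul_def vec_eq_iff nda_add_right nda_scaleR_right)
  obtain i where "v $ i \<noteq> 0" using assms by (auto simp: vec_eq_iff)
  then have "x = 0" if "rmul v x = 0" for x
    using that by (auto simp: rmul_def vec_eq_iff nda_mult_eq_0_iff)
  then have inj: "inj (rmul v)" unfolding linear_injective_0[OF lin] by blast
  show "subspace (range (rmul v))" using lin by (simp add: linear_subspace_image)
  show "dim (range (rmul v)) = DIM('a)"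
    using dim_image_eq[OF lin, of UNIV] inj by (simp add: inj_on_subset)
qed

text \<open>Split off the right multiples of one vector, a subspace of dimension DIM('a);
  associativity makes the orthogonal complement closed under right multiplication again. The purpose
  is exactness of the \<open>div\<close> in \<open>lead_det\<close>.\<close>

lemma dvd_dim_rmul_closed:
  fixes V :: "('a::normed_division_algebra, 'm::finite) vec set"
  assumes assoc: "\<forall>x y z :: 'a. (x * y) * z = x * (y * z)"
    and "subspace V" "\<And>v x. v \<in> V \<Longrightarrow> rmul v x \<in> V"
  shows "DIM('a) dvd dim V"
  using assms(2,3)
proof (induction "dim V" arbitrary: V rule: less_induct)
  case less
  show ?case
  proof (cases "V = {0}")
    case False
    then obtain v where v: "v \<in> V" "v \<noteq> 0" using subspace_0[OF less.prems(1)] by blast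
    note d = dim_rmul_image[OF v(2)]
    let ?V = "{y \<in> V. \<forall>x\<in>range (rmul v). orthogonal x y}"
    have sub: "range (rmul v) \<subseteq> V" using less.prems(2) v(1) by blast
    have dim: "dim ?V + DIM('a) = dim V"
      using dim_subspace_orthogonal_to_vectors[OF d(1) less.prems(1) sub] d(2) by simp
    have "subspace ?V"
      using less.prems(1) by (auto simp: subspace_def orthogonal_def inner_add_right)
    moreover have "rmul y x \<in> ?V" if y: "y \<in> ?V" for y x
    proof -
      have "rmul v z \<bullet> rmul y x = rmul v (z * nda_cnj x) \<bullet> y" for z
      proof -
        have "rmul v z \<bullet> rmul y x = (\<Sum>i\<in>UNIV. (v $ i * (z * nda_cnj x)) \<bullet> y $ i)"
          unfolding inner_vec_def rmul_def
          by (intro sum.cong refl)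
             (simp add: inner_commute[of "v $ _ * z"] nda_adjoint_right[of "y $ _"] assoc,
              simp add: inner_commute)
        then show ?thesis by (simp add: inner_vec_def rmul_def)
      qed
      then show ?thesis using y less.prems(2) by (auto simp: orthogonal_def)
    qed
    moreover have "dim ?V < dim V" using dim DIM_positive[where 'a='a] by linarith
    ultimately have "DIM('a) dvd dim ?V" by (intro less.hyps)
    then show ?thesis unfolding dim[symmetric] by simp
  qed simp
qed

lemma lead_eigenspace_eq:
  "lead_eigenspace p A c = {v. proj (leading p) v = v \<and> mvmul (pad (leading p) A) v = c *\<^sub>R v}"
proof -
  let ?J = "leading p"
  have supp: "(\<forall>i. i \<notin> ?J \<longrightarrow> v $ i = 0) \<longleftrightarrow> proj ?J v = v" for v :: "('a, 'b) vec"
    by (auto simp: vec_eq_iff proj_nth)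
  have "(\<forall>i\<in>?J. (\<Sum>j\<in>?J. A $ i $ j * v $ j) = c *\<^sub>R (v $ i)) \<longleftrightarrow> mvmul (pad ?J A) v = c *\<^sub>R v"
    if v: "proj ?J v = v" for v
  proof -
    have v0: "v $ i = 0" if "i \<notin> ?J" for i using v that by (metis proj_nth)
    have s: "(\<Sum>j\<in>?J. A $ i $ j * v $ j) = mvmul A v $ i" for i
      unfolding mvmul_nth by (rule sum.mono_neutral_left) (auto simp: v0 nda_mult.zero_right)
    have c: "proj (- ?J) v = 0" using v0 by (auto simp: vec_eq_iff proj_nth)
    show ?thesis
      unfolding mvmul_pad v c s by (auto simp: vec_eq_iff proj_nth v0)
  qed
  then show ?thesis unfolding lead_eigenspace_def using supp by blast
qed

text \<open>Over an associative algebra eigenspaces are closed under right multiplication. For two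
  indices without associativity they are found explicitly: coordinate subspaces if the off-diagonal
  entry vanishes, otherwise zero or the right multiples of one vector.\<close>

lemma dvd_dim_lead_eigenspace:
  fixes A :: "('a::normed_division_algebra, 'm::{finite,linorder}, 'm) mtx"
  assumes "hermitian A" and good: "(\<forall>x y z :: 'a. (x * y) * z = x * (y * z)) \<or> CARD('m) \<le> 2"
  shows "DIM('a) dvd dim (lead_eigenspace p A c)"
proof -
  let ?J = "leading p :: 'm set" and ?L = "lead_eigenspace p A c"
  have sub: "subspace ?L"
    unfolding lead_eigenspace_eq
    by (auto simp: subspace_def linear_0[OF linear_mvmul] linear_0[OF linear_proj] linear_add[OF linear_mvmul]
        linear_add[OF linear_proj] linear_scale[OF linear_mvmul] linear_scale[OF linear_proj] scaleR_add_right)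
  consider (assoc) "\<forall>x y z :: 'a. (x * y) * z = x * (y * z)"
    | (diag) "\<forall>i\<in>?J. \<forall>j\<in>?J. i \<noteq> j \<longrightarrow> A $ i $ j = 0"
    | (off) i k where "i \<in> ?J" "k \<in> ?J" "i \<noteq> k" "A $ i $ k \<noteq> 0" "CARD('m) \<le> 2"
    using good by blast
  then show ?thesis
  proof cases
    case assoc
    show ?thesis
    proof (rule dvd_dim_rmul_closed[OF assoc sub])
      fix v x assume "v \<in> ?L"
      then have v: "\<And>i. i \<notin> ?J \<Longrightarrow> v $ i = 0" "\<And>i. i \<in> ?J \<Longrightarrow> (\<Sum>j\<in>?J. A $ i $ j * v $ j) = c *\<^sub>R (v $ i)"
        by (auto simp: lead_eigenspace_def)
      have "(\<Sum>j\<in>?J. A $ i $ j * (v $ j * x)) = c *\<^sub>R (v $ i * x)" if "i \<in> ?J" for i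
      proof -
        have "(\<Sum>j\<in>?J. A $ i $ j * (v $ j * x)) = (\<Sum>j\<in>?J. A $ i $ j * v $ j) * x"
          using assoc by (simp add: nda_mult.sum_left)
        then show ?thesis by (simp add: v(2)[OF that] nda_scaleR_left)
      qed
      then show "rmul v x \<in> ?L"
        using v(1) by (simp add: lead_eigenspace_def rmul_def nda_mult.zero_left)
    qed
  next
    case diag
    have "v \<in> ?L \<longleftrightarrow> (\<forall>i. i \<notin> {i \<in> ?J. A $ i $ i = c *\<^sub>R 1} \<longrightarrow> v $ i = 0)" for v
    proof -
      have s: "(\<Sum>j\<in>?J. A $ i $ j * v $ j) = A $ i $ i * v $ i" if "i \<in> ?J" for i
      proof -
        have "(\<Sum>j\<in>?J. A $ i $ j * v $ j) = (\<Sum>j\<in>{i}. A $ i $ j * v $ j)"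
        proof (rule sum.mono_neutral_right)
          show "\<forall>j\<in>?J - {i}. A $ i $ j * v $ j = 0"
            using that diag by (metis DiffE insertI1 nda_mult.zero_left)
        qed (use that in auto)
        then show ?thesis by simp
      qed
      have e: "A $ i $ i * v $ i = c *\<^sub>R (v $ i) \<longleftrightarrow> A $ i $ i = c *\<^sub>R 1 \<or> v $ i = 0" for i
      proof -
        have "A $ i $ i * v $ i - c *\<^sub>R (v $ i) = (A $ i $ i - c *\<^sub>R 1) * v $ i"
          by (simp add: nda_mult.diff_left)
        then show ?thesis by (metis nda_mult_eq_0_iff right_minus_eq)
      qed
      show ?thesis unfolding lead_eigenspace_def by (auto simp: s e)
    qed
    then have "?L = {v. \<forall>i. i \<notin> {i \<in> ?J. A $ i $ i = c *\<^sub>R 1} \<longrightarrow> v $ i = 0}" by blast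
    then show ?thesis by (simp only: dim_coordinate_subspace dvd_triv_right)
  next
    case off
    have "{i, k} = UNIV"
      by (rule card_seteq) (use off in auto)
    then have U: "UNIV = {i, k}" by simp
    have J: "?J = {i, k}" using off(1,2) U by auto
    obtain a where a: "A $ i $ i = a *\<^sub>R 1" using hermitian_diag[OF assms(1)] by blast
    obtain b where b: "A $ k $ k = b *\<^sub>R 1" using hermitian_diag[OF assms(1)] by blast
    define x where "x = A $ i $ k"
    have x: "x \<noteq> 0" "A $ k $ i = nda_cnj x" using off(4) assms(1) by (auto simp: x_def hermitian_nth)
    have mem: "v \<in> ?L \<longleftrightarrow> x * v $ k = (c - a) *\<^sub>R (v $ i) \<and> nda_cnj x * v $ i = (c - b) *\<^sub>R (v $ k)" for v
    proof -
      have e: "r *\<^sub>R u + w = c *\<^sub>R u \<longleftrightarrow> w = (c - r) *\<^sub>R u" for r and u w :: 'a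
        by (simp add: scaleR_left_diff_distrib eq_diff_eq add.commute)
      have "j \<in> {i, k}" for j using U by (metis UNIV_I)
      then have v0: "\<forall>j. j \<notin> {i, k} \<longrightarrow> v $ j = 0" by blast
      have s1: "(\<Sum>j\<in>{i, k}. A $ i $ j * v $ j) = a *\<^sub>R (v $ i) + x * v $ k"
        using off(3) by (simp add: a x_def)
      have s2: "(\<Sum>j\<in>{i, k}. A $ k $ j * v $ j) = b *\<^sub>R (v $ k) + nda_cnj x * v $ i"
        using off(3) by (simp add: b x(2))
      have ball: "(\<forall>r\<in>{i, k}. P r) \<longleftrightarrow> P i \<and> P k" for P by simp
      show ?thesis
        unfolding lead_eigenspace_def J mem_Collect_eq ball s1 s2 e using v0 by blast
    qed
    \<comment> \<open>The first eigenvalue equation, solved for \<open>v $ k\<close> in terms of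
      \<open>v $ i\<close> by the cancellation law.\<close>
    define z where "z = ((c - a) / (norm x)\<^sup>2) *\<^sub>R nda_cnj x"
    have nx: "(norm x)\<^sup>2 \<noteq> 0" using x(1) by simp
    have first: "x * v $ k = (c - a) *\<^sub>R (v $ i) \<longleftrightarrow> v $ k = z * v $ i" for v :: "('a, 'm) vec"
    proof
      assume "x * v $ k = (c - a) *\<^sub>R (v $ i)"
      then have "(norm x)\<^sup>2 *\<^sub>R (v $ k) = nda_cnj x * ((c - a) *\<^sub>R (v $ i))"
        using nda_cnj_mult_cancel[of x "v $ k"] by simp
      then have "(1 / (norm x)\<^sup>2) *\<^sub>R ((norm x)\<^sup>2 *\<^sub>R (v $ k)) =
          (1 / (norm x)\<^sup>2) *\<^sub>R (nda_cnj x * ((c - a) *\<^sub>R (v $ i)))" by (simp only:)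
      then have "v $ k = (1 / (norm x)\<^sup>2) *\<^sub>R (nda_cnj x * ((c - a) *\<^sub>R (v $ i)))"
        using nx by simp
      then show "v $ k = z * v $ i" by (simp add: z_def nda_scaleR_left nda_scaleR_right)
    next
      assume "v $ k = z * v $ i"
      then show "x * v $ k = (c - a) *\<^sub>R (v $ i)"
        using nx by (simp add: z_def nda_scaleR_left nda_scaleR_right nda_mult_cnj_cancel)
    qed
    \<comment> \<open>After the substitution both sides are real multiples of
      \<open>nda_cnj x * v $ i\<close>, so a non-zero solution exists precisely when c is a root of
      the characteristic equation (c - a) (c - b) = |x|^2.\<close>
    have second: "nda_cnj x * v $ i = (c - b) *\<^sub>R (z * v $ i) \<longleftrightarrow> v $ i = 0 \<or> (c - b) * ((c - a) / (norm x)\<^sup>2) = 1"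
      for v :: "('a, 'm) vec"
    proof -
      have "nda_cnj x * v $ i - (c - b) *\<^sub>R (z * v $ i) = (1 - (c - b) * ((c - a) / (norm x)\<^sup>2)) *\<^sub>R (nda_cnj x * v $ i)"
        by (simp add: z_def nda_scaleR_left scaleR_left_diff_distrib)
      moreover have "nda_cnj x \<noteq> 0" using x(1) by (metis nda_cnj_cnj nda_cnj_zero)
      ultimately show ?thesis
        by (metis (no_types, opaque_lifting) nda_mult_eq_0_iff right_minus_eq scaleR_eq_0_iff)
    qed
    have mem': "v \<in> ?L \<longleftrightarrow> v $ k = z * v $ i \<and> (v $ i = 0 \<or> (c - b) * ((c - a) / (norm x)\<^sup>2) = 1)" for v
      unfolding mem first using second[of v] by auto
    show ?thesis
    proof (cases "(c - b) * ((c - a) / (norm x)\<^sup>2) = 1")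
      case False
      have "v = 0" if "v \<in> ?L" for v
      proof -
        have "v $ i = 0" "v $ k = 0" using mem'[of v] that False by (auto simp: nda_mult.zero_right)
        then have "v $ j = 0" for j using U by (metis UNIV_I empty_iff insert_iff)
        then show ?thesis by (simp add: vec_eq_iff)
      qed
      then have "?L \<subseteq> {0}" by blast
      then have "dim ?L = 0" by (rule dim_eq_0[THEN iffD2])
      then show ?thesis by (metis dvd_0_right)
    next
      case True
      define w :: "('a, 'm) vec" where "w = (\<chi> j. if j = i then 1 else z)"
      have "?L = range (rmul w)"
      proof (intro equalityI subsetI)
        fix v assume "v \<in> ?L"
        then have "v $ k = z * v $ i" using mem' by blast
        then have "v $ j = rmul w (v $ i) $ j" for j
        proof -
          have "j = i \<or> j = k" using U by (metis UNIV_I insert_iff singletonD)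
          then show ?thesis using off(3) \<open>v $ k = z * v $ i\<close> by (auto simp: rmul_def w_def nda_one_left)
        qed
        then have "v = rmul w (v $ i)" unfolding vec_eq_iff by blast
        then show "v \<in> range (rmul w)" by (rule range_eqI)
      next
        fix v assume "v \<in> range (rmul w)"
        then show "v \<in> ?L" unfolding mem' using True off(3) by (auto simp: rmul_def w_def nda_one_left)
      qed
      moreover have "w $ i \<noteq> 0" by (simp add: w_def nda_one_neq_zero)
      then have "w \<noteq> 0" by (metis zero_index)
      ultimately show ?thesis using dim_rmul_image(2)[of w] by simp
    qed
  qed
qed

text \<open>The volume factor of the padded operator is the product of its eigenvalues, each to the
  power of its real multiplicity. Padding adds eigenvectors only for the eigenvalue 1, which does
  not affect the product, and dividing multiplicities by DIM('a) matches the root in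
  \<open>gdet\<close>.\<close>

theorem lead_det_eq_gdet:
  fixes A :: "('a::normed_division_algebra, 'm::{finite,linorder}, 'm) mtx"
  assumes pd: "A \<in> pos_def" and good: "(\<forall>x y z :: 'a. (x * y) * z = x * (y * z)) \<or> CARD('m) \<le> 2"
  shows "lead_det p A = gdet (pad (leading p) A)"
proof -
  let ?J = "leading p :: 'm set"
  let ?T = "mvmul (pad ?J A)"
  let ?E = "\<lambda>c. {v. ?T v = c *\<^sub>R v}" and ?L = "lead_eigenspace p A"
  have pdJ: "pad ?J A \<in> pos_def" by (rule pad_pos_def[OF pd])
  have h: "hermitian A" using pd by (simp add: pos_def_iff)
  note v = vol_eq_prod_eigenvalues[OF linear_mvmul pos_def_symmetric[OF pdJ]]
  have pos: "v \<bullet> ?T v > 0" if "v \<noteq> 0" for v using pdJ that by (simp add: pos_def_iff)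
  have EL: "?E c = ?L c" if "c \<noteq> 1" for c
  proof -
    have "proj ?J v = v" if Tv: "?T v = c *\<^sub>R v" for v
    proof -
      have "proj (- ?J) (?T v) = proj (- ?J) v"
        by (simp add: mvmul_pad linear_add[OF linear_proj])
      then have "proj (- ?J) v = c *\<^sub>R proj (- ?J) v" by (simp add: Tv linear_scale[OF linear_proj])
      then have "proj (- ?J) v = 0" using \<open>c \<noteq> 1\<close>
        by (metis scaleR_cancel_right scaleR_one)
      then show ?thesis using proj_compl[of ?J v] by simp
    qed
    then show ?thesis unfolding lead_eigenspace_eq by auto
  qed
  have LE: "?L c \<subseteq> ?E c" for c unfolding lead_eigenspace_eq by auto
  have 0: "0 \<in> ?L c" for c by (simp add: lead_eigenspace_def nda_mult.zero_right)
  let ?CE = "{c. ?E c \<noteq> {0}}" and ?CL = "{c. ?L c \<noteq> {0}}"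
  have sub: "?CL \<subseteq> ?CE" using LE 0 by fastforce
  have fin: "finite ?CE" using v(1) pos by blast
  have "vol ?T = (\<Prod>c\<in>?CE. c ^ dim (?E c))" using v(2) pos by blast
  also have "\<dots> = (\<Prod>c\<in>?CL. c ^ dim (?E c))"
  proof (rule prod.mono_neutral_right[OF fin sub], rule ballI)
    fix c assume "c \<in> ?CE - ?CL"
    then have "c = 1" using EL[of c] by auto
    then show "c ^ dim (?E c) = 1" by simp
  qed
  also have "\<dots> = (\<Prod>c\<in>?CL. c ^ dim (?L c))"
  proof (rule prod.cong)
    fix c show "c ^ dim (?E c) = c ^ dim (?L c)" using EL[of c] by (cases "c = 1") simp_all
  qed simp
  also have "\<dots> = (\<Prod>c\<in>?CL. (c ^ (dim (?L c) div DIM('a))) ^ DIM('a))"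
    using dvd_dim_lead_eigenspace[OF h good] by (intro prod.cong refl) (simp add: power_mult[symmetric])
  also have "\<dots> = lead_det p A ^ DIM('a)" by (simp add: lead_det_def prod_power_distrib)
  finally have vol: "vol ?T = lead_det p A ^ DIM('a)" .
  have "c > 0" if "c \<in> ?CL" for c
  proof -
    obtain v where v: "v \<in> ?L c" "v \<noteq> 0" using \<open>c \<in> ?CL\<close> 0[of c] by blast
    then have "v \<bullet> ?T v = c * (v \<bullet> v)" using LE[of c] by auto
    moreover have "v \<bullet> v > 0" using v(2) by simp
    ultimately show ?thesis using pos[OF v(2)] by (metis zero_less_mult_pos2)
  qed
  then have "lead_det p A > 0" unfolding lead_det_def by (intro prod_pos) auto
  then have L: "lead_det p A > 0" "lead_det p A ^ DIM('a) = lead_det p A powr real DIM('a)"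
    by (simp_all add: powr_realpow)
  then show ?thesis unfolding pos_def_vol(3)[OF pdJ] vol L(2) powr_powr by simp
qed

section \<open>Triangular matrices and the Cholesky decomposition\<close>

text \<open>Triangularity is taken with respect to an injective ranking \<open>f\<close> of the indices, which covers
  upper and lower triangular matrices at once.\<close>

definition tri :: "('m \<Rightarrow> nat) \<Rightarrow> ('a::normed_division_algebra, 'm::finite, 'm) mtx \<Rightarrow> bool" where
  "tri f U \<longleftrightarrow> (\<forall>i j. f j < f i \<longrightarrow> U $ i $ j = 0) \<and> (\<forall>i. \<exists>r>0. U $ i $ i = r *\<^sub>R 1)"

lemma triD: "tri f U \<Longrightarrow> f j < f i \<Longrightarrow> U $ i $ j = 0"
  and tri_diag: "tri f U \<Longrightarrow> \<exists>r>0. U $ i $ i = r *\<^sub>R 1"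
  by (auto simp: tri_def)

lemma mvmul_mmul:
  assumes "\<And>i k l x. A $ i $ k * (B $ k $ l * x) = (A $ i $ k * B $ k $ l) * x"
  shows "mvmul (A \<odot> B) v = mvmul A (mvmul B v)"
proof -
  have "mvmul (A \<odot> B) v $ i = mvmul A (mvmul B v) $ i" for i
  proof -
    have "mvmul (A \<odot> B) v $ i = (\<Sum>j\<in>UNIV. \<Sum>k\<in>UNIV. (A $ i $ k * B $ k $ j) * v $ j)"
      by (simp add: mvmul_nth mmul_nth nda_mult.sum_left)
    also have "\<dots> = (\<Sum>k\<in>UNIV. \<Sum>j\<in>UNIV. A $ i $ k * (B $ k $ j * v $ j))"
      by (subst sum.swap) (simp add: assms)
    also have "\<dots> = mvmul A (mvmul B v) $ i" by (simp add: mvmul_nth nda_mult.sum_right)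
    finally show ?thesis .
  qed
  then show ?thesis by (simp add: vec_eq_iff)
qed

lemma card_le_2_not_distinct:
  assumes "CARD('m::finite) \<le> 2" "(i::'m) \<noteq> j" "i \<noteq> k" shows "j = k"
proof (rule ccontr)
  assume "j \<noteq> k"
  then have "card {i, j, k} = 3" using assms(2,3) by simp
  moreover have "card {i, j, k} \<le> CARD('m)" by (rule card_mono) auto
  ultimately show False using assms(1) by simp
qed

locale good_matrices =
  fixes ty :: "('a::normed_division_algebra \<times> 'm::finite) itself" and f :: "'m \<Rightarrow> nat"
  assumes good: "(\<forall>x y z :: 'a. (x * y) * z = x * (y * z)) \<or> CARD('m) \<le> 2" and inj_f: "inj f"
begin

lemma rank_cases: "f i < f j \<or> i = j \<or> f j < f i"
  using inj_f by (metis injD linorder_neqE_nat)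

text \<open>With at most two indices a strictly increasing chain i, k, l cannot occur, so every
  non-zero product contains a diagonal factor, which is real.\<close>

lemma tri_mult_assoc:
  fixes U V :: "('a, 'm, 'm) mtx"
  assumes "tri f U" "tri f V"
  shows "U $ i $ k * (V $ k $ l * x) = (U $ i $ k * V $ k $ l) * x"
  using good
proof
  assume c: "CARD('m) \<le> 2"
  obtain r s where r: "U $ i $ i = r *\<^sub>R 1" "V $ k $ k = s *\<^sub>R 1" using tri_diag assms by blast
  consider "f k < f i" | "f l < f k" | "i = k" | "k = l" | "f i < f k" "f k < f l" using rank_cases by metis
  then show ?thesis
  proof cases
    case 5
    then have False using card_le_2_not_distinct[OF c, of k i l] by (metis less_irrefl less_trans)
    then show ?thesis ..
  qed (use triD[OF assms(1)] triD[OF assms(2)] r in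
    \<open>auto simp: nda_mult.zero_left nda_mult.zero_right nda_scaleR_left nda_scaleR_right nda_one_left nda_one_right\<close>)
qed simp

lemma mvmul_tri_mmul:
  fixes U V :: "('a, 'm, 'm) mtx"
  assumes "tri f U" "tri f V" shows "mvmul (U \<odot> V) v = mvmul U (mvmul V v)"
  by (rule mvmul_mmul) (rule tri_mult_assoc[OF assms])

text \<open>Of three indices taken from two, some pair agrees: either a diagonal factor is real, or
  i = l and the product has the form conj(u) (u x).\<close>

lemma mvmul_ctrans_tri_mmul:
  fixes U :: "('a, 'm, 'm) mtx"
  assumes U: "tri f U" shows "mvmul (ctrans U \<odot> U) v = mvmul (ctrans U) (mvmul U v)"
proof (rule mvmul_mmul)
  fix i k l and x :: 'a
  show "ctrans U $ i $ k * (U $ k $ l * x) = (ctrans U $ i $ k * U $ k $ l) * x"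
    using good
  proof
    assume c: "CARD('m) \<le> 2"
    obtain r where r: "U $ k $ k = r *\<^sub>R 1" using tri_diag[OF U] by blast
    consider "k = i" | "k = l" | "i = l" using card_le_2_not_distinct[OF c, of k i l] by blast
    then show ?thesis
      by cases (use r in \<open>auto simp: ctrans_def nda_cnj_scaleR nda_scaleR_left nda_scaleR_right nda_one_left nda_one_right
        nda_cnj_mult_cancel nda_cnj_mult_self\<close>)
  qed simp
qed

lemma mvmul_tri_ctrans_mmul:
  fixes V :: "('a, 'm, 'm) mtx"
  assumes V: "tri f V" shows "mvmul (V \<odot> ctrans V) v = mvmul V (mvmul (ctrans V) v)"
proof (rule mvmul_mmul)
  fix i k l and x :: 'a
  show "V $ i $ k * (ctrans V $ k $ l * x) = (V $ i $ k * ctrans V $ k $ l) * x"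
    using good
  proof
    assume c: "CARD('m) \<le> 2"
    obtain r where r: "V $ k $ k = r *\<^sub>R 1" using tri_diag[OF V] by blast
    consider "k = i" | "k = l" | "i = l" using card_le_2_not_distinct[OF c, of k i l] by blast
    then show ?thesis
      by cases (use r in \<open>auto simp: ctrans_def nda_cnj_scaleR nda_scaleR_left nda_scaleR_right nda_one_left nda_one_right
        nda_mult_cnj_cancel nda_mult_cnj_self\<close>)
  qed simp
qed

lemma tri_mmul:
  fixes U V :: "('a, 'm, 'm) mtx"
  assumes U: "tri f U" and V: "tri f V" shows "tri f (U \<odot> V)"
  unfolding tri_def
proof (intro conjI allI impI)
  fix i j assume ij: "f j < f i"
  have "U $ i $ k * V $ k $ j = 0" for k
    using triD[OF U, of k i] triD[OF V, of j k] ij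
    by (cases "f k < f i") (auto simp: nda_mult.zero_left nda_mult.zero_right)
  then show "(U \<odot> V) $ i $ j = 0" by (simp add: mmul_nth)
next
  fix i
  obtain r s where r: "r > 0" "U $ i $ i = r *\<^sub>R 1" "s > 0" "V $ i $ i = s *\<^sub>R 1"
    using tri_diag U V by blast
  have "(\<Sum>k\<in>UNIV. U $ i $ k * V $ k $ i) = (\<Sum>k\<in>{i}. U $ i $ k * V $ k $ i)"
  proof (rule sum.mono_neutral_right)
    show "\<forall>k\<in>UNIV - {i}. U $ i $ k * V $ k $ i = 0"
    proof
      fix k assume "k \<in> UNIV - {i}"
      then have "f k < f i \<or> f i < f k" using rank_cases[of k i] by auto
      then show "U $ i $ k * V $ k $ i = 0"
        using triD[OF U, of k i] triD[OF V, of i k] by (auto simp: nda_mult.zero_left nda_mult.zero_right)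
    qed
  qed auto
  then have "(U \<odot> V) $ i $ i = (r * s) *\<^sub>R 1" by (simp add: mmul_nth r)
  then show "\<exists>r>0. (U \<odot> V) $ i $ i = r *\<^sub>R 1" using r by (intro exI[of _ "r * s"]) simp
qed

text \<open>Termwise: with at most two indices, every non-zero term has a diagonal, hence real,
  factor in each half of the fourfold product, so the bracketings agree.\<close>

lemma ctrans_mmul_tri_assoc:
  fixes C V :: "('a, 'm, 'm) mtx"
  assumes C: "tri f C" and V: "tri f V"
  shows "ctrans V \<odot> (ctrans C \<odot> C) \<odot> V = ctrans (C \<odot> V) \<odot> (C \<odot> V)"
proof -
  have t: "(nda_cnj (V $ k $ i) * (nda_cnj (C $ p $ k) * C $ p $ l)) * V $ l $ j
      = (nda_cnj (V $ k $ i) * nda_cnj (C $ p $ k)) * (C $ p $ l * V $ l $ j)" for i j k l p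
    using good
  proof
    assume c: "CARD('m) \<le> 2"
    obtain r s where r: "C $ p $ p = r *\<^sub>R 1" "V $ i $ i = s *\<^sub>R 1" using tri_diag C V by blast
    obtain r' s' where r': "V $ j $ j = s' *\<^sub>R 1" using tri_diag C V by blast
    consider (z1) "f i < f k" | (z2) "f k < f p" | (z3) "f l < f p" | (z4) "f j < f l"
      | (n1) "p = k" "p = l" | (n2) "p = k" "l = j" | (n3) "k = i" "p = l" | (n4) "k = i" "l = j"
      | (d1) "f p < f k" "f k < f i" | (d2) "f p < f l" "f l < f j"
      using rank_cases by metis
    then show ?thesis
    proof cases
      case d1
      then have False using card_le_2_not_distinct[OF c, of k p i] by (metis less_irrefl less_trans)
      then show ?thesis ..
    next
      case d2
      then have False using card_le_2_not_distinct[OF c, of l p j] by (metis less_irrefl less_trans)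
      then show ?thesis ..
    qed (use triD[OF C] triD[OF V] r r' in \<open>auto simp: nda_mult.zero_left nda_mult.zero_right
      nda_cnj_scaleR nda_scaleR_left nda_scaleR_right nda_one_left nda_one_right\<close>)
  next
    assume "\<forall>x y z :: 'a. (x * y) * z = x * (y * z)"
    then show ?thesis by metis
  qed
  have "(ctrans V \<odot> (ctrans C \<odot> C) \<odot> V) $ i $ j = (ctrans (C \<odot> V) \<odot> (C \<odot> V)) $ i $ j" for i j
  proof -
    have "(ctrans V \<odot> (ctrans C \<odot> C) \<odot> V) $ i $ j
      = (\<Sum>l\<in>UNIV. \<Sum>k\<in>UNIV. \<Sum>p\<in>UNIV. (nda_cnj (V $ k $ i) * (nda_cnj (C $ p $ k) * C $ p $ l)) * V $ l $ j)"
      by (simp add: mmul_nth ctrans_def nda_mult.sum_left nda_mult.sum_right)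
    also have "\<dots> = (\<Sum>l\<in>UNIV. \<Sum>k\<in>UNIV. \<Sum>p\<in>UNIV. (nda_cnj (V $ k $ i) * nda_cnj (C $ p $ k)) * (C $ p $ l * V $ l $ j))"
      by (simp only: t)
    also have "\<dots> = (\<Sum>l\<in>UNIV. \<Sum>p\<in>UNIV. \<Sum>k\<in>UNIV. (nda_cnj (V $ k $ i) * nda_cnj (C $ p $ k)) * (C $ p $ l * V $ l $ j))"
      by (intro sum.cong refl sum.swap)
    also have "\<dots> = (\<Sum>p\<in>UNIV. \<Sum>l\<in>UNIV. \<Sum>k\<in>UNIV. (nda_cnj (V $ k $ i) * nda_cnj (C $ p $ k)) * (C $ p $ l * V $ l $ j))"
      by (rule sum.swap)
    also have "\<dots> = (\<Sum>p\<in>UNIV. (\<Sum>k\<in>UNIV. nda_cnj (V $ k $ i) * nda_cnj (C $ p $ k)) * (\<Sum>l\<in>UNIV. C $ p $ l * V $ l $ j))"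
      by (simp only: nda_mult.sum_left nda_mult.sum_right)
    also have "\<dots> = (ctrans (C \<odot> V) \<odot> (C \<odot> V)) $ i $ j"
      by (simp add: mmul_nth ctrans_def nda_cnj_sum nda_cnj_mult)
    finally show ?thesis .
  qed
  then show ?thesis by (simp add: vec_eq_iff)
qed

lemma tri_top_entry:
  fixes U :: "('a, 'm, 'm) mtx"
  assumes U: "tri f U" and v: "\<And>k. f i < f k \<Longrightarrow> v $ k = 0"
  shows "mvmul U v $ i = U $ i $ i * v $ i"
proof -
  have "(\<Sum>k\<in>UNIV. U $ i $ k * v $ k) = (\<Sum>k\<in>{i}. U $ i $ k * v $ k)"
  proof (rule sum.mono_neutral_right)
    show "\<forall>k\<in>UNIV - {i}. U $ i $ k * v $ k = 0"
    proof
      fix k assume "k \<in> UNIV - {i}"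
      then have "f k < f i \<or> f i < f k" using rank_cases[of k i] by auto
      then show "U $ i $ k * v $ k = 0"
        using triD[OF U, of k i] v[of k] by (auto simp: nda_mult.zero_left nda_mult.zero_right)
    qed
  qed auto
  then show ?thesis by (simp add: mvmul_nth)
qed

text \<open>Back substitution: at the highest-ranked coordinate where \<open>v\<close> does not
  vanish, \<open>mvmul U v\<close> is a positive multiple of that coordinate.\<close>

lemma tri_support:
  fixes U :: "('a, 'm, 'm) mtx"
  assumes U: "tri f U" and w: "\<And>k. n < f k \<Longrightarrow> mvmul U v $ k = 0"
  shows "n < f k \<Longrightarrow> v $ k = 0"
proof (rule ccontr)
  assume k: "n < f k" "v $ k \<noteq> 0"
  let ?K = "{k. n < f k \<and> v $ k \<noteq> 0}"
  have "finite (f ` ?K)" "f ` ?K \<noteq> {}" using k by auto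
  then have "Max (f ` ?K) \<in> f ` ?K" by (rule Max_in)
  then obtain i where i: "i \<in> ?K" "f i = Max (f ` ?K)" by auto
  have "v $ l = 0" if "f i < f l" for l
  proof (rule ccontr)
    assume "v $ l \<noteq> 0"
    then have "l \<in> ?K" using that i(1) by auto
    then have "f l \<le> f i" unfolding i(2) by (intro Max_ge) auto
    then show False using that by simp
  qed
  then have "mvmul U v $ i = U $ i $ i * v $ i" by (rule tri_top_entry[OF U])
  moreover obtain r where "r > 0" "U $ i $ i = r *\<^sub>R 1" using tri_diag[OF U] by blast
  ultimately have "mvmul U v $ i \<noteq> 0" using i(1) by simp
  then show False using w[of i] i(1) by simp
qed

lemma tri_inj:
  fixes U :: "('a, 'm, 'm) mtx"
  assumes U: "tri f U" shows "inj (mvmul U)"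
  unfolding linear_injective_0[OF linear_mvmul]
proof (intro allI impI)
  fix v assume v: "mvmul U v = 0"
  have z: "v $ k = 0" if "f k > 0" for k
    by (rule tri_support[OF U, of 0]) (use v that in auto)
  have "v $ k = 0" for k
  proof (cases "f k > 0")
    case False
    have "mvmul U v $ k = U $ k $ k * v $ k" using False z by (intro tri_top_entry[OF U]) auto
    moreover obtain r where "r > 0" "U $ k $ k = r *\<^sub>R 1" using tri_diag[OF U] by blast
    ultimately show ?thesis using v by simp
  qed (rule z)
  then show "v = 0" by (simp add: vec_eq_iff)
qed

text \<open>The columns of \<open>V\<close> solve the triangular systems for the unit vectors, and
  their supports give triangularity. Products with \<open>U\<close> may then be rebracketed, which
  extends the inverse property from these vectors to all.\<close>

lemma tri_inverse:
  fixes U :: "('a, 'm, 'm) mtx"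
  assumes U: "tri f U"
  obtains V where "tri f V" "U \<odot> V = mident" "V \<odot> U = mident"
    "\<And>v. mvmul U (mvmul V v) = v" "\<And>v. mvmul V (mvmul U v) = v"
proof -
  obtain S where S: "linear S" "\<And>v. S (mvmul U v) = v" "\<And>v. mvmul U (S v) = v"
    using linear_inverse_obtain[OF linear_mvmul tri_inj[OF U]] by metis
  define V :: "('a, 'm, 'm) mtx" where "V = (\<chi> i j. S (axis j 1) $ i)"
  have VS: "mvmul V (axis j 1) = S (axis j 1)" for j
    by (simp add: vec_eq_iff mvmul_axis V_def nda_one_right)
  have supp: "S (axis j 1) $ k = 0" if "f j < f k" for j k
  proof (rule tri_support[OF U, of "f j"])
    fix k assume "f j < f k"
    then show "mvmul U (S (axis j 1)) $ k = 0" by (auto simp: S(3) axis_def)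
  qed (fact that)
  have V: "tri f V"
    unfolding tri_def
  proof (intro conjI allI impI)
    fix i j assume "f j < f i"
    then show "V $ i $ j = 0" by (simp add: V_def supp)
  next
    fix i
    obtain r where r: "r > 0" "U $ i $ i = r *\<^sub>R 1" using tri_diag[OF U] by blast
    have "mvmul U (S (axis i 1)) $ i = U $ i $ i * S (axis i 1) $ i"
      by (rule tri_top_entry[OF U]) (rule supp)
    then have "r *\<^sub>R V $ i $ i = 1" using r(2) by (simp add: S(3) V_def axis_def)
    then have "V $ i $ i = inverse r *\<^sub>R 1" using r(1) by (metis less_irrefl scaleR_scaleR left_inverse scaleR_one)
    then show "\<exists>r>0. V $ i $ i = r *\<^sub>R 1" using r(1) by (intro exI[of _ "inverse r"]) simp
  qed
  have UV: "U \<odot> V = mident"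
    unfolding vec_eq_iff mmul_column VS S(3) by (simp add: mident_def axis_def)
  have 1: "mvmul U (mvmul V v) = v" for v
    using mvmul_tri_mmul[OF U V, of v] UV by simp
  then have VS': "mvmul V v = S v" for v by (metis S(2))
  have VU: "V \<odot> U = mident"
    unfolding vec_eq_iff mmul_column VS' S(2) by (simp add: mident_def axis_def)
  show thesis by (rule that[OF V UV VU 1]) (simp add: VS' S(2))
qed

text \<open>The \<open>THE\<close> in \<open>minv\<close> asks for uniqueness, usually a consequence
  of associativity; here injectivity of \<open>mvmul A\<close>, applied to columns, provides
  it.\<close>

lemma minv_eqI:
  fixes A B :: "('a, 'm, 'm) mtx"
  assumes "A \<odot> B = mident" "B \<odot> A = mident" "inj (mvmul A)" shows "minv A = B"
  unfolding minv_def
proof (rule the_equality)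
  fix B' assume B': "A \<odot> B' = mident \<and> B' \<odot> A = mident"
  have "mvmul A (mvmul B' (axis j 1)) = mvmul A (mvmul B (axis j 1))" for j
    using B' assms(1) by (simp add: vec_eq_iff flip: mmul_column)
  then have "mvmul B' (axis j 1) $ i = mvmul B (axis j 1) $ i" for i j
    using assms(3) by (metis injD)
  then show "B' = B" by (simp add: vec_eq_iff mvmul_axis nda_one_right)
qed (use assms in simp)

lemma inj_ctrans:
  fixes A :: "('a, 'm, 'm) mtx"
  assumes "inj (mvmul A)" shows "inj (mvmul (ctrans A))"
  unfolding linear_injective_0[OF linear_mvmul]
proof (intro allI impI)
  fix v assume v: "mvmul (ctrans A) v = 0"
  obtain S where "\<And>v. mvmul A (S v) = v"
    using linear_inverse_obtain[OF linear_mvmul assms] by metis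
  then have "v \<bullet> v = S v \<bullet> mvmul (ctrans A) v" by (metis mvmul_adjoint)
  then show "v = 0" by (simp add: v)
qed

text \<open>Row by row in order of rank: by induction the lower-ranked rows contribute equally to
  row i of the product, and what remains is the diagonal entry times the unknown row.\<close>

lemma cholesky_unique:
  fixes U V :: "('a, 'm, 'm) mtx"
  assumes U: "tri f U" and V: "tri f V" and eq: "ctrans U \<odot> U = ctrans V \<odot> V"
  shows "U = V"
proof -
  have "\<forall>j. U $ i $ j = V $ i $ j" for i
  proof (induction "f i" arbitrary: i rule: less_induct)
    case less
    have ex: "(ctrans A \<odot> A) $ i $ j = (\<Sum>k\<in>{k. f k < f i}. nda_cnj (A $ k $ i) * A $ k $ j) + nda_cnj (A $ i $ i) * A $ i $ j"
      if A: "tri f A" for A :: "('a, 'm, 'm) mtx" and j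
    proof -
      have "(\<Sum>k\<in>UNIV. nda_cnj (A $ k $ i) * A $ k $ j) = (\<Sum>k\<in>insert i {k. f k < f i}. nda_cnj (A $ k $ i) * A $ k $ j)"
      proof (rule sum.mono_neutral_right)
        show "\<forall>k\<in>UNIV - insert i {k. f k < f i}. nda_cnj (A $ k $ i) * A $ k $ j = 0"
        proof
          fix k assume "k \<in> UNIV - insert i {k. f k < f i}"
          then have "f i < f k" using rank_cases[of i k] by auto
          then show "nda_cnj (A $ k $ i) * A $ k $ j = 0" using triD[OF A] by (simp add: nda_mult.zero_left)
        qed
      qed auto
      then show ?thesis by (simp add: mmul_nth ctrans_def add.commute)
    qed
    have "(\<Sum>k\<in>{k. f k < f i}. nda_cnj (U $ k $ i) * U $ k $ j) = (\<Sum>k\<in>{k. f k < f i}. nda_cnj (V $ k $ i) * V $ k $ j)" for j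
      using less by (intro sum.cong) auto
    then have e: "nda_cnj (U $ i $ i) * U $ i $ j = nda_cnj (V $ i $ i) * V $ i $ j" for j
      using ex[OF U, of j] ex[OF V, of j] eq by simp
    obtain r s where r: "r > 0" "U $ i $ i = r *\<^sub>R 1" "s > 0" "V $ i $ i = s *\<^sub>R 1" using tri_diag U V by blast
    have e': "r *\<^sub>R U $ i $ j = s *\<^sub>R V $ i $ j" for j using e[of j] by (simp add: r nda_cnj_scaleR)
    have "(r * r) *\<^sub>R (1::'a) = (s * s) *\<^sub>R 1" using e'[of i] r by simp
    then have "r * r = s * s" using nda_one_neq_zero by (metis scaleR_cancel_right)
    then have "r = s" using r by (simp add: power2_eq_square[symmetric])
    then show ?case using e' r by auto
  qed
  then show ?thesis by (simp add: vec_eq_iff)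
qed

text \<open>Border the factor of the old block: the new column \<open>u\<close> solves
  \<open>mvmul (ctrans U) u = w\<close>, and the new diagonal entry is the root of the Schur
  complement, positive by \<open>border_pos_def_imp\<close>. Induction by rank places the new index
  last, which keeps the factor triangular.\<close>

lemma cholesky_block_exists:
  fixes A :: "('a, 'm, 'm) mtx"
  assumes A: "A \<in> pos_def"
  shows "\<exists>U. tri f U \<and> pad J U = U \<and> ctrans U \<odot> U = pad J A"
  using finite[of J]
proof (induction J rule: finite_ranking_induct[where f = f])
  case empty
  have "tri f mident" by (auto simp: tri_def mident_def intro: exI[of _ 1])
  moreover have "ctrans mident \<odot> mident = (mident :: ('a, 'm, 'm) mtx)"
    by (simp add: vec_eq_iff mmul_column)
       (simp add: mident_def axis_def)
  ultimately show ?case by (intro exI[of _ mident]) simp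
next
  case (insert j J)
  show ?case
  proof (cases "j \<in> J")
    case True
    then show ?thesis using insert by (simp add: insert_absorb)
  next
    case jJ: False
    obtain U where U: "tri f U" "pad J U = U" "ctrans U \<odot> U = pad J A" using insert by blast
    have rank: "f a < f j" if "a \<in> J" for a
      using insert(2)[OF that] inj_f jJ that by (metis injD le_neq_implies_less)
    define W where "W = pad J A"
    have Wpd: "W \<in> pos_def" unfolding W_def by (rule pad_pos_def[OF A])
    obtain S where S: "linear S" "\<And>v. S (mvmul W v) = v" "\<And>v. mvmul W (S v) = v"
      using linear_inverse_obtain[OF linear_mvmul pos_def_inj[OF Wpd]] by metis
    have good': "(\<forall>x y z :: 'a. (x * y) * z = x * (y * z)) \<or> card J \<le> 1"
      using good
    proof
      assume c: "CARD('m) \<le> 2"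
      have "card (insert j J) \<le> CARD('m)" by (rule card_mono) auto
      then show ?thesis using c jJ by simp
    qed simp
    have padW: "pad J W = W" by (auto simp: W_def pad_def vec_eq_iff)
    interpret padded_block J W S
      by (rule padded_block.intro) (fact good' padW Wpd S)+
    have hA: "nda_cnj (A $ b $ a) = A $ a $ b" for a b
      using A by (simp add: pos_def_iff hermitian_nth)
    obtain \<omega> where \<omega>: "A $ j $ j = \<omega> *\<^sub>R 1" using A hermitian_diag[of A j] by (auto simp: pos_def_iff)
    define w where "w = proj J (\<chi> a. A $ a $ j)"
    have w: "proj J w = w" by (simp add: w_def)
    have "border J j W w \<omega> = pad (insert j J) A"
      using jJ hA by (auto simp: vec_eq_iff border_def pad_def W_def w_def proj_nth \<omega>)
    then have "border J j W w \<omega> \<in> pos_def" using pad_pos_def[OF A] by simp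
    then have schur: "S w \<bullet> w < \<omega>" by (rule border_pos_def_imp[OF jJ w])
    \<comment> \<open>\<open>W\<close> acts as \<open>mvmul U\<close> followed by
      \<open>mvmul (ctrans U)\<close>, so \<open>mvmul (ctrans U)\<close> sends this vector to
      \<open>W (S w) = w\<close>.\<close>
    define u where "u = mvmul U (S w)"
    have Uu: "mvmul (ctrans U) u = w"
      using mvmul_ctrans_tri_mmul[OF U(1), of "S w"] S(3)[of w] U(3) by (simp add: u_def W_def)
    have uu: "u \<bullet> u = S w \<bullet> w" unfolding u_def[of] using Uu by (simp add: mvmul_adjoint u_def)
    have u0: "u $ a = 0" if "a \<notin> J" for a
    proof -
      have "mvmul U (S w) = proj J (mvmul U (proj J (S w))) + proj (- J) (S w)"
        using mvmul_pad[of J U "S w"] U(2) by simp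
      then have "u = proj J (mvmul U (S w))"
        using S_supp[OF w] S_compl[of w] w by (simp add: u_def) (metis add.right_neutral proj_proj Compl_disjoint2 proj_empty)
      then show ?thesis using that by (metis proj_nth)
    qed
    define s where "s = sqrt (\<omega> - u \<bullet> u)"
    have s: "s > 0" "s\<^sup>2 = \<omega> - u \<bullet> u" using schur by (auto simp: s_def uu)
    define U' where "U' = (\<chi> a b. if b = j then if a = j then s *\<^sub>R 1 else u $ a else U $ a $ b)"
    have Uj: "U $ j $ a = 0" if "a \<noteq> j" for a
      using U(2) jJ that by (auto simp: pad_def vec_eq_iff split: if_splits)
    have tri: "tri f U'"
      unfolding tri_def
    proof (intro conjI allI impI)
      fix a b assume ab: "f b < f a"
      show "U' $ a $ b = 0"
      proof (cases "b = j")
        case True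
        then have "a \<notin> J" "a \<noteq> j" using rank[of a] ab by auto
        then show ?thesis using True u0 by (simp add: U'_def)
      next
        case False
        then show ?thesis using triD[OF U(1) ab] by (simp add: U'_def)
      qed
    next
      fix a show "\<exists>r>0. U' $ a $ a = r *\<^sub>R 1"
        using tri_diag[OF U(1), of a] s(1) by (cases "a = j") (auto simp: U'_def)
    qed
    have pad': "pad (insert j J) U' = U'"
    proof -
      have "U $ a $ b = (if a = b then 1 else 0)" if "a \<notin> J \<or> b \<notin> J" for a b
        using arg_cong[OF U(2), of "\<lambda>M. M $ a $ b"] that by (auto simp: pad_def)
      then show ?thesis using u0 jJ by (auto simp: vec_eq_iff pad_def U'_def)
    qed
    have G: "(ctrans U' \<odot> U') $ a $ b = pad (insert j J) A $ a $ b" if "a \<noteq> j" for a b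
    proof (cases "b = j")
      case False
      have "(ctrans U' \<odot> U') $ a $ b = (ctrans U \<odot> U) $ a $ b"
        using that False by (simp add: mmul_nth ctrans_def U'_def)
      then show ?thesis using that False by (simp add: U(3) pad_def)
    next
      case True
      have "(ctrans U' \<odot> U') $ a $ j = (\<Sum>k\<in>UNIV. nda_cnj (U $ k $ a) * u $ k)"
        unfolding mmul_nth
        using that Uj[OF that] u0[OF jJ]
        by (intro sum.cong refl) (auto simp: ctrans_def U'_def nda_mult.zero_left)
      also have "\<dots> = w $ a" using Uu by (simp add: vec_eq_iff mvmul_nth ctrans_def)
      finally show ?thesis using True that by (simp add: w_def proj_nth pad_def)
    qed
    have Gj: "(ctrans U' \<odot> U') $ j $ j = pad (insert j J) A $ j $ j"
    proof -
      have "(ctrans U' \<odot> U') $ j $ j = (\<Sum>k\<in>UNIV. (norm (U' $ k $ j))\<^sup>2 *\<^sub>R 1)"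
        by (simp add: mmul_nth ctrans_def nda_cnj_mult_self)
      also have "\<dots> = (\<Sum>k\<in>UNIV. (norm (U' $ k $ j))\<^sup>2) *\<^sub>R 1" by (simp add: scaleR_left.sum)
      also have "(\<Sum>k\<in>UNIV. (norm (U' $ k $ j))\<^sup>2) = (\<Sum>k\<in>UNIV. (norm (u $ k))\<^sup>2 + (if k = j then s\<^sup>2 else 0))"
        using u0[OF jJ] s(1) by (intro sum.cong refl) (auto simp: U'_def)
      also have "\<dots> = u \<bullet> u + s\<^sup>2" by (simp add: sum.distrib inner_vec_def power2_norm_eq_inner)
      finally show ?thesis using s(2) by (simp add: pad_def \<omega>)
    qed
    have "(ctrans U' \<odot> U') $ a $ b = pad (insert j J) A $ a $ b" for a b
    proof (cases "a = j")
      case a: True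
      show ?thesis
      proof (cases "b = j")
        case False
        have "hermitian (ctrans U' \<odot> U')" by (rule hermitian_gram)
        moreover have "hermitian (pad (insert j J) A)" using A by (simp add: pos_def_iff hermitian_pad)
        ultimately show ?thesis using G[OF False, of a] by (metis hermitian_nth)
      qed (use a Gj in simp)
    qed (rule G)
    then show ?thesis using tri pad' by (intro exI[of _ U']) (simp add: vec_eq_iff)
  qed
qed

lemma cholesky_exists:
  fixes A :: "('a, 'm, 'm) mtx"
  assumes "A \<in> pos_def" obtains U where "tri f U" "ctrans U \<odot> U = A"
  using cholesky_block_exists[OF assms, of UNIV] by auto

end

section \<open>Inverses and generalised powers\<close>

context good_matrices
begin

text \<open>The inverse is assembled as \<open>V \<odot> ctrans V\<close> from the inverse
  \<open>V\<close> of the Cholesky factor, a form in which symmetry and positivity are visible and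
  brackets can be moved.\<close>

lemma pos_def_minv:
  fixes A :: "('a, 'm, 'm) mtx"
  assumes A: "A \<in> pos_def"
  shows "minv A \<in> pos_def" "mvmul A (mvmul (minv A) v) = v"
    "A \<odot> minv A = mident" "minv A \<odot> A = mident"
proof -
  obtain U where U: "tri f U" "ctrans U \<odot> U = A" by (rule cholesky_exists[OF A])
  obtain V where V: "tri f V" "\<And>v. mvmul U (mvmul V v) = v" "\<And>v. mvmul V (mvmul U v) = v"
    by (rule tri_inverse[OF U(1)]) blast
  define B where "B = V \<odot> ctrans V"
  have B: "mvmul B v = mvmul V (mvmul (ctrans V) v)" for v unfolding B_def by (rule mvmul_tri_ctrans_mmul[OF V(1)])
  have Am: "mvmul A v = mvmul (ctrans U) (mvmul U v)" for v using mvmul_ctrans_tri_mmul[OF U(1)] U(2) by simp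
  have UV: "mvmul (ctrans U) (mvmul (ctrans V) v) = v" for v
  proof -
    have "mvmul (ctrans U) (mvmul (ctrans V) v) \<bullet> w = v \<bullet> w" for w
      using mvmul_adjoint[of "ctrans U" "mvmul (ctrans V) v" w] mvmul_adjoint[of "ctrans V" v "mvmul U w"] V(3)
      by simp
    then show ?thesis by (metis vector_eq_rdot)
  qed
  have AB: "mvmul A (mvmul B v) = v" for v by (simp add: Am B V(2) UV)
  have BA: "mvmul B (mvmul A v) = v" for v
    using pos_def_inj[OF A] AB by (metis injD)
  have 1: "A \<odot> B = mident" "B \<odot> A = mident"
    unfolding vec_eq_iff mmul_column AB BA by (simp_all add: mident_def axis_def)
  have m: "minv A = B" by (rule minv_eqI[OF 1 pos_def_inj[OF A]])
  show "A \<odot> minv A = mident" "minv A \<odot> A = mident" "mvmul A (mvmul (minv A) v) = v"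
    using 1 AB by (simp_all add: m)
  have "hermitian B" by (simp add: hermitian_def B_def ctrans_mmul)
  moreover have "v \<bullet> mvmul B v > 0" if "v \<noteq> 0" for v
  proof -
    have "mvmul (ctrans V) v \<noteq> 0" using that UV by (metis linear_0[OF linear_mvmul])
    moreover have "v \<bullet> mvmul B v = mvmul (ctrans V) v \<bullet> mvmul (ctrans V) v"
      using mvmul_adjoint[of "ctrans V" v] by (simp add: B)
    ultimately show ?thesis by simp
  qed
  ultimately show "minv A \<in> pos_def" by (simp add: pos_def_iff m)
qed

text \<open>\<open>J\<close> is an initial segment of the ranking, so the inverse \<open>V\<close>
  of the triangular \<open>L\<close> preserves its coordinates, and the determinants of these blocks
  change by a factor independent of \<open>W\<close>. Writing \<open>W\<close> through its own
  Cholesky factor exhibits \<open>X\<close> as a Gram matrix of a triangular product.\<close>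

lemma congruence_minors:
  fixes \<Sigma> W L :: "('a, 'm, 'm) mtx"
  assumes \<Sigma>: "\<Sigma> \<in> pos_def" and W: "W \<in> pos_def" and L: "tri f L" "ctrans L \<odot> L = \<Sigma>"
  defines "X \<equiv> minv (ctrans L) \<odot> W \<odot> minv L"
  shows "X \<in> pos_def"
    "(\<And>i k. i \<notin> J \<Longrightarrow> k \<in> J \<Longrightarrow> f k < f i) \<Longrightarrow> gdet (pad J X) = gdet (pad J W) / gdet (pad J \<Sigma>)"
proof -
  obtain V where V: "tri f V" "L \<odot> V = mident" "V \<odot> L = mident"
    and LV: "\<And>v. mvmul L (mvmul V v) = v" "\<And>v. mvmul V (mvmul L v) = v"
    by (rule tri_inverse[OF L(1)]) blast
  have mL: "minv L = V" by (rule minv_eqI[OF V(2,3) tri_inj[OF L(1)]])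
  have "ctrans L \<odot> ctrans V = mident" "ctrans V \<odot> ctrans L = mident"
    using V(2,3) by (metis ctrans_mident ctrans_mmul)+
  then have mLc: "minv (ctrans L) = ctrans V" by (rule minv_eqI) (rule inj_ctrans[OF tri_inj[OF L(1)]])
  obtain C where C: "tri f C" "ctrans C \<odot> C = W" by (rule cholesky_exists[OF W])
  have X: "X = ctrans (C \<odot> V) \<odot> (C \<odot> V)"
    unfolding X_def mL mLc C(2)[symmetric] by (rule ctrans_mmul_tri_assoc[OF C(1) V(1)])
  have hX: "hermitian X" unfolding X by (rule hermitian_gram)
  have gr: "v \<bullet> mvmul (ctrans A \<odot> A) v = mvmul A v \<bullet> mvmul A v" if "tri f A" for A :: "('a, 'm, 'm) mtx" and v
    using mvmul_ctrans_tri_mmul[OF that, of v] mvmul_adjoint[of A v "mvmul A v"] by simp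
  have qX: "v \<bullet> mvmul X v = mvmul V v \<bullet> mvmul W (mvmul V v)" for v
    unfolding X gr[OF tri_mmul[OF C(1) V(1)]] mvmul_tri_mmul[OF C(1) V(1)]
    using gr[OF C(1), of "mvmul V v"] C(2) by simp
  have qI: "v \<bullet> mvmul mident v = mvmul V v \<bullet> mvmul \<Sigma> (mvmul V v)" for v
    using gr[OF L(1), of "mvmul V v"] by (simp add: L(2) LV)
  show "X \<in> pos_def" by (rule gdet_transform(1)[OF linear_mvmul tri_inj[OF V(1)] qX W hX])
  assume J: "\<And>i k. i \<notin> J \<Longrightarrow> k \<in> J \<Longrightarrow> f k < f i"
  have "proj J (mvmul V (proj J v)) = mvmul V (proj J v)" for v
  proof -
    have "mvmul V (proj J v) $ i = 0" if "i \<notin> J" for i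
      unfolding mvmul_nth
    proof (rule sum.neutral, rule ballI)
      fix k show "V $ i $ k * proj J v $ k = 0"
        using J[OF that, of k] triD[OF V(1), of k i]
        by (cases "k \<in> J") (auto simp: proj_nth nda_mult.zero_left nda_mult.zero_right)
    qed
    then show ?thesis by (auto simp: vec_eq_iff proj_nth)
  qed
  then obtain c where c: "c > 0" "\<And>A B :: ('a, 'm, 'm) mtx. A \<in> pos_def \<Longrightarrow> hermitian B \<Longrightarrow>
      (\<And>v. v \<bullet> mvmul B v = mvmul V v \<bullet> mvmul A (mvmul V v)) \<Longrightarrow> gdet (pad J B) = gdet (pad J A) * c"
    using gdet_pad_block_transform[OF linear_mvmul tri_inj[OF V(1)], of J] by metis
  have "pad J mident = (mident :: ('a, 'm, 'm) mtx)" by (auto simp: vec_eq_iff pad_def mident_def)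
  \<comment> \<open>The factor is evaluated on \<Sigma>, which the same congruence turns into the
    identity.\<close>
  then have "gdet (pad J \<Sigma>) * c = 1"
    using c(2)[OF \<Sigma> _ qI] by (simp add: hermitian_def)
  then have "c = 1 / gdet (pad J \<Sigma>)"
    using pos_def_vol(4)[OF pad_pos_def[OF \<Sigma>, of J]] by (simp add: field_simps)
  then show "gdet (pad J X) = gdet (pad J W) / gdet (pad J \<Sigma>)" using c(2)[OF W hX qX] by simp
qed

end

section \<open>Leading index sets and the two orders of elimination\<close>

definition upper_rank :: "'m::{finite,linorder} \<Rightarrow> nat" where "upper_rank i = card {..<i}"
definition lower_rank :: "'m::{finite,linorder} \<Rightarrow> nat" where "lower_rank i = card {i<..}"

lemma upper_rank_less_iff: "upper_rank i < upper_rank j \<longleftrightarrow> i < j"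
proof -
  have *: "upper_rank i < upper_rank j" if "i < j" for i j :: 'a
    unfolding upper_rank_def using that by (intro psubset_card_mono) auto
  then show ?thesis by (metis linorder_neqE less_asym less_irrefl)
qed

lemma lower_rank_less_iff: "lower_rank i < lower_rank j \<longleftrightarrow> j < i"
proof -
  have *: "lower_rank i < lower_rank j" if "j < i" for i j :: 'a
    unfolding lower_rank_def using that by (intro psubset_card_mono) auto
  then show ?thesis by (metis linorder_neqE less_asym less_irrefl)
qed

lemma inj_upper_rank: "inj upper_rank"
  by (rule injI) (metis upper_rank_less_iff less_irrefl linorder_neqE)

lemma inj_lower_rank: "inj lower_rank"
  by (rule injI) (metis lower_rank_less_iff less_irrefl linorder_neqE)

lemma leading_eq: "leading p = {i. upper_rank i < p}"
  by (simp add: leading_def upper_rank_def)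

lemma card_leading:
  assumes "p \<le> CARD('m::{finite,linorder})" shows "card (leading p :: 'm set) = p"
proof -
  have "upper_rank i < CARD('m)" for i :: 'm
    unfolding upper_rank_def by (rule psubset_card_mono) auto
  then have "range (upper_rank :: 'm \<Rightarrow> nat) \<subseteq> {..<CARD('m)}" by auto
  moreover have "card (range (upper_rank :: 'm \<Rightarrow> nat)) = CARD('m)" by (rule card_image[OF inj_upper_rank])
  ultimately have r: "range (upper_rank :: 'm \<Rightarrow> nat) = {..<CARD('m)}"
    by (intro card_subset_eq) auto
  have "upper_rank ` (leading p :: 'm set) = {..<p}"
  proof
    show "{..<p} \<subseteq> upper_rank ` (leading p :: 'm set)"
    proof
      fix q assume "q \<in> {..<p}"
      then have "q \<in> range (upper_rank :: 'm \<Rightarrow> nat)" unfolding r using assms by auto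
      then show "q \<in> upper_rank ` (leading p :: 'm set)" using \<open>q \<in> {..<p}\<close> by (auto simp: leading_eq)
    qed
  qed (auto simp: leading_eq)
  then show ?thesis using card_image[OF inj_on_subset[OF inj_upper_rank subset_UNIV], of "leading p :: 'm set"] by simp
qed

lemma leading_CARD: "leading CARD('m) = (UNIV :: 'm::{finite,linorder} set)"
  by (rule card_subset_eq) (auto simp: card_leading)

locale good_ordered =
  fixes ty :: "('a::normed_division_algebra \<times> 'm::{finite,linorder}) itself"
  assumes good: "(\<forall>x y z :: 'a. (x * y) * z = x * (y * z)) \<or> CARD('m) \<le> 2"
begin

sublocale upper: good_matrices ty upper_rank
  by standard (fact good inj_upper_rank)+

sublocale lower: good_matrices ty lower_rank
  by standard (fact good inj_lower_rank)+

lemma lead_det_gdet: "A \<in> pos_def \<Longrightarrow> lead_det p (A :: ('a, 'm, 'm) mtx) = gdet (pad (leading p) A)"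
  by (rule lead_det_eq_gdet[OF _ good])

lemma lead_det_minv:
  fixes A :: "('a, 'm, 'm) mtx"
  assumes "A \<in> pos_def"
  shows "lead_det p (minv A) = gdet (pad (- leading p) A) / gdet A"
proof -
  note m = upper.pos_def_minv[OF assms]
  have "gdet A > 0" by (rule pos_def_vol(4)[OF assms])
  then show ?thesis using gdet_complementary[OF assms m(1,2), of "leading p"]
    by (simp add: lead_det_gdet[OF m(1)] field_simps)
qed

lemma lead_det_pos: "A \<in> pos_def \<Longrightarrow> lead_det p (A :: ('a, 'm, 'm) mtx) > 0"
  unfolding lead_det_gdet by (rule pos_def_vol(4)[OF pad_pos_def])

lemma hdet_gdet: "A \<in> pos_def \<Longrightarrow> hdet (A :: ('a, 'm, 'm) mtx) = gdet A"
  by (simp add: hdet_def lead_det_gdet leading_CARD)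

lemma gpower_pos: "A \<in> pos_def \<Longrightarrow> gpower \<kappa> (A :: ('a, 'm, 'm) mtx) > 0"
proof -
  assume "A \<in> pos_def"
  then have "lead_det p A powr x > 0" for p x using lead_det_pos[of A p] by simp
  then show "gpower \<kappa> A > 0" unfolding gpower_def by (simp add: prod_pos)
qed

lemma gpower_quotient:
  fixes A B C :: "('a, 'm, 'm) mtx"
  assumes "\<And>p. lead_det p A = lead_det p B / lead_det p C" "B \<in> pos_def" "C \<in> pos_def"
  shows "gpower \<kappa> A = gpower \<kappa> B / gpower \<kappa> C"
proof -
  have "lead_det p A powr x = lead_det p B powr x / lead_det p C powr x" for p x
    unfolding assms(1) by (rule powr_divide)
  then show ?thesis by (simp add: gpower_def prod_dividef)
qed

lemma tri_upper_iff:
  "tri upper_rank (U :: ('a, 'm, 'm) mtx) \<longleftrightarrow> (\<forall>i j. j < i \<longrightarrow> U $ i $ j = 0) \<and> (\<forall>i. \<exists>r>0. U $ i $ i = r *\<^sub>R 1)"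
  by (simp add: tri_def upper_rank_less_iff)

lemma tri_lower_iff:
  "tri lower_rank (U :: ('a, 'm, 'm) mtx) \<longleftrightarrow> (\<forall>i j. i < j \<longrightarrow> U $ i $ j = 0) \<and> (\<forall>i. \<exists>r>0. U $ i $ i = r *\<^sub>R 1)"
  by (simp add: tri_def lower_rank_less_iff)

lemma chol_upper:
  fixes A :: "('a, 'm, 'm) mtx"
  assumes "A \<in> pos_def"
  shows "tri upper_rank (chol_upper A)" "ctrans (chol_upper A) \<odot> chol_upper A = A"
proof -
  obtain U :: "('a, 'm, 'm) mtx" where U: "tri upper_rank U" "ctrans U \<odot> U = A"
    by (rule upper.cholesky_exists[OF assms])
  have "chol_upper A = U"
    unfolding chol_upper_def conj_assoc[symmetric] tri_upper_iff[symmetric]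
  proof (rule the_equality)
    fix V :: "('a, 'm, 'm) mtx" assume "tri upper_rank V \<and> ctrans V \<odot> V = A"
    then show "V = U" using upper.cholesky_unique[of V U] U by simp
  qed (use U in simp)
  then show "tri upper_rank (chol_upper A)" "ctrans (chol_upper A) \<odot> chol_upper A = A" using U by simp_all
qed

lemma chol_lower:
  fixes A :: "('a, 'm, 'm) mtx"
  assumes "A \<in> pos_def"
  shows "tri lower_rank (chol_lower A)" "ctrans (chol_lower A) \<odot> chol_lower A = A"
proof -
  obtain U :: "('a, 'm, 'm) mtx" where U: "tri lower_rank U" "ctrans U \<odot> U = A"
    by (rule lower.cholesky_exists[OF assms])
  have "chol_lower A = U"
    unfolding chol_lower_def conj_assoc[symmetric] tri_lower_iff[symmetric]
  proof (rule the_equality)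
    fix V :: "('a, 'm, 'm) mtx" assume "tri lower_rank V \<and> ctrans V \<odot> V = A"
    then show "V = U" using lower.cholesky_unique[of V U] U by simp
  qed (use U in simp)
  then show "tri lower_rank (chol_lower A)" "ctrans (chol_lower A) \<odot> chol_lower A = A" using U by simp_all
qed

lemma gpower_congruence_upper:
  fixes \<Sigma> W :: "('a, 'm, 'm) mtx"
  assumes \<Sigma>: "\<Sigma> \<in> pos_def" and W: "W \<in> pos_def"
  shows "gpower \<kappa> (minv (ctrans (chol_upper \<Sigma>)) \<odot> W \<odot> minv (chol_upper \<Sigma>)) = gpower \<kappa> W / gpower \<kappa> \<Sigma>"
proof (rule gpower_quotient[OF _ W \<Sigma>])
  fix p
  note c = upper.congruence_minors[OF \<Sigma> W chol_upper[OF \<Sigma>]]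
  show "lead_det p (minv (ctrans (chol_upper \<Sigma>)) \<odot> W \<odot> minv (chol_upper \<Sigma>)) = lead_det p W / lead_det p \<Sigma>"
    unfolding lead_det_gdet[OF c(1)] lead_det_gdet[OF W] lead_det_gdet[OF \<Sigma>]
    by (rule c(2)) (auto simp: leading_eq)
qed

text \<open>By Jacobi's identity, leading minors of an inverse are complementary minors of the
  matrix divided by its determinant. Complements of leading sets are initial segments for
  \<open>lower_rank\<close>, which is why type II pairs with the lower triangular factor.\<close>

lemma gpower_congruence_lower:
  fixes \<Sigma> W :: "('a, 'm, 'm) mtx"
  assumes \<Sigma>: "\<Sigma> \<in> pos_def" and W: "W \<in> pos_def"
  shows "gpower \<kappa> (minv (minv (ctrans (chol_lower \<Sigma>)) \<odot> W \<odot> minv (chol_lower \<Sigma>))) =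
    gpower \<kappa> (minv W) / gpower \<kappa> (minv \<Sigma>)"
proof (rule gpower_quotient[OF _ lower.pos_def_minv(1)[OF W] lower.pos_def_minv(1)[OF \<Sigma>]])
  fix p
  let ?X = "minv (ctrans (chol_lower \<Sigma>)) \<odot> W \<odot> minv (chol_lower \<Sigma>)"
  note c = lower.congruence_minors[OF \<Sigma> W chol_lower[OF \<Sigma>]]
  have "gdet (pad (- leading p) ?X) = gdet (pad (- leading p) W) / gdet (pad (- leading p) \<Sigma>)"
  proof (rule c(2))
    fix i k :: 'm assume "i \<notin> - leading p" "k \<in> - leading p"
    then have "upper_rank i < upper_rank k" by (simp add: leading_eq)
    then show "lower_rank k < lower_rank i" by (simp add: upper_rank_less_iff lower_rank_less_iff)
  qed
  moreover have "gdet ?X = gdet W / gdet \<Sigma>" using c(2)[of UNIV] by simp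
  ultimately show "lead_det p (minv ?X) = lead_det p (minv W) / lead_det p (minv \<Sigma>)"
    unfolding lead_det_minv[OF c(1)] lead_det_minv[OF W] lead_det_minv[OF \<Sigma>] by simp
qed

section \<open>Homogeneity and measurability of determinants and generalised powers\<close>

lemma pos_def_scaleR: "s > 0 \<Longrightarrow> A \<in> pos_def \<Longrightarrow> s *\<^sub>R (A :: ('a, 'm, 'm) mtx) \<in> pos_def"
  by (auto simp: pos_def_iff hermitian_nth nda_cnj_scaleR mvmul_scaleR_left)

lemma pos_def_scaleR_iff: "s > 0 \<Longrightarrow> s *\<^sub>R (A :: ('a, 'm, 'm) mtx) \<in> pos_def \<longleftrightarrow> A \<in> pos_def"
  using pos_def_scaleR[of s A] pos_def_scaleR[of "inverse s" "s *\<^sub>R A"] by auto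

lemma lead_det_scaleR:
  fixes A :: "('a, 'm, 'm) mtx"
  assumes "s > 0" "A \<in> pos_def" "p \<le> CARD('m)"
  shows "lead_det p (s *\<^sub>R A) = s ^ p * lead_det p A"
  using gdet_pad_scaleR[OF assms(1,2), of "leading p"]
  by (simp add: lead_det_gdet[OF pos_def_scaleR[OF assms(1,2)]] lead_det_gdet[OF assms(2)] card_leading[OF assms(3)])

lemma minv_scaleR:
  fixes A :: "('a, 'm, 'm) mtx"
  assumes "s > 0" "A \<in> pos_def"
  shows "minv (s *\<^sub>R A) = inverse s *\<^sub>R minv A"
  using upper.pos_def_minv(3,4)[OF assms(2)] assms
  by (intro upper.minv_eqI pos_def_inj[OF pos_def_scaleR])
     (simp_all add: mmul_scaleR_left mmul_scaleR_right)

text \<open>The left side is the degree of homogeneity of \<open>gpower\<close>: a leading minor of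
  size i has degree i and exponent \<open>\<kappa> i - \<kappa> (i + 1)\<close>, the last one
  \<open>\<kappa> (Suc m)\<close>.\<close>

lemma abel_summation: "(\<Sum>i = 1..m. real i * (\<kappa> i - \<kappa> (i + 1))) + real (Suc m) * \<kappa> (Suc m) = (\<Sum>i = 1..Suc m. \<kappa> i)"
  by (induction m) (auto simp: algebra_simps)

lemma gpower_scaleR:
  fixes A :: "('a, 'm, 'm) mtx"
  assumes s: "s > 0" and A: "A \<in> pos_def"
  shows "gpower \<kappa> (s *\<^sub>R A) = s powr (\<Sum>i = 1..CARD('m). \<kappa> i) * gpower \<kappa> A"
proof -
  obtain m where m: "CARD('m) = Suc m" by (metis not0_implies_Suc zero_less_card_finite less_irrefl)
  have d: "lead_det p (s *\<^sub>R A) powr x = s powr (real p * x) * lead_det p A powr x" if "p \<le> CARD('m)" for p x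
    using s lead_det_pos[OF A, of p]
    by (simp add: lead_det_scaleR[OF s A that] powr_mult powr_realpow[symmetric] powr_powr)
  have "(\<Prod>i = 1..m. lead_det i (s *\<^sub>R A) powr (\<kappa> i - \<kappa> (i + 1)))
    = (\<Prod>i = 1..m. s powr (real i * (\<kappa> i - \<kappa> (i + 1))) * lead_det i A powr (\<kappa> i - \<kappa> (i + 1)))"
    by (intro prod.cong refl d) (simp add: m)
  also have "\<dots> = s powr (\<Sum>i = 1..m. real i * (\<kappa> i - \<kappa> (i + 1))) * (\<Prod>i = 1..m. lead_det i A powr (\<kappa> i - \<kappa> (i + 1)))"
    using s by (simp add: prod.distrib powr_sum)
  finally have "gpower \<kappa> (s *\<^sub>R A) = s powr ((\<Sum>i = 1..m. real i * (\<kappa> i - \<kappa> (i + 1))) + real (Suc m) * \<kappa> (Suc m)) * gpower \<kappa> A"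
    unfolding gpower_def by (simp add: d m powr_add)
  then show ?thesis unfolding abel_summation m .
qed

lemma gpower_minv_scaleR:
  fixes A :: "('a, 'm, 'm) mtx"
  assumes s: "s > 0" and A: "A \<in> pos_def"
  shows "gpower \<kappa> (minv (s *\<^sub>R A)) = s powr (- (\<Sum>i = 1..CARD('m). \<kappa> i)) * gpower \<kappa> (minv A)"
  using gpower_scaleR[OF _ upper.pos_def_minv(1)[OF A], of "inverse s" \<kappa>] s
  by (simp add: minv_scaleR[OF s A] powr_minus inverse_powr)

lemma hdet_scaleR:
  fixes A :: "('a, 'm, 'm) mtx"
  shows "s > 0 \<Longrightarrow> A \<in> pos_def \<Longrightarrow> hdet (s *\<^sub>R A) = s ^ CARD('m) * hdet A"
  by (simp add: hdet_def lead_det_scaleR)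

text \<open>\<open>gpower\<close> is defined through eigenspaces; on \<open>pos_def\<close> it
  agrees with an expression in \<open>gdet\<close> that is Borel on the whole matrix space.
  Densities are compared through that representative.\<close>

lemma gpower_measurable:
  obtains G where "G \<in> borel_measurable borel" "\<And>A :: ('a, 'm, 'm) mtx. A \<in> pos_def \<Longrightarrow> gpower \<kappa> A = G A"
proof
  show "(\<lambda>A :: ('a, 'm, 'm) mtx. gdet (pad (leading CARD('m)) A) powr \<kappa> CARD('m) *
      (\<Prod>i = 1..CARD('m) - 1. gdet (pad (leading i) A) powr (\<kappa> i - \<kappa> (i + 1)))) \<in> borel_measurable borel"
    by measurable
qed (simp add: gpower_def lead_det_gdet)

lemma gpower_minv_measurable:
  obtains G where "G \<in> borel_measurable borel" "\<And>A :: ('a, 'm, 'm) mtx. A \<in> pos_def \<Longrightarrow> gpower \<kappa> (minv A) = G A"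
proof
  show "(\<lambda>A :: ('a, 'm, 'm) mtx. (gdet (pad (- leading CARD('m)) A) / gdet A) powr \<kappa> CARD('m) *
      (\<Prod>i = 1..CARD('m) - 1. (gdet (pad (- leading i) A) / gdet A) powr (\<kappa> i - \<kappa> (i + 1)))) \<in> borel_measurable borel"
    by measurable
qed (simp add: gpower_def lead_det_minv)

end

section \<open>Non-associative algebras\<close>

text \<open>If \<open>m \<ge> 3\<close> and \<open>(x y) z \<noteq> x (y z)\<close>, the Gram matrix of the row \<open>(1, x\<^sup>*, y)\<close> takes the value
  \<open>- 2 \<bar>(x y) z - x (y z)\<bar>\<^sup>2\<close> on a suitable vector with last entry \<open>z\<close>. By continuity the Gram matrix fails
  to be positive definite on a nonempty open set.\<close>

lemma nonassociative_gram:
  assumes na: "(x * y) * z \<noteq> x * (y * (z :: 'a::normed_division_algebra))" and m: "CARD('m::finite) > 2"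
  shows "\<not> (AE A in (lborel :: ('a, 'n::finite, 'm) mtx measure). ctrans A \<odot> A \<in> pos_def)"
proof
  assume ae: "AE A in (lborel :: ('a, 'n, 'm) mtx measure). ctrans A \<odot> A \<in> pos_def"
  obtain K where K: "K \<subseteq> (UNIV :: 'm set)" "card K = 3"
    using obtain_subset_with_card_n[of 3 "UNIV :: 'm set"] m by auto
  then obtain a b c :: 'm where abc: "a \<noteq> b" "a \<noteq> c" "b \<noteq> c" by (auto simp: card_3_iff)
  define d where "d = (x * y) * z - x * (y * z)"
  have d: "d \<noteq> 0" using na by (simp add: d_def)
  \<comment> \<open>The entry at \<open>a\<close> is chosen to cancel row \<open>a\<close> of the
    Gram matrix applied to \<open>v\<close>; with \<open>- d\<close> at \<open>b\<close> and
    \<open>z\<close> at \<open>c\<close>, rows \<open>b\<close> and \<open>c\<close> each contribute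
    - |d|^2.\<close>
  define v where "v = (\<chi> i. if i = a then nda_cnj x * d - y * z else if i = b then - d else if i = c then z else 0)"
  obtain k0 :: 'n where True by blast
  define A0 :: "('a, 'n, 'm) mtx" where
    "A0 = (\<chi> k i. if k = k0 then if i = a then 1 else if i = b then nda_cnj x else if i = c then y else 0 else 0)"
  let ?q = "\<lambda>A :: ('a, 'n, 'm) mtx. v \<bullet> mvmul (ctrans A \<odot> A) v"
  have vn: "v $ a = nda_cnj x * d - y * z" "v $ b = - d" "v $ c = z" "\<And>i. i \<noteq> a \<Longrightarrow> i \<noteq> b \<Longrightarrow> i \<noteq> c \<Longrightarrow> v $ i = 0"
    using abc by (auto simp: v_def)
  have An: "A0 $ k0 $ a = 1" "A0 $ k0 $ b = nda_cnj x" "A0 $ k0 $ c = y"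
    using abc by (auto simp: A0_def)
  have G: "(ctrans A0 \<odot> A0) $ i $ j = nda_cnj (A0 $ k0 $ i) * A0 $ k0 $ j" for i j
  proof -
    have "(\<Sum>k\<in>UNIV. nda_cnj (A0 $ k $ i) * A0 $ k $ j) = (\<Sum>k\<in>{k0}. nda_cnj (A0 $ k $ i) * A0 $ k $ j)"
      by (rule sum.mono_neutral_right) (auto simp: A0_def nda_mult.zero_right)
    then show ?thesis by (simp add: mmul_nth ctrans_def)
  qed
  have sum3: "(\<Sum>i\<in>UNIV. g i) = g a + g b + g c" if "\<And>i. i \<noteq> a \<Longrightarrow> i \<noteq> b \<Longrightarrow> i \<noteq> c \<Longrightarrow> g i = 0" for g :: "'m \<Rightarrow> 'z::ab_group_add"
  proof -
    have "(\<Sum>i\<in>UNIV. g i) = (\<Sum>i\<in>{a, b, c}. g i)" by (rule sum.mono_neutral_right) (use that in auto)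
    then show ?thesis using abc by (simp add: add.assoc)
  qed
  have mv: "mvmul (ctrans A0 \<odot> A0) v $ i = (nda_cnj (A0 $ k0 $ i) * A0 $ k0 $ a) * v $ a +
      (nda_cnj (A0 $ k0 $ i) * A0 $ k0 $ b) * v $ b + (nda_cnj (A0 $ k0 $ i) * A0 $ k0 $ c) * v $ c" for i
    unfolding mvmul_nth G by (rule sum3) (simp add: vn nda_mult.zero_right)
  have q0: "?q A0 = - 2 * (d \<bullet> d)"
  proof -
    have "?q A0 = v $ a \<bullet> mvmul (ctrans A0 \<odot> A0) v $ a + v $ b \<bullet> mvmul (ctrans A0 \<odot> A0) v $ b +
        v $ c \<bullet> mvmul (ctrans A0 \<odot> A0) v $ c"
      unfolding inner_vec_def by (rule sum3) (simp add: vn)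
    also have "mvmul (ctrans A0 \<odot> A0) v $ a = 0"
      unfolding mv An vn by (simp add: nda_one_left nda_mult.minus_right)
    also have "mvmul (ctrans A0 \<odot> A0) v $ b = d"
      unfolding mv An vn
      by (simp add: nda_one_right nda_mult.diff_right nda_mult_cnj_cancel nda_mult_cnj_self nda_scaleR_left nda_one_left
          nda_mult.minus_right d_def)
    also have "mvmul (ctrans A0 \<odot> A0) v $ c = nda_cnj y * (nda_cnj x * d) - (nda_cnj y * nda_cnj x) * d"
      unfolding mv An vn
      by (simp add: nda_one_right nda_mult.diff_right nda_cnj_mult_cancel nda_cnj_mult_self nda_scaleR_left nda_one_left
          nda_mult.minus_right)
    also have "v $ c \<bullet> (nda_cnj y * (nda_cnj x * d) - (nda_cnj y * nda_cnj x) * d) = - (d \<bullet> d)"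
    proof -
      have "z \<bullet> (nda_cnj y * (nda_cnj x * d)) = (x * (y * z)) \<bullet> d"
        by (simp only: nda_adjoint_left)
      moreover have "z \<bullet> ((nda_cnj y * nda_cnj x) * d) = ((x * y) * z) \<bullet> d"
        by (simp only: nda_adjoint_left nda_cnj_mult)
      ultimately have "z \<bullet> (nda_cnj y * (nda_cnj x * d) - (nda_cnj y * nda_cnj x) * d) = - (d \<bullet> d)"
        unfolding inner_diff_right by (simp add: d_def inner_diff_left)
      then show ?thesis by (simp add: vn)
    qed
    finally show ?thesis by (simp add: vn)
  qed
  have cont: "continuous_on UNIV ?q"
    unfolding inner_vec_def mvmul_nth mmul_nth ctrans_def
    by (simp, intro continuous_intros nda_mult.continuous_on linear_continuous_on_compose[OF _ linear_nda_cnj])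
  have op: "open {A. ?q A < 0}" using cont by (intro open_Collect_less) auto
  have "A0 \<in> {A. ?q A < 0}" using q0 d by simp
  then obtain e where e: "e > 0" "ball A0 e \<subseteq> {A. ?q A < 0}" using op open_contains_ball by blast
  have "v \<noteq> 0" using d vn(2) by auto
  have "AE A in lborel. A \<notin> ball A0 e"
    using ae
  proof eventually_elim
    case (elim A)
    then have "?q A > 0" using \<open>v \<noteq> 0\<close> unfolding pos_def_iff by blast
    then have "A \<notin> {A. ?q A < 0}" by simp
    then show ?case using e(2) by blast
  qed
  then have "emeasure lborel (ball A0 e) = 0"
    using AE_iff_measurable[of "ball A0 e" lborel "\<lambda>A. A \<notin> ball A0 e"] by (simp del: mem_ball)
  moreover have "emeasure lborel (ball A0 e) \<noteq> 0"
    using content_ball_pos[OF e(1), of A0] by (auto simp: measure_def)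
  ultimately show False by simp
qed

section \<open>The scale mixture\<close>

text \<open>A converse to \<open>gamma_nn_integral\<close>: the integral diverges at 0 unless e > 0
  and then at infinity unless b > 0. It turns finiteness of the mixture density into positivity of
  its parameters.\<close>

lemma gamma_integral_finiteD:
  assumes fin: "(\<integral>\<^sup>+s. ennreal (indicator {0<..} s * s powr (e - 1) * exp (- b * s)) \<partial>lborel) < \<infinity>"
  shows "e > 0" "b > 0"
proof -
  let ?I = "\<integral>\<^sup>+s. ennreal (indicator {0<..} s * s powr (e - 1) * exp (- b * s)) \<partial>lborel"
  obtain r where r: "?I = ennreal r" "r \<ge> 0" using fin by (cases ?I) auto
  show e: "e > 0"
  proof (rule ccontr)
    assume "\<not> e > 0"
    then have e0: "e \<le> 0" by simp
    \<comment> \<open>On (0, 1] the integrand dominates exp(- |b|) s^(e' - 1) for every e' > 0, and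
      the integral of the latter grows without bound as e' tends to 0.\<close>
    have "exp (- \<bar>b\<bar>) / e' \<le> r" if e': "e' > 0" for e'
    proof -
      have "ennreal (exp (- \<bar>b\<bar>)) * ennreal (1 / e') =
          ennreal (exp (- \<bar>b\<bar>)) * (\<integral>\<^sup>+s. ennreal (indicator {0<..} s * s powr (e' - 1)) * indicator {..1} s \<partial>lborel)"
        using powr_nn_integral[OF e', of 1] by simp
      also have "\<dots> = (\<integral>\<^sup>+s. ennreal (exp (- \<bar>b\<bar>)) * (ennreal (indicator {0<..} s * s powr (e' - 1)) * indicator {..1} s) \<partial>lborel)"
        by (rule nn_integral_cmult[symmetric]) measurable
      also have "\<dots> \<le> ?I"
      proof (rule nn_integral_mono)
        fix s :: real
        show "ennreal (exp (- \<bar>b\<bar>)) * (ennreal (indicator {0<..} s * s powr (e' - 1)) * indicator {..1} s)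
            \<le> ennreal (indicator {0<..} s * s powr (e - 1) * exp (- b * s))"
        proof (cases "0 < s \<and> s \<le> 1")
          case True
          have "s powr (e' - 1) \<le> s powr (e - 1)"
            using True e0 e' by (intro powr_mono') auto
          moreover have "exp (- \<bar>b\<bar>) \<le> exp (- b * s)"
          proof -
            have "b * s \<le> \<bar>b\<bar> * s" using True by (intro mult_right_mono) auto
            also have "\<dots> \<le> \<bar>b\<bar> * 1" using True by (intro mult_left_mono) auto
            finally show ?thesis by simp
          qed
          ultimately have "exp (- \<bar>b\<bar>) * s powr (e' - 1) \<le> s powr (e - 1) * exp (- b * s)"
            by (subst mult.commute) (intro mult_mono, auto)
          then show ?thesis using True by (simp add: ennreal_leI flip: ennreal_mult)
        qed (auto simp: indicator_def)
      qed
      finally have "ennreal (exp (- \<bar>b\<bar>) / e') \<le> ennreal r" using e' r by (simp flip: ennreal_mult)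
      then show ?thesis using r by (simp add: ennreal_le_iff)
    qed
    \<comment> \<open>This e' makes the lower bound equal to r + 1.\<close>
    from this[of "exp (- \<bar>b\<bar>) / (r + 1)"] have "r + 1 \<le> r" using r(2) by simp
    then show False by simp
  qed
  show "b > 0"
  proof (rule ccontr)
    assume "\<not> b > 0"
    then have b: "b \<le> 0" by simp
    have "R powr e / e \<le> r" if R: "R \<ge> 0" for R
    proof -
      have "ennreal (R powr e / e) = (\<integral>\<^sup>+s. ennreal (indicator {0<..} s * s powr (e - 1)) * indicator {..R} s \<partial>lborel)"
        using powr_nn_integral[OF e R] by simp
      also have "\<dots> \<le> ?I"
      proof (rule nn_integral_mono)
        fix s :: real
        show "ennreal (indicator {0<..} s * s powr (e - 1)) * indicator {..R} s
            \<le> ennreal (indicator {0<..} s * s powr (e - 1) * exp (- b * s))"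
        proof (cases "0 < s \<and> s \<le> R")
          case True
          have "b * s \<le> 0" using b True by (simp add: mult_nonpos_nonneg)
          then have "1 \<le> exp (- b * s)" by simp
          then have "s powr (e - 1) * 1 \<le> s powr (e - 1) * exp (- b * s)" by (intro mult_left_mono) auto
          then show ?thesis using True by (simp add: ennreal_leI)
        qed (auto simp: indicator_def)
      qed
      finally show ?thesis using r by (simp add: ennreal_le_iff)
    qed
    \<comment> \<open>This R makes R^e / e equal to r + 1.\<close>
    from this[of "(e * (r + 1)) powr (1 / e)"] have "e * (r + 1) / e \<le> r"
      using e r(2) by (simp add: powr_powr)
    then show False using e by simp
  qed
qed

text \<open>For each further column the two Gamma factors cancel and the exponents of \<pi> add up
  to n \<beta> / 2. This turns the constant of the Kotz-Riesz density into that of the Riesz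
  density.\<close>

lemma gram_const_mGamma:
  assumes "\<beta> > 0" "m \<le> n"
  shows "gram_const (real n) \<beta> m * mGamma \<beta> m (real n * \<beta> / 2) = pi powr (real m * real n * \<beta> / 2)"
proof -
  have "gram_const (real n) \<beta> m * mGamma \<beta> m (real n * \<beta> / 2) = pi powr (real m * real n * \<beta> / 2)"
    using assms(2)
  proof (induction m)
    case 0
    show ?case by (simp add: gram_const_def mGamma_def)
  next
    case (Suc m)
    let ?x = "(real n - real m) * \<beta> / 2"
    have g: "Gamma ?x > 0" using Suc.prems assms(1) by (intro Gamma_real_pos) simp
    have arg: "real n * \<beta> / 2 - real m * \<beta> / 2 = ?x" by (simp add: algebra_simps diff_divide_distrib)
    have e1: "real (Suc m) * (real (Suc m) - 1) * \<beta> / 4 = real m * \<beta> / 2 + real m * (real m - 1) * \<beta> / 4"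
      by (simp add: field_simps)
    have 1: "mGamma \<beta> (Suc m) (real n * \<beta> / 2) = pi powr (real m * \<beta> / 2) * Gamma ?x * mGamma \<beta> m (real n * \<beta> / 2)"
      unfolding mGamma_def e1 powr_add by (simp add: arg)
    have 2: "gram_const (real n) \<beta> (Suc m) = gram_const (real n) \<beta> m * (pi powr ?x / Gamma ?x)"
      by (simp add: gram_const_def)
    have "gram_const (real n) \<beta> (Suc m) * mGamma \<beta> (Suc m) (real n * \<beta> / 2)
      = pi powr ?x * pi powr (real m * \<beta> / 2) * (gram_const (real n) \<beta> m * mGamma \<beta> m (real n * \<beta> / 2))"
      unfolding 1 2 using g by simp
    also have "\<dots> = pi powr (?x + real m * \<beta> / 2 + real m * real n * \<beta> / 2)"
      using Suc by (simp add: powr_add)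
    also have "?x + real m * \<beta> / 2 + real m * real n * \<beta> / 2 = real (Suc m) * real n * \<beta> / 2"
      by (simp add: field_simps)
    finally show ?case .
  qed
  then show ?thesis .
qed

section \<open>Lebesgue measure on Hermitian matrices and the laws of \<open>W\<close> and
  \<open>F\<close>\<close>

context good_ordered
begin

lemma sets_herm_lborel [measurable_cong]: "sets (herm_lborel :: ('a, 'm, 'm) mtx measure) = sets borel"
  by (simp add: herm_lborel_def)

lemma space_herm_lborel [simp]: "space (herm_lborel :: ('a, 'm, 'm) mtx measure) = UNIV"
  by (simp add: herm_lborel_def)

abbreviation coord :: "(('m \<Rightarrow> real) \<times> ('m \<times> 'm \<Rightarrow> 'a)) measure" where
  "coord \<equiv> PiM UNIV (\<lambda>_. lborel) \<Otimes>\<^sub>M PiM {p. snd p < fst p} (\<lambda>_. lborel)"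

lemma herm_of_measurable [measurable]: "herm_of \<in> coord \<rightarrow>\<^sub>M (borel :: ('a, 'm, 'm) mtx measure)"
  using borel_measurable_pad_herm_of[of UNIV fst coord snd] by (simp add: below_pairs_UNIV)

lemma nn_integral_herm_lborel:
  "h \<in> borel_measurable borel \<Longrightarrow> (\<integral>\<^sup>+X. h X \<partial>(herm_lborel :: ('a, 'm, 'm) mtx measure)) = (\<integral>\<^sup>+z. h (herm_of z) \<partial>coord)"
  unfolding herm_lborel_def by (rule nn_integral_distr) measurable

lemma sigma_finite_coord: "sigma_finite_measure coord"
proof -
  interpret d: product_sigma_finite "\<lambda>_::'m. lborel :: real measure"
    by (simp add: product_sigma_finite_def sigma_finite_lborel)
  interpret l: product_sigma_finite "\<lambda>_::'m \<times> 'm. lborel :: 'a measure"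
    by (simp add: product_sigma_finite_def sigma_finite_lborel)
  interpret D: sigma_finite_measure "PiM (UNIV :: 'm set) (\<lambda>_. lborel :: real measure)" by (rule d.sigma_finite) simp
  interpret L: sigma_finite_measure "PiM {p :: 'm \<times> 'm. snd p < fst p} (\<lambda>_. lborel :: 'a measure)"
    by (rule l.sigma_finite) simp
  interpret pair_sigma_finite "PiM (UNIV :: 'm set) (\<lambda>_. lborel :: real measure)"
    "PiM {p :: 'm \<times> 'm. snd p < fst p} (\<lambda>_. lborel :: 'a measure)" ..
  show ?thesis ..
qed

lemma card_below_pairs: "2 * card {p :: 'm \<times> 'm. snd p < fst p} + CARD('m) = CARD('m) * CARD('m)"
proof -
  let ?A = "{p :: 'm \<times> 'm. snd p < fst p}" and ?B = "{p :: 'm \<times> 'm. fst p < snd p}" and ?D = "{p :: 'm \<times> 'm. fst p = snd p}"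
  have "bij_betw prod.swap ?A ?B" by (rule bij_betwI[where g = prod.swap]) auto
  then have AB: "card ?A = card ?B" by (rule bij_betw_same_card)
  have "bij_betw (\<lambda>i. (i, i)) (UNIV :: 'm set) ?D" by (rule bij_betwI[where g = fst]) auto
  then have D: "card ?D = CARD('m)" by (metis bij_betw_same_card)
  have "card (?A \<union> ?B \<union> ?D) = card ?A + card ?B + card ?D"
    by (subst card_Un_disjoint, simp, simp, fastforce)+ simp
  moreover have "?A \<union> ?B \<union> ?D = UNIV" by auto
  moreover have "CARD('m \<times> 'm) = CARD('m) * CARD('m)" by simp
  ultimately show ?thesis using AB D by simp
qed

definition herm_dim :: real where "herm_dim = real CARD('m) + real CARD('m) * (real CARD('m) - 1) * real DIM('a) / 2"

lemma nn_integral_herm_lborel_scale: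
  fixes h :: "('a, 'm, 'm) mtx \<Rightarrow> ennreal"
  assumes s: "s > 0" and h [measurable]: "h \<in> borel_measurable borel"
  shows "(\<integral>\<^sup>+X. h X \<partial>herm_lborel) = ennreal (s powr herm_dim) * (\<integral>\<^sup>+X. h (s *\<^sub>R X) \<partial>herm_lborel)"
proof -
  let ?D = "PiM (UNIV :: 'm set) (\<lambda>_. lborel :: real measure)"
  let ?P = "{p :: 'm \<times> 'm. snd p < fst p}"
  let ?L = "PiM ?P (\<lambda>_. lborel :: 'a measure)"
  interpret l: product_sigma_finite "\<lambda>_::'m \<times> 'm. lborel :: 'a measure"
    by (simp add: product_sigma_finite_def sigma_finite_lborel)
  interpret L: sigma_finite_measure ?L by (rule l.sigma_finite) simp
  have sc: "herm_of (\<lambda>i\<in>UNIV. s *\<^sub>R d i, \<lambda>p\<in>?P. s *\<^sub>R l p) = s *\<^sub>R (herm_of (d, l) :: ('a, 'm, 'm) mtx)" for d l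
    by (auto simp: herm_of_def vec_eq_iff nda_cnj_scaleR)
  have m1: "(\<lambda>l. h (herm_of (d, l))) \<in> borel_measurable ?L" if "d \<in> space ?D" for d
    using that by measurable
  have m2: "(\<lambda>d. \<integral>\<^sup>+l. h (herm_of (d, \<lambda>p\<in>?P. s *\<^sub>R l p)) \<partial>?L) \<in> borel_measurable ?D"
  proof (rule L.borel_measurable_nn_integral)
    have [measurable]: "(\<lambda>l. \<lambda>p\<in>?P. s *\<^sub>R l p) \<in> ?L \<rightarrow>\<^sub>M ?L" by (rule measurable_restrict) measurable
    show "(\<lambda>(d, l). h (herm_of (d, \<lambda>p\<in>?P. s *\<^sub>R l p))) \<in> borel_measurable (?D \<Otimes>\<^sub>M ?L)" by measurable
  qed
  have m3: "(\<lambda>X. h (s *\<^sub>R X)) \<in> borel_measurable borel" by measurable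
  have "(\<integral>\<^sup>+X. h X \<partial>herm_lborel) = (\<integral>\<^sup>+d. \<integral>\<^sup>+l. h (herm_of (d, l)) \<partial>?L \<partial>?D)"
    unfolding nn_integral_herm_lborel[OF h] by (rule L.nn_integral_fst[symmetric]) measurable
  also have "\<dots> = (\<integral>\<^sup>+d. (\<integral>\<^sup>+l. h (herm_of (d, \<lambda>p\<in>?P. s *\<^sub>R l p)) \<partial>?L) * ennreal (s ^ (card ?P * DIM('a))) \<partial>?D)"
    by (intro nn_integral_cong nn_integral_PiM_lborel_scale[OF s _ m1, symmetric]) auto
  also have "\<dots> = (\<integral>\<^sup>+d. (\<integral>\<^sup>+l. h (herm_of (d, \<lambda>p\<in>?P. s *\<^sub>R l p)) \<partial>?L) \<partial>?D) * ennreal (s ^ (card ?P * DIM('a)))"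
    by (rule nn_integral_multc[OF m2])
  also have "(\<integral>\<^sup>+d. (\<integral>\<^sup>+l. h (herm_of (d, \<lambda>p\<in>?P. s *\<^sub>R l p)) \<partial>?L) \<partial>?D)
    = (\<integral>\<^sup>+d. (\<integral>\<^sup>+l. h (herm_of (\<lambda>i\<in>UNIV. s *\<^sub>R d i, \<lambda>p\<in>?P. s *\<^sub>R l p)) \<partial>?L) \<partial>?D) * ennreal (s ^ (CARD('m) * DIM(real)))"
    by (rule nn_integral_PiM_lborel_scale[OF s _ m2, symmetric]) simp
  also have "(\<integral>\<^sup>+d. (\<integral>\<^sup>+l. h (herm_of (\<lambda>i\<in>UNIV. s *\<^sub>R d i, \<lambda>p\<in>?P. s *\<^sub>R l p)) \<partial>?L) \<partial>?D) = (\<integral>\<^sup>+X. h (s *\<^sub>R X) \<partial>herm_lborel)"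
    unfolding sc nn_integral_herm_lborel[OF m3] by (rule L.nn_integral_fst) measurable
  finally have "(\<integral>\<^sup>+X. h X \<partial>herm_lborel) = (\<integral>\<^sup>+X. h (s *\<^sub>R X) \<partial>herm_lborel) *
      (ennreal (s ^ (CARD('m) * DIM(real))) * ennreal (s ^ (card ?P * DIM('a))))" by (simp only: mult.assoc)
  also have "ennreal (s ^ (CARD('m) * DIM(real))) * ennreal (s ^ (card ?P * DIM('a))) = ennreal (s powr herm_dim)"
  proof -
    have "real (2 * card ?P + CARD('m)) = real (CARD('m) * CARD('m))" by (simp only: card_below_pairs)
    then have "real (card ?P) = real CARD('m) * (real CARD('m) - 1) / 2" by (simp add: algebra_simps)
    then have hd: "herm_dim = real CARD('m) + real (card ?P) * real DIM('a)" by (simp add: herm_dim_def)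
    have "s ^ CARD('m) * s ^ (card ?P * DIM('a)) = s powr herm_dim"
      unfolding hd powr_add using s by (simp add: powr_realpow[symmetric])
    then show ?thesis using s by (simp flip: ennreal_mult)
  qed
  finally show ?thesis by (simp only: mult.commute)
qed

lemma rtr_scaleR: "rtr (B \<odot> (s *\<^sub>R X)) = s * rtr (B \<odot> X)"
  for B X :: "('a, 'm, 'm) mtx"
  by (simp add: mmul_scaleR_right rtr_def nda_re_def inner_sum_left sum_distrib_left)

lemma etr_eq: "etr (- \<beta> *\<^sub>R (A :: ('a, 'm, 'm) mtx)) = exp (- \<beta> * rtr A)"
  by (simp add: etr_def rtr_def nda_re_def inner_sum_left sum_distrib_left sum_negf)

lemma rtr_measurable [measurable (raw)]:
  assumes [measurable]: "f \<in> borel_measurable M"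
  shows "(\<lambda>x. rtr (f x :: ('a, 'm, 'm) mtx)) \<in> borel_measurable M"
  unfolding rtr_def nda_re_def by measurable

text \<open>The density of \<open>Y\<close> has to factor through the Gram matrix where the latter
  is positive definite; the integral formula itself, tested on the complement of
  \<open>pos_def\<close>, shows that this is almost everywhere.\<close>

lemma distributed_gram:
  fixes Y :: "'w \<Rightarrow> ('a, 'n::finite, 'm) mtx" and h :: "('a, 'n, 'm) mtx \<Rightarrow> real" and h' :: "('a, 'm, 'm) mtx \<Rightarrow> real"
  assumes Y: "distributed M lborel Y (\<lambda>A. ennreal (h A))" and mn: "CARD('m) \<le> CARD('n)"
    and [measurable]: "h' \<in> borel_measurable borel"
    and hh': "\<And>A. ctrans A \<odot> A \<in> pos_def \<Longrightarrow> h A = h' (ctrans A \<odot> A)"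
  shows "distributed M herm_lborel (\<lambda>x. ctrans (Y x) \<odot> Y x) (\<lambda>X. ennreal (h' X) * gram_density CARD('n) CARD('m) X)"
proof -
  have Ym [measurable]: "Y \<in> M \<rightarrow>\<^sub>M borel" and hm [measurable]: "(\<lambda>A. ennreal (h A)) \<in> borel_measurable borel"
    and dY: "distr M lborel Y = density lborel (\<lambda>A. ennreal (h A))"
    using Y by (auto simp: distributed_def)
  have gm [measurable]: "(\<lambda>A :: ('a, 'n, 'm) mtx. ctrans A \<odot> A) \<in> borel \<rightarrow>\<^sub>M borel" by measurable
  have pd: "AE A in (lborel :: ('a, 'n, 'm) mtx measure). ctrans A \<odot> A \<in> pos_def"
  proof -
    have z: "indicator (- pos_def) X * gram_density CARD('n) CARD('m) X = 0" for X :: "('a, 'm, 'm) mtx"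
      by (auto simp: gram_density_def indicator_def)
    have "(\<integral>\<^sup>+A. indicator (- pos_def) (ctrans A \<odot> A) \<partial>(lborel :: ('a, 'n, 'm) mtx measure)) =
        (\<integral>\<^sup>+X. indicator (- pos_def) X * gram_density CARD('n) CARD('m) (X :: ('a, 'm, 'm) mtx) \<partial>herm_lborel)"
      by (rule nn_integral_gram[OF good mn]) measurable
    also have "\<dots> = 0" unfolding z by simp
    finally have "AE A in (lborel :: ('a, 'n, 'm) mtx measure). indicator (- pos_def) (ctrans A \<odot> A) = (0::ennreal)"
      by (subst (asm) nn_integral_0_iff_AE) auto
    then show ?thesis by eventually_elim (auto simp: indicator_def split: if_splits)
  qed
  have "distr M herm_lborel (\<lambda>x. ctrans (Y x) \<odot> Y x) = density herm_lborel (\<lambda>X. ennreal (h' X) * gram_density CARD('n) CARD('m) X)"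
  proof (rule measure_eqI)
    show "sets (distr M herm_lborel (\<lambda>x. ctrans (Y x) \<odot> Y x)) =
        sets (density herm_lborel (\<lambda>X. ennreal (h' X) * gram_density CARD('n) CARD('m) X))" by simp
    fix B assume "B \<in> sets (distr M herm_lborel (\<lambda>x. ctrans (Y x) \<odot> Y x))"
    then have B [measurable]: "B \<in> sets borel" by (simp add: sets_herm_lborel)
    have "emeasure (distr M herm_lborel (\<lambda>x. ctrans (Y x) \<odot> Y x)) B
      = (\<integral>\<^sup>+X. indicator B X \<partial>distr M herm_lborel (\<lambda>x. ctrans (Y x) \<odot> Y x))" by (simp add: sets_herm_lborel)
    also have "\<dots> = (\<integral>\<^sup>+x. indicator B (ctrans (Y x) \<odot> Y x) \<partial>M)" by (rule nn_integral_distr) measurable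
    also have "\<dots> = (\<integral>\<^sup>+A. indicator B (ctrans A \<odot> A) \<partial>distr M lborel Y)"
      by (rule nn_integral_distr[symmetric]) measurable
    also have "\<dots> = (\<integral>\<^sup>+A. ennreal (h A) * indicator B (ctrans A \<odot> A) \<partial>lborel)"
      unfolding dY by (rule nn_integral_density) measurable
    also have "\<dots> = (\<integral>\<^sup>+A. ennreal (h' (ctrans A \<odot> A)) * indicator B (ctrans A \<odot> A) \<partial>(lborel :: ('a, 'n, 'm) mtx measure))"
      by (rule nn_integral_cong_AE) (use pd in eventually_elim, simp add: hh')
    also have "\<dots> = (\<integral>\<^sup>+X. ennreal (h' X) * indicator B X * gram_density CARD('n) CARD('m) X \<partial>herm_lborel)"
      by (rule nn_integral_gram[OF good mn, of "\<lambda>X. ennreal (h' X) * indicator B X"]) measurable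
    also have "\<dots> = emeasure (density herm_lborel (\<lambda>X. ennreal (h' X) * gram_density CARD('n) CARD('m) X)) B"
      by (subst emeasure_density) (auto simp: sets_herm_lborel mult_ac)
    finally show "emeasure (distr M herm_lborel (\<lambda>x. ctrans (Y x) \<odot> Y x)) B =
      emeasure (density herm_lborel (\<lambda>X. ennreal (h' X) * gram_density CARD('n) CARD('m) X)) B" .
  qed
  moreover have "(\<lambda>x. ctrans (Y x) \<odot> Y x) \<in> M \<rightarrow>\<^sub>M herm_lborel" by measurable
  ultimately show ?thesis unfolding distributed_def by (auto intro!: borel_measurable_times_ennreal)
qed

text \<open>Serves both types: \<open>q\<close> is the generalised power at \<Sigma> or at its
  inverse, and \<open>R X = Q X / q\<close> expresses the effect of the Cholesky congruence. The
  multivariate gamma value and the power of \<pi> disappear through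
  \<open>gram_const_mGamma\<close>.\<close>

lemma distributed_kotz_riesz_gram:
  fixes Y :: "'w \<Rightarrow> ('a, 'n::finite, 'm) mtx" and Q :: "('a, 'm, 'm) mtx \<Rightarrow> real"
  defines "\<beta> \<equiv> real DIM('a)" and "m \<equiv> real CARD('m)" and "n \<equiv> real CARD('n)"
  assumes Y: "distributed M lborel Y (\<lambda>A. ennreal ((c * mGamma \<beta> CARD('m) (n * \<beta> / 2) /
        (pi powr (m * n * \<beta> / 2) * \<gamma> * d)) * etr (- \<beta> *\<^sub>R (B \<odot> (ctrans A \<odot> A))) * R (ctrans A \<odot> A)))"
    and mn: "CARD('m) \<le> CARD('n)"
    and R: "\<And>X. X \<in> pos_def \<Longrightarrow> R X = Q X / q"
    and G: "G \<in> borel_measurable borel" "\<And>X. X \<in> pos_def \<Longrightarrow> Q X = G X"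
  shows "distributed M herm_lborel (\<lambda>x. ctrans (Y x) \<odot> Y x) (\<lambda>X. ennreal (indicator pos_def X *
    (c / (\<gamma> * d * q)) * etr (- \<beta> *\<^sub>R (B \<odot> X)) * hdet X powr (n * \<beta> / 2 - (m - 1) * \<beta> / 2 - 1) * Q X))"
proof -
  let ?k = "c * mGamma \<beta> CARD('m) (n * \<beta> / 2) / (pi powr (m * n * \<beta> / 2) * \<gamma> * d)"
  have \<beta>: "\<beta> > 0" by (simp add: \<beta>_def)
  note [measurable] = G(1)
  have "distributed M herm_lborel (\<lambda>x. ctrans (Y x) \<odot> Y x)
      (\<lambda>X. ennreal (?k * exp (- \<beta> * rtr (B \<odot> X)) * (G X / q)) * gram_density CARD('n) CARD('m) X)"
    by (rule distributed_gram[OF Y mn]) (measurable, unfold etr_eq, simp add: R G(2))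
  moreover have "ennreal (?k * exp (- \<beta> * rtr (B \<odot> X)) * (G X / q)) * gram_density CARD('n) CARD('m) X =
      ennreal (indicator pos_def X * (c / (\<gamma> * d * q)) * etr (- \<beta> *\<^sub>R (B \<odot> X)) * hdet X powr (n * \<beta> / 2 - (m - 1) * \<beta> / 2 - 1) * Q X)"
    for X
  proof (cases "X \<in> pos_def")
    case True
    let ?g = "gram_const n \<beta> CARD('m)" and ?e = "n * \<beta> / 2 - (m - 1) * \<beta> / 2 - 1"
    have e: "(n - m + 1) * \<beta> / 2 - 1 = ?e" by (simp add: algebra_simps diff_divide_distrib add_divide_distrib)
    have g0: "?g \<ge> 0" unfolding n_def by (rule gram_const_nonneg[OF mn \<beta>])
    have "?g * mGamma \<beta> CARD('m) (n * \<beta> / 2) = pi powr (m * n * \<beta> / 2)"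
      unfolding n_def m_def by (rule gram_const_mGamma[OF \<beta> mn])
    then have "?k * ?g = c / (\<gamma> * d)" by (simp add: field_simps)
    then have kg: "?k * ?g = c / (\<gamma> * d)" .
    have alg: "k * E * (x / q) * (g * y) = (k * g) * (E * y * x) / q" for k g E x y by (simp add: mult_ac)
    have k: "?k * E * (x / q) * (?g * y) = c / (\<gamma> * d * q) * E * y * x" for E x y
      unfolding alg kg by simp
    have "ennreal (?k * exp (- \<beta> * rtr (B \<odot> X)) * (G X / q)) * gram_density CARD('n) CARD('m) X
      = ennreal (?k * exp (- \<beta> * rtr (B \<odot> X)) * (G X / q)) * ennreal (?g * gdet X powr ?e)"
      using True by (simp add: gram_density_def \<beta>_def[symmetric] m_def[symmetric] n_def[symmetric] e)
    \<comment> \<open>Here \<open>?g\<close> is known to be non-negative; should the other factor be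
      negative, \<open>ennreal\<close> sends it and the product to 0 alike.\<close>
    also have "\<dots> = ennreal (?k * exp (- \<beta> * rtr (B \<odot> X)) * (G X / q) * (?g * gdet X powr ?e))"
      using g0 by (intro ennreal_mult''[symmetric]) simp
    finally show ?thesis using True unfolding k etr_eq by (simp add: hdet_gdet G(2))
  qed (simp add: gram_density_def)
  ultimately show ?thesis by simp
qed

text \<open>Given S = s, the variable F is W / s, so its density is an integral over s of rescaled
  densities of W. The powers of s collect to E - 1: b - 1 from S, \<open>herm_dim\<close> from the
  volume, m e from the determinant and the degree \<delta> of Q. What remains is a gamma integral in
  s with rate (\<beta> / \<rho>) (1 + \<rho> tr), where tr is
  \<open>rtr (B \<odot> X)\<close>.\<close>

lemma distributed_scale_mixture:
  fixes W F :: "'w \<Rightarrow> ('a, 'm, 'm) mtx" and S :: "'w \<Rightarrow> real" and Q :: "('a, 'm, 'm) mtx \<Rightarrow> real"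
  defines "\<beta> \<equiv> real DIM('a)"
  assumes "prob_space M" and \<rho>: "\<rho> > 0" and b: "b > 0"
    and S: "distributed M lborel S (\<lambda>s. ennreal (riesz1_density \<beta> b \<rho> s))"
    and W: "distributed M herm_lborel W (\<lambda>X. ennreal (indicator pos_def X * C * etr (- \<beta> *\<^sub>R (B \<odot> X)) * hdet X powr e * Q X))"
    and indep: "\<And>A D. A \<in> sets borel \<Longrightarrow> D \<in> sets borel \<Longrightarrow>
      emeasure M ((\<lambda>x. (S x, W x)) -` (A \<times> D) \<inter> space M) = emeasure M (S -` A \<inter> space M) * emeasure M (W -` D \<inter> space M)"
    and F [measurable]: "F \<in> M \<rightarrow>\<^sub>M borel" and FSW: "\<And>x. S x > 0 \<Longrightarrow> F x = inverse (S x) *\<^sub>R W x"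
    and Q: "\<And>s X. s > 0 \<Longrightarrow> X \<in> pos_def \<Longrightarrow> Q (s *\<^sub>R X) = s powr \<delta> * Q X" "\<And>X. X \<in> pos_def \<Longrightarrow> Q X > 0"
    and G: "G \<in> borel_measurable borel" "\<And>X. X \<in> pos_def \<Longrightarrow> Q X = G X"
    and E: "E = b + real CARD('m) * e + herm_dim + \<delta>"
  shows "distributed M herm_lborel F (\<lambda>X. ennreal (indicator pos_def X *
    (C * (Gamma E * \<rho> powr (E - b) * \<beta> powr (b - E) / Gamma b)) *
    hdet X powr e * (1 + \<rho> * rtr (B \<odot> X)) powr (- E) * Q X))"
proof -
  interpret prob_space M by fact
  note [measurable] = G(1)
  have \<beta>: "\<beta> > 0" by (simp add: \<beta>_def)
  have \<Gamma>b: "Gamma b > 0" by (rule Gamma_real_pos[OF b])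
  define fS where "fS s = ennreal (riesz1_density \<beta> b \<rho> s)" for s
  define fW where "fW X = ennreal (indicator pos_def X * C * exp (- \<beta> * rtr (B \<odot> X)) * gdet X powr e * G X)"
    for X :: "('a, 'm, 'm) mtx"
  have fS [measurable]: "fS \<in> borel_measurable borel" unfolding fS_def riesz1_density_def by measurable
  have fW [measurable]: "fW \<in> borel_measurable borel" unfolding fW_def by measurable
  have fWeq: "fW X = ennreal (indicator pos_def X * C * etr (- \<beta> *\<^sub>R (B \<odot> X)) * hdet X powr e * Q X)" for X
    unfolding fW_def etr_eq by (cases "X \<in> pos_def") (simp_all add: hdet_gdet G(2))
  have Sm [measurable]: "S \<in> M \<rightarrow>\<^sub>M borel" and dS: "distr M lborel S = density lborel fS"
    using S by (auto simp: distributed_def fS_def[abs_def])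
  have W': "distributed M herm_lborel W fW" using W unfolding fWeq[symmetric] .
  have Wm [measurable]: "W \<in> M \<rightarrow>\<^sub>M borel" and dW: "distr M herm_lborel W = density herm_lborel fW"
    using W' by (auto simp: distributed_def sets_herm_lborel cong: measurable_cong_sets)
  have nnS: "(\<integral>\<^sup>+s. k s \<partial>distr M borel S) = (\<integral>\<^sup>+s. fS s * k s \<partial>lborel)" if [measurable]: "k \<in> borel_measurable borel" for k
  proof -
    have "(\<integral>\<^sup>+s. k s \<partial>distr M borel S) = (\<integral>\<^sup>+s. k s \<partial>distr M lborel S)"
      by (simp add: nn_integral_distr)
    then show ?thesis unfolding dS by (simp add: nn_integral_density)
  qed
  have nnW: "(\<integral>\<^sup>+X. k X \<partial>distr M borel W) = (\<integral>\<^sup>+X. fW X * k X \<partial>herm_lborel)" if [measurable]: "k \<in> borel_measurable borel" for k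
  proof -
    have "(\<integral>\<^sup>+X. k X \<partial>distr M borel W) = (\<integral>\<^sup>+X. k X \<partial>distr M herm_lborel W)"
      by (simp add: nn_integral_distr)
    then show ?thesis unfolding dW by (simp add: nn_integral_density)
  qed
  have Spos: "AE x in M. S x > 0"
  proof -
    have "(\<integral>\<^sup>+x. indicator {..0} (S x) \<partial>M) = (\<integral>\<^sup>+s. indicator {..0} s \<partial>distr M borel S)"
      by (rule nn_integral_distr[symmetric]) measurable
    also have "\<dots> = (\<integral>\<^sup>+s. fS s * indicator {..0} s \<partial>lborel)" by (rule nnS) measurable
    also have "(\<lambda>s. fS s * indicator {..0} s) = (\<lambda>s. 0)"
      by (auto simp: fS_def riesz1_density_def indicator_def fun_eq_iff)
    finally have "(\<integral>\<^sup>+x. indicator {..0} (S x) \<partial>M) = 0" by simp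
    then have "AE x in M. indicator {..0} (S x) = (0::ennreal)"
      by (subst (asm) nn_integral_0_iff_AE) auto
    then show ?thesis by eventually_elim (auto simp: indicator_def split: if_splits)
  qed
  \<comment> \<open>The sign of C is not evident from its Gamma factors, but C <= 0 would give the
    law of W total mass 0.\<close>
  have C: "C > 0"
  proof (rule ccontr)
    assume "\<not> C > 0"
    then have "fW X = 0" for X
      unfolding fW_def using Q(2)[of X] G(2)[of X]
      by (cases "X \<in> pos_def") (auto intro!: ennreal_neg simp: mult_nonpos_nonneg mult_le_0_iff)
    then have "(\<integral>\<^sup>+X. 1 \<partial>distr M borel W) = 0" by (subst nnW) auto
    moreover have "(\<integral>\<^sup>+X. 1 \<partial>distr M borel W) = 1" by (simp add: emeasure_distr emeasure_space_1)
    ultimately show False by simp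
  qed
  define fF where "fF X = (\<integral>\<^sup>+s. fS s * (ennreal (s powr herm_dim) * fW (s *\<^sub>R X)) \<partial>lborel)" for X
  have fF [measurable]: "fF \<in> borel_measurable borel" unfolding fF_def by measurable
  have law: "(\<integral>\<^sup>+x. h (F x) \<partial>M) = (\<integral>\<^sup>+X. h X * fF X \<partial>herm_lborel)"
    if h [measurable]: "h \<in> borel_measurable borel" for h
  proof -
    interpret dS: prob_space "distr M borel S" by (rule prob_space_distr) simp
    interpret dW: prob_space "distr M borel W" by (rule prob_space_distr) simp
    have joint: "distr M borel S \<Otimes>\<^sub>M distr M borel W = distr M (borel \<Otimes>\<^sub>M borel) (\<lambda>x. (S x, W x))"
    proof (rule pair_measure_eqI)
      fix A D assume "A \<in> sets (distr M borel S)" "D \<in> sets (distr M borel W)"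
      then show "emeasure (distr M borel S) A * emeasure (distr M borel W) D =
          emeasure (distr M (borel \<Otimes>\<^sub>M borel) (\<lambda>x. (S x, W x))) (A \<times> D)"
        by (simp add: emeasure_distr indep)
    qed (auto intro: dS.sigma_finite_measure_axioms dW.sigma_finite_measure_axioms cong: sets_pair_measure_cong)
    have "(\<integral>\<^sup>+x. h (F x) \<partial>M) = (\<integral>\<^sup>+x. h (inverse (S x) *\<^sub>R W x) \<partial>M)"
      by (rule nn_integral_cong_AE) (use Spos in eventually_elim, simp add: FSW)
    also have "\<dots> = (\<integral>\<^sup>+z. h (inverse (fst z) *\<^sub>R snd z) \<partial>distr M (borel \<Otimes>\<^sub>M borel) (\<lambda>x. (S x, W x)))"
      by (subst nn_integral_distr) (auto simp: split_beta)
    also have "\<dots> = (\<integral>\<^sup>+s. \<integral>\<^sup>+X. h (inverse s *\<^sub>R X) \<partial>distr M borel W \<partial>distr M borel S)"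
      unfolding joint[symmetric] by (subst dW.nn_integral_fst[symmetric]) auto
    also have "\<dots> = (\<integral>\<^sup>+s. fS s * (\<integral>\<^sup>+X. h (inverse s *\<^sub>R X) \<partial>distr M borel W) \<partial>lborel)"
    proof (rule nnS, rule dW.borel_measurable_nn_integral)
      show "(\<lambda>(s, X). h (inverse s *\<^sub>R X)) \<in> borel_measurable (borel \<Otimes>\<^sub>M distr M borel W)"
        unfolding split_beta by measurable
    qed
    also have "\<dots> = (\<integral>\<^sup>+s. fS s * (\<integral>\<^sup>+X. h X * (ennreal (s powr herm_dim) * fW (s *\<^sub>R X)) \<partial>herm_lborel) \<partial>lborel)"
    proof (rule nn_integral_cong)
      fix s :: real
      show "fS s * (\<integral>\<^sup>+X. h (inverse s *\<^sub>R X) \<partial>distr M borel W) =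
          fS s * (\<integral>\<^sup>+X. h X * (ennreal (s powr herm_dim) * fW (s *\<^sub>R X)) \<partial>herm_lborel)"
      proof (cases "s > 0")
        case True
        have "(\<integral>\<^sup>+X. h (inverse s *\<^sub>R X) \<partial>distr M borel W) = (\<integral>\<^sup>+X. fW X * h (inverse s *\<^sub>R X) \<partial>herm_lborel)"
          by (rule nnW) measurable
        also have "\<dots> = ennreal (s powr herm_dim) * (\<integral>\<^sup>+X. fW (s *\<^sub>R X) * h (inverse s *\<^sub>R (s *\<^sub>R X)) \<partial>herm_lborel)"
          by (rule nn_integral_herm_lborel_scale[OF True]) measurable
        also have "\<dots> = (\<integral>\<^sup>+X. ennreal (s powr herm_dim) * (fW (s *\<^sub>R X) * h (inverse s *\<^sub>R (s *\<^sub>R X))) \<partial>herm_lborel)"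
          by (rule nn_integral_cmult[symmetric]) measurable
        also have "\<dots> = (\<integral>\<^sup>+X. h X * (ennreal (s powr herm_dim) * fW (s *\<^sub>R X)) \<partial>herm_lborel)"
          using True by (intro nn_integral_cong) (simp add: mult_ac)
        finally show ?thesis by simp
      qed (simp add: fS_def riesz1_density_def)
    qed
    \<comment> \<open>\<open>herm_lborel\<close> is an image measure; the integrals are interchanged
      on \<open>coord\<close>, whose sigma-finiteness comes from the product structure.\<close>
    also have "\<dots> = (\<integral>\<^sup>+s. \<integral>\<^sup>+z. fS s * (h (herm_of z) * (ennreal (s powr herm_dim) * fW (s *\<^sub>R herm_of z))) \<partial>coord \<partial>lborel)"
    proof (rule nn_integral_cong)
      fix s :: real
      have "(\<integral>\<^sup>+X. h X * (ennreal (s powr herm_dim) * fW (s *\<^sub>R X)) \<partial>herm_lborel) =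
          (\<integral>\<^sup>+z. h (herm_of z) * (ennreal (s powr herm_dim) * fW (s *\<^sub>R herm_of z)) \<partial>coord)"
        by (rule nn_integral_herm_lborel) measurable
      then show "fS s * (\<integral>\<^sup>+X. h X * (ennreal (s powr herm_dim) * fW (s *\<^sub>R X)) \<partial>herm_lborel) =
          (\<integral>\<^sup>+z. fS s * (h (herm_of z) * (ennreal (s powr herm_dim) * fW (s *\<^sub>R herm_of z))) \<partial>coord)"
        by (subst nn_integral_cmult) auto
    qed
    also have "\<dots> = (\<integral>\<^sup>+z. \<integral>\<^sup>+s. fS s * (h (herm_of z) * (ennreal (s powr herm_dim) * fW (s *\<^sub>R herm_of z))) \<partial>lborel \<partial>coord)"
    proof -
      interpret c: sigma_finite_measure coord by (rule sigma_finite_coord)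
      interpret pair_sigma_finite coord "lborel :: real measure" ..
      show ?thesis by (rule Fubini') measurable
    qed
    also have "\<dots> = (\<integral>\<^sup>+z. h (herm_of z) * fF (herm_of z) \<partial>coord)"
    proof (rule nn_integral_cong)
      fix z
      have "(\<integral>\<^sup>+s. fS s * (h (herm_of z) * (ennreal (s powr herm_dim) * fW (s *\<^sub>R herm_of z))) \<partial>lborel)
        = (\<integral>\<^sup>+s. h (herm_of z) * (fS s * (ennreal (s powr herm_dim) * fW (s *\<^sub>R herm_of z))) \<partial>lborel)"
        by (simp only: mult_ac)
      also have "\<dots> = h (herm_of z) * fF (herm_of z)"
        unfolding fF_def by (rule nn_integral_cmult) measurable
      finally show "(\<integral>\<^sup>+s. fS s * (h (herm_of z) * (ennreal (s powr herm_dim) * fW (s *\<^sub>R herm_of z))) \<partial>lborel)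
        = h (herm_of z) * fF (herm_of z)" .
    qed
    also have "\<dots> = (\<integral>\<^sup>+X. h X * fF X \<partial>herm_lborel)" by (rule nn_integral_herm_lborel[symmetric]) measurable
    finally show ?thesis .
  qed
  define tgt where "tgt X = indicator pos_def X * (C * (Gamma E * \<rho> powr (E - b) * \<beta> powr (b - E) / Gamma b)) *
    gdet X powr e * (1 + \<rho> * rtr (B \<odot> X)) powr (- E) * G X" for X :: "('a, 'm, 'm) mtx"
  have tgt [measurable]: "tgt \<in> borel_measurable borel" unfolding tgt_def by measurable
  have tgt_eq: "tgt X = indicator pos_def X * (C * (Gamma E * \<rho> powr (E - b) * \<beta> powr (b - E) / Gamma b)) *
    hdet X powr e * (1 + \<rho> * rtr (B \<odot> X)) powr (- E) * Q X" for X
    by (cases "X \<in> pos_def") (simp_all add: tgt_def hdet_gdet G(2))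
  have form: "fF X = ennreal (C * \<beta> powr b / (Gamma b * \<rho> powr b) * gdet X powr e * G X) *
      (\<integral>\<^sup>+s. ennreal (indicator {0<..} s * s powr (E - 1) * exp (- (\<beta> / \<rho> * (1 + \<rho> * rtr (B \<odot> X))) * s)) \<partial>lborel)"
    if X: "X \<in> pos_def" for X
  proof -
    have k0: "C * \<beta> powr b / (Gamma b * \<rho> powr b) * gdet X powr e * G X \<ge> 0"
      using C \<Gamma>b Q(2)[OF X] G(2)[OF X] by simp
    have "fS s * (ennreal (s powr herm_dim) * fW (s *\<^sub>R X)) =
        ennreal (C * \<beta> powr b / (Gamma b * \<rho> powr b) * gdet X powr e * G X) *
        ennreal (indicator {0<..} s * s powr (E - 1) * exp (- (\<beta> / \<rho> * (1 + \<rho> * rtr (B \<odot> X))) * s))" for s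
    proof (cases "s > 0")
      case True
      have sX: "s *\<^sub>R X \<in> pos_def" by (rule pos_def_scaleR[OF True X])
      have gs: "gdet (s *\<^sub>R X) powr e = s powr (real CARD('m) * e) * gdet X powr e"
      proof -
        have "gdet (s *\<^sub>R X) = s powr real CARD('m) * gdet X"
          using hdet_scaleR[OF True X] True by (simp add: hdet_gdet[OF sX] hdet_gdet[OF X] powr_realpow)
        then show ?thesis by (simp add: powr_mult powr_powr)
      qed
      have Gs: "G (s *\<^sub>R X) = s powr \<delta> * G X" using Q(1)[OF True X] G(2)[OF X] G(2)[OF sX] by simp
      have ex: "exp (- \<beta> * s / \<rho>) * exp (- \<beta> * (s * rtr (B \<odot> X))) = exp (- (\<beta> / \<rho> * (1 + \<rho> * rtr (B \<odot> X))) * s)"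
        unfolding exp_add[symmetric] using \<rho> by (simp add: field_simps)
      have ps: "s powr (b - 1) * (s powr herm_dim * (s powr (real CARD('m) * e) * s powr \<delta>)) = s powr (E - 1)"
        unfolding powr_add[symmetric] E by (simp add: algebra_simps)
      have a0: "riesz1_density \<beta> b \<rho> s = \<beta> powr b / (Gamma b * \<rho> powr b) * exp (- \<beta> * s / \<rho>) * s powr (b - 1)"
        using True by (simp add: riesz1_density_def)
      have a1: "fW (s *\<^sub>R X) = ennreal (C * exp (- \<beta> * (s * rtr (B \<odot> X))) * (s powr (real CARD('m) * e) * gdet X powr e) * (s powr \<delta> * G X))"
        using sX by (simp add: fW_def gs Gs rtr_scaleR)
      have n1: "\<beta> powr b / (Gamma b * \<rho> powr b) * exp (- \<beta> * s / \<rho>) * s powr (b - 1) \<ge> 0" using \<Gamma>b by simp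
      have n2: "C * exp (- \<beta> * (s * rtr (B \<odot> X))) * (s powr (real CARD('m) * e) * gdet X powr e) * (s powr \<delta> * G X) \<ge> 0"
        using C Q(2)[OF X] G(2)[OF X] by simp
      have "fS s * (ennreal (s powr herm_dim) * fW (s *\<^sub>R X)) =
          ennreal ((\<beta> powr b / (Gamma b * \<rho> powr b) * exp (- \<beta> * s / \<rho>) * s powr (b - 1)) * (s powr herm_dim *
            (C * exp (- \<beta> * (s * rtr (B \<odot> X))) * (s powr (real CARD('m) * e) * gdet X powr e) * (s powr \<delta> * G X))))"
        unfolding fS_def a0 a1 using n1 n2 by (simp only: ennreal_mult mult_nonneg_nonneg powr_ge_zero)
      also have "(\<beta> powr b / (Gamma b * \<rho> powr b) * exp (- \<beta> * s / \<rho>) * s powr (b - 1)) * (s powr herm_dim *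
            (C * exp (- \<beta> * (s * rtr (B \<odot> X))) * (s powr (real CARD('m) * e) * gdet X powr e) * (s powr \<delta> * G X)))
        = (C * (\<beta> powr b / (Gamma b * \<rho> powr b)) * gdet X powr e * G X) *
          ((s powr (b - 1) * (s powr herm_dim * (s powr (real CARD('m) * e) * s powr \<delta>))) *
           (exp (- \<beta> * s / \<rho>) * exp (- \<beta> * (s * rtr (B \<odot> X)))))"
        by (simp only: mult_ac)
      also have "\<dots> = (C * \<beta> powr b / (Gamma b * \<rho> powr b) * gdet X powr e * G X) *
          (indicator {0<..} s * s powr (E - 1) * exp (- (\<beta> / \<rho> * (1 + \<rho> * rtr (B \<odot> X))) * s))"
        unfolding ps ex using True by simp
      finally show ?thesis unfolding ennreal_mult'[OF k0] .
    qed (simp add: fS_def riesz1_density_def)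
    then have "fF X = (\<integral>\<^sup>+s. ennreal (C * \<beta> powr b / (Gamma b * \<rho> powr b) * gdet X powr e * G X) *
        ennreal (indicator {0<..} s * s powr (E - 1) * exp (- (\<beta> / \<rho> * (1 + \<rho> * rtr (B \<odot> X))) * s)) \<partial>lborel)"
      by (simp only: fF_def)
    also have "\<dots> = ennreal (C * \<beta> powr b / (Gamma b * \<rho> powr b) * gdet X powr e * G X) *
        (\<integral>\<^sup>+s. ennreal (indicator {0<..} s * s powr (E - 1) * exp (- (\<beta> / \<rho> * (1 + \<rho> * rtr (B \<odot> X))) * s)) \<partial>lborel)"
      by (rule nn_integral_cmult) measurable
    finally show ?thesis .
  qed
  have zero: "fF X = 0" if X: "X \<notin> pos_def" for X
  proof -
    have z: "fS s * (ennreal (s powr herm_dim) * fW (s *\<^sub>R X)) = 0" for s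
      using X by (cases "s > 0") (simp_all add: fS_def riesz1_density_def fW_def pos_def_scaleR_iff)
    show ?thesis unfolding fF_def z by simp
  qed
  \<comment> \<open>The law of F has total mass 1, so its density is finite almost everywhere.
    Convergence of the gamma integral then yields E > 0 and 1 + \<rho> tr > 0 at almost every
    positive definite X, in place of an argument about the trace of a product.\<close>
  have "(\<integral>\<^sup>+X. 1 * fF X \<partial>herm_lborel) = 1"
    using law[of "\<lambda>_. 1"] by (simp add: emeasure_space_1)
  then have "AE X in herm_lborel. fF X \<noteq> \<infinity>"
    by (intro nn_integral_PInf_AE) auto
  then have AE_eq: "AE X in herm_lborel. fF X = ennreal (tgt X)"
  proof eventually_elim
    case (elim X)
    show ?case
    proof (cases "X \<in> pos_def")
      case True
      let ?k = "C * \<beta> powr b / (Gamma b * \<rho> powr b) * gdet X powr e * G X" and ?b = "\<beta> / \<rho> * (1 + \<rho> * rtr (B \<odot> X))"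
      let ?I = "\<integral>\<^sup>+s. ennreal (indicator {0<..} s * s powr (E - 1) * exp (- ?b * s)) \<partial>lborel"
      have k: "?k > 0" using C \<Gamma>b \<beta> \<rho> Q(2)[OF True] G(2)[OF True] pos_def_vol(4)[OF True] by simp
      have "?I < \<infinity>" using elim form[OF True] k by (auto simp: ennreal_mult_eq_top_iff less_top)
      then have E0: "E > 0" and b0: "?b > 0" by (rule gamma_integral_finiteD)+
      have t0: "1 + \<rho> * rtr (B \<odot> X) > 0" by (rule zero_less_mult_pos[OF b0]) (use \<beta> \<rho> in simp)
      have "fF X = ennreal ?k * ennreal (Gamma E / ?b powr E)" unfolding form[OF True] gamma_nn_integral[OF E0 b0] ..
      also have "\<dots> = ennreal (?k * (Gamma E / ?b powr E))"
        using k E0 by (intro ennreal_mult[symmetric]) (auto simp: Gamma_real_nonneg)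
      also have "?k * (Gamma E / ?b powr E) = tgt X"
      proof -
        have pb: "?b powr E = \<beta> powr E / \<rho> powr E * (1 + \<rho> * rtr (B \<odot> X)) powr E"
          using \<beta> \<rho> t0 by (simp add: powr_mult powr_divide)
        show ?thesis unfolding pb using True
          by (simp add: tgt_def powr_diff powr_minus divide_inverse mult_ac)
      qed
      finally show ?thesis .
    qed (simp add: zero tgt_def)
  qed
  have "distr M herm_lborel F = density herm_lborel (\<lambda>X. ennreal (tgt X))"
  proof (rule measure_eqI)
    fix D assume "D \<in> sets (distr M herm_lborel F)"
    then have [measurable]: "D \<in> sets borel" by (simp add: sets_herm_lborel)
    have "emeasure (distr M herm_lborel F) D = (\<integral>\<^sup>+X. indicator D X \<partial>distr M herm_lborel F)" by (simp add: sets_herm_lborel)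
    also have "\<dots> = (\<integral>\<^sup>+x. indicator D (F x) \<partial>M)" by (rule nn_integral_distr) measurable
    also have "\<dots> = (\<integral>\<^sup>+X. indicator D X * fF X \<partial>herm_lborel)" by (rule law) measurable
    also have "\<dots> = (\<integral>\<^sup>+X. ennreal (tgt X) * indicator D X \<partial>herm_lborel)"
      by (rule nn_integral_cong_AE) (use AE_eq in eventually_elim, simp add: mult.commute)
    also have "\<dots> = emeasure (density herm_lborel (\<lambda>X. ennreal (tgt X))) D"
      by (rule emeasure_density[symmetric]) (auto simp: sets_herm_lborel)
    finally show "emeasure (distr M herm_lborel F) D = emeasure (density herm_lborel (\<lambda>X. ennreal (tgt X))) D" .
  qed simp
  moreover have "F \<in> M \<rightarrow>\<^sub>M herm_lborel" by measurable
  moreover have "(\<lambda>X. ennreal (tgt X)) \<in> borel_measurable herm_lborel" by measurable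
  ultimately have "distributed M herm_lborel F (\<lambda>X. ennreal (tgt X))" unfolding distributed_def by blast
  then show ?thesis unfolding tgt_eq .
qed

end

theorem theorem3p3:
  fixes M :: "'w measure"
    and S :: "'w \<Rightarrow> real"
    and Y T :: "'w \<Rightarrow> ('a::normed_division_algebra, 'n::finite, 'm::{finite,linorder}) mtx"
    and W F :: "'w \<Rightarrow> ('a, 'm, 'm) mtx"
    and \<Sigma> :: "('a, 'm, 'm) mtx"
    and \<rho> k \<nu> \<beta> :: real
    and t :: "nat \<Rightarrow> real"
    and m n :: nat
  assumes "m = CARD('m)" and "n = CARD('n)" and "\<beta> = real DIM('a)"
    and "m \<le> n"
    and "\<rho> > 0" and "\<Sigma> \<in> pos_def"
    and "prob_space M"
    and "indep_rv M S Y"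
    and "\<And>\<omega>. T \<omega> = (S \<omega> powr (- 1 / 2)) *\<^sub>R Y \<omega>"
    and "\<And>\<omega>. W \<omega> = ctrans (Y \<omega>) \<odot> Y \<omega>"
    and "\<And>\<omega>. F \<omega> = ctrans (T \<omega>) \<odot> T \<omega>"
    and octonion_case: "\<not> (\<forall>x y z :: 'a. (x * y) * z = x * (y * z)) \<Longrightarrow>
           AE A in (lborel :: ('a, 'n, 'm) mtx measure). ctrans A \<odot> A \<in> pos_def"
  shows
    "(riesz1_I M S \<beta> (\<nu> * \<beta> / 2) k \<rho> \<and> \<nu> * \<beta> / 2 > - k \<and>
     kotz_riesz_I M Y t \<Sigma> \<and> real n * \<beta> / 2 > (real m - 1) * \<beta> / 2 - t m
     \<longrightarrow> riesz_I M W (real n * \<beta> / 2) t \<Sigma> \<and>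
       (\<nu> * \<beta> / 2 > (real m - 1) * \<beta> / 2 - k \<and> real m * \<beta> / 2 > (real m - 1) * \<beta> / 2 - t m
        \<longrightarrow> distributed M herm_lborel F (\<lambda>X. ennreal (indicator pos_def X *
          (Gamma ((\<nu> + real m * real n) * \<beta> / 2 + k + (\<Sum>i = 1..m. t i)) *
             \<rho> powr (\<beta> * real m * real n / 2 + (\<Sum>i = 1..m. t i)) /
           (mGamma_I \<beta> m (real n * \<beta> / 2) t * Gamma (\<nu> * \<beta> / 2 + k) *
             hdet \<Sigma> powr (real n * \<beta> / 2) * gpower t \<Sigma>)) *
          hdet X powr ((real n - real m + 1) * \<beta> / 2 - 1) *
          (1 + \<rho> * rtr (minv \<Sigma> \<odot> X)) powr
            (- ((real m * real n + \<nu>) * \<beta> / 2 + k + (\<Sum>i = 1..m. t i))) *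
          gpower t X))))
     \<and>
     (riesz1_II M S \<beta> (\<nu> * \<beta> / 2) k \<rho> \<and> \<nu> * \<beta> / 2 > k \<and>
     kotz_riesz_II M Y t \<Sigma> \<and> real n * \<beta> / 2 > (real m - 1) * \<beta> / 2 + t 1
     \<longrightarrow> riesz_II M W (real n * \<beta> / 2) t \<Sigma> \<and>
       (\<nu> * \<beta> / 2 > (real m - 1) * \<beta> / 2 + k \<and> real m * \<beta> / 2 > (real m - 1) * \<beta> / 2 + t 1
        \<longrightarrow> distributed M herm_lborel F (\<lambda>X. ennreal (indicator pos_def X *
          (Gamma ((\<nu> + real m * real n) * \<beta> / 2 - k - (\<Sum>i = 1..m. t i)) *
             \<rho> powr (\<beta> * real m * real n / 2 - (\<Sum>i = 1..m. t i)) /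
           (mGamma_II \<beta> m (real n * \<beta> / 2) t * Gamma (\<nu> * \<beta> / 2 - k) *
             hdet \<Sigma> powr (real n * \<beta> / 2) * gpower t (minv \<Sigma>))) *
          hdet X powr ((real n - real m + 1) * \<beta> / 2 - 1) *
          (1 + \<rho> * rtr (minv \<Sigma> \<odot> X)) powr
            (- ((real m * real n + \<nu>) * \<beta> / 2 - k - (\<Sum>i = 1..m. t i))) *
          gpower t (minv X)))))"
proof -
  have good: "(\<forall>x y z :: 'a. (x * y) * z = x * (y * z)) \<or> CARD('m) \<le> 2"
  proof (rule ccontr)
    assume "\<not> ((\<forall>x y z :: 'a. (x * y) * z = x * (y * z)) \<or> CARD('m) \<le> 2)"
    then obtain x y z :: 'a where na: "(x * y) * z \<noteq> x * (y * z)" and m: "CARD('m) > 2" by auto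
    then have "AE A in (lborel :: ('a, 'n, 'm) mtx measure). ctrans A \<odot> A \<in> pos_def"
      by (intro octonion_case) blast
    then show False using nonassociative_gram[OF na m, where 'n = 'n] by blast
  qed
  interpret good_ordered "TYPE('a \<times> 'm)" by standard (rule good)
  interpret prob_space M by fact
  have mn: "CARD('m) \<le> CARD('n)" and \<rho>: "\<rho> > 0" and \<Sigma>: "\<Sigma> \<in> pos_def" using assms by simp_all
  note \<Sigma>' = upper.pos_def_minv(1)[OF \<Sigma>]
  have Sm [measurable]: "S \<in> M \<rightarrow>\<^sub>M borel" and Ym [measurable]: "Y \<in> M \<rightarrow>\<^sub>M borel"
    and ind: "indep_set {S -` A \<inter> space M | A. A \<in> sets borel} {Y -` B \<inter> space M | B. B \<in> sets borel}"
    using \<open>indep_rv M S Y\<close> by (auto simp: indep_rv_def)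
  have W: "W = (\<lambda>\<omega>. ctrans (Y \<omega>) \<odot> Y \<omega>)" using assms(10) by auto
  have T: "T = (\<lambda>\<omega>. (S \<omega> powr (- 1 / 2)) *\<^sub>R Y \<omega>)" using assms(9) by auto
  have F: "F = (\<lambda>\<omega>. ctrans (T \<omega>) \<odot> T \<omega>)" using assms(11) by auto
  have Fm: "F \<in> M \<rightarrow>\<^sub>M borel" unfolding F T by measurable
  \<comment> \<open>It suffices to treat S > 0, since the law of \<open>S\<close> charges no other
    values.\<close>
  have FSW: "F \<omega> = inverse (S \<omega>) *\<^sub>R W \<omega>" if "S \<omega> > 0" for \<omega>
  proof -
    have "S \<omega> powr (- 1 / 2) * S \<omega> powr (- 1 / 2) = S \<omega> powr (- 1 / 2 + - 1 / 2)"
      by (rule powr_add[symmetric])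
    also have "\<dots> = inverse (S \<omega>)"
      using that powr_minus[of "S \<omega>" 1] by simp
    finally show ?thesis by (simp add: F T W ctrans_scaleR mmul_scaleR_left mmul_scaleR_right)
  qed
  have indep: "emeasure M ((\<lambda>\<omega>. (S \<omega>, W \<omega>)) -` (A \<times> D) \<inter> space M) =
      emeasure M (S -` A \<inter> space M) * emeasure M (W -` D \<inter> space M)"
    if A: "A \<in> sets borel" and D [measurable]: "D \<in> sets borel" for A D
  proof -
    let ?D = "(\<lambda>B :: ('a, 'n, 'm) mtx. ctrans B \<odot> B) -` D"
    have "(\<lambda>B :: ('a, 'n, 'm) mtx. ctrans B \<odot> B) \<in> borel \<rightarrow>\<^sub>M borel" by measurable
    from measurable_sets[OF this D] have D': "?D \<in> sets borel" by simp
    have "prob ((S -` A \<inter> space M) \<inter> (Y -` ?D \<inter> space M)) = prob (S -` A \<inter> space M) * prob (Y -` ?D \<inter> space M)"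
      by (rule indep_setD[OF ind]) (use A D' in blast)+
    moreover have "(\<lambda>\<omega>. (S \<omega>, W \<omega>)) -` (A \<times> D) \<inter> space M = (S -` A \<inter> space M) \<inter> (Y -` ?D \<inter> space M)"
      "W -` D \<inter> space M = Y -` ?D \<inter> space M" by (auto simp: W)
    ultimately show ?thesis by (simp add: emeasure_eq_measure ennreal_mult)
  qed
  let ?e = "real n * \<beta> / 2 - (real m - 1) * \<beta> / 2 - 1"
  have e: "?e = (real n - real m + 1) * \<beta> / 2 - 1"
    by (simp add: algebra_simps add_divide_distrib diff_divide_distrib)
  \<comment> \<open>The degree of the determinant power and the dimension of the space of Hermitian
    matrices add up to \<beta> m n / 2, half the number of real coordinates of
    \<open>Y\<close>.\<close>
  have dims: "real m * ?e + herm_dim = \<beta> * real m * real n / 2"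
    unfolding herm_dim_def using assms(1,3) by (simp add: field_simps)
  have \<beta>: "\<beta> > 0" using assms(3) by simp
  let ?s = "\<Sum>i = 1..m. t i"
  \<comment> \<open>Common to both types, with \<delta> the sum of the t_i for type I and its
    negative for type II. The power of \<beta> in the constant of \<open>W\<close> cancels against
    the one produced by the gamma integral.\<close>
  have mixture: "distributed M herm_lborel F (\<lambda>X. ennreal (indicator pos_def X *
      (Gamma E * \<rho> powr (\<beta> * real m * real n / 2 + \<delta>) / (\<gamma> * Gamma b * hdet \<Sigma> powr (real n * \<beta> / 2) * q)) *
      hdet X powr ((real n - real m + 1) * \<beta> / 2 - 1) * (1 + \<rho> * rtr (minv \<Sigma> \<odot> X)) powr (- E) * Q X))"
    if "b > 0" and "distributed M lborel S (\<lambda>s. ennreal (riesz1_density \<beta> b \<rho> s))"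
      and W_law: "distributed M herm_lborel W (\<lambda>X. ennreal (indicator pos_def X *
        (\<beta> powr (real n * \<beta> / 2 * real m + \<delta>) / (\<gamma> * hdet \<Sigma> powr (real n * \<beta> / 2) * q)) *
        etr (- \<beta> *\<^sub>R (minv \<Sigma> \<odot> X)) * hdet X powr ?e * Q X))"
      and Q: "\<And>s X. s > 0 \<Longrightarrow> X \<in> pos_def \<Longrightarrow> Q (s *\<^sub>R X) = s powr \<delta> * Q X" "\<And>X. X \<in> pos_def \<Longrightarrow> Q X > 0"
      and G: "G \<in> borel_measurable borel" "\<And>X. X \<in> pos_def \<Longrightarrow> Q X = G X"
      and E: "E = b + \<beta> * real m * real n / 2 + \<delta>" for b \<delta> \<gamma> q Q G E
  proof -
    let ?C = "\<beta> powr (real n * \<beta> / 2 * real m + \<delta>) / (\<gamma> * hdet \<Sigma> powr (real n * \<beta> / 2) * q)"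
    have Eb: "E - b = \<beta> * real m * real n / 2 + \<delta>" "b - E = - (real n * \<beta> / 2 * real m + \<delta>)"
      by (simp_all add: E)
    have "E = b + real m * ?e + herm_dim + \<delta>" using dims E by linarith
    then have D: "distributed M herm_lborel F (\<lambda>X. ennreal (indicator pos_def X *
        (?C * (Gamma E * \<rho> powr (E - b) * \<beta> powr (b - E) / Gamma b)) *
        hdet X powr ?e * (1 + \<rho> * rtr (minv \<Sigma> \<odot> X)) powr (- E) * Q X))"
      using that(2) W_law unfolding assms(1,3)
      by (intro distributed_scale_mixture[OF \<open>prob_space M\<close> \<rho> \<open>b > 0\<close> _ _ indep Fm FSW Q G]) simp_all
    have c: "?C * (Gamma E * \<rho> powr (E - b) * \<beta> powr (b - E) / Gamma b) =
        Gamma E * \<rho> powr (\<beta> * real m * real n / 2 + \<delta>) / (\<gamma> * Gamma b * hdet \<Sigma> powr (real n * \<beta> / 2) * q)"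
    proof -
      have "\<beta> powr (real n * \<beta> / 2 * real m + \<delta>) * \<beta> powr (b - E) = 1"
        unfolding Eb(2) using \<beta> by (simp add: powr_add[symmetric])
      then have "\<beta> powr (real n * \<beta> / 2 * real m + \<delta>) / h * (x * \<beta> powr (b - E) / g) = x / (h * g)" for h x g
        by (simp add: times_divide_times_eq)
      then show ?thesis unfolding Eb(1) by (simp add: mult_ac)
    qed
    show ?thesis using D unfolding c e .
  qed
  show ?thesis
  proof (intro conjI impI; elim conjE)
    assume Y: "kotz_riesz_I M Y t \<Sigma>" and n: "real n * \<beta> / 2 > (real m - 1) * \<beta> / 2 - t m"
    obtain G where G: "G \<in> borel_measurable borel" "\<And>A :: ('a, 'm, 'm) mtx. A \<in> pos_def \<Longrightarrow> gpower t A = G A"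
      by (rule gpower_measurable[of t]) blast
    have "distributed M herm_lborel (\<lambda>\<omega>. ctrans (Y \<omega>) \<odot> Y \<omega>) (\<lambda>X. ennreal (indicator pos_def X *
        (real DIM('a) powr (real CARD('m) * real CARD('n) * real DIM('a) / 2 + (\<Sum>i = 1..CARD('m). t i)) /
          (mGamma_I (real DIM('a)) CARD('m) (real CARD('n) * real DIM('a) / 2) t *
           hdet \<Sigma> powr (real CARD('n) * real DIM('a) / 2) * gpower t \<Sigma>)) *
        etr (- real DIM('a) *\<^sub>R (minv \<Sigma> \<odot> X)) *
        hdet X powr (real CARD('n) * real DIM('a) / 2 - (real CARD('m) - 1) * real DIM('a) / 2 - 1) * gpower t X))"
      by (rule distributed_kotz_riesz_gram[OF Y[unfolded kotz_riesz_I_def kotz_riesz_I_density_def Let_def] mn _ G])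
         (rule gpower_congruence_upper[OF \<Sigma>])
    then have W_law: "distributed M herm_lborel W (\<lambda>X. ennreal (indicator pos_def X *
        (\<beta> powr (real n * \<beta> / 2 * real m + ?s) / (mGamma_I \<beta> m (real n * \<beta> / 2) t * hdet \<Sigma> powr (real n * \<beta> / 2) * gpower t \<Sigma>)) *
        etr (- \<beta> *\<^sub>R (minv \<Sigma> \<odot> X)) * hdet X powr ?e * gpower t X))"
      unfolding assms(1-3) W by (simp only: mult_ac times_divide_eq_left times_divide_eq_right)
    then show "riesz_I M W (real n * \<beta> / 2) t \<Sigma>"
      using n \<Sigma> unfolding riesz_I_def riesz_I_density_def Let_def assms(1-3) by simp
    assume S: "riesz1_I M S \<beta> (\<nu> * \<beta> / 2) k \<rho>" and b: "- k < \<nu> * \<beta> / 2"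
    show "distributed M herm_lborel F (\<lambda>X. ennreal (indicator pos_def X *
          (Gamma ((\<nu> + real m * real n) * \<beta> / 2 + k + ?s) * \<rho> powr (\<beta> * real m * real n / 2 + ?s) /
           (mGamma_I \<beta> m (real n * \<beta> / 2) t * Gamma (\<nu> * \<beta> / 2 + k) *
             hdet \<Sigma> powr (real n * \<beta> / 2) * gpower t \<Sigma>)) *
          hdet X powr ((real n - real m + 1) * \<beta> / 2 - 1) *
          (1 + \<rho> * rtr (minv \<Sigma> \<odot> X)) powr (- ((real m * real n + \<nu>) * \<beta> / 2 + k + ?s)) * gpower t X))"
      unfolding add.commute[of \<nu>]
      using S b assms(1) unfolding riesz1_I_def
      by (intro mixture[OF _ _ W_law _ gpower_pos G]) (auto simp: gpower_scaleR field_simps)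
  next
    assume Y: "kotz_riesz_II M Y t \<Sigma>" and n: "real n * \<beta> / 2 > (real m - 1) * \<beta> / 2 + t 1"
    obtain G where G: "G \<in> borel_measurable borel" "\<And>A :: ('a, 'm, 'm) mtx. A \<in> pos_def \<Longrightarrow> gpower t (minv A) = G A"
      by (rule gpower_minv_measurable[of t]) blast
    have "distributed M herm_lborel (\<lambda>\<omega>. ctrans (Y \<omega>) \<odot> Y \<omega>) (\<lambda>X. ennreal (indicator pos_def X *
        (real DIM('a) powr (real CARD('m) * real CARD('n) * real DIM('a) / 2 - (\<Sum>i = 1..CARD('m). t i)) /
          (mGamma_II (real DIM('a)) CARD('m) (real CARD('n) * real DIM('a) / 2) t *
           hdet \<Sigma> powr (real CARD('n) * real DIM('a) / 2) * gpower t (minv \<Sigma>))) *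
        etr (- real DIM('a) *\<^sub>R (minv \<Sigma> \<odot> X)) *
        hdet X powr (real CARD('n) * real DIM('a) / 2 - (real CARD('m) - 1) * real DIM('a) / 2 - 1) * gpower t (minv X)))"
      by (rule distributed_kotz_riesz_gram[OF Y[unfolded kotz_riesz_II_def kotz_riesz_II_density_def Let_def] mn _ G])
         (rule gpower_congruence_lower[OF \<Sigma>])
    \<comment> \<open>The exponent is written with \<open>+ - ?s\<close> to match \<delta> =
      \<open>- ?s\<close> in \<open>mixture\<close>.\<close>
    then have W_law: "distributed M herm_lborel W (\<lambda>X. ennreal (indicator pos_def X *
        (\<beta> powr (real n * \<beta> / 2 * real m + - ?s) / (mGamma_II \<beta> m (real n * \<beta> / 2) t * hdet \<Sigma> powr (real n * \<beta> / 2) * gpower t (minv \<Sigma>))) *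
        etr (- \<beta> *\<^sub>R (minv \<Sigma> \<odot> X)) * hdet X powr ?e * gpower t (minv X)))"
      unfolding assms(1-3) W by (simp only: mult_ac times_divide_eq_left times_divide_eq_right add_uminus_conv_diff)
    then show "riesz_II M W (real n * \<beta> / 2) t \<Sigma>"
      using n \<Sigma> unfolding riesz_II_def riesz_II_density_def Let_def assms(1-3) by simp
    assume S: "riesz1_II M S \<beta> (\<nu> * \<beta> / 2) k \<rho>" and b: "k < \<nu> * \<beta> / 2"
    have "distributed M herm_lborel F (\<lambda>X. ennreal (indicator pos_def X *
          (Gamma ((\<nu> + real m * real n) * \<beta> / 2 - k - ?s) * \<rho> powr (\<beta> * real m * real n / 2 + - ?s) /
           (mGamma_II \<beta> m (real n * \<beta> / 2) t * Gamma (\<nu> * \<beta> / 2 - k) *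
             hdet \<Sigma> powr (real n * \<beta> / 2) * gpower t (minv \<Sigma>))) *
          hdet X powr ((real n - real m + 1) * \<beta> / 2 - 1) *
          (1 + \<rho> * rtr (minv \<Sigma> \<odot> X)) powr (- ((\<nu> + real m * real n) * \<beta> / 2 - k - ?s)) * gpower t (minv X)))"
      using S b assms(1) unfolding riesz1_II_def
      by (intro mixture[OF _ _ W_law _ gpower_pos[OF upper.pos_def_minv(1)] G])
         (auto simp: gpower_minv_scaleR field_simps)
    then show "distributed M herm_lborel F (\<lambda>X. ennreal (indicator pos_def X *
          (Gamma ((\<nu> + real m * real n) * \<beta> / 2 - k - ?s) * \<rho> powr (\<beta> * real m * real n / 2 - ?s) /
           (mGamma_II \<beta> m (real n * \<beta> / 2) t * Gamma (\<nu> * \<beta> / 2 - k) *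
             hdet \<Sigma> powr (real n * \<beta> / 2) * gpower t (minv \<Sigma>))) *
          hdet X powr ((real n - real m + 1) * \<beta> / 2 - 1) *
          (1 + \<rho> * rtr (minv \<Sigma> \<odot> X)) powr (- ((real m * real n + \<nu>) * \<beta> / 2 - k - ?s)) * gpower t (minv X)))"
      by (simp add: add.commute)
  qed
qed

end
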